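(* Let $s>\frac32$ and $\mu\in(0,1)$. Consider the Cauchy problem $$\partial_t\zeta+\partial_x v+\varepsilon\partial_x(\zeta v)=0,\qquad \partial_t v+\mathcal T_\mu(D)\partial_x\zeta+\varepsilon v\partial_x v=0,\qquad (\zeta,v)(0)=(\zeta_0,v_0),$$ with $(\zeta_0,v_0)\in V^s_{\sqrt\mu}(\mathbb R)$ and assume there is $h_0\in(0,1)$ with $1+\varepsilon\zeta_0(x)\ge h_0$ for all $x\in\mathbb R$. Then there is a constant $c>0$ independent of $\varepsilon,\mu$ such that, if $0<\varepsilon\le c\,\|(\zeta_0,v_0)\|^{-1}_{V^s_{\sqrt\mu}}$ and $T=c\,\|(\zeta_0,v_0)\|^{-1}_{V^s_{\sqrt\mu}}$, the problem admits a unique solution $$(\zeta,v)\in C([0,T/\varepsilon];V^s_{\sqrt\mu}(\mathbb R))\cap C^1([0,T/\varepsilon];V^{s-1}_{\sqrt\mu}(\mathbb R)),$$ satisfying $\sup_{t\in[0,T/\varepsilon]}\|(\zeta,v)(t)\|_{V^s_{\sqrt\mu}}\lesssim\|(\zeta_0,v_0)\|_{V^s_{\sqrt\mu}}$. Moreover, the solution depends continuously on the initial data (in $V^s_{\sqrt\mu}$).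
   Context: Notation. For a function $m:\mathbb R\to\mathbb R$, $m(D)$ denotes the Fourier multiplier defined by $\widehat{m(D)f}(\xi)=m(\xi)\hat f(\xi)$. We write $\langle\xi\rangle=(1+\xi^2)^{1/2}$, $J^s=\langle D\rangle^s$, and $H^s(\mathbb R)$ for the Sobolev space with norm $\|f\|_{H^s}=\|J^sf\|_{L^2}$. $D^s$ is the multiplier with symbol $|\xi|^s$. For $\mu>0$ set $T_\mu(\xi)=\frac{\tanh(\sqrt\mu|\xi|)}{\sqrt\mu|\xi|}$ (with $T_\mu(0)=1$), and $\mathcal T_\mu(D)$ is the multiplier with symbol $T_\mu$. $a\lesssim b$ means $a\le Cb$ with $C$ independent of $\mu,\varepsilon$. The space $V^s_{\sqrt\mu}(\mathbb R)$ consists of pairs $(\zeta,v)$ with finite norm $\|(\zeta,v)\|^2_{V^s_{\sqrt\mu}}=\|\zeta\|_{H^s}^2+\|v\|_{H^s}^2+\sqrt\mu\|D^{1/2}v\|_{H^s}^2$. *)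

theory Defs
  imports "HOL-Analysis.Analysis"
begin

definition jbr :: "real \<Rightarrow> real" where
  "jbr \<xi> = sqrt (1 + \<xi>\<^sup>2)"

definition sq_int :: "(real \<Rightarrow> real) \<Rightarrow> bool" where
  "sq_int f \<longleftrightarrow> f \<in> borel_measurable lborel \<and> integrable lborel (\<lambda>x. (f x)\<^sup>2)"

definition csq_int :: "(real \<Rightarrow> complex) \<Rightarrow> bool" where
  "csq_int g \<longleftrightarrow> g \<in> borel_measurable lborel \<and> integrable lborel (\<lambda>x. (cmod (g x))\<^sup>2)"

text \<open>Fourier transform of the truncation f 1_[-R,R] (unitary convention,
  f(x) = (2 pi)^(-1/2) int e^(i x xi) hat f(xi) d xi, so that D = -i d/dx has symbol xi).\<close>
definition trunc_ft :: "(real \<Rightarrow> real) \<Rightarrow> real \<Rightarrow> real \<Rightarrow> complex" where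
  "trunc_ft f R \<xi> = complex_of_real (1 / sqrt (2 * pi)) *
     (LINT x:{-R..R}|lborel. complex_of_real (f x) * cis (- (x * \<xi>)))"

definition is_FT :: "(real \<Rightarrow> real) \<Rightarrow> (real \<Rightarrow> complex) \<Rightarrow> bool" where
  "is_FT f g \<longleftrightarrow> sq_int f \<and> csq_int g \<and>
     ((\<lambda>R. \<integral>\<^sup>+\<xi>. ennreal ((cmod (trunc_ft f R \<xi> - g \<xi>))\<^sup>2) \<partial>lborel) \<longlongrightarrow> 0) at_top"

definition FT :: "(real \<Rightarrow> real) \<Rightarrow> real \<Rightarrow> complex" where
  "FT f = (SOME g. is_FT f g)"

definition wint :: "(real \<Rightarrow> real) \<Rightarrow> (real \<Rightarrow> real) \<Rightarrow> ennreal" where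
  "wint w f = (\<integral>\<^sup>+\<xi>. ennreal (w \<xi> * (cmod (FT f \<xi>))\<^sup>2) \<partial>lborel)"

definition Hs :: "real \<Rightarrow> (real \<Rightarrow> real) \<Rightarrow> bool" where
  "Hs s f \<longleftrightarrow> (\<exists>g. is_FT f g) \<and> wint (\<lambda>\<xi>. jbr \<xi> powr (2 * s)) f < \<infinity>"

definition Hs_norm :: "real \<Rightarrow> (real \<Rightarrow> real) \<Rightarrow> real" where
  "Hs_norm s f = sqrt (enn2real (wint (\<lambda>\<xi>. jbr \<xi> powr (2 * s)) f))"

definition Dhalf_Hs_norm :: "real \<Rightarrow> (real \<Rightarrow> real) \<Rightarrow> real" where
  "Dhalf_Hs_norm s f = sqrt (enn2real (wint (\<lambda>\<xi>. jbr \<xi> powr (2 * s) * \<bar>\<xi>\<bar>) f))"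

definition V_space :: "real \<Rightarrow> real \<Rightarrow> (real \<Rightarrow> real) \<Rightarrow> (real \<Rightarrow> real) \<Rightarrow> bool" where
  "V_space s \<mu> \<zeta> v \<longleftrightarrow> Hs s \<zeta> \<and> Hs s v \<and>
     wint (\<lambda>\<xi>. jbr \<xi> powr (2 * s) * \<bar>\<xi>\<bar>) v < \<infinity>"

definition V_norm :: "real \<Rightarrow> real \<Rightarrow> (real \<Rightarrow> real) \<Rightarrow> (real \<Rightarrow> real) \<Rightarrow> real" where
  "V_norm s \<mu> \<zeta> v = sqrt ((Hs_norm s \<zeta>)\<^sup>2 + (Hs_norm s v)\<^sup>2 + sqrt \<mu> * (Dhalf_Hs_norm s v)\<^sup>2)"

definition Tmu :: "real \<Rightarrow> real \<Rightarrow> real" where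
  "Tmu \<mu> \<xi> = (if \<xi> = 0 then 1 else tanh (sqrt \<mu> * \<bar>\<xi>\<bar>) / (sqrt \<mu> * \<bar>\<xi>\<bar>))"

definition test_fun :: "(real \<Rightarrow> real) \<Rightarrow> (real \<Rightarrow> real) \<Rightarrow> bool" where
  "test_fun \<phi> \<phi>' \<longleftrightarrow> (\<forall>x. (\<phi> has_real_derivative \<phi>' x) (at x)) \<and> continuous_on UNIV \<phi>' \<and>
     (\<exists>R. \<forall>x. \<bar>x\<bar> > R \<longrightarrow> \<phi> x = 0)"

text \<open>(zeta, v) in C([0,Tf]; V^s) \<inter> C^1([0,Tf]; V^{s-1}) solves the system on [0,Tf],
  the equations holding in V^{s-1} (tested against test functions; the nonlinear
  term v v_x is written as (v^2/2)_x), with initial datum (zeta0, v0).\<close>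
definition is_solution :: "real \<Rightarrow> real \<Rightarrow> real \<Rightarrow> real \<Rightarrow> (real \<Rightarrow> real) \<Rightarrow> (real \<Rightarrow> real)
    \<Rightarrow> (real \<Rightarrow> real \<Rightarrow> real) \<Rightarrow> (real \<Rightarrow> real \<Rightarrow> real) \<Rightarrow> bool" where
  "is_solution s \<mu> \<epsilon> Tf \<zeta>0 v0 \<zeta> v \<longleftrightarrow>
     \<zeta> 0 = \<zeta>0 \<and> v 0 = v0 \<and>
     (\<forall>t\<in>{0..Tf}. V_space s \<mu> (\<zeta> t) (v t)) \<and>
     (\<forall>t\<in>{0..Tf}. ((\<lambda>t'. V_norm s \<mu> (\<lambda>x. \<zeta> t' x - \<zeta> t x) (\<lambda>x. v t' x - v t x)) \<longlongrightarrow> 0)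
                      (at t within {0..Tf})) \<and>
     (\<exists>\<zeta>' v'.
        (\<forall>t\<in>{0..Tf}. V_space (s - 1) \<mu> (\<zeta>' t) (v' t)) \<and>
        (\<forall>t\<in>{0..Tf}. ((\<lambda>t'. V_norm (s - 1) \<mu> (\<lambda>x. \<zeta>' t' x - \<zeta>' t x) (\<lambda>x. v' t' x - v' t x)) \<longlongrightarrow> 0)
                      (at t within {0..Tf})) \<and>
        (\<forall>t\<in>{0..Tf}. ((\<lambda>t'. V_norm (s - 1) \<mu>
                          (\<lambda>x. (\<zeta> t' x - \<zeta> t x) / (t' - t) - \<zeta>' t x)
                          (\<lambda>x. (v t' x - v t x) / (t' - t) - v' t x)) \<longlongrightarrow> 0)
                      (at t within {0..Tf})) \<and>
        (\<forall>t\<in>{0..Tf}. \<exists>w. is_FT w (\<lambda>\<xi>. \<i> * complex_of_real (\<xi> * Tmu \<mu> \<xi>) * FT (\<zeta> t) \<xi>) \<and>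
           (\<forall>\<phi> \<phi>'. test_fun \<phi> \<phi>' \<longrightarrow>
              (\<integral>x. \<zeta>' t x * \<phi> x \<partial>lborel) =
                (\<integral>x. (v t x + \<epsilon> * \<zeta> t x * v t x) * \<phi>' x \<partial>lborel) \<and>
              (\<integral>x. v' t x * \<phi> x \<partial>lborel) =
                - (\<integral>x. w x * \<phi> x \<partial>lborel) + \<epsilon> * (\<integral>x. ((v t x)\<^sup>2 / 2) * \<phi>' x \<partial>lborel))))"

end

theory Submission
  imports Defs "HOL-Probability.Probability"
begin

text \<open>After scaling by \<open>\<epsilon>\<close> the claim concerns data of small size \<open>\<delta>\<close> on times of order \<open>1/\<delta>\<close>.
  Writing \<open>\<zeta> = q + q\<^sup>2/4\<close>, so that \<open>1 + \<zeta> = (1 + q/2)\<^sup>2\<close>, turns the system into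
  \<open>q\<^sub>t = - v\<^sub>x - q v\<^sub>x/2 - v q\<^sub>x\<close>, \<open>v\<^sub>t = - T \<partial>\<^sub>x (q + q\<^sup>2/4) - v v\<^sub>x\<close>, which is quadratic and
  symmetric for the norm of \<open>(\<langle>D\<rangle>\<^sup>s q, \<langle>D\<rangle>\<^sup>s T\<^sup>-\<^sup>1\<^sup>/\<^sup>2 v)\<close>, equivalent to the \<open>V\<^sup>s\<close> norm uniformly in \<open>\<mu>\<close>.
  On the Fourier side every nonlinearity is a bilinear integral operator. The commutator structure
  gives an energy inequality \<open>d/dt \<parallel>w X\<parallel>\<^sup>2 \<le> C \<parallel>X\<parallel> \<parallel>w X\<parallel>\<^sup>2\<close> for all slowly varying weights \<open>w\<close>, uniformly under
  frequency truncation, and an \<open>L\<^sup>2\<close> inequality for differences of solutions. Truncated solutions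
  therefore converge; weights concentrating at high frequencies control the tails uniformly and give
  convergence and continuous dependence in the strong norm. Uniqueness follows from the \<open>L\<^sup>2\<close>
  inequality after a continuity argument that keeps \<open>\<zeta>\<close> in the range where \<open>\<zeta> \<mapsto> q\<close> is defined.\<close>

text \<open>The obstacle is the loss of one derivative: each nonlinearity maps level
  \<open>s\<close> to level \<open>s - 1\<close>, so no fixed point argument closes at level
  \<open>s\<close>, and every constant must be uniform in \<mu>. The estimates therefore use only
  the growth bounds collected in \<open>slow\<close>. The weight \<open>Lam\<close> (that is, T to
  the power -1/2) is slow with exponent 1 for every \<mu>, so that all kernel bounds and the final
  constant \<open>c1\<close> depend on \<open>s\<close> alone. In the original variables the
  symmetrizer contains the factor 1 + \<zeta>, which depends on the solution and does not commute
  with T. In terms of \<open>q\<close> it is the fixed multiplier \<open>Lam\<close>: the linear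
  part becomes exactly skew, and the coupling terms q v_x / 2 and T(q q_x) / 2 have one common
  kernel up to the place of a factor 1/\<open>Lam\<close>, so that they cancel up to a commutator.
  Analysis takes place in the Hilbert space \<open>h\<close> on the Fourier side. Real functions
  enter through the relation \<open>isF\<close>, which serves to read the given definitions and to
  inherit associativity of products. Smallness serves the lifespan and the inversion of q + q^2/4,
  the latter on a ball of radius of order 1/\<open>KA\<close>.\<close>

abbreviation "cx \<equiv> complex_of_real"
abbreviation "meas \<equiv> borel_measurable borel"
abbreviation "meas2 \<equiv> borel_measurable (borel \<Otimes>\<^sub>M borel)"
abbreviation NNL :: "(real \<Rightarrow> ennreal) \<Rightarrow> ennreal" (binder "NN " 10) where
  "NNL f \<equiv> nn_integral lborel f"

section \<open>Hermitian square integrable functions\<close>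

lemma csq_intD [measurable_dest]: "csq_int f ==> f \<in> borel_measurable lborel"
  by (simp add: csq_int_def)

lemma csq_int_nn:
  "csq_int f \<longleftrightarrow> f \<in> borel_measurable lborel \<and> (NN x. ennreal ((cmod (f x))^2)) < \<infinity>"
  by (auto simp: csq_int_def integrable_iff_bounded)

lemma cmod_add_sq_le: "(cmod (a + b))^2 <= 2 * (cmod a)^2 + 2 * (cmod b)^2"
proof -
  have "(cmod (a + b))^2 <= (cmod a + cmod b)^2"
    by (intro power_mono norm_triangle_ineq) auto
  also have "... <= 2 * (cmod a)^2 + 2 * (cmod b)^2"
    using sum_squares_bound[of "cmod a" "cmod b"] by (simp add: power2_sum)
  finally show ?thesis .
qed

lemma csq_int_bound:
  assumes "integrable lborel h" "f \<in> borel_measurable lborel" "\<And>x. (cmod (f x))^2 <= h x"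
  shows "csq_int f"
  unfolding csq_int_def
proof (intro conjI Bochner_Integration.integrable_bound[OF assms(1)])
  show "AE x in lborel. norm ((cmod (f x))^2) <= norm (h x)"
    using assms(3) by (intro AE_I2) (auto intro: order_trans[OF _ abs_ge_self])
qed (use assms(2) in measurable)

lemma csq_int_add: "csq_int f ==> csq_int g ==> csq_int (\<lambda>x. f x + g x)"
  by (rule csq_int_bound[where h = "\<lambda>x. 2 * (cmod (f x))^2 + 2 * (cmod (g x))^2"])
     (auto simp: csq_int_def intro: cmod_add_sq_le)

lemma csq_int_mult_bounded:
  assumes "csq_int f" "m \<in> borel_measurable lborel" "\<And>x. cmod (m x) <= C"
  shows "csq_int (\<lambda>x. m x * f x)"
proof -
  have "(cmod (m x * f x))^2 <= C^2 * (cmod (f x))^2" for x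
    unfolding norm_mult power_mult_distrib by (intro mult_right_mono power_mono assms) auto
  then show ?thesis
    using assms(1,2) by (intro csq_int_bound[where h = "\<lambda>x. C^2 * (cmod (f x))^2"]) (auto simp: csq_int_def)
qed

lemma csq_int_cmult: "csq_int f ==> csq_int (\<lambda>x. c * f x)"
  by (rule csq_int_mult_bounded[where C = "cmod c"]) auto

lemma csq_int_uminus: "csq_int f ==> csq_int (\<lambda>x. - f x)"
  using csq_int_cmult[of f "-1"] by simp

lemma csq_int_diff: "csq_int f ==> csq_int g ==> csq_int (\<lambda>x. f x - g x)"
  using csq_int_add[OF _ csq_int_uminus, of f g] by simp

lemma csq_int_0 [simp]: "csq_int (\<lambda>x. 0)"
  by (auto simp: csq_int_def)

lemma csq_int_mult_integrable:
  assumes "csq_int f" "csq_int g"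
  shows "integrable lborel (\<lambda>x. f x * g x)"
proof (rule Bochner_Integration.integrable_bound)
  show "integrable lborel (\<lambda>x. (cmod (f x))^2 + (cmod (g x))^2)"
    using assms by (auto simp: csq_int_def)
  show "(\<lambda>x. f x * g x) \<in> borel_measurable lborel" using assms by (auto simp: csq_int_def)
  have "cmod (f x * g x) <= (cmod (f x))^2 + (cmod (g x))^2" for x
  proof -
    have "cmod (f x) * cmod (g x) <= 2 * cmod (f x) * cmod (g x)" by simp
    also have "... <= (cmod (f x))^2 + (cmod (g x))^2" by (rule sum_squares_bound)
    finally show ?thesis by (simp add: norm_mult)
  qed
  then show "AE x in lborel. cmod (f x * g x) <= norm ((cmod (f x))^2 + (cmod (g x))^2)"
    by (intro AE_I2) auto
qed

lemma csq_int_cnj: "csq_int f ==> csq_int (\<lambda>x. cnj (f x))"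
proof -
  have "cnj \<in> meas" by (intro borel_measurable_continuous_onI continuous_intros)
  then show "csq_int f ==> csq_int (\<lambda>x. cnj (f x))" by (auto simp: csq_int_def)
qed

lemma csq_int_cong_AE:
  assumes "csq_int f" "g \<in> borel_measurable lborel" "AE x in lborel. f x = g x"
  shows "csq_int g"
proof -
  have "(NN x. ennreal ((cmod (f x))^2)) = (NN x. ennreal ((cmod (g x))^2))"
    using assms(3) by (intro nn_integral_cong_AE) auto
  then show ?thesis using assms by (simp add: csq_int_nn)
qed

lemma nn_integral_csq: "csq_int f ==>
   (NN x. ennreal ((cmod (f x))^2)) = ennreal (LBINT x. (cmod (f x))^2)"
  by (intro nn_integral_eq_integral) (auto simp: csq_int_def)

lemma lborel_AE_uminus:
  assumes "AE x in lborel. P x"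
  shows "AE x in lborel. P (- x :: real)"
proof -
  obtain N where N: "N \<in> null_sets lborel" "{x. \<not> P x} \<subseteq> N"
    using assms by (auto simp: eventually_ae_filter)
  have "emeasure lborel ((\<lambda>x. -x) -` N) = emeasure (distr lborel borel (\<lambda>x::real. -x)) N"
    using N by (subst emeasure_distr) auto
  also have "... = 0" using N by (simp add: lborel_distr_uminus null_sets_def)
  finally have "(\<lambda>x::real. -x) -` N \<in> null_sets lborel"
    using N measurable_sets_borel[of "\<lambda>x::real. -x" borel N] by (auto simp: null_sets_def)
  moreover have "{x. \<not> P (-x)} \<subseteq> (\<lambda>x. -x) -` N" using N by auto
  ultimately show ?thesis by (auto simp: eventually_ae_filter)
qed

text \<open>Weighting the increments by powers of 2 makes the almost everywhere convergence of a fast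
  subsequence a consequence of the finiteness of a single integral.\<close>
theorem Riesz_Fischer:
  fixes f :: "nat => real => complex"
  assumes meas: "\<And>n. f n \<in> borel_measurable lborel"
    and cau: "\<And>e. e > 0 ==> \<exists>N. \<forall>m\<ge>N. \<forall>n\<ge>N. (NN x. ennreal ((cmod (f m x - f n x))^2)) <= ennreal e"
  obtains g r where "strict_mono (r :: nat => nat)" "g \<in> borel_measurable lborel"
    "g = (\<lambda>x. if convergent (\<lambda>k. f (r k) x) then lim (\<lambda>k. f (r k) x) else 0)"
    "AE x in lborel. (\<lambda>k. f (r k) x) \<longlonglongrightarrow> g x"
    "\<And>e. e > 0 ==> \<exists>N. \<forall>n\<ge>N. (NN x. ennreal ((cmod (f n x - g x))^2)) <= ennreal e"
proof -
  define I where "I m n = (NN x. ennreal ((cmod (f m x - f n x))^2))" for m n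
  have "\<exists>N. \<forall>m\<ge>N. \<forall>n\<ge>N. I m n <= ennreal ((1/4)^k)" for k :: nat
    unfolding I_def by (rule cau) auto
  then obtain N where N: "\<And>k m n. m \<ge> N k ==> n \<ge> N k ==> I m n <= ennreal ((1/4)^k)"
    by metis
  \<comment> \<open>The maximum keeps \<open>r\<close> strictly increasing and at least
    \<open>N k\<close>, so consecutive terms differ by at most \<open>(1/4)^k\<close> in squared
    norm; against the weight \<open>2^k\<close> this leaves a convergent series.\<close>
  define r where "r = rec_nat (N 0) (\<lambda>k m. max (Suc m) (N (Suc k)))"
  have r_Suc: "r (Suc k) = max (Suc (r k)) (N (Suc k))" for k by (simp add: r_def)
  have r_mono: "strict_mono r" by (rule strict_monoI_Suc) (simp add: r_Suc)
  have rN: "r k \<ge> N k" for k by (cases k) (auto simp: r_Suc, simp add: r_def)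
  have I_r: "I (r (Suc k)) (r k) <= ennreal ((1/4)^k)" for k
    using rN[of k] r_Suc[of k] by (intro N) auto
  define d where "d k x = (cmod (f (r (Suc k)) x - f (r k) x))^2" for k x
  have [measurable]: "d k \<in> borel_measurable lborel" for k unfolding d_def using meas by measurable
  have "(NN x. (\<Sum>k. ennreal (2^k * d k x))) = (\<Sum>k. \<integral>\<^sup>+x. ennreal (2^k * d k x) \<partial>lborel)"
    by (intro nn_integral_suminf) auto
  also have "... <= (\<Sum>k. ennreal ((1/2)^k))"
  proof (intro suminf_le)
    fix k
    have "(NN x. ennreal (2^k * d k x)) = ennreal (2^k) * I (r (Suc k)) (r k)"
      unfolding I_def d_def using meas by (simp add: ennreal_mult' nn_integral_cmult)
    also have "... <= ennreal (2^k) * ennreal ((1/4)^k)" by (intro mult_left_mono I_r) auto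
    also have "... = ennreal ((1/2)^k)"
      by (simp add: ennreal_mult'[symmetric] power_mult_distrib[symmetric] del: ennreal_power)
    finally show "(NN x. ennreal (2^k * d k x)) <= ennreal ((1/2)^k)" .
  qed auto
  also have "... < \<infinity>"
    by (subst suminf_ennreal2) (auto simp: summable_geometric)
  finally have "AE x in lborel. (\<Sum>k. ennreal (2^k * d k x)) \<noteq> \<infinity>"
    by (intro nn_integral_PInf_AE) auto
  then have conv: "AE x in lborel. convergent (\<lambda>k. f (r k) x)"
  proof eventually_elim
    case (elim x)
    then obtain B where B: "(\<Sum>k. ennreal (2^k * d k x)) = ennreal B" "B \<ge> 0"
      by (cases "(\<Sum>k. ennreal (2^k * d k x))") auto
    have "2^k * d k x <= B" for k
    proof -
      have "ennreal (2^k * d k x) <= (\<Sum>k. ennreal (2^k * d k x))"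
        using sum_le_suminf[of "\<lambda>k. ennreal (2^k * d k x)" "{k}"] by simp
      then show ?thesis using B by simp
    qed
    then have dk: "d k x <= B * (1/2)^k" for k by (simp add: field_simps power_divide)
    have "cmod (f (r (Suc k)) x - f (r k) x) <= sqrt B * (sqrt (1/2))^k" for k
    proof -
      have "cmod (f (r (Suc k)) x - f (r k) x) = sqrt (d k x)" by (simp add: d_def)
      also have "... <= sqrt (B * (1/2)^k)" using dk by simp
      finally show ?thesis by (simp add: real_sqrt_mult real_sqrt_power)
    qed
    moreover have "summable (\<lambda>k. sqrt B * (sqrt (1/2))^k)"
      by (intro summable_mult summable_geometric) auto
    ultimately have "summable (\<lambda>k. f (r (Suc k)) x - f (r k) x)"
      by (rule summable_comparison_test'[rotated])
    then have "convergent (\<lambda>n. \<Sum>k<n. f (r (Suc k)) x - f (r k) x)"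
      by (simp add: summable_iff_convergent)
    then have "convergent (\<lambda>n. f (r n) x - f (r 0) x)"
      using sum_lessThan_telescope[of "\<lambda>k. f (r k) x"] by simp
    then show ?case
      using convergent_add[of "\<lambda>n. f (r n) x - f (r 0) x" "\<lambda>n. f (r 0) x"] by (simp add: convergent_const)
  qed
  \<comment> \<open>The explicit formula, with value 0 off the convergence set, is exported on
    purpose: completeness of \<open>h\<close> needs a limit whose symmetry can be checked at every
    point.\<close>
  define g where "g x = (if convergent (\<lambda>k. f (r k) x) then lim (\<lambda>k. f (r k) x) else 0)" for x
  have "g \<in> borel_measurable lborel"
  proof -
    have [measurable]: "f n \<in> borel_measurable lborel" for n by (rule meas)
    have *: "{x\<in>space lborel. convergent (\<lambda>k. f (r k) x)} \<in> sets lborel"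
      unfolding Cauchy_convergent_iff[symmetric] by (intro sets_Collect_Cauchy meas)
    show ?thesis unfolding g_def
      using * by (intro measurable_If borel_measurable_lim_metric meas) auto
  qed
  note gm = this
  have lim: "AE x in lborel. (\<lambda>k. f (r k) x) \<longlonglongrightarrow> g x"
    using conv by eventually_elim (simp add: g_def convergent_LIMSEQ_iff)
  have "\<exists>N. \<forall>n\<ge>N. (NN x. ennreal ((cmod (f n x - g x))^2)) <= ennreal e" if epos: "e > 0" for e
  proof -
    obtain M where M: "\<And>m n. m \<ge> M ==> n \<ge> M ==> I m n <= ennreal e"
      using cau[OF epos] unfolding I_def by blast
    have "(NN x. ennreal ((cmod (f n x - g x))^2)) <= ennreal e" if n: "n \<ge> M" for n
    proof -
      \<comment> \<open>Fatou's lemma along the fast subsequence turns pointwise convergence into a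
        norm bound.\<close>
      have "(NN x. ennreal ((cmod (f n x - g x))^2))
          = (NN x. liminf (\<lambda>k. ennreal ((cmod (f n x - f (r k) x))^2)))"
      proof (rule nn_integral_cong_AE)
        show "AE x in lborel. ennreal ((cmod (f n x - g x))^2) = liminf (\<lambda>k. ennreal ((cmod (f n x - f (r k) x))^2))"
          using lim
        proof eventually_elim
          case (elim x)
          then have "(\<lambda>k. ennreal ((cmod (f n x - f (r k) x))^2)) \<longlonglongrightarrow> ennreal ((cmod (f n x - g x))^2)"
            by (intro tendsto_ennrealI tendsto_intros)
          then show ?case by (intro lim_imp_Liminf[symmetric]) auto
        qed
      qed
      also have "... <= liminf (\<lambda>k. I n (r k))"
        unfolding I_def using meas by (intro nn_integral_liminf) auto
      also have "... <= ennreal e"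
      proof (rule Liminf_le)
        show "\<forall>\<^sub>F k in sequentially. I n (r k) <= ennreal e"
          using eventually_ge_at_top[of M]
          by eventually_elim (use n in \<open>auto intro!: M order_trans[OF _ strict_mono_imp_increasing[OF r_mono]]\<close>)
      qed auto
      finally show ?thesis .
    qed
    then show ?thesis by blast
  qed
  then show ?thesis using that[OF r_mono gm _ lim] by (auto simp: g_def[abs_def])
qed

text \<open>The symmetry is demanded at every point, not almost everywhere, so that each
  representative satisfies \<open>fn_minus\<close> as an unconditional rewrite rule.\<close>

definition herm2 :: "(real => complex) => bool" where
  "herm2 f \<longleftrightarrow> csq_int f \<and> (\<forall>x. f (- x) = cnj (f x))"

text \<open>Fourier transforms of real square integrable functions: Hermitian functions modulo null sets.\<close>
quotient_type h = "real => complex" / partial: "\<lambda>f g. herm2 f \<and> herm2 g \<and> (AE x in lborel. f x = g x)"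
proof (rule part_equivpI)
  show "\<exists>x. herm2 x \<and> herm2 x \<and> (AE xa in lborel. x xa = x xa)"
    by (rule exI[of _ "\<lambda>_. 0"]) (simp add: herm2_def)
  show "symp (\<lambda>f g. herm2 f \<and> herm2 g \<and> (AE x in lborel. f x = g x))"
    by (auto intro!: sympI)
  show "transp (\<lambda>f g. herm2 f \<and> herm2 g \<and> (AE x in lborel. f x = g x))"
    by (intro transpI) (auto elim!: eventually_elim2)
qed

instantiation h :: real_vector
begin

lift_definition zero_h :: h is "\<lambda>_. 0" by (simp add: herm2_def)

lift_definition plus_h :: "h => h => h" is "\<lambda>f g x. f x + g x"
  by (auto simp: herm2_def csq_int_add)

lift_definition minus_h :: "h => h => h" is "\<lambda>f g x. f x - g x"
  by (auto simp: herm2_def csq_int_diff)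

lift_definition uminus_h :: "h => h" is "\<lambda>f x. - f x"
  by (auto simp: herm2_def csq_int_uminus)

lift_definition scaleR_h :: "real => h => h" is "\<lambda>c f x. cx c * f x"
  by (auto simp: herm2_def csq_int_cmult)

instance
proof
  fix x y z :: h and a b :: real
  show "x + y + z = x + (y + z)" by transfer (auto simp: herm2_def csq_int_add algebra_simps)
  show "x + y = y + x" by transfer (auto simp: herm2_def csq_int_add algebra_simps)
  show "0 + x = x" by transfer (auto simp: herm2_def)
  show "- x + x = 0" by transfer (auto simp: herm2_def)
  show "x - y = x + - y" by transfer (auto simp: herm2_def csq_int_diff)
  show "a *\<^sub>R (x + y) = a *\<^sub>R x + a *\<^sub>R y"
    by transfer (auto simp: herm2_def ring_distribs intro!: csq_int_add csq_int_cmult)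
  show "(a + b) *\<^sub>R x = a *\<^sub>R x + b *\<^sub>R x"
    by transfer (auto simp: herm2_def ring_distribs intro!: csq_int_add csq_int_cmult)
  show "a *\<^sub>R b *\<^sub>R x = (a * b) *\<^sub>R x" by transfer (auto simp: herm2_def mult.assoc intro!: csq_int_cmult)
  show "1 *\<^sub>R x = x" by transfer (auto simp: herm2_def)
qed

end

text \<open>Hermitian functions form only a real vector space. For two of them the integral is real
  already by symmetry; taking \<open>Re\<close> spares that argument in the definition.\<close>

instantiation h :: real_inner
begin

lift_definition inner_h :: "h => h => real" is "\<lambda>f g. Re (LBINT x. f x * cnj (g x))"
proof -
  fix f f' g g' :: "real => complex"
  assume a: "herm2 f \<and> herm2 f' \<and> (AE x in lborel. f x = f' x)"
    "herm2 g \<and> herm2 g' \<and> (AE x in lborel. g x = g' x)"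
  have "(LBINT x. f x * cnj (g x)) = (LBINT x. f' x * cnj (g' x))"
    using a by (intro integral_cong_AE borel_measurable_integrable csq_int_mult_integrable csq_int_cnj)
      (auto simp: herm2_def)
  then show "Re (LBINT x. f x * cnj (g x)) = Re (LBINT x. f' x * cnj (g' x))" by simp
qed

definition "norm_h (x::h) = sqrt (inner x x)"
definition "dist_h (x::h) y = norm (x - y)"
definition "sgn_h (x::h) = x /\<^sub>R norm x"
definition [code del]: "(uniformity :: (h \<times> h) filter) = (INF e\<in>{0 <..}. principal {(x, y). dist x y < e})"
definition [code del]: "open (U :: h set) = (\<forall>x\<in>U. eventually (\<lambda>(x', y). x' = x \<longrightarrow> y \<in> U) uniformity)"

instance
proof
  fix x y z :: h and r :: real and U :: "h set"
  show "dist x y = norm (x - y)" by (simp add: dist_h_def)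
  show "sgn x = x /\<^sub>R norm x" by (simp add: sgn_h_def)
  show "(uniformity :: (h \<times> h) filter) = (INF e\<in>{0 <..}. principal {(x, y). dist x y < e})"
    by (simp add: uniformity_h_def)
  show "open U = (\<forall>x\<in>U. eventually (\<lambda>(x', y). x' = x \<longrightarrow> y \<in> U) uniformity)"
    by (simp add: open_h_def)
  show "inner x y = inner y x"
  proof transfer
    fix f g :: "real => complex"
    have "(LBINT x. g x * cnj (f x)) = cnj (LBINT x. f x * cnj (g x))"
      by (subst Bochner_Integration.integral_cnj[symmetric]) (simp add: mult.commute)
    then show "Re (LBINT x. f x * cnj (g x)) = Re (LBINT x. g x * cnj (f x))"
      by simp
  qed
  show "inner (x + y) z = inner x z + inner y z"
    by transfer (auto simp: ring_distribs csq_int_mult_integrable csq_int_cnj herm2_def)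
  show "inner (r *\<^sub>R x) y = r * inner x y"
    by transfer (auto simp: mult.assoc)
  have ii: "(LBINT x. f x * cnj (f x)) = of_real (LBINT x. (cmod (f x))^2)" for f :: "real => complex"
    by (subst integral_complex_of_real[symmetric]) (simp add: complex_norm_square del: of_real_power)
  show "0 <= inner x x" by transfer (simp add: ii)
  show "(inner x x = 0) = (x = 0)"
    by transfer (auto simp: ii integral_nonneg_eq_0_iff_AE csq_int_def herm2_def)
  show "norm x = sqrt (inner x x)" by (simp add: norm_h_def)
qed

end

lift_definition toh :: "(real => complex) => h" is "\<lambda>f. if herm2 f then f else (\<lambda>_. 0)"
  by (auto simp: herm2_def)

text \<open>The representative is an arbitrary choice in each class; for this reason the algebraic
  laws for \<open>fn\<close> below hold only almost everywhere.\<close>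

definition fn :: "h => real => complex" where "fn x = rep_h x"

lemma herm2_fn: "herm2 (fn x)"
  unfolding fn_def using Quotient3_rel_rep[OF Quotient3_h, of x x] by auto

lemma csq_fn: "csq_int (fn x)" using herm2_fn by (simp add: herm2_def)
lemma fn_minus [simp]: "fn x (- t) = cnj (fn x t)" using herm2_fn by (simp add: herm2_def)
lemma fn_measurable [measurable]: "fn x \<in> meas"
  using csq_fn[of x] by (simp add: csq_int_def)

lemma toh_fn [simp]: "toh (fn x) = x"
proof -
  have "abs_h (rep_h x) = x" using Quotient3_abs_rep[OF Quotient3_h] .
  then show ?thesis using herm2_fn[of x] by (simp add: toh_def fn_def)
qed

lemma fn_toh: "herm2 f ==> AE x in lborel. fn (toh f) x = f x"
  using Quotient3_rep_abs[OF Quotient3_h, of f] by (simp add: toh_def fn_def)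

lemma toh_eqI: "herm2 f ==> herm2 g ==> (AE x in lborel. f x = g x) ==> toh f = toh g"
  by transfer auto

lemma h_eqI: "(AE t in lborel. fn x t = fn y t) ==> x = y"
  using toh_eqI[OF herm2_fn herm2_fn, of x y] by simp

lemma herm2_add: "herm2 f ==> herm2 g ==> herm2 (\<lambda>x. f x + g x)"
  by (auto simp: herm2_def csq_int_add)
lemma herm2_diff: "herm2 f ==> herm2 g ==> herm2 (\<lambda>x. f x - g x)"
  by (auto simp: herm2_def csq_int_diff)
lemma herm2_scale: "herm2 f ==> herm2 (\<lambda>x. cx c * f x)"
  by (auto simp: herm2_def csq_int_cmult)

lemma toh_add: "herm2 f ==> herm2 g ==> toh f + toh g = toh (\<lambda>x. f x + g x)"
  by transfer (auto simp: herm2_add)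
lemma toh_diff: "herm2 f ==> herm2 g ==> toh f - toh g = toh (\<lambda>x. f x - g x)"
  by transfer (auto simp: herm2_diff)
lemma toh_scale: "herm2 f ==> c *\<^sub>R toh f = toh (\<lambda>x. cx c * f x)"
  by transfer (auto simp: herm2_scale)

lemma fn_add: "AE t in lborel. fn (x + y) t = fn x t + fn y t"
  using fn_toh[OF herm2_add[OF herm2_fn herm2_fn, of x y]] toh_add[OF herm2_fn herm2_fn, of x y] by simp
lemma fn_diff: "AE t in lborel. fn (x - y) t = fn x t - fn y t"
  using fn_toh[OF herm2_diff[OF herm2_fn herm2_fn, of x y]] toh_diff[OF herm2_fn herm2_fn, of x y] by simp
lemma fn_scale: "AE t in lborel. fn (c *\<^sub>R x) t = cx c * fn x t"
  using fn_toh[OF herm2_scale[OF herm2_fn, of c x]] toh_scale[OF herm2_fn, of c x] by simp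
lemma fn_zero: "AE t in lborel. fn 0 t = 0"
proof -
  have "herm2 (\<lambda>_. 0)" by (simp add: herm2_def)
  moreover from this have "toh (\<lambda>_. 0) = 0" by transfer auto
  ultimately show ?thesis using fn_toh[of "\<lambda>_. 0"] by simp
qed

lemma inner_toh: "herm2 f ==> herm2 g ==> inner (toh f) (toh g) = Re (LBINT x. f x * cnj (g x))"
  by transfer auto
lemma inner_fn: "inner x y = Re (LBINT t. fn x t * cnj (fn y t))"
  using inner_toh[OF herm2_fn herm2_fn, of x y] by simp

lemma norm_sq_fn: "(norm x)^2 = (LBINT t. (cmod (fn x t))^2)"
proof -
  have "(LBINT t. fn x t * cnj (fn x t)) = of_real (LBINT t. (cmod (fn x t))^2)"
    by (subst integral_complex_of_real[symmetric]) (simp add: complex_norm_square del: of_real_power)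
  then show ?thesis by (simp add: power2_norm_eq_inner inner_fn)
qed

lemma nn_norm_fn: "(NN t. ennreal ((cmod (fn x t))^2)) = ennreal ((norm x)^2)"
  by (simp add: nn_integral_csq[OF csq_fn] norm_sq_fn)

lemma nn_norm_toh: "herm2 f ==> (NN t. ennreal ((cmod (f t))^2)) = ennreal ((norm (toh f))^2)"
  unfolding nn_norm_fn[symmetric] by (intro nn_integral_cong_AE) (rule eventually_mono[OF fn_toh], auto)

lemma norm_toh_le:
  assumes "herm2 f" "(NN t. ennreal ((cmod (f t))^2)) <= ennreal (C^2)" "C \<ge> 0"
  shows "norm (toh f) <= C"
proof -
  have "(norm (toh f))^2 <= C^2" using assms by (simp add: nn_norm_toh)
  then show ?thesis using assms(3) by (simp add: power2_le_iff_abs_le)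
qed

lemma nn_dist_fn: "(NN t. ennreal ((cmod (fn x t - fn y t))^2)) = ennreal ((dist x y)^2)"
  unfolding dist_norm nn_norm_fn[symmetric]
  by (intro nn_integral_cong_AE) (rule eventually_mono[OF fn_diff[of x y]], auto)

instance h :: complete_space
proof
  fix X :: "nat => h" assume X: "Cauchy X"
  have cau: "\<exists>N. \<forall>m\<ge>N. \<forall>n\<ge>N. (NN t. ennreal ((cmod (fn (X m) t - fn (X n) t))^2)) <= ennreal e"
    if "e > 0" for e
  proof -
    from metric_CauchyD[OF X real_sqrt_gt_zero[OF \<open>e > 0\<close>]]
    obtain N where N: "\<forall>m\<ge>N. \<forall>n\<ge>N. dist (X m) (X n) < sqrt e" ..
    have "(dist (X m) (X n))^2 <= e" if "m \<ge> N" "n \<ge> N" for m n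
    proof -
      have "dist (X m) (X n) <= sqrt e" using N that less_imp_le by blast
      then have "(dist (X m) (X n))^2 <= (sqrt e)^2" by (rule power_mono) simp
      then show ?thesis using \<open>e > 0\<close> by simp
    qed
    then show ?thesis by (auto simp: nn_dist_fn intro!: exI[of _ N] ennreal_leI)
  qed
  obtain r :: "nat => nat" and g where "strict_mono r" and g: "g \<in> borel_measurable lborel"
    "g = (\<lambda>t. if convergent (\<lambda>k. fn (X (r k)) t) then lim (\<lambda>k. fn (X (r k)) t) else 0)"
    "AE t in lborel. (\<lambda>k. fn (X (r k)) t) \<longlonglongrightarrow> g t"
    "\<And>e. e > 0 ==> \<exists>N. \<forall>n\<ge>N. (NN t. ennreal ((cmod (fn (X n) t - g t))^2)) <= ennreal e"
    by (rule Riesz_Fischer[of "\<lambda>n. fn (X n)", OF csq_intD[OF csq_fn] cau]) (assumption | rule that)+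
  have gx: "g t = (if convergent (\<lambda>k. fn (X (r k)) t) then lim (\<lambda>k. fn (X (r k)) t) else 0)" for t
    by (rule fun_cong[OF g(2)])
  \<comment> \<open>Conjugation carries the sequence at \<open>t\<close> to the sequence at
    \<open>-t\<close>, so both converge or neither does, and the default value 0 is its own
    conjugate.\<close>
  have "g (- t) = cnj (g t)" for t
  proof (cases "convergent (\<lambda>k. fn (X (r k)) t)")
    case True
    then have "(\<lambda>k. fn (X (r k)) t) \<longlonglongrightarrow> g t" by (simp add: gx convergent_LIMSEQ_iff)
    then have *: "(\<lambda>k. fn (X (r k)) (- t)) \<longlonglongrightarrow> cnj (g t)"
      unfolding fn_minus by (rule tendsto_cnj)
    then have "convergent (\<lambda>k. fn (X (r k)) (- t))" by (rule convergentI)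
    then have "g (-t) = lim (\<lambda>k. fn (X (r k)) (- t))" using gx[of "-t"] by simp
    then show ?thesis using limI[OF *] by simp
  next
    case False
    then have "\<not> convergent (\<lambda>k. fn (X (r k)) (- t))"
      unfolding convergent_def fn_minus lim_cnj by (metis complex_cnj_cnj lim_cnj)
    then show ?thesis using False gx[of t] gx[of "-t"] by simp
  qed
  moreover have "csq_int g"
  proof -
    obtain n where n: "(NN t. ennreal ((cmod (fn (X n) t - g t))^2)) <= ennreal 1"
      using g(4)[of 1] by auto
    have "csq_int (\<lambda>t. fn (X n) t - g t)" unfolding csq_int_nn using n g(1)
      by (auto simp: less_top[symmetric] top_unique)
    from csq_int_diff[OF csq_fn this, of "X n"] show ?thesis by simp
  qed
  ultimately have hg: "herm2 g" by (simp add: herm2_def)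
  have "X \<longlonglongrightarrow> toh g"
  proof (rule metric_LIMSEQ_I)
    fix e :: real assume e: "e > 0"
    then have "(e/2)^2 > 0" by simp
    from g(4)[OF this] obtain N where
      N: "\<forall>n\<ge>N. (NN t. ennreal ((cmod (fn (X n) t - g t))^2)) <= ennreal ((e/2)^2)" ..
    have "dist (X n) (toh g) < e" if "n \<ge> N" for n
    proof -
      have "X n - toh g = toh (\<lambda>t. fn (X n) t - g t)" using toh_diff[OF herm2_fn hg, of "X n"] by simp
      moreover have "norm (toh (\<lambda>t. fn (X n) t - g t)) <= e / 2"
        using N that e by (intro norm_toh_le herm2_diff herm2_fn hg) auto
      ultimately show ?thesis using e by (simp add: dist_norm)
    qed
    then show "\<exists>N. \<forall>n\<ge>N. dist (X n) (toh g) < e" by blast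
  qed
  then show "convergent X" by (auto simp: convergent_def)
qed

instance h :: banach ..

section \<open>Multipliers and bilinear integral operators\<close>

definition bsym :: "real => (real => complex) => bool" where
  "bsym C m \<longleftrightarrow> m \<in> meas \<and> (\<forall>x. m (- x) = cnj (m x)) \<and> (\<forall>x. cmod (m x) <= C)"

definition Mul :: "(real => complex) => h => h" where
  "Mul m x = toh (\<lambda>t. m t * fn x t)"

lemma bsym_nonneg: "bsym C m ==> 0 <= C"
  using norm_ge_zero order_trans unfolding bsym_def by blast

lemma bsym_measurable: "bsym C m ==> m \<in> meas" by (simp add: bsym_def)

lemma bsym_mult: "bsym C m ==> bsym D l ==> bsym (C * D) (\<lambda>t. m t * l t)"
  using bsym_nonneg[of C m] by (auto simp: bsym_def norm_mult intro!: mult_mono)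

lemma bsym_cnj: "bsym C m ==> bsym C (\<lambda>t. cnj (m t))"
proof -
  have "cnj \<in> meas" by (intro borel_measurable_continuous_onI continuous_intros)
  then show "bsym C m ==> bsym C (\<lambda>t. cnj (m t))" by (auto simp: bsym_def)
qed

lemma bsym_real:
  assumes "a \<in> meas" "\<And>x. a (- x) = a x" "\<And>x. \<bar>a x\<bar> <= C"
  shows "bsym C (\<lambda>t. cx (a t))"
  using assms by (auto simp: bsym_def)

lemma herm2_bsym: "bsym C m ==> herm2 f ==> herm2 (\<lambda>t. m t * f t)"
  by (auto simp: bsym_def herm2_def intro!: csq_int_mult_bounded[where C = C])

lemma fn_Mul: "bsym C m ==> AE t in lborel. fn (Mul m x) t = m t * fn x t"
  unfolding Mul_def by (rule fn_toh[OF herm2_bsym[OF _ herm2_fn]])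

lemma Mul_toh: assumes "bsym C m" "herm2 f" shows "Mul m (toh f) = toh (\<lambda>t. m t * f t)"
  unfolding Mul_def
  by (rule toh_eqI) (use assms in \<open>auto intro!: herm2_bsym herm2_fn eventually_mono[OF fn_toh[OF assms(2)]]\<close>)

lemma norm_Mul_le: assumes "bsym C m" shows "norm (Mul m x) <= C * norm x"
  unfolding Mul_def
proof (rule norm_toh_le)
  have "(NN t. ennreal ((cmod (m t * fn x t))^2)) <= (NN t. ennreal (C^2) * ennreal ((cmod (fn x t))^2))"
    using assms by (intro nn_integral_mono)
      (auto simp: ennreal_mult'[symmetric] norm_mult power_mult_distrib bsym_def intro!: ennreal_leI mult_right_mono power_mono)
  also have "... = ennreal ((C * norm x)^2)"
    by (subst nn_integral_cmult) (auto simp: nn_norm_fn ennreal_mult'[symmetric] power_mult_distrib)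
  finally show "(NN t. ennreal ((cmod (m t * fn x t))^2)) <= ennreal ((C * norm x)^2)" .
qed (use assms bsym_nonneg herm2_bsym herm2_fn in auto)

lemma Mul_add: assumes "bsym C m" shows "Mul m (x + y) = Mul m x + Mul m y"
  unfolding Mul_def toh_add[OF herm2_bsym[OF assms herm2_fn] herm2_bsym[OF assms herm2_fn]]
  by (rule toh_eqI) (auto intro!: herm2_bsym[OF assms] herm2_add herm2_fn eventually_mono[OF fn_add[of x y]] simp: ring_distribs)

lemma Mul_scale: assumes "bsym C m" shows "Mul m (c *\<^sub>R x) = c *\<^sub>R Mul m x"
  unfolding Mul_def toh_scale[OF herm2_bsym[OF assms herm2_fn]]
  by (rule toh_eqI) (auto intro!: herm2_bsym[OF assms] herm2_scale herm2_fn eventually_mono[OF fn_scale[of c x]])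

lemma bounded_linear_Mul: "bsym C m ==> bounded_linear (Mul m)"
  by (rule bounded_linear_intro[where K = C]) (auto simp: Mul_add Mul_scale mult.commute norm_Mul_le)

lemma Mul_Mul: assumes "bsym C m" "bsym D l" shows "Mul m (Mul l x) = Mul (\<lambda>t. m t * l t) x"
  unfolding Mul_def[of l] Mul_toh[OF assms(1) herm2_bsym[OF assms(2) herm2_fn]]
  by (simp add: Mul_def mult.assoc)

lemma Mul_cong: "(\<And>t. m t = l t) ==> Mul m = Mul l"
  by (metis ext)

lemma Mul_one: "Mul (\<lambda>t. 1) x = x"
  by (simp add: Mul_def)

lemma inner_Mul: assumes "bsym C m" shows "inner (Mul m x) y = inner x (Mul (\<lambda>t. cnj (m t)) y)"
proof -
  have "inner (Mul m x) (toh (fn y)) = Re (LBINT t. (m t * fn x t) * cnj (fn y t))"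
    unfolding Mul_def by (intro inner_toh herm2_bsym[OF assms] herm2_fn)
  moreover have "inner (toh (fn x)) (Mul (\<lambda>t. cnj (m t)) y) = Re (LBINT t. fn x t * cnj (cnj (m t) * fn y t))"
    unfolding Mul_def by (intro inner_toh herm2_bsym[OF bsym_cnj[OF assms]] herm2_fn)
  ultimately show ?thesis by (simp add: mult_ac)
qed

lemma Mul_eq_0_iff:
  assumes "bsym C m" "\<And>t. m t \<noteq> 0" "Mul m x = 0" shows "x = 0"
proof (rule h_eqI)
  have "AE t in lborel. fn (Mul m x) t = 0" using assms(3) fn_zero by simp
  with fn_Mul[OF assms(1), of x] fn_zero show "AE t in lborel. fn x t = fn 0 t"
    by eventually_elim (use assms(2) in auto)
qed

text \<open>The integrands below contain \<open>fn x (u - v)\<close> as a function of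
  \<open>v\<close> for a fixed \<open>u\<close>; this carries almost everywhere identities for
  \<open>fn x\<close> over to it.\<close>

lemma AE_lborel_reflect_shift:
  fixes c :: real
  assumes "AE t in lborel. P t" shows "AE t in lborel. P (c - t)"
proof -
  have *: "AE t in lborel. P (- t)" by (rule lborel_AE_uminus[OF assms])
  then obtain N where N: "N \<in> null_sets lborel" "{x. \<not> P (-x)} \<subseteq> N"
    by (auto simp: eventually_ae_filter)
  have "emeasure lborel ((\<lambda>x. - c + x) -` N) = emeasure (distr lborel borel ((+) (- c))) N"
    using N by (subst emeasure_distr) auto
  also have "... = 0" using N by (simp add: lborel_distr_plus null_sets_def)
  finally have "(\<lambda>x. - c + x) -` N \<in> null_sets lborel"
    using N measurable_sets_borel[of "\<lambda>x. - c + x" borel N] by (auto simp: null_sets_def)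
  moreover have "{x. \<not> P (c - x)} \<subseteq> (\<lambda>x. - c + x) -` N"
  proof
    fix x assume "x \<in> {x. \<not> P (c - x)}"
    then have "\<not> P (- (- c + x))" by (simp add: add.commute)
    with N show "x \<in> (\<lambda>x. - c + x) -` N" by blast
  qed
  ultimately show ?thesis by (auto simp: eventually_ae_filter)
qed

lemma nn_integral_reflect_shift:
  fixes f :: "real => ennreal" and c :: real
  assumes "f \<in> meas"
  shows "(NN t. f (c - t)) = (NN t. f t)"
  using nn_integral_real_affine[OF assms, of "-1" c] by simp

lemma integral_reflect_shift:
  fixes f :: "real => complex" and c :: real
  shows "(LBINT t. f (c - t)) = (LBINT t. f t)"
  using lborel_integral_real_affine[of "-1" f c] by simp

text \<open>Young's convolution inequality for L1 and L2: Cauchy-Schwarz for the measure with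
  density \<open>p (u - v)\<close>, followed by Tonelli.\<close>

lemma Young_nn:
  fixes p g :: "real => ennreal"
  assumes [measurable]: "p \<in> meas" "g \<in> meas"
  shows "(NN u. (NN v. p (u - v) * g v)^2) <= (NN t. p t)^2 * (NN t. (g t)^2)"
proof -
  have "(NN v. p (u - v) * g v)^2 <= (NN t. p t) * (NN v. p (u - v) * (g v)^2)" for u
    using Cauchy_Schwarz_nn_integral[of "\<lambda>_. 1" "density lborel (\<lambda>v. p (u - v))" g]
    by (simp add: nn_integral_density nn_integral_reflect_shift emeasure_density)
  then have "(NN u. (NN v. p (u - v) * g v)^2)
      <= (NN u. (NN t. p t) * (NN v. p (u - v) * (g v)^2))"
    by (intro nn_integral_mono)
  also have "... = (NN t. p t) * (NN v. \<integral>\<^sup>+u. p (u - v) * (g v)^2 \<partial>lborel)"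
    by (subst nn_integral_cmult, measurable) (subst lborel_pair.Fubini', auto)
  also have "(NN v. \<integral>\<^sup>+u. p (u - v) * (g v)^2 \<partial>lborel) = (NN v. (NN t. p t) * (g v)^2)"
  proof (intro nn_integral_cong)
    fix v :: real
    have "(NN u. p (u - v) * (g v)^2) = (NN u. p (u - v)) * (g v)^2"
      by (rule nn_integral_multc) measurable
    also have "(NN u. p (u - v)) = (NN t. p t)"
      using nn_integral_real_affine[of p 1 "-v"] by simp
    finally show "(NN u. p (u - v) * (g v)^2) = (NN t. p t) * (g v)^2" .
  qed
  also have "... = (NN t. p t) * (NN t. (g t)^2)"
    by (rule nn_integral_cmult) measurable
  finally show ?thesis by (simp add: power2_eq_square mult.assoc)
qed

lemma ennreal_sq_le_imp_le:
  assumes "a^2 <= (ennreal b)^2" "b \<ge> 0" shows "a <= ennreal b"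
proof (cases a)
  case (real r)
  then have "ennreal (r^2) <= ennreal (b^2)" using assms by (simp add: ennreal_power)
  then have "r^2 <= b^2" by (simp only: ennreal_le_iff zero_le_power2)
  then have "r <= b" using assms(2) by (rule power2_le_imp_le)
  then show ?thesis using real by (simp add: ennreal_leI)
next
  case top
  have "(ennreal b)^2 < \<top>" using assms(2) by (simp add: ennreal_power)
  with assms(1) have "a^2 < \<top>" by (rule le_less_trans)
  then show ?thesis using top by (simp add: power2_eq_square)
qed

lemma ennreal_sq_less_top: "(a::ennreal)^2 < \<top> ==> a < \<top>"
  by (cases a) (auto simp: power2_eq_square)

lemma norm_integral_le_nn:
  fixes f :: "'a => complex"
  shows "ennreal (cmod (\<integral>x. f x \<partial>M)) <= (\<integral>\<^sup>+x. ennreal (cmod (f x)) \<partial>M)"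
  by (cases "integrable M f") (auto simp: integral_norm_bound_ennreal not_integrable_integral_eq)

section \<open>The Japanese bracket\<close>

lemma jbr_ge_1: "jbr x \<ge> 1" by (simp add: jbr_def)
lemma jbr_pos [simp]: "jbr x > 0" using jbr_ge_1[of x] by linarith
lemma jbr_nonneg [simp]: "jbr x \<ge> 0" using jbr_pos[of x] by linarith
lemma jbr_minus [simp]: "jbr (- x) = jbr x" by (simp add: jbr_def)
lemma jbr_measurable [measurable]: "jbr \<in> meas"
  unfolding jbr_def[abs_def] by measurable
lemma abs_le_jbr: "\<bar>x\<bar> <= jbr x"
  unfolding jbr_def by (metis real_sqrt_abs real_sqrt_le_iff add_increasing order_refl zero_le_one)
lemma jbr_mono: "\<bar>x\<bar> <= \<bar>y\<bar> ==> jbr x <= jbr y"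
  by (simp add: jbr_def abs_le_square_iff)
lemma jbr_le_1_abs: "jbr x <= 1 + \<bar>x\<bar>"
  unfolding jbr_def by (rule real_le_lsqrt) (auto simp: power2_eq_square algebra_simps)
lemma jbr_lipschitz: "\<bar>jbr x - jbr y\<bar> <= \<bar>x - y\<bar>"
proof -
  have e: "(jbr x)^2 - (jbr y)^2 = x^2 - y^2" by (simp add: jbr_def)
  have "\<bar>jbr x - jbr y\<bar> * (jbr x + jbr y) = \<bar>(jbr x)^2 - (jbr y)^2\<bar>"
    by (simp add: power2_eq_square square_diff_square_factored abs_mult)
  also have "... = \<bar>x - y\<bar> * \<bar>x + y\<bar>"
    unfolding e by (simp add: power2_eq_square square_diff_square_factored abs_mult)
  also have "... <= \<bar>x - y\<bar> * (jbr x + jbr y)"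
    using abs_le_jbr[of x] abs_le_jbr[of y] by (intro mult_left_mono) auto
  finally show ?thesis using jbr_pos[of x] jbr_pos[of y] by (simp add: mult_le_cancel_right)
qed

lemma integrable_jbr_powr:
  assumes "e < -1"
  shows "integrable lborel (\<lambda>x. jbr x powr e)"
proof -
  have "((\<lambda>x. x powr e) has_integral - (1 powr (e + 1)) / (e + 1)) {1..}"
    using assms by (intro has_integral_powr_to_inf) auto
  then have "(\<lambda>x::real. x powr e) absolutely_integrable_on {1..}"
    by (intro nonnegative_absolutely_integrable_1) (auto simp: has_integral_integrable)
  then have "integrable lebesgue (\<lambda>x::real. indicator {1..} x *\<^sub>R (x powr e))"
    by (simp add: set_integrable_def)
  then have i1: "integrable lborel (\<lambda>x::real. indicator {1..} x *\<^sub>R (x powr e))"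
    by (subst (asm) integrable_completion) auto
  have i2: "integrable lborel (\<lambda>x::real. indicator {1..} (- x) *\<^sub>R ((- x) powr e))"
    using lborel_integrable_real_affine[OF i1, of "-1" 0] by simp
  have i3: "integrable lborel (\<lambda>x::real. indicator {-1..1} x :: real)" by simp
  have "integrable lborel (\<lambda>x::real. indicator {1..} x *\<^sub>R (x powr e) + indicator {1..} (- x) *\<^sub>R ((- x) powr e) + indicator {-1..1} x)"
    by (intro Bochner_Integration.integrable_add i1 i2 i3)
  then show ?thesis
  proof (rule Bochner_Integration.integrable_bound)
    show "AE x in lborel. norm (jbr x powr e) <= norm (indicator {1..} x *\<^sub>R (x powr e) + indicator {1..} (- x) *\<^sub>R ((- x) powr e) + indicator {-1..1} x)"
    proof (rule AE_I2)
      fix x :: real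
      have "jbr x powr e <= \<bar>x\<bar> powr e" if "1 <= \<bar>x\<bar>"
        using abs_le_jbr[of x] assms that by (intro powr_mono2') auto
      moreover have "jbr x powr e <= 1 powr e"
        using jbr_ge_1[of x] assms by (intro powr_mono2') auto
      ultimately show "norm (jbr x powr e) <= norm (indicator {1..} x *\<^sub>R (x powr e) + indicator {1..} (- x) *\<^sub>R ((- x) powr e) + indicator {-1..1} x)"
        by (auto simp: indicator_def)
    qed
  qed measurable
qed

section \<open>Bilinear integral operators with kernels controlled by a square integrable
  weight\<close>

locale sob =
  fixes s :: real
  assumes s_gt: "s > 3 / 2"
begin

text \<open>\<open>J\<close> is \<open>jbr\<close> divided by the Sobolev weight of order
  \<open>s\<close>. It is square integrable because \<open>2 * (1 - s) < -1\<close>, which is the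
  condition s > 3/2; then \<open>J\<close> times an L2 function is integrable, the Fourier form of
  the embedding of H^(s-1) into bounded functions.\<close>

definition J :: "real => real" where "J t = jbr t powr (1 - s)"

lemma J_measurable [measurable]: "J \<in> meas"
  unfolding J_def[abs_def] by measurable
lemma J_pos [simp]: "J t > 0" by (simp add: J_def less_imp_neq[OF jbr_pos, symmetric])
lemma J_nonneg [simp]: "J t \<ge> 0" by (simp add: less_imp_le)
lemma J_minus [simp]: "J (- t) = J t" by (simp add: J_def)

lemma integrable_J2: "integrable lborel (\<lambda>t. (J t)^2)"
proof -
  have "(\<lambda>t. (J t)^2) = (\<lambda>t. jbr t powr (2 * (1 - s)))"
    by (auto simp: J_def powr_powr[symmetric] powr_realpow[symmetric] powr_add[symmetric] power2_eq_square)
  then show ?thesis using integrable_jbr_powr[of "2 * (1 - s)"] s_gt by simp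
qed

definition nJ :: real where "nJ = sqrt (LBINT t. (J t)^2)"
text \<open>The factor 3 counts the three terms in the bound of \<open>kern\<close>, each of which
  costs \<open>nJ\<close>.\<close>

definition CJ :: real where "CJ = 3 * nJ"

lemma nJ_nonneg [simp]: "nJ \<ge> 0" by (simp add: nJ_def)
lemma CJ_nonneg [simp]: "CJ \<ge> 0" by (simp add: CJ_def)

lemma nn_J2: "(NN t. ennreal ((J t)^2)) = ennreal (nJ^2)"
  unfolding nJ_def using integrable_J2 by (subst nn_integral_eq_integral) auto

text \<open>The decay \<open>J\<close> may sit in the frequency \<open>u - v\<close> of the first
  argument, in the frequency \<open>v\<close> of the second, or in the output frequency
  \<open>u\<close>. The symmetry condition makes the operator preserve Hermitian functions.\<close>

definition kern :: "real => (real => real => complex) => bool" where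
  "kern K k \<longleftrightarrow> (\<lambda>(u, v). k u v) \<in> meas2 \<and>
     (\<forall>u v. k (- u) (- v) = cnj (k u v)) \<and>
     (\<forall>u v. cmod (k u v) <= K * (J (u - v) + J v + J u))"

definition bilf :: "(real => real => complex) => h => h => real => complex" where
  "bilf k x y u = (LBINT v. k u v * fn x (u - v) * fn y v)"

definition bil :: "(real => real => complex) => h => h => h" where
  "bil k x y = toh (bilf k x y)"

definition bilN :: "(real => real => complex) => h => h => real => ennreal" where
  "bilN k x y u = (NN v. ennreal (cmod (k u v * fn x (u - v) * fn y v)))"

lemma kern_nonneg: assumes "kern K k" shows "K \<ge> 0"
proof -
  have "0 <= K * (J (0 - 0) + J 0 + J 0)" using assms norm_ge_zero order_trans unfolding kern_def by blast
  moreover have "J (0 - 0) + J 0 + J 0 > 0" by (intro add_pos_pos J_pos)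
  ultimately show ?thesis by (simp only: zero_le_mult_iff) linarith
qed

lemma kern_measurable: "kern K k ==> (\<lambda>(u, v). k u v) \<in> meas2"
  by (simp add: kern_def)

lemma kern_section_measurable: assumes "kern K k" shows "k u \<in> meas"
proof -
  have "(\<lambda>v. (\<lambda>(u, v). k u v) (u, v)) \<in> meas"
    by (rule measurable_compose[OF _ kern_measurable[OF assms]]) measurable
  then show ?thesis by simp
qed

lemma integrand_measurable:
  assumes "kern K k"
  shows "(\<lambda>(u, v). k u v * fn x (u - v) * fn y v) \<in> meas2"
proof -
  note [measurable] = kern_measurable[OF assms]
  have "(\<lambda>p. (\<lambda>(u, v). k u v) p * fn x (fst p - snd p) * fn y (snd p)) \<in> meas2"
    by measurable
  then show ?thesis by (simp add: case_prod_beta')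
qed

lemma nn_J_fn: "(NN t. ennreal (J t) * ennreal (cmod (fn x t))) <= ennreal (nJ * norm x)"
proof -
  have "(NN t. ennreal (J t) * ennreal (cmod (fn x t)))^2 <= ennreal (nJ^2) * ennreal ((norm x)^2)"
    using Cauchy_Schwarz_nn_integral[of "\<lambda>t. ennreal (J t)" lborel "\<lambda>t. ennreal (cmod (fn x t))"]
    by (simp add: ennreal_power nn_J2 nn_norm_fn)
  also have "... = (ennreal (nJ * norm x))^2"
    by (simp add: ennreal_power ennreal_mult'[symmetric] power_mult_distrib)
  finally show ?thesis by (rule ennreal_sq_le_imp_le) simp
qed

text \<open>When \<open>J\<close> sits on an argument, that argument becomes integrable and Young's
  inequality applies (\<open>A\<close>, \<open>B\<close>). When it sits on \<open>u\<close>,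
  Cauchy-Schwarz bounds the convolution uniformly in \<open>u\<close>, and \<open>J\<close> itself
  is square integrable (\<open>C\<close>).\<close>

lemma bilN_bound:
  assumes "kern K k"
  shows "(NN u. (bilN k x y u)^2) <= ennreal ((K * CJ * norm x * norm y)^2)"
proof -
  define X Y where "X t = ennreal (cmod (fn x t))" and "Y t = ennreal (cmod (fn y t))" for t
  have [measurable]: "X \<in> meas" "Y \<in> meas"
    unfolding X_def[abs_def] Y_def[abs_def] by measurable
  define A where "A u = (NN v. (ennreal (J (u - v)) * X (u - v)) * Y v)" for u
  define B where "B u = (NN v. (ennreal (J (u - v)) * Y (u - v)) * X v)" for u
  define C where "C u = ennreal (J u) * (NN v. X (u - v) * Y v)" for u
  have K0: "K \<ge> 0" by (rule kern_nonneg[OF assms])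
  have X2: "(NN t. (X t)^2) = ennreal ((norm x)^2)" and Y2: "(NN t. (Y t)^2) = ennreal ((norm y)^2)"
    by (simp_all add: X_def Y_def ennreal_power nn_norm_fn)
  have [measurable]: "A \<in> meas" "B \<in> meas" "C \<in> meas"
    unfolding A_def[abs_def] B_def[abs_def] C_def[abs_def] by measurable
  have le: "bilN k x y u <= ennreal K * (A u + B u + C u)" for u
  proof -
    have "bilN k x y u <= (NN v. ennreal K * ((ennreal (J (u - v)) * X (u - v)) * Y v + X (u - v) * (ennreal (J v) * Y v) + ennreal (J u) * (X (u - v) * Y v)))"
      unfolding bilN_def
    proof (intro nn_integral_mono)
      fix v :: real
      have "cmod (k u v * fn x (u - v) * fn y v) <= K * (J (u - v) + J v + J u) * cmod (fn x (u - v)) * cmod (fn y v)"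
        using assms unfolding norm_mult kern_def by (intro mult_right_mono) auto
      also have "... = K * ((J (u - v) * cmod (fn x (u - v))) * cmod (fn y v) + cmod (fn x (u - v)) * (J v * cmod (fn y v)) + J u * (cmod (fn x (u - v)) * cmod (fn y v)))"
        by (simp add: algebra_simps)
      finally show "ennreal (cmod (k u v * fn x (u - v) * fn y v)) <= ennreal K * ((ennreal (J (u - v)) * X (u - v)) * Y v + X (u - v) * (ennreal (J v) * Y v) + ennreal (J u) * (X (u - v) * Y v))"
        unfolding X_def Y_def using K0
        by (simp add: ennreal_mult'[symmetric] ennreal_plus[symmetric] ennreal_leI del: ennreal_plus)
    qed
    also have "... = ennreal K * (A u + (NN v. X (u - v) * (ennreal (J v) * Y v)) + C u)"
      unfolding A_def C_def by (simp add: nn_integral_cmult nn_integral_add)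
    also have "(NN v. X (u - v) * (ennreal (J v) * Y v)) = B u"
      using nn_integral_reflect_shift[of "\<lambda>v. X (u - v) * (ennreal (J v) * Y v)" u]
      by (simp add: B_def mult.commute)
    finally show ?thesis .
  qed
  have iA: "(NN u. (A u)^2) <= ennreal ((nJ * norm x * norm y)^2)"
  proof -
    have "(NN u. (A u)^2) <= (NN t. ennreal (J t) * X t)^2 * ennreal ((norm y)^2)"
      unfolding A_def Y2[symmetric] by (rule Young_nn) measurable
    also have "... <= (ennreal (nJ * norm x))^2 * ennreal ((norm y)^2)"
      unfolding X_def by (intro mult_right_mono power_mono nn_J_fn) auto
    finally show ?thesis by (simp add: ennreal_power ennreal_mult'[symmetric] power_mult_distrib)
  qed
  have iB: "(NN u. (B u)^2) <= ennreal ((nJ * norm x * norm y)^2)"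
  proof -
    have "(NN u. (B u)^2) <= (NN t. ennreal (J t) * Y t)^2 * ennreal ((norm x)^2)"
      unfolding B_def X2[symmetric] by (rule Young_nn) measurable
    also have "... <= (ennreal (nJ * norm y))^2 * ennreal ((norm x)^2)"
      unfolding Y_def by (intro mult_right_mono power_mono nn_J_fn) auto
    finally show ?thesis by (simp add: ennreal_power ennreal_mult'[symmetric] power_mult_distrib mult_ac)
  qed
  have iC: "(NN u. (C u)^2) <= ennreal ((nJ * norm x * norm y)^2)"
  proof -
    have "(NN v. X (u - v) * Y v)^2 <= ennreal ((norm x)^2 * (norm y)^2)" for u
    proof -
      have "(NN v. X (u - v) * Y v)^2 <= (NN v. (X (u - v))^2) * (NN v. (Y v)^2)"
        by (rule Cauchy_Schwarz_nn_integral) measurable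
      also have "(NN v. (X (u - v))^2) = ennreal ((norm x)^2)"
        using nn_integral_reflect_shift[of "\<lambda>t. (X t)^2" u] X2 by simp
      finally show ?thesis by (simp add: Y2 ennreal_mult'[symmetric])
    qed
    then have "(NN u. (C u)^2) <= (NN u. ennreal ((J u)^2) * ennreal ((norm x)^2 * (norm y)^2))"
      unfolding C_def by (intro nn_integral_mono) (auto simp: power_mult_distrib ennreal_power intro!: mult_left_mono)
    also have "... = ennreal ((nJ * norm x * norm y)^2)"
      by (subst nn_integral_multc) (auto simp: nn_J2 ennreal_mult'[symmetric] power_mult_distrib mult_ac)
    finally show ?thesis .
  qed
  have sq3: "(a + b + c)^2 <= 3 * (a^2 + b^2 + c^2)" for a b c :: ennreal
  proof (cases "a = \<top> \<or> b = \<top> \<or> c = \<top>")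
    case True then show ?thesis by (auto simp: ennreal_mult_top ennreal_top_mult power2_eq_square)
  next
    case False
    then obtain a' b' c' where r: "a = ennreal a'" "b = ennreal b'" "c = ennreal c'" "a' \<ge> 0" "b' \<ge> 0" "c' \<ge> 0"
      by (metis ennreal_cases)
    have "(a' + b' + c')^2 <= 3 * (a'^2 + b'^2 + c'^2)"
      using sum_squares_bound[of a' b'] sum_squares_bound[of a' c'] sum_squares_bound[of b' c']
      by (simp add: power2_eq_square algebra_simps)
    then have "ennreal ((a' + b' + c')^2) <= ennreal (3 * (a'^2 + b'^2 + c'^2))" by (rule ennreal_leI)
    also have "ennreal (3 * (a'^2 + b'^2 + c'^2)) = 3 * ennreal (a'^2 + b'^2 + c'^2)"
      by (simp only: ennreal_mult' ennreal_numeral)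
    finally show ?thesis using r by (simp add: ennreal_power ennreal_plus[symmetric] del: ennreal_plus)
  qed
  have "(NN u. (bilN k x y u)^2) <= (NN u. ennreal (3 * K^2) * ((A u)^2 + (B u)^2 + (C u)^2))"
  proof (intro nn_integral_mono)
    fix u :: real
    have "(bilN k x y u)^2 <= (ennreal K * (A u + B u + C u))^2" by (intro power_mono le) auto
    also have "... <= ennreal (K^2) * (3 * ((A u)^2 + (B u)^2 + (C u)^2))"
      unfolding power_mult_distrib ennreal_power[OF K0] by (intro mult_left_mono sq3) auto
    also have "... = ennreal (3 * K^2) * ((A u)^2 + (B u)^2 + (C u)^2)"
      by (simp add: ennreal_mult' mult_ac del: distrib_left_numeral)
    finally show "(bilN k x y u)^2 <= ennreal (3 * K^2) * ((A u)^2 + (B u)^2 + (C u)^2)" .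
  qed
  also have "... = ennreal (3 * K^2) * ((NN u. (A u)^2) + (NN u. (B u)^2) + (NN u. (C u)^2))"
    by (simp add: nn_integral_cmult nn_integral_add)
  also have "... <= ennreal (3 * K^2) * (ennreal ((nJ * norm x * norm y)^2) + ennreal ((nJ * norm x * norm y)^2) + ennreal ((nJ * norm x * norm y)^2))"
    by (intro mult_left_mono add_mono iA iB iC) auto
  also have "... = ennreal ((K * CJ * norm x * norm y)^2)"
    by (simp add: ennreal_plus[symmetric] ennreal_mult'[symmetric] CJ_def power_mult_distrib del: ennreal_plus)
  finally show ?thesis .
qed

lemma bilN_measurable: assumes "kern K k" shows "bilN k x y \<in> meas"
proof -
  note [measurable] = integrand_measurable[OF assms, of x y]
  have "(\<lambda>u. \<integral>\<^sup>+v. ennreal (cmod ((\<lambda>(u, v). k u v * fn x (u - v) * fn y v) (u, v))) \<partial>lborel) \<in> meas"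
    by measurable
  then show ?thesis by (simp add: bilN_def[abs_def])
qed

lemma bilf_measurable: assumes "kern K k" shows "bilf k x y \<in> meas"
proof -
  have "(\<lambda>(u, v). k u v * fn x (u - v) * fn y v) \<in> borel_measurable (borel \<Otimes>\<^sub>M lborel)"
    using integrand_measurable[OF assms, of x y] by (simp cong: measurable_cong_sets)
  from lborel.borel_measurable_lebesgue_integral[OF this]
  show ?thesis by (simp add: bilf_def[abs_def])
qed

lemma bilf_integrable_AE:
  assumes "kern K k"
  shows "AE u in lborel. integrable lborel (\<lambda>v. k u v * fn x (u - v) * fn y v)"
proof -
  note [measurable] = bilN_measurable[OF assms, of x y] kern_section_measurable[OF assms]
  have "(NN u. (bilN k x y u)^2) \<noteq> \<infinity>"
    using bilN_bound[OF assms, of x y] by (auto simp: top_unique)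
  then have "AE u in lborel. (bilN k x y u)^2 \<noteq> \<infinity>"
    by (intro nn_integral_PInf_AE) auto
  then show ?thesis
  proof eventually_elim
    case (elim u)
    then have "bilN k x y u < \<infinity>" using ennreal_sq_less_top by (simp add: less_top)
    then show ?case unfolding bilN_def by (intro integrableI_bounded) auto
  qed
qed

lemma herm2_bilf: assumes "kern K k" shows "herm2 (bilf k x y)"
  unfolding herm2_def csq_int_nn
proof (intro conjI allI)
  have "(NN u. ennreal ((cmod (bilf k x y u))^2)) <= (NN u. (bilN k x y u)^2)"
    unfolding bilN_def bilf_def
    by (intro nn_integral_mono) (auto simp: ennreal_power[symmetric] intro!: power_mono norm_integral_le_nn)
  with bilN_bound[OF assms, of x y] show "(NN u. ennreal ((cmod (bilf k x y u))^2)) < \<infinity>"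
    by (auto intro: le_less_trans[OF order_trans])
  show "bilf k x y \<in> borel_measurable lborel" using bilf_measurable[OF assms] by simp
  fix u :: real
  have "bilf k x y (- u) = (LBINT v. k (- u) (0 - v) * fn x (- u - (0 - v)) * fn y (0 - v))"
    unfolding bilf_def by (rule integral_reflect_shift[symmetric])
  also have "... = (LBINT v. cnj (k u v * fn x (u - v) * fn y v))"
  proof (intro Bochner_Integration.integral_cong refl)
    fix v :: real
    have "fn x (- u - (0 - v)) = cnj (fn x (u - v))" using fn_minus[of x "u - v"] by (simp add: algebra_simps)
    then show "k (- u) (0 - v) * fn x (- u - (0 - v)) * fn y (0 - v) = cnj (k u v * fn x (u - v) * fn y v)"
      using assms by (simp add: kern_def)
  qed
  finally show "bilf k x y (- u) = cnj (bilf k x y u)" by (simp only: Bochner_Integration.integral_cnj bilf_def)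
qed

lemma norm_bil_le: assumes "kern K k" shows "norm (bil k x y) <= K * CJ * norm x * norm y"
  unfolding bil_def
proof (rule norm_toh_le[OF herm2_bilf[OF assms]])
  have "(NN u. ennreal ((cmod (bilf k x y u))^2)) <= (NN u. (bilN k x y u)^2)"
    unfolding bilN_def bilf_def
    by (intro nn_integral_mono) (auto simp: ennreal_power[symmetric] intro!: power_mono norm_integral_le_nn)
  with bilN_bound[OF assms, of x y]
  show "(NN u. ennreal ((cmod (bilf k x y u))^2)) <= ennreal ((K * CJ * norm x * norm y)^2)" by auto
  show "0 <= K * CJ * norm x * norm y" using kern_nonneg[OF assms] by simp
qed

lemma bil_eqI:
  assumes "kern K k" "kern L l"
    and "\<And>u. AE v in lborel. k u v * fn x (u - v) * fn y v = l u v * fn x' (u - v) * fn y' v"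
  shows "bil k x y = bil l x' y'"
proof -
  have "bilf k x y u = bilf l x' y' u" for u
    unfolding bilf_def
  proof (rule integral_cong_AE)
    note [measurable] = kern_section_measurable[OF assms(1)] kern_section_measurable[OF assms(2)]
    show "(\<lambda>v. k u v * fn x (u - v) * fn y v) \<in> borel_measurable lborel" by measurable
    show "(\<lambda>v. l u v * fn x' (u - v) * fn y' v) \<in> borel_measurable lborel" by measurable
  qed (rule assms(3))
  then have "bilf k x y = bilf l x' y'" by (rule ext)
  then show ?thesis by (simp add: bil_def)
qed

text \<open>The Bochner integral is additive where both integrals exist, which
  \<open>bilf_integrable_AE\<close> gives for almost every \<open>u\<close>; that is enough for an
  equality of classes.\<close>

lemma bil_sumI:
  assumes "kern K k" "kern L l" "kern M m"
    and "\<And>u. AE v in lborel. k u v * fn x (u - v) * fn y v =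
      l u v * fn x' (u - v) * fn y' v + m u v * fn x'' (u - v) * fn y'' v"
  shows "bil k x y = bil l x' y' + bil m x'' y''"
  unfolding bil_def toh_add[OF herm2_bilf[OF assms(2)] herm2_bilf[OF assms(3)]]
proof (rule toh_eqI[OF herm2_bilf[OF assms(1)] herm2_add[OF herm2_bilf[OF assms(2)] herm2_bilf[OF assms(3)]]])
  note [measurable] = kern_section_measurable[OF assms(1)] kern_section_measurable[OF assms(2)] kern_section_measurable[OF assms(3)]
  show "AE u in lborel. bilf k x y u = bilf l x' y' u + bilf m x'' y'' u"
    using bilf_integrable_AE[OF assms(2), of x' y'] bilf_integrable_AE[OF assms(3), of x'' y'']
  proof eventually_elim
    case (elim u)
    have "bilf k x y u = (LBINT v. l u v * fn x' (u - v) * fn y' v + m u v * fn x'' (u - v) * fn y'' v)"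
      unfolding bilf_def by (rule integral_cong_AE[OF _ _ assms(4)]) measurable
    also have "... = bilf l x' y' u + bilf m x'' y'' u"
      unfolding bilf_def by (rule Bochner_Integration.integral_add[OF elim])
    finally show ?case .
  qed
qed

lemma kern_scale: "kern K k ==> kern (\<bar>c\<bar> * K) (\<lambda>u v. cx c * k u v)"
  unfolding kern_def by (auto simp: norm_mult case_prod_beta' mult.assoc intro!: mult_left_mono)

lemma kern_add: assumes "kern K k" "kern L l" shows "kern (K + L) (\<lambda>u v. k u v + l u v)"
  using assms unfolding kern_def
  by (auto simp: case_prod_beta' ring_distribs(2) intro!: order_trans[OF norm_triangle_ineq] add_mono)

lemma kern_swap: assumes "kern K k" shows "kern K (\<lambda>u v. k u (u - v))"
proof -
  have "(\<lambda>p. (\<lambda>(u, v). k u v) (fst p, fst p - snd p)) \<in> meas2"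
    by (rule measurable_compose[OF _ kern_measurable[OF assms]]) measurable
  moreover have "k (- u) (- u - - v) = cnj (k u (u - v))" for u v
  proof -
    have "k (- u) (- (u - v)) = cnj (k u (u - v))" using assms unfolding kern_def by blast
    then show ?thesis by (simp add: algebra_simps)
  qed
  moreover have "cmod (k u (u - v)) <= K * (J (u - v) + J v + J u)" for u v
  proof -
    have "cmod (k u (u - v)) <= K * (J (u - (u - v)) + J (u - v) + J u)" using assms unfolding kern_def by blast
    then show ?thesis by (simp add: add_ac)
  qed
  ultimately show ?thesis unfolding kern_def by (simp add: case_prod_beta')
qed

lemma kern_adj: assumes "kern K k" shows "kern K (\<lambda>u v. cnj (k v u))"
proof -
  have c: "cnj \<in> meas" by (intro borel_measurable_continuous_onI continuous_intros)
  have "(\<lambda>p. (\<lambda>(u, v). k u v) (snd p, fst p)) \<in> meas2"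
    by (rule measurable_compose[OF _ kern_measurable[OF assms]]) measurable
  then have "(\<lambda>p. cnj (k (snd p) (fst p))) \<in> meas2"
    using measurable_compose[OF _ c] by simp
  moreover have "cmod (k v u) <= K * (J (u - v) + J v + J u)" for u v
  proof -
    have "cmod (k v u) <= K * (J (v - u) + J u + J v)" using assms unfolding kern_def by blast
    then show ?thesis using J_minus[of "u - v"] by (simp add: add_ac)
  qed
  ultimately show ?thesis using assms unfolding kern_def by (simp add: case_prod_beta')
qed

lemma kern_Mul:
  assumes "kern K k" "bsym A a" "bsym B b" "bsym M m"
  shows "kern (M * K * A * B) (\<lambda>u v. m u * k u v * a (u - v) * b v)"
proof -
  note [measurable] = kern_measurable[OF assms(1)] bsym_measurable[OF assms(2)] bsym_measurable[OF assms(3)] bsym_measurable[OF assms(4)]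
  have "(\<lambda>p. m (fst p) * (\<lambda>(u, v). k u v) p * a (fst p - snd p) * b (snd p)) \<in> meas2"
    by measurable
  moreover have "a (- u - - v) = cnj (a (u - v))" for u v
  proof -
    have "a (- (u - v)) = cnj (a (u - v))" using assms(2) unfolding bsym_def by blast
    then show ?thesis by (simp add: algebra_simps)
  qed
  moreover have "cmod (m u * k u v * a (u - v) * b v) <= (M * K * A * B) * (J (u - v) + J v + J u)" for u v
  proof -
    have "cmod (m u * k u v * a (u - v) * b v) <= M * (K * (J (u - v) + J v + J u)) * A * B"
      unfolding norm_mult using assms kern_nonneg[OF assms(1)] bsym_nonneg[OF assms(2)] bsym_nonneg[OF assms(3)] bsym_nonneg[OF assms(4)]
      by (intro mult_mono) (auto simp: kern_def bsym_def intro!: mult_nonneg_nonneg add_nonneg_nonneg)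
    then show ?thesis by (simp add: mult_ac)
  qed
  moreover have "m (- u) = cnj (m u)" "k (- u) (- v) = cnj (k u v)" "b (- v) = cnj (b v)" for u v
    using assms(1,3,4) unfolding kern_def bsym_def by blast+
  ultimately show ?thesis unfolding kern_def by (simp only: case_prod_beta' complex_cnj_mult simp_thms prod.collapse)
qed

lemma bil_kernel_add: "kern K k ==> kern L l ==> bil (\<lambda>u v. k u v + l u v) x y = bil k x y + bil l x y"
  by (rule bil_sumI[OF kern_add]) (auto simp: ring_distribs)

lemma bil_add_left: assumes "kern K k" shows "bil k (x + x') y = bil k x y + bil k x' y"
proof (rule bil_sumI[OF assms assms assms])
  fix u :: real
  show "AE v in lborel. k u v * fn (x + x') (u - v) * fn y v = k u v * fn x (u - v) * fn y v + k u v * fn x' (u - v) * fn y v"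
    using AE_lborel_reflect_shift[OF fn_add[of x x'], of u] by eventually_elim (simp add: ring_distribs)
qed

lemma bil_add_right: assumes "kern K k" shows "bil k x (y + y') = bil k x y + bil k x y'"
proof (rule bil_sumI[OF assms assms assms])
  fix u :: real
  show "AE v in lborel. k u v * fn x (u - v) * fn (y + y') v = k u v * fn x (u - v) * fn y v + k u v * fn x (u - v) * fn y' v"
    using fn_add[of y y'] by eventually_elim (simp add: ring_distribs)
qed

lemma bil_kernel_scale: assumes "kern K k" shows "bil (\<lambda>u v. cx c * k u v) x y = c *\<^sub>R bil k x y"
  unfolding bil_def toh_scale[OF herm2_bilf[OF assms]]
  by (rule arg_cong[of _ _ toh]) (simp add: bilf_def[abs_def] mult.assoc)

lemma bil_scale_left: assumes "kern K k" shows "bil k (c *\<^sub>R x) y = c *\<^sub>R bil k x y"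
  unfolding bil_kernel_scale[OF assms, symmetric]
proof (rule bil_eqI[OF assms kern_scale[OF assms]])
  fix u :: real
  show "AE v in lborel. k u v * fn (c *\<^sub>R x) (u - v) * fn y v = cx c * k u v * fn x (u - v) * fn y v"
    using AE_lborel_reflect_shift[OF fn_scale[of c x], of u] by eventually_elim simp
qed

lemma bil_scale_right: assumes "kern K k" shows "bil k x (c *\<^sub>R y) = c *\<^sub>R bil k x y"
  unfolding bil_kernel_scale[OF assms, symmetric]
proof (rule bil_eqI[OF assms kern_scale[OF assms]])
  fix u :: real
  show "AE v in lborel. k u v * fn x (u - v) * fn (c *\<^sub>R y) v = cx c * k u v * fn x (u - v) * fn y v"
    using fn_scale[of c y] by eventually_elim simp
qed

lemma bounded_bilinear_bil: "kern K k ==> bounded_bilinear (bil k)"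
  by standard (auto simp: bil_add_left bil_add_right bil_scale_left bil_scale_right
      intro!: exI[of _ "K * CJ"] order_trans[OF norm_bil_le] simp: mult_ac)

text \<open>Multipliers around a bilinear operator fold into its kernel, so identities between
  operators become scalar identities between symbols.\<close>

lemma Mul_bil_Mul:
  assumes "kern K k" "bsym A a" "bsym B b" "bsym M m"
  shows "Mul m (bil k (Mul a x) (Mul b y)) = bil (\<lambda>u v. m u * k u v * a (u - v) * b v) x y"
proof -
  have k1: "kern (1 * K * A * B) (\<lambda>u v. 1 * k u v * a (u - v) * b v)"
    by (rule kern_Mul[OF assms(1-3)]) (simp add: bsym_def)
  have "bil k (Mul a x) (Mul b y) = bil (\<lambda>u v. 1 * k u v * a (u - v) * b v) x y"
  proof (rule bil_eqI[OF assms(1) k1])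
    fix u :: real
    show "AE v in lborel. k u v * fn (Mul a x) (u - v) * fn (Mul b y) v = 1 * k u v * a (u - v) * b v * fn x (u - v) * fn y v"
      using AE_lborel_reflect_shift[OF fn_Mul[OF assms(2), of x], of u] fn_Mul[OF assms(3), of y]
      by eventually_elim simp
  qed
  then show ?thesis
    unfolding bil_def using Mul_toh[OF assms(4) herm2_bilf[OF k1, of x y]]
    by (simp add: bilf_def[abs_def] mult.assoc)
qed

lemma bil_swap: assumes "kern K k" shows "bil k x y = bil (\<lambda>u v. k u (u - v)) y x"
proof -
  have "bilf k x y u = bilf (\<lambda>u v. k u (u - v)) y x u" for u
    unfolding bilf_def
    using integral_reflect_shift[of "\<lambda>v. k u v * fn x (u - v) * fn y v" u]
    by (simp add: mult_ac)
  then have "bilf k x y = bilf (\<lambda>u v. k u (u - v)) y x" by (rule ext)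
  then show ?thesis by (simp add: bil_def)
qed

text \<open>Absolute integrability on the plane is what allows the two frequency variables to be
  exchanged in \<open>bil_adjoint\<close>.\<close>

lemma inner_bil:
  assumes "kern K k"
  shows "integrable (lborel \<Otimes>\<^sub>M lborel) (\<lambda>(u, v). cnj (fn z u) * (k u v * fn x (u - v) * fn y v))"
    and "inner z (bil k x y) = Re (\<integral>p. (\<lambda>(u, v). cnj (fn z u) * (k u v * fn x (u - v) * fn y v)) p \<partial>(lborel \<Otimes>\<^sub>M lborel))"
proof -
  have c: "cnj \<in> meas" by (intro borel_measurable_continuous_onI continuous_intros)
  note [measurable] = integrand_measurable[OF assms, of x y] c bilN_measurable[OF assms, of x y] kern_section_measurable[OF assms]
  have "(\<lambda>p. cnj (fn z (fst p)) * (\<lambda>(u, v). k u v * fn x (u - v) * fn y v) p) \<in> meas2"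
    by measurable
  then have m: "(\<lambda>(u, v). cnj (fn z u) * (k u v * fn x (u - v) * fn y v)) \<in> borel_measurable (lborel \<Otimes>\<^sub>M lborel)"
    by (simp add: case_prod_beta' cong: measurable_cong_sets)
  have "(\<integral>\<^sup>+p. ennreal (cmod ((\<lambda>(u, v). cnj (fn z u) * (k u v * fn x (u - v) * fn y v)) p)) \<partial>(lborel \<Otimes>\<^sub>M lborel))
     = (NN u. \<integral>\<^sup>+v. ennreal (cmod (cnj (fn z u) * (k u v * fn x (u - v) * fn y v))) \<partial>lborel)"
    using m by (subst lborel.nn_integral_fst[symmetric]) (auto cong: measurable_cong_sets)
  also have "... = (NN u. ennreal (cmod (fn z u)) * bilN k x y u)"
    unfolding bilN_def norm_mult complex_mod_cnj
    by (intro nn_integral_cong) (auto simp: ennreal_mult' nn_integral_cmult[symmetric] intro!: nn_integral_cong)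
  also have "... < \<infinity>"
  proof -
    have "(NN u. ennreal (cmod (fn z u)) * bilN k x y u)^2 <= (NN u. (ennreal (cmod (fn z u)))^2) * (NN u. (bilN k x y u)^2)"
      by (rule Cauchy_Schwarz_nn_integral) measurable
    also have "... <= ennreal ((norm z)^2) * ennreal ((K * CJ * norm x * norm y)^2)"
      by (intro mult_mono bilN_bound[OF assms]) (auto simp: ennreal_power nn_norm_fn)
    also have "... < \<infinity>" by (simp add: ennreal_mult'[symmetric])
    finally show ?thesis using ennreal_sq_less_top by simp
  qed
  finally show i: "integrable (lborel \<Otimes>\<^sub>M lborel) (\<lambda>(u, v). cnj (fn z u) * (k u v * fn x (u - v) * fn y v))"
    using m by (intro integrableI_bounded) auto
  have "inner z (bil k x y) = inner (bil k x y) (toh (fn z))" by (simp add: inner_commute)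
  also have "... = Re (LBINT u. bilf k x y u * cnj (fn z u))"
    unfolding bil_def by (rule inner_toh[OF herm2_bilf[OF assms] herm2_fn])
  also have "(LBINT u. bilf k x y u * cnj (fn z u)) = (LBINT u. \<integral>v. cnj (fn z u) * (k u v * fn x (u - v) * fn y v) \<partial>lborel)"
    by (simp add: bilf_def mult.commute)
  also have "... = (\<integral>p. (\<lambda>(u, v). cnj (fn z u) * (k u v * fn x (u - v) * fn y v)) p \<partial>(lborel \<Otimes>\<^sub>M lborel))"
    using lborel_pair.integral_fst'[OF i] by simp
  finally show "inner z (bil k x y) = Re (\<integral>p. (\<lambda>(u, v). cnj (fn z u) * (k u v * fn x (u - v) * fn y v)) p \<partial>(lborel \<Otimes>\<^sub>M lborel))" .
qed

text \<open>Exchange \<open>u\<close> and \<open>v\<close> in the double integral: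
  \<open>fn x (v - u)\<close> is the conjugate of \<open>fn x (u - v)\<close>, so the integrand
  turns into its conjugate, and the real part does not change.\<close>

lemma bil_adjoint:
  assumes "kern K k"
  shows "inner z (bil k x y) = inner y (bil (\<lambda>u v. cnj (k v u)) x z)"
proof -
  let ?f = "\<lambda>(u, v). cnj (fn z u) * (k u v * fn x (u - v) * fn y v)"
  let ?g = "\<lambda>(u, v). cnj (fn y u) * (cnj (k v u) * fn x (u - v) * fn z v)"
  have eq: "?g p = cnj (?f (snd p, fst p))" for p
    using fn_minus[of x "fst p - snd p"] by (cases p) (simp add: mult_ac)
  have "(\<integral>p. ?g p \<partial>(lborel \<Otimes>\<^sub>M lborel)) = (\<integral>p. cnj (?f (snd p, fst p)) \<partial>(lborel \<Otimes>\<^sub>M lborel))"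
    by (intro Bochner_Integration.integral_cong refl eq)
  also have "... = cnj (\<integral>p. ?f (snd p, fst p) \<partial>(lborel \<Otimes>\<^sub>M lborel))"
    by (rule Bochner_Integration.integral_cnj)
  also have "(\<integral>p. ?f (snd p, fst p) \<partial>(lborel \<Otimes>\<^sub>M lborel)) = (\<integral>p. ?f p \<partial>(lborel \<Otimes>\<^sub>M lborel))"
    using lborel_pair.integral_product_swap[of ?f] borel_measurable_integrable[OF inner_bil(1)[OF assms, of z x y]]
    by (simp add: case_prod_beta')
  finally show ?thesis
    using inner_bil(2)[OF assms, of z x y] inner_bil(2)[OF kern_adj[OF assms], of y x z] by simp
qed

end

section \<open>Slowly varying weights\<close>

lemma jbr_neq_0 [simp]: "jbr x \<noteq> 0" using jbr_pos[of x] by linarith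

text \<open>The exponent controls the logarithmic derivative, which is all that the commutator estimates use.\<close>
definition slow :: "nat => (real => real) => bool" where
  "slow K a \<longleftrightarrow> a \<in> meas \<and> (\<forall>x. 0 < a x) \<and>
     (\<forall>x y. \<bar>x\<bar> <= \<bar>y\<bar> \<longrightarrow> a x <= a y \<and> a y <= a x * (jbr y / jbr x) ^ K)"

lemma slow_pos: "slow K a ==> 0 < a x" by (simp add: slow_def)
lemma slow_measurable: "slow K a ==> a \<in> meas" by (simp add: slow_def)
lemma slow_mono: "slow K a ==> \<bar>x\<bar> <= \<bar>y\<bar> ==> a x <= a y" by (simp add: slow_def)
lemma slow_growth: "slow K a ==> \<bar>x\<bar> <= \<bar>y\<bar> ==> a y <= a x * (jbr y / jbr x) ^ K" by (simp add: slow_def)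
lemma slow_even: "slow K a ==> a (- x) = a x"
  using slow_mono[of K a x "-x"] slow_mono[of K a "-x" x] by auto

lemma jbr_ratio_ge_1: "\<bar>x\<bar> <= \<bar>y\<bar> ==> 1 <= jbr y / jbr x"
  using jbr_mono[of x y] by simp

lemma slow_mult: assumes "slow K a" "slow L b" shows "slow (K + L) (\<lambda>x. a x * b x)"
  unfolding slow_def
proof (intro conjI allI impI)
  show "(\<lambda>x. a x * b x) \<in> meas"
    using assms by (intro borel_measurable_times) (auto simp: slow_def)
  fix x y :: real
  show "0 < a x * b x" using assms by (simp add: slow_def)
  assume xy: "\<bar>x\<bar> <= \<bar>y\<bar>"
  show "a x * b x <= a y * b y"
    using slow_mono[OF assms(1) xy] slow_mono[OF assms(2) xy] slow_pos[OF assms(1)] slow_pos[OF assms(2)]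
    by (intro mult_mono) (auto intro: less_imp_le)
  have "a y * b y <= (a x * (jbr y / jbr x) ^ K) * (b x * (jbr y / jbr x) ^ L)"
    using slow_growth[OF assms(1) xy] slow_growth[OF assms(2) xy] slow_pos[OF assms(1)] slow_pos[OF assms(2)]
    by (intro mult_mono) (auto intro: less_imp_le)
  then show "a y * b y <= a x * b x * (jbr y / jbr x) ^ (K + L)" by (simp add: power_add mult_ac)
qed

lemma slow_jbr_powr: assumes "0 <= e" "e <= real K" shows "slow K (\<lambda>x. jbr x powr e)"
  unfolding slow_def
proof (intro conjI allI impI)
  fix x y :: real
  show "0 < jbr x powr e" using jbr_pos[of x] by simp
  assume xy: "\<bar>x\<bar> <= \<bar>y\<bar>"
  show "jbr x powr e <= jbr y powr e" using jbr_mono[OF xy] assms by (intro powr_mono2) auto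
  have "jbr y powr e = jbr x powr e * (jbr y / jbr x) powr e"
    by (simp add: powr_divide less_imp_neq[OF jbr_pos, symmetric])
  also have "... <= jbr x powr e * (jbr y / jbr x) powr (real K)"
    using jbr_ratio_ge_1[OF xy] assms by (intro mult_left_mono powr_mono) auto
  also have "(jbr y / jbr x) powr (real K) = (jbr y / jbr x) ^ K"
    by (rule powr_realpow) (simp add: jbr_pos)
  finally show "jbr y powr e <= jbr x powr e * (jbr y / jbr x) ^ K" .
qed measurable

text \<open>A detector of high frequencies: it equals 1 where \<open>jbr x >= R\<close> and is small
  for \<open>jbr x\<close> far below \<open>R\<close>, with the same growth exponent for every
  \<open>R\<close>.\<close>

lemma slow_min: assumes "R > 0" shows "slow 1 (\<lambda>x. min 1 (jbr x / R))"
  unfolding slow_def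
proof (intro conjI allI impI)
  fix x y :: real
  show "0 < min 1 (jbr x / R)" using assms by simp
  assume xy: "\<bar>x\<bar> <= \<bar>y\<bar>"
  show "min 1 (jbr x / R) <= min 1 (jbr y / R)"
    using jbr_mono[OF xy] assms by (intro min.mono divide_right_mono) auto
  have r: "1 <= jbr y / jbr x" by (rule jbr_ratio_ge_1[OF xy])
  show "min 1 (jbr y / R) <= min 1 (jbr x / R) * (jbr y / jbr x) ^ 1"
  proof (cases "jbr x / R <= 1")
    case True
    then have "min 1 (jbr x / R) * (jbr y / jbr x) ^ 1 = jbr y / R" by (simp add: min_def)
    then show ?thesis by simp
  next
    case False
    then have "min 1 (jbr x / R) * (jbr y / jbr x) ^ 1 = jbr y / jbr x" by (simp add: min_def)
    then show ?thesis using r by (simp only: min_le_iff_disj simp_thms)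
  qed
qed measurable

text \<open>Bernoulli's inequality for the power of \<open>jbr x / jbr y\<close> takes the place of
  a derivative bound, since \<open>a\<close> need not be differentiable.\<close>

lemma slow_diff:
  assumes "slow K a" "\<bar>x\<bar> <= \<bar>y\<bar>"
  shows "a y - a x <= real K * a y * \<bar>y - x\<bar> / jbr y"
proof -
  define t where "t = jbr x / jbr y"
  have t: "0 < t" "t <= 1" using jbr_mono[OF assms(2)] by (auto simp: t_def)
  have "1 + real K * (t - 1) <= (1 + (t - 1)) ^ K" using t by (intro Bernoulli_inequality) auto
  then have B: "1 - real K * (1 - t) <= t ^ K" by (simp add: algebra_simps)
  have "a y * t ^ K <= a x * (jbr y / jbr x) ^ K * t ^ K"
    using slow_growth[OF assms] t by (intro mult_right_mono) auto
  also have "... = a x" by (simp add: t_def power_divide less_imp_neq[OF jbr_pos, symmetric])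
  finally have "a y - a x <= a y * (1 - t ^ K)" by (simp add: algebra_simps)
  also have "... <= a y * (real K * (1 - t))"
    using B slow_pos[OF assms(1)] by (intro mult_left_mono) (auto intro: less_imp_le)
  also have "1 - t = (jbr y - jbr x) / jbr y" by (simp add: t_def field_simps less_imp_neq[OF jbr_pos, symmetric])
  also have "a y * (real K * ((jbr y - jbr x) / jbr y)) <= a y * (real K * (\<bar>y - x\<bar> / jbr y))"
    using jbr_lipschitz[of y x] slow_pos[OF assms(1), of y]
    by (intro mult_left_mono divide_right_mono) (auto intro: less_imp_le)
  finally show ?thesis by (simp add: mult_ac)
qed

lemma slow_double:
  assumes "slow K a" "\<bar>x\<bar> <= c * \<bar>y\<bar>" "c \<ge> 1"
  shows "a x <= c ^ K * a y"
proof (cases "\<bar>x\<bar> <= \<bar>y\<bar>")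
  case True
  have "a x <= 1 * a y" using slow_mono[OF assms(1) True] by simp
  also have "... <= c ^ K * a y" using assms(3) slow_pos[OF assms(1), of y] by (intro mult_right_mono) auto
  finally show ?thesis .
next
  case False
  have "jbr x <= c * jbr y"
  proof -
    have "\<bar>x\<bar>^2 <= (c * \<bar>y\<bar>)^2" using assms(2) by (intro power_mono) auto
    then have "x^2 <= (c * \<bar>y\<bar>)^2" by simp
    moreover have "1 <= c^2" using assms(3) by simp
    ultimately have "1 + x^2 <= c^2 * (1 + y^2)" by (simp add: power_mult_distrib algebra_simps)
    then have "sqrt (1 + x^2) <= sqrt (c^2 * (1 + y^2))" by simp
    then show ?thesis using assms(3) by (simp add: jbr_def real_sqrt_mult)
  qed
  then have "jbr x / jbr y <= c" by (simp add: field_simps)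
  then have "(jbr x / jbr y) ^ K <= c ^ K" by (intro power_mono) auto
  then have "a y * (jbr x / jbr y) ^ K <= a y * c ^ K"
    using slow_pos[OF assms(1), of y] by (intro mult_left_mono) auto
  then show ?thesis using slow_growth[OF assms(1), of y x] False by (simp add: mult.commute)
qed

text \<open>At least one of \<open>x - y\<close> and \<open>y\<close> has half the size of
  \<open>x\<close>; doubling costs \<open>2 ^ K\<close>.\<close>

lemma slow_sum: assumes "slow K a" shows "a x <= 2 ^ K * (a (x - y) + a y)"
proof -
  have p: "0 < a (x - y)" "0 < a y" using slow_pos[OF assms] by auto
  have "\<bar>x\<bar> <= 2 * \<bar>x - y\<bar> \<or> \<bar>x\<bar> <= 2 * \<bar>y\<bar>"
    using abs_triangle_ineq[of "x - y" y] by auto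
  then consider "\<bar>x\<bar> <= 2 * \<bar>x - y\<bar>" | "\<bar>x\<bar> <= 2 * \<bar>y\<bar>" by blast
  then show ?thesis
  proof cases
    case 1
    then have "a x <= 2 ^ K * a (x - y)" by (rule slow_double[OF assms]) auto
    also have "... <= 2 ^ K * (a (x - y) + a y)" using p by simp
    finally show ?thesis .
  next
    case 2
    then have "a x <= 2 ^ K * a y" by (rule slow_double[OF assms]) auto
    also have "... <= 2 ^ K * (a (x - y) + a y)" using p by simp
    finally show ?thesis .
  qed
qed

lemma slow_peetre: assumes "slow K a" "\<And>t. a t \<ge> 1" shows "a x <= 2 ^ K * (a (x - y) * a y)"
proof -
  have p: "1 <= a (x - y)" "1 <= a y" using assms(2) by auto
  have "\<bar>x\<bar> <= 2 * \<bar>x - y\<bar> \<or> \<bar>x\<bar> <= 2 * \<bar>y\<bar>"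
    using abs_triangle_ineq[of "x - y" y] by auto
  then consider "\<bar>x\<bar> <= 2 * \<bar>x - y\<bar>" | "\<bar>x\<bar> <= 2 * \<bar>y\<bar>" by blast
  then show ?thesis
  proof cases
    case 1
    then have "a x <= 2 ^ K * a (x - y)" by (rule slow_double[OF assms(1)]) auto
    also have "... <= 2 ^ K * (a (x - y) * a y)" using p by simp
    finally show ?thesis .
  next
    case 2
    then have "a x <= 2 ^ K * a y" by (rule slow_double[OF assms(1)]) auto
    also have "... <= 2 ^ K * (a (x - y) * a y)" using p by simp
    finally show ?thesis .
  qed
qed

text \<open>The commutator estimate in scalar form. The bracket equals
  \<open>(a x)^2 * (y - x) - ((a y)^2 - (a x)^2) * x\<close>; in the second term
  \<open>slow_diff\<close> for the square, of exponent 2K, gains \<open>1 / jbr y\<close>, which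
  absorbs the factor \<open>x\<close> when |x| <= |y|.\<close>

lemma slow_bracket:
  assumes "slow K a"
  shows "\<bar>(a x)^2 * y - (a y)^2 * x\<bar> <= (2 * real K + 1) * (max (a x) (a y))^2 * \<bar>x - y\<bar>"
proof -
  have sq: "slow (K + K) (\<lambda>x. a x * a x)" by (rule slow_mult[OF assms assms])
  have main: "\<bar>(a x)^2 * y - (a y)^2 * x\<bar> <= (2 * real K + 1) * (a y)^2 * \<bar>x - y\<bar>" if xy: "\<bar>x\<bar> <= \<bar>y\<bar>" for x y
  proof -
    have d: "(a y)^2 - (a x)^2 <= real (K + K) * (a y)^2 * \<bar>y - x\<bar> / jbr y"
      using slow_diff[OF sq xy] by (simp add: power2_eq_square)
    have ge: "(a x)^2 <= (a y)^2" using slow_mono[OF assms xy] slow_pos[OF assms, of x] by (intro power_mono) auto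
    have "\<bar>(a x)^2 * y - (a y)^2 * x\<bar> = \<bar>(a x)^2 * (y - x) - ((a y)^2 - (a x)^2) * x\<bar>" by (simp add: algebra_simps)
    also have "... <= (a x)^2 * \<bar>y - x\<bar> + ((a y)^2 - (a x)^2) * \<bar>x\<bar>"
      using abs_triangle_ineq4[of "(a x)^2 * (y - x)" "((a y)^2 - (a x)^2) * x"] ge by (simp add: abs_mult)
    also have "((a y)^2 - (a x)^2) * \<bar>x\<bar> <= (real (K + K) * (a y)^2 * \<bar>y - x\<bar> / jbr y) * jbr y"
      using d ge xy abs_le_jbr[of y] by (intro mult_mono) (auto intro!: divide_nonneg_pos)
    also have "... = real (K + K) * (a y)^2 * \<bar>y - x\<bar>" by (simp add: less_imp_neq[OF jbr_pos, symmetric])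
    also have "(a x)^2 * \<bar>y - x\<bar> <= (a y)^2 * \<bar>y - x\<bar>" using ge by (intro mult_right_mono) auto
    finally show ?thesis by (simp add: algebra_simps abs_minus_commute)
  qed
  show ?thesis
  proof (cases "\<bar>x\<bar> <= \<bar>y\<bar>")
    case True
    then show ?thesis using main[OF True] slow_mono[OF assms True] by (simp add: max_def)
  next
    case False
    then have yx: "\<bar>y\<bar> <= \<bar>x\<bar>" by simp
    have "max (a x) (a y) = a x" using slow_mono[OF assms yx] by (simp add: max_def)
    then show ?thesis using main[OF yx] by (simp add: abs_minus_commute)
  qed
qed

section \<open>Inequalities for tanh and the symbol T\<close>

lemma tanh_le_self: "0 <= z ==> tanh z <= (z::real)"
proof -
  assume z: "0 <= z"
  have "(\<lambda>z::real. z - tanh z) 0 <= (\<lambda>z. z - tanh z) z"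
  proof (rule DERIV_nonneg_imp_nondecreasing[OF z])
    fix x :: real
    have "((\<lambda>z. z - tanh z) has_real_derivative 1 - (1 - (tanh x)^2)) (at x)"
      by (auto intro!: derivative_eq_intros)
    then show "\<exists>y. ((\<lambda>z. z - tanh z) has_real_derivative y) (at x) \<and> 0 <= y" by (intro exI conjI) auto
  qed
  then show ?thesis by simp
qed

lemma tanh_sq_le_1: "(tanh (x::real))^2 <= 1"
  using tanh_real_bounds[of x] by (auto simp: abs_square_le_1 intro!: abs_leI)

text \<open>The left side is \<open>z\<close> times the derivative of \<open>tanh\<close>, so this
  is the sign of the derivative of \<open>tanh z / z\<close>.\<close>

lemma tanh_ge_sech: "0 <= z ==> z * (1 - (tanh z)^2) <= tanh (z::real)"
proof -
  assume z: "0 <= z"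
  have "(\<lambda>z::real. tanh z - z * (1 - (tanh z)^2)) 0 <= (\<lambda>z. tanh z - z * (1 - (tanh z)^2)) z"
  proof (rule DERIV_nonneg_imp_nondecreasing[OF z])
    fix x :: real assume "0 <= x"
    have "((\<lambda>z. tanh z - z * (1 - (tanh z)^2)) has_real_derivative 2 * x * tanh x * (1 - (tanh x)^2)) (at x)"
      by (auto intro!: derivative_eq_intros simp: algebra_simps power2_eq_square)
    moreover have "0 <= 2 * x * tanh x * (1 - (tanh x)^2)"
      using \<open>0 <= x\<close> tanh_sq_le_1[of x] by simp
    ultimately show "\<exists>y. ((\<lambda>z. tanh z - z * (1 - (tanh z)^2)) has_real_derivative y) (at x) \<and> 0 <= y"
      by blast
  qed
  then show ?thesis by simp
qed

lemma self_le_tanh: "0 <= z ==> z <= (1 + z) * tanh (z::real)"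
proof -
  assume z: "0 <= z"
  have "(\<lambda>z::real. (1 + z) * tanh z - z) 0 <= (\<lambda>z. (1 + z) * tanh z - z) z"
  proof (rule DERIV_nonneg_imp_nondecreasing[OF z])
    fix x :: real assume x: "0 <= x"
    have "((\<lambda>z. (1 + z) * tanh z - z) has_real_derivative tanh x * (1 - tanh x) + x * (1 - (tanh x)^2)) (at x)"
      by (auto intro!: derivative_eq_intros simp: algebra_simps power2_eq_square)
    moreover have "0 <= tanh x * (1 - tanh x) + x * (1 - (tanh x)^2)"
      using x tanh_sq_le_1[of x] tanh_real_lt_1[of x] by (intro add_nonneg_nonneg mult_nonneg_nonneg) auto
    ultimately show "\<exists>y. ((\<lambda>z. (1 + z) * tanh z - z) has_real_derivative y) (at x) \<and> 0 <= y"
      by blast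
  qed
  then show ?thesis by simp
qed

context
  fixes m :: real assumes m: "0 < m" "m < 1"
begin

lemma tanh_quot_decreasing: assumes "0 < x" "x <= y" shows "tanh (m * y) / y <= tanh (m * x) / x"
proof (rule DERIV_nonpos_imp_nonincreasing[OF assms(2)])
  fix z assume "x <= z" "z <= y"
  then have z: "z > 0" using assms by linarith
  have "((\<lambda>z. tanh (m * z) / z) has_real_derivative ((m * z) * (1 - (tanh (m * z))^2) - tanh (m * z)) / (z * z)) (at z)"
    using z by (auto intro!: derivative_eq_intros simp: algebra_simps power2_eq_square)
  moreover have "((m * z) * (1 - (tanh (m * z))^2) - tanh (m * z)) / (z * z) <= 0"
    using tanh_ge_sech[of "m * z"] z m by (intro divide_nonpos_pos) auto
  ultimately show "\<exists>d. ((\<lambda>z. tanh (m * z) / z) has_real_derivative d) (at z) \<and> d <= 0" by blast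
qed

text \<open>It bounds the decay of T by that of \<open>1 / jbr^2\<close>. For z >= 1 both terms of
  the derivative are nonnegative; for z < 1 the bound m < 1 gives \<open>tanh (m * z) <= z\<close>,
  which lets the first term dominate.\<close>

lemma tanh_quot_jbr_increasing:
  assumes "0 < x" "x <= y" shows "tanh (m * x) / x * (1 + x^2) <= tanh (m * y) / y * (1 + y^2)"
proof (rule DERIV_nonneg_imp_nondecreasing[OF assms(2)])
  fix z assume "x <= z" "z <= y"
  then have z: "z > 0" using assms by linarith
  define t where "t = tanh (m * z)"
  have t0: "0 < t" "t <= m * z" "t^2 <= 1" using z m tanh_le_self[of "m * z"] tanh_sq_le_1[of "m * z"] by (auto simp: t_def)
  have D: "((\<lambda>z. tanh (m * z) / z * (1 + z^2)) has_real_derivative (((m * z) * (1 - t^2)) * (1 + z^2) + t * (z^2 - 1)) / (z * z)) (at z)"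
    using z unfolding t_def by (auto intro!: derivative_eq_intros simp: field_simps power2_eq_square)
  have "0 <= ((m * z) * (1 - t^2)) * (1 + z^2) + t * (z^2 - 1)"
  proof (cases "z \<ge> 1")
    case True
    then have "z^2 \<ge> 1" by simp
    then show ?thesis using t0 z m by (intro add_nonneg_nonneg mult_nonneg_nonneg) auto
  next
    case False
    have "m * z <= 1 * z" using m z by (intro mult_right_mono) auto
    then have "t <= z" using t0(2) by linarith
    then have tz: "t^2 <= z^2" using t0 by (intro power_mono) auto
    have z1: "z^2 <= 1" using False z by (simp add: power_le_one)
    have "t * (1 - z^2) <= (m * z) * ((1 - t^2) * (1 + z^2))"
    proof (rule mult_mono)
      have "(1 - z^2) * 1 <= (1 - z^2) * (1 + z^2)" using z1 by (intro mult_left_mono) auto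
      then have "1 - z^2 <= (1 - z^2) * (1 + z^2)" by simp
      also have "... <= (1 - t^2) * (1 + z^2)" using tz by (intro mult_right_mono) auto
      finally show "1 - z^2 <= (1 - t^2) * (1 + z^2)" .
    qed (use t0 z m z1 in auto)
    then show ?thesis by (simp add: algebra_simps)
  qed
  then have "0 <= (((m * z) * (1 - t^2)) * (1 + z^2) + t * (z^2 - 1)) / (z * z)" by simp
  with D show "\<exists>d. ((\<lambda>z. tanh (m * z) / z * (1 + z^2)) has_real_derivative d) (at z) \<and> 0 <= d"
    by blast
qed

end

locale wb = sob +
  fixes \<mu> :: real
  assumes mu: "0 < \<mu>" "\<mu> < 1"
begin

text \<open>\<open>Lam\<close> symmetrizes the linear part: \<open>Lam\<close> times T is
  1/\<open>Lam\<close>. Its square is comparable to 1 + sqrt \<mu> |\<xi>|, the weight that the V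
  norm puts on \<open>v\<close>.\<close>

definition Lam :: "real => real" where "Lam x = 1 / sqrt (Tmu \<mu> x)"
definition sig :: "real => real" where "sig x = jbr x powr s"

lemma sqrt_mu: "0 < sqrt \<mu>" "sqrt \<mu> < 1" using mu by auto

lemma Tmu_abs: "Tmu \<mu> x = (if x = 0 then 1 else (1 / sqrt \<mu>) * (tanh (sqrt \<mu> * \<bar>x\<bar>) / \<bar>x\<bar>))"
  by (simp add: Tmu_def)

lemma Tmu_pos: "0 < Tmu \<mu> x"
  using sqrt_mu by (auto simp: Tmu_def)

lemma Tmu_le_1: "Tmu \<mu> x <= 1"
  using sqrt_mu tanh_le_self[of "sqrt \<mu> * \<bar>x\<bar>"] by (auto simp: Tmu_def divide_le_eq_1)

lemma Tmu_measurable [measurable]: "Tmu \<mu> \<in> meas"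
proof -
  have [measurable]: "(tanh :: real => real) \<in> meas"
    by (intro borel_measurable_continuous_onI continuous_intros) auto
  show ?thesis unfolding Tmu_def[abs_def] by measurable
qed

lemma Tmu_decreasing: assumes "\<bar>x\<bar> <= \<bar>y\<bar>" shows "Tmu \<mu> y <= Tmu \<mu> x"
proof (cases "x = 0")
  case True then show ?thesis using Tmu_le_1 by (simp add: Tmu_def[of \<mu> 0])
next
  case False
  then show ?thesis using tanh_quot_decreasing[OF sqrt_mu, of "\<bar>x\<bar>" "\<bar>y\<bar>"] assms sqrt_mu
    unfolding Tmu_abs by (auto simp del: times_divide_eq_right times_divide_eq_left intro!: mult_left_mono)
qed

lemma Tmu_growth: assumes "\<bar>x\<bar> <= \<bar>y\<bar>" shows "Tmu \<mu> x <= Tmu \<mu> y * (jbr y / jbr x)^2"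
proof -
  have j: "(jbr y / jbr x)^2 = (1 + y^2) / (1 + x^2)" by (simp add: jbr_def power_divide)
  have p: "0 < 1 + x^2" by (simp add: add_pos_nonneg)
  have "Tmu \<mu> x * (1 + x^2) <= Tmu \<mu> y * (1 + y^2)"
  proof (cases "x = 0")
    case False
    then show ?thesis using tanh_quot_jbr_increasing[OF sqrt_mu, of "\<bar>x\<bar>" "\<bar>y\<bar>"] assms sqrt_mu
      unfolding Tmu_abs by (auto simp: divide_right_mono field_simps)
  next
    case True
    show ?thesis
    proof (cases "y = 0")
      case False
      define z where "z = sqrt \<mu> * \<bar>y\<bar>"
      have z: "z > 0" "z <= \<bar>y\<bar>" using False sqrt_mu by (auto simp: z_def mult_le_cancel_right2)
      have "z <= (1 + z) * tanh z" using z by (intro self_le_tanh) auto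
      have "z^2 <= y^2" using z by (simp add: abs_le_square_iff[symmetric])
      \<comment> \<open>The quotient lemmas exclude the origin, where T is 1 by definition; this
        inequality provides the comparison of the origin with \<open>y\<close>.\<close>
      have *: "z <= (1 + z^2) * tanh z"
      proof -
        have "(\<lambda>z::real. (1 + z^2) * tanh z - z) 0 <= (\<lambda>z. (1 + z^2) * tanh z - z) z"
        proof (rule DERIV_nonneg_imp_nondecreasing[OF less_imp_le[OF z(1)]])
          fix w :: real assume w: "0 <= w"
          have "((\<lambda>z. (1 + z^2) * tanh z - z) has_real_derivative 2 * w * tanh w + w^2 * (1 - (tanh w)^2) - (tanh w)^2) (at w)"
            by (auto intro!: derivative_eq_intros simp: algebra_simps power2_eq_square)
          moreover have "0 <= 2 * w * tanh w + w^2 * (1 - (tanh w)^2) - (tanh w)^2"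
          proof -
            have "tanh w * tanh w <= (2 * w) * tanh w"
              using tanh_le_self[OF w] w by (intro mult_right_mono) auto
            moreover have "0 <= w^2 * (1 - (tanh w)^2)" using tanh_sq_le_1[of w] by simp
            ultimately show ?thesis by (simp add: power2_eq_square)
          qed
          ultimately show "\<exists>d. ((\<lambda>z. (1 + z^2) * tanh z - z) has_real_derivative d) (at w) \<and> 0 <= d" by blast
        qed
        then show ?thesis by simp
      qed
      have "(1 + z^2) * tanh z <= (1 + y^2) * tanh z" using \<open>z^2 <= y^2\<close> z by (intro mult_right_mono) auto
      with * have "z <= (1 + y^2) * tanh z" by (rule order_trans)
      then have "1 <= tanh z / z * (1 + y^2)" using z by (simp add: field_simps)
      then show ?thesis using True False by (simp add: Tmu_def z_def)
    qed (use True in simp)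
  qed
  then show ?thesis unfolding j using p by (simp add: pos_le_divide_eq)
qed

text \<open>The exponent 1 is the same for all \<mu>; uniformity in \<mu> of the later constants
  rests on this and on \<open>Lam_sq_bounds\<close>.\<close>

lemma slow_Lam: "slow 1 Lam"
  unfolding slow_def
proof (intro conjI allI impI)
  show "Lam \<in> meas" unfolding Lam_def[abs_def] by measurable
  fix x y :: real
  show "0 < Lam x" using Tmu_pos[of x] by (simp add: Lam_def)
  assume xy: "\<bar>x\<bar> <= \<bar>y\<bar>"
  show "Lam x <= Lam y"
    using Tmu_decreasing[OF xy] Tmu_pos[of x] Tmu_pos[of y] by (auto simp: Lam_def intro!: divide_left_mono)
  have "sqrt (Tmu \<mu> x) <= sqrt (Tmu \<mu> y * (jbr y / jbr x)^2)" using Tmu_growth[OF xy] by simp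
  also have "... = sqrt (Tmu \<mu> y) * (jbr y / jbr x)" by (simp add: real_sqrt_mult)
  finally show "Lam y <= Lam x * (jbr y / jbr x) ^ 1"
    using Tmu_pos[of x] Tmu_pos[of y] by (simp add: Lam_def field_simps)
qed

lemma Lam_ge_1: "Lam x \<ge> 1"
  using Tmu_pos[of x] Tmu_le_1[of x] by (simp add: Lam_def)

lemma Lam_sq: "(Lam x)^2 = 1 / Tmu \<mu> x" using Tmu_pos[of x] by (simp add: Lam_def power_divide)

text \<open>With \<open>z = sqrt \<mu> * |x|\<close> the square is \<open>z / tanh z\<close>, which
  lies above both 1 and \<open>z\<close>, hence above their mean, and below 1 + z by
  \<open>self_le_tanh\<close>.\<close>

lemma Lam_sq_bounds: "(1 + sqrt \<mu> * \<bar>x\<bar>) / 2 <= (Lam x)^2" "(Lam x)^2 <= 1 + sqrt \<mu> * \<bar>x\<bar>"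
proof -
  define z where "z = sqrt \<mu> * \<bar>x\<bar>"
  have z0: "z \<ge> 0" using sqrt_mu by (simp add: z_def)
  have "(1 + z) / 2 <= (Lam x)^2 \<and> (Lam x)^2 <= 1 + z"
  proof (cases "x = 0")
    case True then show ?thesis by (simp add: Lam_sq Tmu_def z_def)
  next
    case False
    then have z: "z > 0" using sqrt_mu by (simp add: z_def)
    have L: "(Lam x)^2 = z / tanh z" using False by (simp add: Lam_sq Tmu_def z_def)
    have t: "0 < tanh z" "tanh z <= z" "tanh z <= 1" using z tanh_le_self[of z] tanh_real_lt_1[of z] by (auto intro: less_imp_le)
    have "1 <= z / tanh z" using t by simp
    moreover have "z <= z / tanh z" using t z by (simp add: field_simps)
    moreover have "z / tanh z <= 1 + z" using self_le_tanh[OF z0] t by (simp add: field_simps)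
    moreover have "(1 + z) / 2 <= w" if "1 <= w" "z <= w" for w using that by simp
    ultimately show ?thesis unfolding L by blast
  qed
  then show "(1 + sqrt \<mu> * \<bar>x\<bar>) / 2 <= (Lam x)^2" "(Lam x)^2 <= 1 + sqrt \<mu> * \<bar>x\<bar>" by (auto simp: z_def)
qed

end

section \<open>Real even multipliers, diagonal region and frequency cutoff\<close>

definition rsym :: "real => (real => real) => bool" where
  "rsym C a \<longleftrightarrow> a \<in> meas \<and> (\<forall>x. a (- x) = a x) \<and> (\<forall>x. \<bar>a x\<bar> <= C)"

definition rM :: "(real => real) => h => h" where
  "rM a = Mul (\<lambda>t. cx (a t))"

lemma rsym_bsym: "rsym C a ==> bsym C (\<lambda>t. cx (a t))"
  unfolding rsym_def by (intro bsym_real) auto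

lemma rsym_mult: "rsym C a ==> rsym D b ==> rsym (C * D) (\<lambda>t. a t * b t)"
  unfolding rsym_def abs_mult by (auto intro!: mult_mono intro: order_trans[OF abs_ge_zero])

lemma rsym_one: "rsym 1 (\<lambda>_. 1)" by (simp add: rsym_def)
lemma rsym_measurable: "rsym C a ==> a \<in> meas" by (simp add: rsym_def)
lemma rsym_even: "rsym C a ==> a (- x) = a x" by (simp add: rsym_def)

lemma rM_one [simp]: "rM (\<lambda>_. 1) x = x" by (simp add: rM_def Mul_one)
lemma norm_rM_le: "rsym C a ==> norm (rM a x) <= C * norm x"
  unfolding rM_def by (rule norm_Mul_le[OF rsym_bsym])
lemma bounded_linear_rM: "rsym C a ==> bounded_linear (rM a)"
  unfolding rM_def by (rule bounded_linear_Mul[OF rsym_bsym])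
lemma rM_rM: "rsym C a ==> rsym D b ==> rM a (rM b x) = rM (\<lambda>t. a t * b t) x"
  unfolding rM_def by (subst Mul_Mul[OF rsym_bsym rsym_bsym]) auto
lemma inner_rM: "rsym C a ==> inner (rM a x) y = inner x (rM a y)"
  unfolding rM_def by (subst inner_Mul[OF rsym_bsym]) auto
lemma rM_cong: "(\<And>t. a t = b t) ==> rM a x = rM b x" by (metis ext)
lemma fn_rM: "rsym C a ==> AE t in lborel. fn (rM a x) t = cx (a t) * fn x t"
  unfolding rM_def by (rule fn_Mul[OF rsym_bsym])

text \<open>Kernels of differentiation type: \<open>-\<i> * \<xi>\<close> is the symbol of minus
  d/dx. For real \<open>r\<close>, odd under a joint change of sign, the kernel is
  Hermitian.\<close>

definition ik :: "(real => real => real) => real => real => complex" where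
  "ik r u v = - \<i> * cx (r u v)"

lemma slow_mono_exp: assumes "slow K a" "K <= L" shows "slow L a"
  unfolding slow_def
proof (intro conjI allI impI)
  fix x y :: real assume xy: "\<bar>x\<bar> <= \<bar>y\<bar>"
  have "(jbr y / jbr x) ^ K <= (jbr y / jbr x) ^ L"
    by (intro power_increasing assms jbr_ratio_ge_1 xy)
  then have "a x * (jbr y / jbr x) ^ K <= a x * (jbr y / jbr x) ^ L"
    using slow_pos[OF assms(1), of x] by (intro mult_left_mono) auto
  then show "a y <= a x * (jbr y / jbr x) ^ L" using slow_growth[OF assms(1) xy] by linarith
qed (use assms(1) in \<open>auto simp: slow_def\<close>)

text \<open>The region in which the first argument carries a low frequency and the derivative meets
  the high one. It is symmetric in \<open>u\<close> and \<open>v\<close>, so passing to the adjoint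
  does not leave it.\<close>

definition dg :: "real => real => real" where
  "dg u v = (if 2 * \<bar>u - v\<bar> <= \<bar>u\<bar> \<and> 2 * \<bar>u - v\<bar> <= \<bar>v\<bar> then 1 else 0)"

lemma dg_sym: "dg v u = dg u v" by (auto simp: dg_def abs_minus_commute)
lemma dg_minus: "dg (- u) (- v) = dg u v" by (auto simp: dg_def abs_minus_commute)
lemma dg_01: "0 <= dg u v" "dg u v <= 1" by (auto simp: dg_def)
lemma dg_measurable [measurable]: "(\<lambda>(u, v). dg u v) \<in> meas2"
  unfolding dg_def[abs_def] case_prod_beta' by measurable

definition cut :: "real => real => real" where "cut n t = (if \<bar>t\<bar> <= n then 1 else 0)"

lemma cut_measurable [measurable]: "cut n \<in> meas"
  unfolding cut_def[abs_def] by measurable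
lemma cut_01: "0 <= cut n t" "cut n t <= 1" "cut n t * cut n t = cut n t" by (auto simp: cut_def)
lemma cut_minus [simp]: "cut n (- t) = cut n t" by (simp add: cut_def)
lemma rsym_cut: "rsym 1 (cut n)" by (auto simp: rsym_def cut_def)

context sob
begin

lemma kern_ik:
  assumes "(\<lambda>(u, v). r u v) \<in> meas2"
    "\<And>u v. r (- u) (- v) = - r u v"
    "\<And>u v. \<bar>r u v\<bar> <= K * (J (u - v) + J v + J u)"
  shows "kern K (ik r)"
  unfolding kern_def
proof (intro conjI allI)
  have "(\<lambda>p. - \<i> * cx ((\<lambda>(u, v). r u v) p)) \<in> meas2"
    using assms(1) by measurable
  then show "(\<lambda>(u, v). ik r u v) \<in> meas2"
    by (simp add: ik_def case_prod_beta')
qed (use assms(2,3) in \<open>auto simp: ik_def norm_mult\<close>)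

lemma kern_ik_J:
  assumes "(\<lambda>(u, v). r u v) \<in> meas2"
    "\<And>u v. r (- u) (- v) = - r u v" "K \<ge> 0"
    "\<And>u v. \<bar>r u v\<bar> <= K * J (u - v) \<or> \<bar>r u v\<bar> <= K * J v \<or> \<bar>r u v\<bar> <= K * (J (u - v) + J v)"
  shows "kern K (ik r)"
proof (rule kern_ik[OF assms(1,2)])
  fix u v :: real
  have "J (u - v) \<ge> 0" "J v \<ge> 0" "J u \<ge> 0" by simp_all
  then have "K * J (u - v) <= K * (J (u - v) + J v + J u)" "K * J v <= K * (J (u - v) + J v + J u)"
    "K * (J (u - v) + J v) <= K * (J (u - v) + J v + J u)"
    by (auto intro!: mult_left_mono assms(3))
  then show "\<bar>r u v\<bar> <= K * (J (u - v) + J v + J u)" using assms(4)[of u v] by linarith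
qed

lemma rM_bil_ik:
  assumes "kern K (ik r)" "rsym A a" "rsym B b" "rsym M m"
  shows "rM m (bil (ik r) (rM a x) (rM b y)) = bil (ik (\<lambda>u v. m u * r u v * a (u - v) * b v)) x y"
proof -
  have "(\<lambda>u v. cx (m u) * ik r u v * cx (a (u - v)) * cx (b v))
     = ik (\<lambda>u v. m u * r u v * a (u - v) * b v)"
    by (intro ext) (simp add: ik_def)
  then show ?thesis
    unfolding rM_def using Mul_bil_Mul[OF assms(1) rsym_bsym[OF assms(2)] rsym_bsym[OF assms(3)] rsym_bsym[OF assms(4)], of x y]
    by simp
qed

lemma kern_ik_Mul:
  assumes "kern K (ik r)" "rsym A a" "rsym B b" "rsym M m"
  shows "kern (M * K * A * B) (ik (\<lambda>u v. m u * r u v * a (u - v) * b v))"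
proof -
  have "(\<lambda>u v. cx (m u) * ik r u v * cx (a (u - v)) * cx (b v))
     = ik (\<lambda>u v. m u * r u v * a (u - v) * b v)"
    by (intro ext) (simp add: ik_def)
  then show ?thesis
    using kern_Mul[OF assms(1) rsym_bsym[OF assms(2)] rsym_bsym[OF assms(3)] rsym_bsym[OF assms(4)]] by simp
qed

lemma bil_ik_cong: "(\<And>u v. r u v = r' u v) ==> bil (ik r) x y = bil (ik r') x y"
  by (metis ext)

text \<open>The two terms are adjoint to each other up to the sign of the factor i, so only the
  antisymmetric part of the kernel survives.\<close>
lemma cross_cancel:
  assumes "kern K (ik (\<lambda>u v. r u v * l v))" "kern L (ik (\<lambda>u v. r u v * l u))"
  shows "inner A (bil (ik (\<lambda>u v. r u v * l v)) F B) + inner B (bil (ik (\<lambda>u v. r u v * l u)) F A)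
    = inner A (bil (ik (\<lambda>u v. (r u v - r v u) * l v)) F B)"
proof -
  have "(\<lambda>u v. cnj (ik (\<lambda>u v. r u v * l u) v u)) = ik (\<lambda>u v. - (r v u * l v))"
    by (intro ext) (simp add: ik_def)
  then have "inner B (bil (ik (\<lambda>u v. r u v * l u)) F A) = inner A (bil (ik (\<lambda>u v. - (r v u * l v))) F B)"
    and k: "kern L (ik (\<lambda>u v. - (r v u * l v)))"
    using bil_adjoint[OF assms(2), of B F A] kern_adj[OF assms(2)] by simp_all
  moreover have "(\<lambda>u v. ik (\<lambda>u v. r u v * l v) u v + ik (\<lambda>u v. - (r v u * l v)) u v) = ik (\<lambda>u v. (r u v - r v u) * l v)"
    by (intro ext) (simp add: ik_def algebra_simps)
  ultimately show ?thesis
    using bil_kernel_add[OF assms(1) k, of F B] by (simp add: inner_add_right)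
qed

lemma inner_bil_le: "kern K k ==> \<bar>inner z (bil k x y)\<bar> <= K * CJ * norm x * norm y * norm z"
  using Cauchy_Schwarz_ineq2[of z "bil k x y"] mult_left_mono[OF norm_bil_le, of K k "norm z" x y] by (simp add: mult_ac)

end

text \<open>In the unitary convention the transform of a product is \<open>kap\<close> times the
  convolution of the transforms.\<close>

definition kap :: real where "kap = 1 / sqrt (2 * pi)"

lemma kap: "0 < kap" "kap <= 1"
proof -
  show "0 < kap" by (simp add: kap_def)
  have "1 <= sqrt (2 * pi)" using pi_ge_two by simp
  then show "kap <= 1" by (simp add: kap_def)
qed

lemma norm_fst_le': "norm (fst X) <= norm (X :: 'a::real_normed_vector \<times> 'b::real_normed_vector)"
  and norm_snd_le': "norm (snd X) <= norm X"
  by (cases X; simp add: norm_fst_le norm_snd_le)+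

definition M2 :: "(real => real) => h \<times> h => h \<times> h" where
  "M2 a X = (rM a (fst X), rM a (snd X))"

lemma M2_simps [simp]: "fst (M2 a X) = rM a (fst X)" "snd (M2 a X) = rM a (snd X)" by (simp_all add: M2_def)

lemma bounded_linear_M2: "rsym C a ==> bounded_linear (M2 a)"
  unfolding M2_def[abs_def]
  by (intro bounded_linear_Pair bounded_linear_compose[OF bounded_linear_rM] bounded_linear_fst bounded_linear_snd)

lemma norm_M2_le: assumes "rsym C a" shows "norm (M2 a X) <= C * norm X"
proof -
  have C: "C \<ge> 0" using assms norm_ge_zero order_trans unfolding rsym_def by (metis abs_ge_zero)
  have "(norm (M2 a X))^2 <= (C * norm X)^2"
    unfolding M2_def norm_Pair power_mult_distrib
    using power_mono[OF norm_rM_le[OF assms, of "fst X"], of 2] power_mono[OF norm_rM_le[OF assms, of "snd X"], of 2]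
    by (simp add: norm_prod_def power_mult_distrib algebra_simps)
  then show ?thesis using C by (auto simp: power2_le_iff_abs_le abs_mult)
qed

lemma M2_M2: "rsym C a ==> rsym D b ==> M2 a (M2 b X) = M2 (\<lambda>t. a t * b t) X"
  by (simp add: M2_def rM_rM)

lemma inner_M2: "rsym C a ==> inner (M2 a X) Y = inner X (M2 a Y)"
  by (simp add: M2_def inner_prod_def inner_rM)

lemma M2_add: "rsym C a ==> M2 a (X + Y) = M2 a X + M2 a Y"
  using bounded_linear_M2 by (rule linear_add[OF bounded_linear.linear])
lemma M2_diff: "rsym C a ==> M2 a (X - Y) = M2 a X - M2 a Y"
  using bounded_linear_M2 by (rule linear_diff[OF bounded_linear.linear])

section \<open>The symmetric quadratic system on the Fourier side\<close>

context wb
begin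

text \<open>One exponent for all weights in use: \<open>sig\<close> takes the ceiling of
  \<open>s\<close>, and the two extra units pay for \<open>Lam\<close> and for an auxiliary weight
  \<open>w\<close>.\<close>

definition NK :: nat where "NK = nat \<lceil>s\<rceil> + 2"

lemma s_le_NK: "s <= real (nat \<lceil>s\<rceil>)" by linarith

lemma sig_pos [simp]: "0 < sig x" by (simp add: sig_def)
lemma sig_nonneg [simp]: "0 <= sig x" by (simp add: less_imp_le)
lemma sig_neq_0 [simp]: "sig x \<noteq> 0" using sig_pos[of x] by linarith
lemma sig_minus [simp]: "sig (- x) = sig x" by (simp add: sig_def)
lemma sig_measurable [measurable]: "sig \<in> meas" unfolding sig_def[abs_def] by measurable
lemma Lam_measurable [measurable]: "Lam \<in> meas" using slow_Lam by (rule slow_measurable)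
lemma Lam_pos [simp]: "0 < Lam x" using Lam_ge_1[of x] by linarith
lemma Lam_nonneg [simp]: "0 <= Lam x" using Lam_pos[of x] by linarith
lemma Lam_neq_0 [simp]: "Lam x \<noteq> 0" using Lam_pos[of x] by linarith
lemma Lam_minus [simp]: "Lam (- x) = Lam x" using slow_even[OF slow_Lam] .

lemma slow_sig: "slow (nat \<lceil>s\<rceil>) sig"
  unfolding sig_def[abs_def] using s_gt s_le_NK by (intro slow_jbr_powr) auto

lemma sig_ge_1: "1 <= sig x"
  unfolding sig_def using jbr_ge_1[of x] s_gt by (intro ge_one_powr_ge_zero) auto

lemma jbr_div_sig: "jbr x / sig x = J x"
  unfolding J_def sig_def using powr_diff[of "jbr x" 1 s] by simp

lemma abs_div_sig_le: "\<bar>x\<bar> / sig x <= J x"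
  unfolding jbr_div_sig[symmetric] using abs_le_jbr[of x] by (intro divide_right_mono) auto

lemma one_div_sig_le: "1 / sig x <= J x"
  unfolding jbr_div_sig[symmetric] using jbr_ge_1[of x] by (intro divide_right_mono) auto

lemma J_le_1: "J x <= 1"
  unfolding J_def using jbr_ge_1[of x] s_gt powr_mono[of "1 - s" 0 "jbr x"] by simp

text \<open>The symbol of (first argument) times (derivative of the second), conjugated by
  \<open>sig\<close>. With F = sig q and G = sig Lam v, the kernels \<open>r1\<close> to
  \<open>r4\<close> encode q v_x / 2, v q_x, T(q q_x) / 2 and v v_x; in \<open>r3\<close> the factor
  1/\<open>Lam\<close> is \<open>Lam\<close> times T, and \<open>ik\<close> supplies the minus sign
  and the factor i.\<close>

definition g :: "real => real => real" where "g u v = sig u * v / (sig (u - v) * sig v)"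
definition r1 :: "real => real => real" where "r1 u v = kap / 2 * g u v / Lam v"
definition r2 :: "real => real => real" where "r2 u v = kap * g u v / Lam (u - v)"
definition r3 :: "real => real => real" where "r3 u v = kap / 2 * g u v / Lam u"
definition r4 :: "real => real => real" where "r4 u v = kap * g u v * Lam u / (Lam (u - v) * Lam v)"

lemmas rdefs = r1_def r2_def r3_def r4_def

lemma diff_minus_minus: "- u - - v = - (u - v)" for u v :: real by simp

lemma g_minus: "g (- u) (- v) = - g u v"
  unfolding g_def diff_minus_minus sig_minus by simp

lemma r_minus: "r1 (- u) (- v) = - r1 u v" "r2 (- u) (- v) = - r2 u v"
  "r3 (- u) (- v) = - r3 u v" "r4 (- u) (- v) = - r4 u v"
  unfolding rdefs diff_minus_minus Lam_minus g_minus by simp_all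

lemma g_measurable [measurable]: "(\<lambda>(u, v). g u v) \<in> meas2"
  unfolding g_def[abs_def] by measurable

lemma r_measurable [measurable]: "(\<lambda>(u, v). r1 u v) \<in> meas2"
  "(\<lambda>(u, v). r2 u v) \<in> meas2"
  "(\<lambda>(u, v). r3 u v) \<in> meas2"
  "(\<lambda>(u, v). r4 u v) \<in> meas2"
  unfolding rdefs[abs_def] g_def[abs_def] by measurable

lemma Lam_ratio_le: "Lam u / (Lam (u - v) * Lam v) <= 2"
  using slow_peetre[OF slow_Lam Lam_ge_1, of u v] by (simp add: field_simps)

lemma r_le_g: "\<bar>r1 u v\<bar> <= 2 * \<bar>g u v\<bar>" "\<bar>r2 u v\<bar> <= 2 * \<bar>g u v\<bar>" "\<bar>r3 u v\<bar> <= 2 * \<bar>g u v\<bar>" "\<bar>r4 u v\<bar> <= 2 * \<bar>g u v\<bar>"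
proof -
  have gen: "\<bar>c * g u v * l\<bar> <= 2 * \<bar>g u v\<bar>" if "0 <= c" "c <= 1" "0 <= l" "l <= 2" for c l
  proof -
    have "\<bar>c * g u v * l\<bar> = (c * l) * \<bar>g u v\<bar>" using that by (simp add: abs_mult)
    also have "... <= (1 * 2) * \<bar>g u v\<bar>" using that by (intro mult_right_mono mult_mono) auto
    finally show ?thesis by simp
  qed
  have L: "0 <= 1 / Lam x \<and> 1 / Lam x <= 2" for x
  proof -
    have "1 / Lam x <= 1" using Lam_ge_1[of x] by simp
    then have "1 / Lam x <= 2" by (rule order_trans) simp
    moreover have "0 <= 1 / Lam x" using Lam_pos[of x] by (simp add: less_imp_le)
    ultimately show ?thesis by blast
  qed
  show "\<bar>r1 u v\<bar> <= 2 * \<bar>g u v\<bar>" using gen[of "kap/2" "1 / Lam v"] L[of v] kap by (simp add: r1_def)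
  show "\<bar>r2 u v\<bar> <= 2 * \<bar>g u v\<bar>" using gen[of kap "1 / Lam (u - v)"] L[of "u - v"] kap by (simp add: r2_def)
  show "\<bar>r3 u v\<bar> <= 2 * \<bar>g u v\<bar>" using gen[of "kap/2" "1 / Lam u"] L[of u] kap by (simp add: r3_def)
  show "\<bar>r4 u v\<bar> <= 2 * \<bar>g u v\<bar>" using gen[of kap "Lam u / (Lam (u - v) * Lam v)"] Lam_ratio_le[of u v] kap by (simp add: r4_def)
qed

lemma slow_sm1: "slow NK (\<lambda>x. jbr x powr (s - 1))"
proof (rule slow_jbr_powr)
  show "0 <= s - 1" using s_gt by simp
  show "s - 1 <= real NK" using s_le_NK unfolding NK_def of_nat_add by simp
qed

lemma sig_powr: "sig x = jbr x * jbr x powr (s - 1)"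
  using powr_add[of "jbr x" 1 "s - 1"] by (simp add: sig_def)

text \<open>Dividing by \<open>jbr u\<close> leaves a weight of order \<open>s - 1\<close> on the
  output; \<open>slow_sum\<close> hands it to one of the two factors, and the other factor then
  decays like \<open>J\<close>.\<close>

lemma g_bound: "\<bar>g u v\<bar> / jbr u <= 2 ^ NK * (J (u - v) + J v)"
proof -
  define w where "w x = jbr x powr (s - 1)" for x
  have w: "0 < w x" for x by (simp add: w_def)
  have sw: "sig x = jbr x * w x" for x by (simp add: sig_powr w_def)
  have "\<bar>g u v\<bar> / jbr u = w u * (\<bar>v\<bar> / (sig (u - v) * sig v))"
    using w[of u] by (simp add: g_def abs_mult sw[of u])
  also have "... <= (2 ^ NK * (w (u - v) + w v)) * (\<bar>v\<bar> / (sig (u - v) * sig v))"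
    using slow_sum[OF slow_sm1, of u v] by (intro mult_right_mono) (auto simp: w_def)
  also have "... = 2 ^ NK * ((w (u - v) / sig (u - v)) * (\<bar>v\<bar> / sig v) + (1 / sig (u - v)) * (w v * \<bar>v\<bar> / sig v))"
    by (simp add: field_simps)
  also have "... <= 2 ^ NK * (1 * J v + J (u - v) * 1)"
  proof (intro mult_left_mono add_mono mult_mono abs_div_sig_le one_div_sig_le)
    show "w (u - v) / sig (u - v) <= 1" using w[of "u - v"] jbr_ge_1[of "u - v"] by (simp add: sw)
    show "w v * \<bar>v\<bar> / sig v <= 1" using w[of v] abs_le_jbr[of v] by (simp add: sw)
  qed (use w in \<open>auto simp: less_imp_le\<close>)
  finally show ?thesis by (simp add: add.commute)
qed

lemma kern_level:
  assumes "(\<lambda>(u, v). r u v) \<in> meas2" "\<And>u v. r (- u) (- v) = - r u v"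
    "\<And>u v. \<bar>r u v\<bar> <= 2 * \<bar>g u v\<bar>"
  shows "kern (2 * 2 ^ NK) (ik (\<lambda>u v. r u v / jbr u))"
proof (rule kern_ik_J)
  have "(\<lambda>p. (\<lambda>(u, v). r u v) p / jbr (fst p)) \<in> meas2" using assms(1) by measurable
  then show "(\<lambda>(u, v). r u v / jbr u) \<in> meas2" by (simp add: case_prod_beta')
  fix u v :: real
  have "\<bar>r u v / jbr u\<bar> = \<bar>r u v\<bar> / jbr u" by (simp add: abs_divide)
  also have "... <= 2 * \<bar>g u v\<bar> / jbr u" by (intro divide_right_mono assms(3)) auto
  also have "... <= 2 * 2 ^ NK * (J (u - v) + J v)" using g_bound[of u v] by simp
  finally show "\<bar>r u v / jbr u\<bar> <= 2 * 2 ^ NK * J (u - v) \<or> \<bar>r u v / jbr u\<bar> <= 2 * 2 ^ NK * J v \<or> \<bar>r u v / jbr u\<bar> <= 2 * 2 ^ NK * (J (u - v) + J v)" by blast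
qed (auto simp: assms(2))

lemmas kern_r1 = kern_level[OF r_measurable(1) r_minus(1) r_le_g(1)]
lemmas kern_r2 = kern_level[OF r_measurable(2) r_minus(2) r_le_g(2)]
lemmas kern_r3 = kern_level[OF r_measurable(3) r_minus(3) r_le_g(3)]
lemmas kern_r4 = kern_level[OF r_measurable(4) r_minus(4) r_le_g(4)]

text \<open>The pair \<open>X = (F, G)\<close> stands for \<open>F = sig q\<close>, \<open>G = sig Lam v\<close> on the Fourier side,
  where \<open>q + q^2/4\<close> is the surface elevation; \<open>Bop X Y\<close> puts the derivative on \<open>Y\<close>, and its values
  carry the weight \<open>sig / jbr\<close>.\<close>
definition Bop :: "h \<times> h => h \<times> h => h \<times> h" where
  "Bop X Y = (bil (ik (\<lambda>u v. r1 u v / jbr u)) (fst X) (snd Y) + bil (ik (\<lambda>u v. r2 u v / jbr u)) (snd X) (fst Y),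
              bil (ik (\<lambda>u v. r3 u v / jbr u)) (fst X) (fst Y) + bil (ik (\<lambda>u v. r4 u v / jbr u)) (snd X) (snd Y))"

text \<open>Minus d/dx composed with the square root of T, divided by \<open>jbr\<close> to become
  bounded. In the unknowns (F, G) both off-diagonal entries of the linear part have this
  symbol.\<close>

definition Lsym :: "real => complex" where "Lsym u = - \<i> * cx (u / (Lam u * jbr u))"
definition Lop :: "h \<times> h => h \<times> h" where "Lop X = (Mul Lsym (snd X), Mul Lsym (fst X))"

lemma bsym_Lsym: "bsym 1 Lsym"
  unfolding bsym_def
proof (intro conjI allI)
  show "Lsym \<in> meas" unfolding Lsym_def[abs_def] by measurable
  fix x
  show "Lsym (- x) = cnj (Lsym x)" by (simp add: Lsym_def)
  have "\<bar>x\<bar> <= Lam x * jbr x"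
    using mult_mono[OF Lam_ge_1 abs_le_jbr, of x x] Lam_pos[of x] by simp
  moreover have "cmod (Lsym x) = \<bar>x\<bar> / (Lam x * jbr x)"
    using abs_of_pos[OF Lam_pos[of x]] by (simp add: Lsym_def norm_mult norm_divide)
  ultimately show "cmod (Lsym x) <= 1" using Lam_pos[of x] by simp
qed

lemma bounded_linear_Lop: "bounded_linear Lop"
  unfolding Lop_def[abs_def]
  by (intro bounded_linear_Pair bounded_linear_compose[OF bounded_linear_Mul[OF bsym_Lsym]] bounded_linear_fst bounded_linear_snd)

lemma bounded_bilinear_Bop: "bounded_bilinear Bop"
proof -
  note bb = bounded_bilinear_bil[OF kern_r1] bounded_bilinear_bil[OF kern_r2] bounded_bilinear_bil[OF kern_r3] bounded_bilinear_bil[OF kern_r4]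
  note b = norm_bil_le[OF kern_r1] norm_bil_le[OF kern_r2] norm_bil_le[OF kern_r3] norm_bil_le[OF kern_r4]
  show ?thesis
  proof
    fix X X' Y Y' :: "h \<times> h" and c :: real
    show "Bop (X + X') Y = Bop X Y + Bop X' Y"
      by (simp add: Bop_def bb[THEN bounded_bilinear.add_left] algebra_simps)
    show "Bop X (Y + Y') = Bop X Y + Bop X Y'"
      by (simp add: Bop_def bb[THEN bounded_bilinear.add_right] algebra_simps)
    show "Bop (c *\<^sub>R X) Y = c *\<^sub>R Bop X Y"
      by (simp add: Bop_def bb[THEN bounded_bilinear.scaleR_left] scaleR_add_right)
    show "Bop X (c *\<^sub>R Y) = c *\<^sub>R Bop X Y"
      by (simp add: Bop_def bb[THEN bounded_bilinear.scaleR_right] scaleR_add_right)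
    let ?C = "2 * 2 ^ NK * CJ"
    have C: "0 <= ?C" by simp
    have gen: "norm (bil k x y) <= ?C * (norm X * norm Y)"
      if "\<And>x y. norm (bil k x y) <= ?C * norm x * norm y" "norm x <= norm X" "norm y <= norm Y" for k x y and X Y :: "h \<times> h"
    proof -
      have "norm (bil k x y) <= ?C * (norm x * norm y)" using that(1)[of x y] by (simp add: mult.assoc)
      also have "... <= ?C * (norm X * norm Y)" by (intro mult_left_mono mult_mono that C) auto
      finally show ?thesis .
    qed
    have "norm (Bop X Y) <= norm X * norm Y * (4 * ?C)" for X Y
    proof -
      have "norm (Bop X Y) <= norm (fst (Bop X Y)) + norm (snd (Bop X Y))"
        using norm_Pair_le[of "fst (Bop X Y)" "snd (Bop X Y)"] by simp
      also have "... <= (norm (bil (ik (\<lambda>u v. r1 u v / jbr u)) (fst X) (snd Y)) + norm (bil (ik (\<lambda>u v. r2 u v / jbr u)) (snd X) (fst Y)))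
        + (norm (bil (ik (\<lambda>u v. r3 u v / jbr u)) (fst X) (fst Y)) + norm (bil (ik (\<lambda>u v. r4 u v / jbr u)) (snd X) (snd Y)))"
        unfolding Bop_def fst_conv snd_conv by (intro add_mono norm_triangle_ineq)
      also have "... <= (?C * (norm X * norm Y) + ?C * (norm X * norm Y)) + (?C * (norm X * norm Y) + ?C * (norm X * norm Y))"
        by (intro add_mono gen b norm_fst_le' norm_snd_le')
      finally show ?thesis by (simp add: algebra_simps)
    qed
    then show "\<exists>K. \<forall>a b. norm (Bop a b) <= norm a * norm b * K" by blast
  qed
qed

end

section \<open>Energy estimates\<close>

context wb
begin

text \<open>It restores the factor \<open>jbr\<close> that was divided out of \<open>Zop\<close> and
  truncates at frequency \<open>n\<close>, so the truncated vector field is a locally Lipschitz map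
  of the Hilbert space.\<close>

definition Jc :: "real => real => real" where "Jc n t = jbr t * cut n t"

lemma rsym_Jc: "rsym (1 + \<bar>n\<bar>) (Jc n)"
  unfolding rsym_def
proof (intro conjI allI)
  show "Jc n \<in> meas" unfolding Jc_def[abs_def] by measurable
  fix x
  show "Jc n (- x) = Jc n x" by (simp add: Jc_def)
  show "\<bar>Jc n x\<bar> <= 1 + \<bar>n\<bar>" using jbr_le_1_abs[of x] by (auto simp: Jc_def cut_def abs_mult)
qed

lemma rM_Jc_bil:
  assumes r: "(\<lambda>(u, v). r u v) \<in> meas2" "\<And>u v. r (- u) (- v) = - r u v"
    "\<And>u v. \<bar>r u v\<bar> <= 2 * \<bar>g u v\<bar>"
    and m: "rsym M m" and b: "rsym B b"
  shows "rM m (rM (Jc n) (bil (ik (\<lambda>u v. r u v / jbr u)) x (rM b y)))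
    = bil (ik (\<lambda>u v. m u * cut n u * b v * r u v)) x y"
proof -
  have "rM m (rM (Jc n) (bil (ik (\<lambda>u v. r u v / jbr u)) (rM (\<lambda>_. 1) x) (rM b y)))
    = bil (ik (\<lambda>u v. (m u * Jc n u) * (r u v / jbr u) * 1 * b v)) x y"
    unfolding rM_rM[OF m rsym_Jc]
    by (rule rM_bil_ik[OF kern_level[OF r] rsym_one b rsym_mult[OF m rsym_Jc]])
  also have "... = bil (ik (\<lambda>u v. m u * cut n u * b v * r u v)) x y"
    by (rule bil_ik_cong) (simp add: Jc_def)
  finally show ?thesis by simp
qed

text \<open>Off the diagonal region the weight \<open>w\<close> moves to the first argument, whose
  frequency controls the output; on the region it moves to the second. In both pieces one argument
  carries \<open>w\<close>, so the energy contains the weighted norm twice.\<close>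

lemma bil_split:
  assumes w: "slow L w" "\<And>t. w t <= 1"
    and q: "(\<lambda>(u, v). q u v) \<in> meas2" "\<And>u v. q (- u) (- v) = - q u v"
    and C: "C \<ge> 0" "\<And>u v. (1 - dg u v) * \<bar>q u v\<bar> <= C * (w (u - v) * J v)"
    and N: "N \<ge> 0" "\<And>u v. dg u v * \<bar>q u v\<bar> <= N * (w v * J (u - v))"
  shows "kern C (ik (\<lambda>u v. (1 - dg u v) * q u v / w (u - v)))"
    and "kern N (ik (\<lambda>u v. dg u v * q u v / w v))"
    and "bil (ik q) x y = bil (ik (\<lambda>u v. (1 - dg u v) * q u v / w (u - v))) (rM w x) y
       + bil (ik (\<lambda>u v. dg u v * q u v / w v)) x (rM w y)"
proof -
  note [measurable] = slow_measurable[OF w(1)] q(1)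
  have wp: "0 < w t" for t by (rule slow_pos[OF w(1)])
  have wn: "w t \<noteq> 0" for t using wp[of t] by linarith
  have rw: "rsym 1 w" unfolding rsym_def using wp w(2) slow_even[OF w(1)] by (auto simp: less_imp_le)
  show k1: "kern C (ik (\<lambda>u v. (1 - dg u v) * q u v / w (u - v)))"
  proof (rule kern_ik_J[OF _ _ C(1)])
    have "(\<lambda>p. (1 - (\<lambda>(u, v). dg u v) p) * (\<lambda>(u, v). q u v) p / w (fst p - snd p)) \<in> meas2" by measurable
    then show "(\<lambda>(u, v). (1 - dg u v) * q u v / w (u - v)) \<in> meas2" by (simp add: case_prod_beta')
    fix u v :: real
    show "(1 - dg (- u) (- v)) * q (- u) (- v) / w (- u - - v) = - ((1 - dg u v) * q u v / w (u - v))"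
      unfolding diff_minus_minus slow_even[OF w(1)] dg_minus q(2) by simp
    have "\<bar>(1 - dg u v) * q u v / w (u - v)\<bar> = (1 - dg u v) * \<bar>q u v\<bar> / w (u - v)"
      using dg_01[of u v] wp[of "u - v"] by (simp add: abs_mult)
    also have "... <= C * (w (u - v) * J v) / w (u - v)" using wp[of "u - v"] by (intro divide_right_mono C(2)) auto
    also have "... = C * J v" using wn by simp
    finally show "\<bar>(1 - dg u v) * q u v / w (u - v)\<bar> <= C * J (u - v) \<or> \<bar>(1 - dg u v) * q u v / w (u - v)\<bar> <= C * J v \<or> \<bar>(1 - dg u v) * q u v / w (u - v)\<bar> <= C * (J (u - v) + J v)" by blast
  qed
  show k2: "kern N (ik (\<lambda>u v. dg u v * q u v / w v))"
  proof (rule kern_ik_J[OF _ _ N(1)])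
    have "(\<lambda>p. (\<lambda>(u, v). dg u v) p * (\<lambda>(u, v). q u v) p / w (snd p)) \<in> meas2" by measurable
    then show "(\<lambda>(u, v). dg u v * q u v / w v) \<in> meas2" by (simp add: case_prod_beta')
    fix u v :: real
    show "dg (- u) (- v) * q (- u) (- v) / w (- v) = - (dg u v * q u v / w v)"
      unfolding slow_even[OF w(1)] dg_minus q(2) by simp
    have "\<bar>dg u v * q u v / w v\<bar> = dg u v * \<bar>q u v\<bar> / w v"
      using dg_01[of u v] wp[of v] by (simp add: abs_mult)
    also have "... <= N * (w v * J (u - v)) / w v" using wp[of v] by (intro divide_right_mono N(2)) auto
    also have "... = N * J (u - v)" using wn by simp
    finally show "\<bar>dg u v * q u v / w v\<bar> <= N * J (u - v) \<or> \<bar>dg u v * q u v / w v\<bar> <= N * J v \<or> \<bar>dg u v * q u v / w v\<bar> <= N * (J (u - v) + J v)" by blast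
  qed
  let ?a = "\<lambda>u v. 1 * ((1 - dg u v) * q u v / w (u - v)) * w (u - v) * 1"
  let ?b = "\<lambda>u v. 1 * (dg u v * q u v / w v) * 1 * w v"
  have e1: "bil (ik (\<lambda>u v. (1 - dg u v) * q u v / w (u - v))) (rM w x) y = bil (ik ?a) x y"
    using rM_bil_ik[OF k1 rw rsym_one rsym_one, of x y] by simp
  have e2: "bil (ik (\<lambda>u v. dg u v * q u v / w v)) x (rM w y) = bil (ik ?b) x y"
    using rM_bil_ik[OF k2 rsym_one rw rsym_one, of x y] by simp
  have c: "kern (1 * C * 1 * 1) (ik ?a)" "kern (1 * N * 1 * 1) (ik ?b)"
    using kern_ik_Mul[OF k1 rw rsym_one rsym_one] kern_ik_Mul[OF k2 rsym_one rw rsym_one] by simp_all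
  have "q u v = ?a u v + ?b u v" for u v by (simp add: wn) (simp add: algebra_simps)
  then have "cx (q u v) = cx (?a u v) + cx (?b u v)" for u v
    by (metis of_real_add)
  then have "ik q = (\<lambda>u v. ik ?a u v + ik ?b u v)"
    by (intro ext) (simp only: ik_def ring_distribs)
  then show "bil (ik q) x y = bil (ik (\<lambda>u v. (1 - dg u v) * q u v / w (u - v))) (rM w x) y
       + bil (ik (\<lambda>u v. dg u v * q u v / w v)) x (rM w y)"
    unfolding e1 e2 using bil_kernel_add[OF c, of x y] by simp
qed

lemma dg_D: "dg u v \<noteq> 0 ==> \<bar>u\<bar> <= 2 * \<bar>v\<bar> \<and> \<bar>v\<bar> <= 2 * \<bar>u\<bar>"
  using abs_triangle_ineq[of "u - v" v] abs_triangle_ineq[of "v - u" u] abs_minus_commute[of u v]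
  by (auto simp: dg_def split: if_splits)

text \<open>In the worst case |v| < 2|u - v|, hence |u| < 3|u - v|; this is the origin of the
  factors \<open>3 ^ NK\<close>.\<close>

lemma off_dg_D: "dg u v \<noteq> 1 ==> \<bar>u\<bar> <= 3 * \<bar>u - v\<bar>"
  using abs_triangle_ineq[of "u - v" v] by (auto simp: dg_def split: if_splits)

text \<open>The bound \<open>N\<close> only guarantees that the operators exist and may depend on
  the truncation; the estimate itself involves only the bound \<open>C\<close> of the antisymmetric
  part.\<close>

lemma cross_bound:
  assumes R: "(\<lambda>p. R (fst p) (snd p)) \<in> meas2" "\<And>u v. R (- u) (- v) = - R u v"
    and N: "N \<ge> 0" "\<And>u v. \<bar>R u v\<bar> <= N * J (u - v)"
    and C: "C \<ge> 0" "\<And>u v. \<bar>R u v - R v u\<bar> <= C * J (u - v)"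
    and l: "rsym 1 l"
  shows "\<bar>inner A (bil (ik (\<lambda>u v. R u v * l v)) F B) + inner B (bil (ik (\<lambda>u v. R u v * l u)) F A)\<bar>
    <= C * CJ * norm F * norm B * norm A"
proof -
  note [measurable] = R(1) rsym_measurable[OF l]
  have l1: "\<bar>l t\<bar> <= 1" for t using l by (simp add: rsym_def)
  have b: "\<bar>R u v * l t\<bar> <= N * J (u - v)" for u v t
    using mult_mono[OF N(2)[of u v] l1[of t]] N(1) by (simp add: abs_mult)
  have k1: "kern N (ik (\<lambda>u v. R u v * l v))"
    by (rule kern_ik_J) (use b R(2) N(1) rsym_even[OF l] in \<open>auto simp: case_prod_beta'\<close>)
  have k2: "kern N (ik (\<lambda>u v. R u v * l u))"
    by (rule kern_ik_J) (use b R(2) N(1) rsym_even[OF l] in \<open>auto simp: case_prod_beta'\<close>)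
  have [measurable]: "(\<lambda>p. R (snd p) (fst p)) \<in> meas2"
    using measurable_compose[OF _ R(1), of "\<lambda>p. (snd p, fst p)"] by simp
  have k3: "kern C (ik (\<lambda>u v. (R u v - R v u) * l v))"
  proof (rule kern_ik_J)
    fix u v :: real
    have "\<bar>(R u v - R v u) * l v\<bar> <= C * J (u - v) * 1"
      unfolding abs_mult using C(1) by (intro mult_mono C(2) l1) auto
    then show "\<bar>(R u v - R v u) * l v\<bar> <= C * J (u - v) \<or> \<bar>(R u v - R v u) * l v\<bar> <= C * J v \<or> \<bar>(R u v - R v u) * l v\<bar> <= C * (J (u - v) + J v)"
      by simp
  qed (use C(1) R(2) rsym_even[OF l] in \<open>auto simp: case_prod_beta' algebra_simps\<close>)
  show ?thesis unfolding cross_cancel[OF k1 k2] by (rule inner_bil_le[OF k3])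
qed

text \<open>A first order operator with low frequency coefficient \<open>c\<close>, conjugated by
  the weight \<open>a\<close> and restricted to the diagonal region. Its antisymmetric part has the
  numerator \<open>(a u)^2 * v - (a v)^2 * u\<close> of \<open>slow_bracket\<close>.\<close>

definition RR :: "real => (real => real) => (real => real) => real => real => real" where
  "RR n a c u v = dg u v * cut n u * cut n v * (a u * v / a v) * c (u - v)"

text \<open>\<open>2 * real NK + 1\<close> comes from \<open>slow_bracket\<close>,
  \<open>2 ^ NK\<close> from the comparability of \<open>a u\<close> and \<open>a v\<close> on the
  diagonal region.\<close>

definition Cb :: real where "Cb = (2 * real NK + 1) * 2 ^ NK"

lemma Cb_pos: "0 <= Cb" by (simp add: Cb_def)

context
  fixes n :: real and a c :: "real => real"
  assumes a: "slow NK a"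
    and c: "c \<in> meas" "\<And>t. c (- t) = c t" "\<And>t. 0 <= c t" "\<And>t. c t <= 1 / sig t"
begin

lemma RR_measurable: "(\<lambda>p. RR n a c (fst p) (snd p)) \<in> meas2"
proof -
  note [measurable] = slow_measurable[OF a] c(1)
  have "(\<lambda>p. (\<lambda>(u, v). dg u v) p * cut n (fst p) * cut n (snd p) * (a (fst p) * snd p / a (snd p)) * c (fst p - snd p)) \<in> meas2"
    by measurable
  then show ?thesis by (simp add: RR_def case_prod_beta')
qed

lemma RR_minus: "RR n a c (- u) (- v) = - RR n a c u v"
  unfolding RR_def diff_minus_minus c(2) dg_minus cut_minus slow_even[OF a] by simp

lemma RR_bound: "\<bar>RR n a c u v\<bar> <= 2 ^ NK * \<bar>n\<bar> * J (u - v)"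
proof (cases "dg u v = 0 \<or> cut n v = 0")
  case True then show ?thesis by (auto simp: RR_def)
next
  case False
  then have d: "dg u v = 1" "\<bar>v\<bar> <= \<bar>n\<bar>" by (auto simp: dg_def cut_def split: if_splits)
  have ap: "0 < a u" "0 < a v" using slow_pos[OF a] by auto
  have "a u <= 2 ^ NK * a v" using dg_D[of u v] d(1) by (intro slow_double[OF a]) auto
  then have r: "a u / a v <= 2 ^ NK" using ap by (simp add: pos_divide_le_eq)
  have "\<bar>RR n a c u v\<bar> = cut n u * cut n v * ((a u / a v) * \<bar>v\<bar>) * c (u - v)"
    using ap c(3)[of "u - v"] cut_01 by (simp add: RR_def d abs_mult)
  also have "... <= 1 * 1 * (2 ^ NK * \<bar>n\<bar>) * J (u - v)"
    using ap c(3,4)[of "u - v"] cut_01[of n u] cut_01[of n v] r d one_div_sig_le[of "u - v"]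
    by (intro mult_mono) auto
  finally show ?thesis by simp
qed

text \<open>On the diagonal region \<open>a u\<close> and \<open>a v\<close> are comparable, so the
  denominator \<open>a u * a v\<close> absorbs the squared maximum of \<open>slow_bracket\<close>.
  The factor |u - v| that remains is paid by the coefficient: |t| / sig t <= J t.\<close>

lemma RR_anti: "\<bar>RR n a c u v - RR n a c v u\<bar> <= Cb * J (u - v)"
proof (cases "dg u v = 0")
  case True then show ?thesis using Cb_pos by (simp add: RR_def dg_sym[of v u])
next
  case False
  then have d: "dg u v = 1" by (auto simp: dg_def split: if_splits)
  have ap: "0 < a u" "0 < a v" using slow_pos[OF a] by auto
  have le: "a u <= 2 ^ NK * a v" "a v <= 2 ^ NK * a u"
    using dg_D[of u v] False by (intro slow_double[OF a]; auto)+
  have mx: "(max (a u) (a v))^2 <= 2 ^ NK * (a u * a v)"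
  proof (cases "a u <= a v")
    case True
    have "a v * a v <= (2 ^ NK * a u) * a v" using le ap by (intro mult_right_mono) auto
    then show ?thesis using True by (simp add: max_def power2_eq_square mult_ac)
  next
    case False
    have "a u * a u <= (2 ^ NK * a v) * a u" using le ap by (intro mult_right_mono) auto
    then show ?thesis using False by (simp add: max_def power2_eq_square mult_ac)
  qed
  have ceq: "c (v - u) = c (u - v)" using c(2)[of "u - v"] by simp
  have "RR n a c u v - RR n a c v u = cut n u * cut n v * c (u - v) * (((a u)^2 * v - (a v)\<^sup>2 * u) / (a u * a v))"
    using ap by (simp add: RR_def dg_sym[of v u] d ceq field_simps power2_eq_square)
  then have "\<bar>RR n a c u v - RR n a c v u\<bar> = cut n u * cut n v * c (u - v) * (\<bar>(a u)^2 * v - (a v)\<^sup>2 * u\<bar> / (a u * a v))"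
    using ap cut_01 c(3) by (simp add: abs_mult)
  also have "... <= 1 * 1 * (1 / sig (u - v)) * (Cb * \<bar>u - v\<bar>)"
  proof (intro mult_mono)
    have "\<bar>(a u)^2 * v - (a v)\<^sup>2 * u\<bar> <= (2 * real NK + 1) * (max (a u) (a v))^2 * \<bar>u - v\<bar>"
      by (rule slow_bracket[OF a])
    also have "... <= (2 * real NK + 1) * (2 ^ NK * (a u * a v)) * \<bar>u - v\<bar>"
      using mx by (intro mult_right_mono mult_left_mono) auto
    finally show "\<bar>(a u)^2 * v - (a v)\<^sup>2 * u\<bar> / (a u * a v) <= Cb * \<bar>u - v\<bar>"
      using ap by (simp add: pos_divide_le_eq Cb_def mult_ac)
  qed (use cut_01 c Cb_pos ap in \<open>auto intro!: divide_nonneg_pos\<close>)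
  also have "... = Cb * (\<bar>u - v\<bar> / sig (u - v))" by simp
  also have "... <= Cb * J (u - v)" by (intro mult_left_mono abs_div_sig_le Cb_pos)
  finally show ?thesis .
qed

lemma RR_cross:
  assumes "rsym 1 l"
  shows "\<bar>inner A (bil (ik (\<lambda>u v. RR n a c u v * l v)) F B) + inner B (bil (ik (\<lambda>u v. RR n a c u v * l u)) F A)\<bar>
    <= Cb * CJ * norm F * norm B * norm A"
  by (rule cross_bound[OF RR_measurable RR_minus _ RR_bound Cb_pos RR_anti assms]) simp

lemma RR_self: "\<bar>inner A (bil (ik (RR n a c)) F A)\<bar> <= Cb * CJ * norm F * norm A * norm A"
  using RR_cross[OF rsym_one, of A F A] Cb_pos by (simp add: mult_nonneg_nonneg)

end

text \<open>Off the diagonal region the derivative can be put on the low frequency factor; on it the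
  commutator with the weight gains the derivative back.\<close>
theorem energy_estimate:
  assumes w: "slow 1 w" "\<And>t. w t <= 1" and X: "M2 (cut n) X = X"
  shows "\<bar>inner (M2 w X) (M2 w (M2 (Jc n) (Bop X X)))\<bar> <= (8 * 3 ^ NK + 3 * Cb) * CJ * norm X * (norm (M2 w X))^2"
proof -
  obtain F G where FG: "X = (F, G)" by (cases X)
  have cF: "rM (cut n) F = F" and cG: "rM (cut n) G = G" using X by (auto simp: FG M2_def)
  define A B where "A = rM w F" and "B = rM w G"
  have wp: "0 < w t" for t by (rule slow_pos[OF w(1)])
  have wn: "w t \<noteq> 0" for t using wp[of t] by linarith
  have rw: "rsym 1 w" unfolding rsym_def using wp w(2) slow_even[OF w(1)] slow_measurable[OF w(1)] by (auto simp: less_imp_le)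
  note [measurable] = slow_measurable[OF w(1)]
  define a where "a t = w t * sig t" for t
  define a' where "a' t = w t * (sig t * Lam t)" for t
  have sa: "slow NK a" unfolding a_def[abs_def]
    by (rule slow_mono_exp[OF slow_mult[OF w(1) slow_sig]]) (unfold NK_def, linarith)
  have sa': "slow NK a'" unfolding a'_def[abs_def]
    by (rule slow_mono_exp[OF slow_mult[OF w(1) slow_mult[OF slow_sig slow_Lam]]]) (unfold NK_def, linarith)
  \<comment> \<open>Here \<open>off_dg_D\<close> lets the combined weight \<open>w * sig\<close>
    pass to the frequency \<open>i - j\<close> at the price \<open>3 ^ NK\<close>, and the
    derivative meets \<open>1 / sig j\<close>, which gives \<open>J j\<close>.\<close>
  have off: "(1 - dg i j) * \<bar>w i * cut n i * cut n j * r i j\<bar> <= 2 * 3 ^ NK * (w (i - j) * J j)"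
    if r: "\<bar>r i j\<bar> <= 2 * \<bar>g i j\<bar>" for r i j
  proof (cases "dg i j = 1")
    case True then show ?thesis using wp[of "i - j"] by simp
  next
    case False
    have "a i <= 3 ^ NK * a (i - j)" by (rule slow_double[OF sa off_dg_D[OF False]]) simp
    then have aa: "w i * sig i <= 3 ^ NK * (w (i - j) * sig (i - j))" by (simp add: a_def)
    have "(1 - dg i j) * \<bar>w i * cut n i * cut n j * r i j\<bar> = (1 - dg i j) * cut n i * cut n j * (w i * \<bar>r i j\<bar>)"
      using wp[of i] cut_01 by (simp add: abs_mult)
    also have "... <= 1 * 1 * 1 * (w i * (2 * \<bar>g i j\<bar>))"
      using wp[of i] cut_01 dg_01[of i j] r by (intro mult_mono) auto
    also have "... = 2 * ((w i * sig i) * (\<bar>j\<bar> / sig j) / sig (i - j))" by (simp add: g_def abs_mult mult_ac)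
    also have "... <= 2 * ((3 ^ NK * (w (i - j) * sig (i - j))) * J j / sig (i - j))"
      using wp[of "i - j"] by (intro mult_left_mono divide_right_mono mult_mono aa abs_div_sig_le) auto
    also have "... = 2 * 3 ^ NK * (w (i - j) * J j)" by simp
    finally show ?thesis .
  qed
  \<comment> \<open>This bound grows with \<open>n\<close> and only makes the splitting legitimate;
    it does not enter the final constant.\<close>
  have dia: "dg i j * \<bar>w i * cut n i * cut n j * r i j\<bar> <= 2 * 2 ^ NK * \<bar>n\<bar> * (w j * J (i - j))"
    if r: "\<bar>r i j\<bar> <= 2 * \<bar>g i j\<bar>" for r i j
  proof (cases "dg i j = 0 \<or> cut n j = 0")
    case True then show ?thesis using wp[of j] by auto
  next
    case False
    then have d: "dg i j \<noteq> 0" "\<bar>j\<bar> <= \<bar>n\<bar>" by (auto simp: cut_def split: if_splits)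
    have "a i <= 2 ^ NK * a j" using dg_D[OF d(1)] by (intro slow_double[OF sa]) auto
    then have aa: "w i * sig i <= 2 ^ NK * (w j * sig j)" by (simp add: a_def)
    have "dg i j * \<bar>w i * cut n i * cut n j * r i j\<bar> = dg i j * cut n i * cut n j * (w i * \<bar>r i j\<bar>)"
      using wp[of i] cut_01 by (simp add: abs_mult)
    also have "... <= 1 * 1 * 1 * (w i * (2 * \<bar>g i j\<bar>))"
      using wp[of i] cut_01 dg_01[of i j] r by (intro mult_mono) auto
    also have "... = 2 * ((w i * sig i) * \<bar>j\<bar> / sig j * (1 / sig (i - j)))" by (simp add: g_def abs_mult mult_ac)
    also have "... <= 2 * ((2 ^ NK * (w j * sig j)) * \<bar>n\<bar> / sig j * J (i - j))"
      using wp[of j] d by (intro mult_left_mono divide_right_mono mult_mono aa one_div_sig_le) auto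
    also have "... = 2 * 2 ^ NK * \<bar>n\<bar> * (w j * J (i - j))" by simp
    finally show ?thesis .
  qed
  have split: "kern (2 * 3 ^ NK) (ik (\<lambda>i j. (1 - dg i j) * (w i * cut n i * cut n j * r i j) / w (i - j))) \<and>
     rM w (rM (Jc n) (bil (ik (\<lambda>i j. r i j / jbr i)) x y))
     = bil (ik (\<lambda>i j. (1 - dg i j) * (w i * cut n i * cut n j * r i j) / w (i - j))) (rM w x) y
     + bil (ik (\<lambda>i j. dg i j * (w i * cut n i * cut n j * r i j) / w j)) x (rM w y)"
    if r: "(\<lambda>(i, j). r i j) \<in> meas2" "\<And>i j. r (- i) (- j) = - r i j"
      "\<And>i j. \<bar>r i j\<bar> <= 2 * \<bar>g i j\<bar>" and y: "rM (cut n) y = y" for r x y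
  proof -
    have e: "rM w (rM (Jc n) (bil (ik (\<lambda>i j. r i j / jbr i)) x y)) = bil (ik (\<lambda>i j. w i * cut n i * cut n j * r i j)) x y"
      using rM_Jc_bil[OF r rw rsym_cut[of n], of n x y] y by simp
    note [measurable] = r(1)
    have "(\<lambda>p. w (fst p) * cut n (fst p) * cut n (snd p) * (\<lambda>(i, j). r i j) p) \<in> meas2" by measurable
    then have m: "(\<lambda>(i, j). w i * cut n i * cut n j * r i j) \<in> meas2" by (simp add: case_prod_beta')
    have o: "w (- i) * cut n (- i) * cut n (- j) * r (- i) (- j) = - (w i * cut n i * cut n j * r i j)" for i j
      unfolding slow_even[OF w(1)] cut_minus r(2) by simp
    show ?thesis unfolding e
      using bil_split(1,3)[OF w m o _ off[where r = r, OF r(3)] _ dia[where r = r, OF r(3)]] by simp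
  qed
  note s1 = split[OF r_measurable(1) r_minus(1) r_le_g(1) cG, of F]
    and s2 = split[OF r_measurable(2) r_minus(2) r_le_g(2) cF, of G]
    and s3 = split[OF r_measurable(3) r_minus(3) r_le_g(3) cF, of F]
    and s4 = split[OF r_measurable(4) r_minus(4) r_le_g(4) cG, of G]
  let ?c1 = "\<lambda>t. kap / 2 / sig t" and ?c2 = "\<lambda>t. kap / (sig t * Lam t)" and ?l = "\<lambda>t. 1 / Lam t"
  \<comment> \<open>\<open>r1\<close> and \<open>r3\<close> reduce to the same kernel
    \<open>RR n a ?c1\<close>, with the factor 1/\<open>Lam\<close> once at \<open>j\<close> and
    once at \<open>i\<close>: the configuration that \<open>RR_cross\<close> cancels.\<close>
  have d1: "(\<lambda>i j. dg i j * (w i * cut n i * cut n j * r1 i j) / w j) = (\<lambda>i j. RR n a ?c1 i j * ?l j)"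
    by (intro ext) (simp add: r1_def RR_def g_def a_def wn field_simps)
  have d3: "(\<lambda>i j. dg i j * (w i * cut n i * cut n j * r3 i j) / w j) = (\<lambda>i j. RR n a ?c1 i j * ?l i)"
    by (intro ext) (simp add: r3_def RR_def g_def a_def wn field_simps)
  have d2: "(\<lambda>i j. dg i j * (w i * cut n i * cut n j * r2 i j) / w j) = RR n a ?c2"
    by (intro ext) (simp add: r2_def RR_def g_def a_def wn field_simps)
  \<comment> \<open>The ratio of \<open>Lam\<close> at \<open>i\<close> and \<open>j\<close> in
    \<open>r4\<close> is absorbed by the larger weight \<open>a'\<close>.\<close>
  have d4: "(\<lambda>i j. dg i j * (w i * cut n i * cut n j * r4 i j) / w j) = RR n a' ?c2"
    by (intro ext) (simp add: r4_def RR_def g_def a'_def wn field_simps)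
  have cc1: "?c1 \<in> meas" "\<And>t. ?c1 (- t) = ?c1 t" "\<And>t. 0 <= ?c1 t" "\<And>t. ?c1 t <= 1 / sig t"
    using kap divide_right_mono[of "kap / 2" 1 "sig _"] by auto
  have cc2: "?c2 \<in> meas" "\<And>t. ?c2 (- t) = ?c2 t" "\<And>t. 0 <= ?c2 t" "\<And>t. ?c2 t <= 1 / sig t"
  proof -
    fix t
    have "kap / Lam t <= 1" using kap Lam_ge_1[of t] by simp
    then show "?c2 t <= 1 / sig t" using divide_right_mono[of "kap / Lam t" 1 "sig t"] by (simp add: mult.commute)
  qed (use kap in \<open>auto simp: less_imp_le\<close>)
  have ll: "rsym 1 ?l" "\<And>t. 0 <= ?l t" unfolding rsym_def using Lam_ge_1 by (auto simp: abs_le_iff less_imp_le)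
  let ?x = "norm X" and ?y = "norm (M2 w X)"
  have n: "norm F <= ?x" "norm G <= ?x" "norm A <= ?y" "norm B <= ?y"
    using norm_fst_le'[of X] norm_snd_le'[of X] norm_fst_le'[of "M2 w X"] norm_snd_le'[of "M2 w X"] by (auto simp: FG A_def B_def)
  have mono3: "K * CJ * norm u * norm v * norm z <= K * CJ * (?x * ?y^2)"
    if "K \<ge> 0" "(norm u <= ?x \<and> norm v <= ?y \<or> norm u <= ?y \<and> norm v <= ?x)" "norm z <= ?y" for K and u v z :: h
  proof -
    have "norm u * norm v <= ?x * ?y"
      using that(2) mult_mono[of "norm u" ?x "norm v" ?y] mult_mono[of "norm u" ?y "norm v" ?x] by (auto simp: mult.commute)
    from mult_mono[OF this that(3)] have "(norm u * norm v) * norm z <= (?x * ?y) * ?y" by simp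
    then have "(K * CJ) * ((norm u * norm v) * norm z) <= (K * CJ) * ((?x * ?y) * ?y)" using that(1) by (intro mult_left_mono) auto
    then show ?thesis by (simp add: power2_eq_square mult.assoc)
  qed
  define o1 o2 o3 o4 where "o1 = inner A (bil (ik (\<lambda>i j. (1 - dg i j) * (w i * cut n i * cut n j * r1 i j) / w (i - j))) A G)"
    and "o2 = inner A (bil (ik (\<lambda>i j. (1 - dg i j) * (w i * cut n i * cut n j * r2 i j) / w (i - j))) B F)"
    and "o3 = inner B (bil (ik (\<lambda>i j. (1 - dg i j) * (w i * cut n i * cut n j * r3 i j) / w (i - j))) A F)"
    and "o4 = inner B (bil (ik (\<lambda>i j. (1 - dg i j) * (w i * cut n i * cut n j * r4 i j) / w (i - j))) B G)"
  define e1 e3 e2 e4 where "e1 = inner A (bil (ik (\<lambda>i j. RR n a ?c1 i j * ?l j)) F B)"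
    and "e3 = inner B (bil (ik (\<lambda>i j. RR n a ?c1 i j * ?l i)) F A)"
    and "e2 = inner A (bil (ik (RR n a ?c2)) G A)" and "e4 = inner B (bil (ik (RR n a' ?c2)) G B)"
  have "inner (M2 w X) (M2 w (M2 (Jc n) (Bop X X))) = o1 + o2 + o3 + o4 + ((e1 + e3) + e2 + e4)"
    using s1 s2 s3 s4 unfolding d1 d2 d3 d4
    by (simp add: FG M2_def Bop_def inner_prod_def linear_add[OF bounded_linear.linear[OF bounded_linear_rM[OF rsym_Jc]]]
        linear_add[OF bounded_linear.linear[OF bounded_linear_rM[OF rw]]] inner_add_right
        o1_def o2_def o3_def o4_def e1_def e2_def e3_def e4_def A_def[symmetric] B_def[symmetric])
  moreover have "\<bar>o1\<bar> <= 2 * 3 ^ NK * CJ * (?x * ?y^2)" "\<bar>o2\<bar> <= 2 * 3 ^ NK * CJ * (?x * ?y^2)"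
    "\<bar>o3\<bar> <= 2 * 3 ^ NK * CJ * (?x * ?y^2)" "\<bar>o4\<bar> <= 2 * 3 ^ NK * CJ * (?x * ?y^2)"
    unfolding o1_def o2_def o3_def o4_def
    using n by (auto intro!: order_trans[OF inner_bil_le mono3] conjunct1[OF s1] conjunct1[OF s2] conjunct1[OF s3] conjunct1[OF s4])
  moreover have "\<bar>e1 + e3\<bar> <= Cb * CJ * (?x * ?y^2)"
    unfolding e1_def e3_def using n Cb_pos by (intro order_trans[OF RR_cross[OF sa cc1 ll(1)] mono3]) auto
  moreover have "\<bar>e2\<bar> <= Cb * CJ * (?x * ?y^2)"
    unfolding e2_def using n Cb_pos by (intro order_trans[OF RR_self[OF sa cc2] mono3]) auto
  moreover have "\<bar>e4\<bar> <= Cb * CJ * (?x * ?y^2)"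
    unfolding e4_def using n Cb_pos by (intro order_trans[OF RR_self[OF sa' cc2] mono3]) auto
  \<comment> \<open>Four off-diagonal terms cost \<open>2 * 3 ^ NK\<close> each; the coupled pair
    and the two transport terms cost \<open>Cb\<close> each.\<close>
  ultimately have "\<bar>inner (M2 w X) (M2 w (M2 (Jc n) (Bop X X)))\<bar>
    <= 4 * (2 * 3 ^ NK * CJ * (?x * ?y^2)) + 3 * (Cb * CJ * (?x * ?y^2))" by linarith
  also have "... = (8 * 3 ^ NK + 3 * Cb) * CJ * ?x * ?y^2" by (simp add: algebra_simps)
  finally show ?thesis .
qed

text \<open>The analogue of \<open>RR\<close> at the L2 level. No restriction to the diagonal region
  is made: the weights used here are 1 and \<open>Lam\<close>, whose variation the coefficient can
  absorb everywhere.\<close>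

definition RS :: "real => (real => real) => (real => real) => real => real => real" where
  "RS n a c u v = cut n u * cut n v * (a u * v / a v) * c (u - v)"

text \<open>Hypothesis \<open>ac\<close> replaces the comparability of \<open>a u\<close> and
  \<open>a v\<close>. The constant 6 is 3 from \<open>slow_bracket\<close> with exponent 1, times
  the 2 in \<open>ac\<close>.\<close>

lemma RS_cross:
  assumes a: "slow 1 a"
    and c: "c \<in> meas" "\<And>t. c (- t) = c t" "\<And>t. 0 <= c t"
    and ac: "\<And>u v. (max (a u) (a v))^2 * c (u - v) <= 2 * (a u * a v) / sig (u - v)"
    and l: "rsym 1 l"
  shows "\<bar>inner A (bil (ik (\<lambda>u v. RS n a c u v * l v)) F B) + inner B (bil (ik (\<lambda>u v. RS n a c u v * l u)) F A)\<bar>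
    <= 6 * CJ * norm F * norm B * norm A"
proof (rule cross_bound[where N = "2 * \<bar>n\<bar>", OF _ _ _ _ _ _ l])
  note [measurable] = slow_measurable[OF a] c(1)
  show "(\<lambda>p. RS n a c (fst p) (snd p)) \<in> meas2"
    unfolding RS_def by measurable
  fix u v :: real
  have ap: "0 < a u" "0 < a v" using slow_pos[OF a] by auto
  show "RS n a c (- u) (- v) = - RS n a c u v"
    unfolding RS_def diff_minus_minus c(2) cut_minus slow_even[OF a] by simp
  show "\<bar>RS n a c u v\<bar> <= 2 * \<bar>n\<bar> * J (u - v)"
  proof (cases "cut n v = 0")
    case True then show ?thesis by (simp add: RS_def)
  next
    case False
    then have d: "\<bar>v\<bar> <= \<bar>n\<bar>" by (auto simp: cut_def split: if_splits)
    have "(a u)^2 * c (u - v) <= (max (a u) (a v))^2 * c (u - v)"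
      using ap c(3) by (intro mult_right_mono power_mono) auto
    also have "... <= 2 * (a u * a v) / sig (u - v)" by (rule ac)
    finally have "a u * (a u * c (u - v)) <= a u * (2 * a v * (1 / sig (u - v)))" by (simp add: power2_eq_square mult_ac)
    then have "a u * c (u - v) <= 2 * a v * (1 / sig (u - v))" using ap(1) by (simp only: mult_le_cancel_left_pos)
    also have "... <= 2 * a v * J (u - v)" using ap by (intro mult_left_mono one_div_sig_le) auto
    finally have r: "a u * c (u - v) / a v <= 2 * J (u - v)" using ap by (simp add: pos_divide_le_eq mult_ac)
    have "\<bar>RS n a c u v\<bar> = cut n u * cut n v * (\<bar>v\<bar> * (a u * c (u - v) / a v))"
      using ap c(3)[of "u - v"] cut_01 by (simp add: RS_def abs_mult mult_ac)
    also have "... <= 1 * 1 * (\<bar>n\<bar> * (2 * J (u - v)))"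
      using ap c(3) cut_01[of n u] cut_01[of n v] r d by (intro mult_mono) auto
    finally show ?thesis by (simp add: mult_ac)
  qed
  have ceq: "c (v - u) = c (u - v)" using c(2)[of "u - v"] by simp
  have "RS n a c u v - RS n a c v u = cut n u * cut n v * (c (u - v) * ((a u)^2 * v - (a v)\<^sup>2 * u) / (a u * a v))"
    using ap by (simp add: RS_def ceq field_simps power2_eq_square)
  then have "\<bar>RS n a c u v - RS n a c v u\<bar> = cut n u * cut n v * (c (u - v) * \<bar>(a u)^2 * v - (a v)\<^sup>2 * u\<bar> / (a u * a v))"
    using ap cut_01 c(3) by (simp add: abs_mult)
  also have "... <= 1 * 1 * (6 * \<bar>u - v\<bar> / sig (u - v))"
  proof (intro mult_mono)
    have "c (u - v) * \<bar>(a u)^2 * v - (a v)\<^sup>2 * u\<bar> <= c (u - v) * ((2 * real 1 + 1) * (max (a u) (a v))^2 * \<bar>u - v\<bar>)"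
      by (intro mult_left_mono slow_bracket[OF a] c(3))
    also have "... = 3 * ((max (a u) (a v))^2 * c (u - v)) * \<bar>u - v\<bar>" by simp
    also have "... <= 3 * (2 * (a u * a v) / sig (u - v)) * \<bar>u - v\<bar>"
      by (intro mult_right_mono mult_left_mono ac) auto
    also have "... = (6 * \<bar>u - v\<bar> / sig (u - v)) * (a u * a v)" by simp
    finally show "c (u - v) * \<bar>(a u)^2 * v - (a v)\<^sup>2 * u\<bar> / (a u * a v) <= 6 * \<bar>u - v\<bar> / sig (u - v)"
      using ap by (subst pos_divide_le_eq) auto
  qed (use cut_01 c ap in \<open>auto intro!: divide_nonneg_pos\<close>)
  also have "... = 6 * (\<bar>u - v\<bar> / sig (u - v))" by simp
  also have "... <= 6 * J (u - v)" by (intro mult_left_mono abs_div_sig_le) auto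
  finally show "\<bar>RS n a c u v - RS n a c v u\<bar> <= 6 * J (u - v)" .
qed auto

text \<open>It strips the Sobolev weight: from (sig q, sig Lam v) it returns (q, Lam v), so
  \<open>M2 Sg\<close> measures differences without loss of derivatives.\<close>

definition Sg :: "real => real" where "Sg t = 1 / sig t"

lemma rsym_Sg: "rsym 1 Sg"
  unfolding rsym_def Sg_def[abs_def] using sig_ge_1 by (auto simp: abs_le_iff)

text \<open>In \<open>Bop Y D\<close> the derivative falls on the difference and is removed by
  antisymmetry; in \<open>Bop D Y\<close> it falls on \<open>Y\<close>, whose weight
  \<open>sig\<close> can pay for it. The constant 26 allows 2 for each of four source terms and 6
  for each of three commutators.\<close>

theorem difference_estimate:
  assumes D: "M2 (cut n) D = D"
  shows "\<bar>inner (M2 Sg D) (M2 Sg (M2 (Jc n) (Bop Y D + Bop D Y)))\<bar> <= 26 * CJ * norm Y * (norm (M2 Sg D))^2"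
proof -
  obtain F G where FG: "Y = (F, G)" by (cases Y)
  obtain P Q where PQ: "D = (P, Q)" by (cases D)
  have cP: "rM (cut n) P = P" and cQ: "rM (cut n) Q = Q" using D by (auto simp: PQ M2_def)
  define A B where "A = rM Sg P" and "B = rM Sg Q"
  note [measurable] = rsym_measurable[OF rsym_Sg]
  have Sgs: "Sg t * sig t = 1" for t by (simp add: Sg_def)
  \<comment> \<open>Terms with the derivative on \<open>D\<close>: conjugation by \<open>Sg\<close>
    cancels the weight ratio \<open>sig i / sig j\<close>, so no Sobolev weight is left on the high
    frequency.\<close>
  have good: "rM Sg (rM (Jc n) (bil (ik (\<lambda>i j. r i j / jbr i)) x y)) = bil (ik (\<lambda>i j. Sg i * cut n i * cut n j * r i j * sig j)) x (rM Sg y)"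
    if r: "(\<lambda>(i, j). r i j) \<in> meas2" "\<And>i j. r (- i) (- j) = - r i j"
      "\<And>i j. \<bar>r i j\<bar> <= 2 * \<bar>g i j\<bar>" and y: "rM (cut n) y = y" for r x y
  proof -
    note [measurable] = r(1)
    have "(\<lambda>p. Sg (fst p) * cut n (fst p) * cut n (snd p) * (\<lambda>(i, j). r i j) p * sig (snd p)) \<in> meas2" by measurable
    then have m: "(\<lambda>(i, j). Sg i * cut n i * cut n j * r i j * sig j) \<in> meas2" by (simp add: case_prod_beta')
    have k: "kern (2 * \<bar>n\<bar>) (ik (\<lambda>i j. Sg i * cut n i * cut n j * r i j * sig j))"
    proof (rule kern_ik_J[OF m])
      fix i j :: real
      show "Sg (- i) * cut n (- i) * cut n (- j) * r (- i) (- j) * sig (- j) = - (Sg i * cut n i * cut n j * r i j * sig j)"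
        by (simp add: Sg_def r(2))
      have "\<bar>Sg i * cut n i * cut n j * r i j * sig j\<bar> <= 2 * \<bar>n\<bar> * J (i - j)"
      proof (cases "cut n j = 0")
        case True then show ?thesis by simp
      next
        case False
        then have d: "\<bar>j\<bar> <= \<bar>n\<bar>" by (auto simp: cut_def split: if_splits)
        have "\<bar>Sg i * cut n i * cut n j * r i j * sig j\<bar> = cut n i * cut n j * (Sg i * sig j * \<bar>r i j\<bar>)"
          using cut_01 by (simp add: abs_mult Sg_def mult_ac)
        also have "... <= 1 * 1 * (Sg i * sig j * (2 * \<bar>g i j\<bar>))"
          using cut_01 r(3) by (intro mult_mono) (auto simp: Sg_def)
        also have "... = 2 * \<bar>j\<bar> * (1 / sig (i - j))" by (simp add: g_def abs_mult Sg_def)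
        also have "... <= 2 * \<bar>n\<bar> * J (i - j)" using d by (intro mult_mono one_div_sig_le) auto
        finally show ?thesis .
      qed
      then show "\<bar>Sg i * cut n i * cut n j * r i j * sig j\<bar> <= 2 * \<bar>n\<bar> * J (i - j) \<or> \<bar>Sg i * cut n i * cut n j * r i j * sig j\<bar> <= 2 * \<bar>n\<bar> * J j \<or> \<bar>Sg i * cut n i * cut n j * r i j * sig j\<bar> <= 2 * \<bar>n\<bar> * (J (i - j) + J j)" by blast
    qed simp
    have "bil (ik (\<lambda>i j. Sg i * cut n i * cut n j * r i j * sig j)) x (rM Sg y)
        = bil (ik (\<lambda>i j. 1 * (Sg i * cut n i * cut n j * r i j * sig j) * 1 * Sg j)) x y"
      using rM_bil_ik[OF k rsym_one rsym_Sg rsym_one, of x y] by simp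
    also have "... = bil (ik (\<lambda>i j. Sg i * cut n i * cut n j * r i j)) x y"
      by (rule bil_ik_cong) (simp add: Sg_def)
    also have "... = rM Sg (rM (Jc n) (bil (ik (\<lambda>i j. r i j / jbr i)) x y))"
      using rM_Jc_bil[OF r rsym_Sg rsym_cut[of n], of n x y] y by simp
    finally show ?thesis by simp
  qed
  \<comment> \<open>Terms with the derivative on \<open>Y\<close>: the weight is stripped from
    \<open>D\<close> and from the output, and \<open>|j| / sig j <= J j\<close> remains.\<close>
  have src: "\<bar>inner z (rM Sg (rM (Jc n) (bil (ik (\<lambda>i j. r i j / jbr i)) x y)))\<bar> <= 2 * CJ * norm (rM Sg x) * norm y * norm z"
    if r: "(\<lambda>(i, j). r i j) \<in> meas2" "\<And>i j. r (- i) (- j) = - r i j"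
      "\<And>i j. \<bar>r i j\<bar> <= 2 * \<bar>g i j\<bar>" for r x y z
  proof -
    note [measurable] = r(1)
    have "(\<lambda>p. Sg (fst p) * cut n (fst p) * (\<lambda>(i, j). r i j) p * sig (fst p - snd p)) \<in> meas2" by measurable
    then have m: "(\<lambda>(i, j). Sg i * cut n i * r i j * sig (i - j)) \<in> meas2" by (simp add: case_prod_beta')
    have k: "kern 2 (ik (\<lambda>i j. Sg i * cut n i * r i j * sig (i - j)))"
    proof (rule kern_ik_J[OF m])
      fix i j :: real
      show "Sg (- i) * cut n (- i) * r (- i) (- j) * sig (- i - - j) = - (Sg i * cut n i * r i j * sig (i - j))"
        unfolding diff_minus_minus sig_minus cut_minus r(2) by (simp add: Sg_def)
      have "\<bar>Sg i * cut n i * r i j * sig (i - j)\<bar> = cut n i * (Sg i * sig (i - j) * \<bar>r i j\<bar>)"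
        using cut_01 by (simp add: abs_mult Sg_def mult_ac)
      also have "... <= 1 * (Sg i * sig (i - j) * (2 * \<bar>g i j\<bar>))"
        using cut_01 r(3) by (intro mult_mono) (auto simp: Sg_def)
      also have "... = 2 * (\<bar>j\<bar> / sig j)" by (simp add: g_def abs_mult Sg_def)
      also have "... <= 2 * J j" by (intro mult_left_mono abs_div_sig_le) auto
      finally show "\<bar>Sg i * cut n i * r i j * sig (i - j)\<bar> <= 2 * J (i - j) \<or> \<bar>Sg i * cut n i * r i j * sig (i - j)\<bar> <= 2 * J j \<or> \<bar>Sg i * cut n i * r i j * sig (i - j)\<bar> <= 2 * (J (i - j) + J j)" by blast
    qed simp
    have "bil (ik (\<lambda>i j. Sg i * cut n i * r i j * sig (i - j))) (rM Sg x) y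
        = bil (ik (\<lambda>i j. 1 * (Sg i * cut n i * r i j * sig (i - j)) * Sg (i - j) * 1)) x y"
      using rM_bil_ik[OF k rsym_Sg rsym_one rsym_one, of x y] by simp
    also have "... = bil (ik (\<lambda>i j. Sg i * cut n i * 1 * r i j)) x y"
      by (rule bil_ik_cong) (simp add: Sg_def)
    also have "... = rM Sg (rM (Jc n) (bil (ik (\<lambda>i j. r i j / jbr i)) x y))"
      using rM_Jc_bil[OF r rsym_Sg rsym_one, of n x y] by simp
    finally show ?thesis using inner_bil_le[OF k, of z "rM Sg x" y] by simp
  qed
  let ?c1 = "\<lambda>t. kap / 2 / sig t" and ?c2 = "\<lambda>t. kap / (sig t * Lam t)" and ?l = "\<lambda>t. 1 / Lam t"
  have d1: "(\<lambda>i j. Sg i * cut n i * cut n j * r1 i j * sig j) = (\<lambda>i j. RS n (\<lambda>_. 1) ?c1 i j * ?l j)"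
    by (intro ext) (simp add: r1_def RS_def g_def Sg_def field_simps)
  have d3: "(\<lambda>i j. Sg i * cut n i * cut n j * r3 i j * sig j) = (\<lambda>i j. RS n (\<lambda>_. 1) ?c1 i j * ?l i)"
    by (intro ext) (simp add: r3_def RS_def g_def Sg_def field_simps)
  have d2: "(\<lambda>i j. Sg i * cut n i * cut n j * r2 i j * sig j) = (\<lambda>i j. RS n (\<lambda>_. 1) ?c2 i j * 1)"
    by (intro ext) (simp add: r2_def RS_def g_def Sg_def field_simps)
  have d4: "(\<lambda>i j. Sg i * cut n i * cut n j * r4 i j * sig j) = (\<lambda>i j. RS n Lam ?c2 i j * 1)"
    by (intro ext) (simp add: r4_def RS_def g_def Sg_def field_simps)
  have s1: "slow 1 (\<lambda>_. 1)" by (auto simp: slow_def jbr_mono)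
  have c2le: "?c2 t <= 1 / sig t" for t
  proof -
    have "kap / Lam t <= 1" using kap Lam_ge_1[of t] by simp
    then show ?thesis using divide_right_mono[of "kap / Lam t" 1 "sig t"] by (simp add: mult.commute)
  qed
  have cc1: "?c1 \<in> meas" "\<And>t. ?c1 (- t) = ?c1 t" "\<And>t. 0 <= ?c1 t"
    "\<And>i j. (max 1 1)^2 * ?c1 (i - j) <= 2 * (1 * 1) / sig (i - j)"
    using kap divide_right_mono[of "kap / 2" 2 "sig _"] by auto
  have cc2: "?c2 \<in> meas" "\<And>t. ?c2 (- t) = ?c2 t" "\<And>t. 0 <= ?c2 t"
    using kap by auto
  have cc3: "(max 1 1)^2 * ?c2 (i - j) <= 2 * (1 * 1) / sig (i - j)" for i j
  proof -
    have "?c2 (i - j) <= 1 / sig (i - j)" by (rule c2le)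
    also have "... <= 2 / sig (i - j)" by (intro divide_right_mono) auto
    finally show ?thesis by simp
  qed
  \<comment> \<open>By Peetre's inequality the ratio of \<open>Lam i\<close> and
    \<open>Lam j\<close> costs a factor \<open>Lam (i - j)\<close>, which the denominator of
    \<open>?c2\<close> contains.\<close>
  have cc4: "(max (Lam i) (Lam j))^2 * ?c2 (i - j) <= 2 * (Lam i * Lam j) / sig (i - j)" for i j
  proof -
    have p1: "Lam i <= 2 * (Lam (i - j) * Lam j)" using slow_peetre[OF slow_Lam Lam_ge_1, of i j] by simp
    have p2: "Lam j <= 2 * (Lam (i - j) * Lam i)" using slow_peetre[OF slow_Lam Lam_ge_1, of j i] Lam_minus[of "i - j"] by simp
    have mx: "(max (Lam i) (Lam j))^2 <= 2 * Lam (i - j) * (Lam i * Lam j)"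
    proof (cases "Lam i <= Lam j")
      case True
      have "Lam j * Lam j <= (2 * (Lam (i - j) * Lam i)) * Lam j" using p2 by (intro mult_right_mono) auto
      then show ?thesis using True by (simp add: max_def power2_eq_square mult_ac)
    next
      case False
      have "Lam i * Lam i <= (2 * (Lam (i - j) * Lam j)) * Lam i" using p1 by (intro mult_right_mono) auto
      then show ?thesis using False by (simp add: max_def power2_eq_square mult_ac)
    qed
    have "(max (Lam i) (Lam j))^2 * ?c2 (i - j) <= (2 * Lam (i - j) * (Lam i * Lam j)) * ?c2 (i - j)"
      by (intro mult_right_mono mx cc2(3))
    also have "... = kap * (2 * (Lam i * Lam j) / sig (i - j))" by simp
    also have "... <= 1 * (2 * (Lam i * Lam j) / sig (i - j))" using kap by (intro mult_right_mono) auto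
    finally show ?thesis by simp
  qed
  have ll: "rsym 1 ?l" unfolding rsym_def using Lam_ge_1 by (auto simp: abs_le_iff less_imp_le)
  let ?x = "norm Y" and ?y = "norm (M2 Sg D)"
  have n: "norm F <= ?x" "norm G <= ?x" "norm A <= ?y" "norm B <= ?y"
    using norm_fst_le'[of Y] norm_snd_le'[of Y] norm_fst_le'[of "M2 Sg D"] norm_snd_le'[of "M2 Sg D"] by (auto simp: FG PQ A_def B_def)
  have mono3: "K * CJ * norm u * norm v * norm z <= K * CJ * (?x * ?y^2)"
    if "K \<ge> 0" "(norm u <= ?x \<and> norm v <= ?y \<or> norm u <= ?y \<and> norm v <= ?x)" "norm z <= ?y" for K and u v z :: h
  proof -
    have "norm u * norm v <= ?x * ?y"
      using that(2) mult_mono[of "norm u" ?x "norm v" ?y] mult_mono[of "norm u" ?y "norm v" ?x] by (auto simp: mult.commute)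
    from mult_mono[OF this that(3)] have "(norm u * norm v) * norm z <= (?x * ?y) * ?y" by simp
    then have "(K * CJ) * ((norm u * norm v) * norm z) <= (K * CJ) * ((?x * ?y) * ?y)" using that(1) by (intro mult_left_mono) auto
    then show ?thesis by (simp add: power2_eq_square mult.assoc)
  qed
  let ?k = "\<lambda>r. ik (\<lambda>i j. r i j / jbr i)"
  let ?T = "\<lambda>u. rM Sg (rM (Jc n) u)"
  define e1 e3 e2 e4 where "e1 = inner A (bil (ik (\<lambda>i j. RS n (\<lambda>_. 1) ?c1 i j * ?l j)) F B)"
    and "e3 = inner B (bil (ik (\<lambda>i j. RS n (\<lambda>_. 1) ?c1 i j * ?l i)) F A)"
    and "e2 = inner A (bil (ik (\<lambda>i j. RS n (\<lambda>_. 1) ?c2 i j * 1)) G A)" and "e4 = inner B (bil (ik (\<lambda>i j. RS n Lam ?c2 i j * 1)) G B)"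
  define o1 o2 o3 o4 where "o1 = inner A (?T (bil (?k r1) P G))" and "o2 = inner A (?T (bil (?k r2) Q F))"
    and "o3 = inner B (?T (bil (?k r3) P F))" and "o4 = inner B (?T (bil (?k r4) Q G))"
  have "inner (M2 Sg D) (M2 Sg (M2 (Jc n) (Bop Y D + Bop D Y))) = o1 + o2 + o3 + o4 + ((e1 + e3) + e2 + e4)"
    using good[OF r_measurable(1) r_minus(1) r_le_g(1) cQ, of F] good[OF r_measurable(2) r_minus(2) r_le_g(2) cP, of G]
      good[OF r_measurable(3) r_minus(3) r_le_g(3) cP, of F] good[OF r_measurable(4) r_minus(4) r_le_g(4) cQ, of G]
    unfolding d1 d2 d3 d4
    by (simp add: FG PQ M2_def Bop_def inner_prod_def linear_add[OF bounded_linear.linear[OF bounded_linear_rM[OF rsym_Jc]]]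
        linear_add[OF bounded_linear.linear[OF bounded_linear_rM[OF rsym_Sg]]] inner_add_right
        o1_def o2_def o3_def o4_def e1_def e2_def e3_def e4_def A_def[symmetric] B_def[symmetric])
  moreover have "\<bar>o1\<bar> <= 2 * CJ * (?x * ?y^2)" "\<bar>o2\<bar> <= 2 * CJ * (?x * ?y^2)"
    "\<bar>o3\<bar> <= 2 * CJ * (?x * ?y^2)" "\<bar>o4\<bar> <= 2 * CJ * (?x * ?y^2)"
    unfolding o1_def o2_def o3_def o4_def
    using n order_trans[OF src[OF r_measurable(1) r_minus(1) r_le_g(1)] mono3] order_trans[OF src[OF r_measurable(2) r_minus(2) r_le_g(2)] mono3]
      order_trans[OF src[OF r_measurable(3) r_minus(3) r_le_g(3)] mono3] order_trans[OF src[OF r_measurable(4) r_minus(4) r_le_g(4)] mono3]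
    by (auto simp: A_def[symmetric] B_def[symmetric])
  moreover have "\<bar>e1 + e3\<bar> <= 6 * CJ * (?x * ?y^2)"
    unfolding e1_def e3_def using n by (intro order_trans[OF RS_cross[OF s1 cc1 ll] mono3]) auto
  moreover have "\<bar>e2 + e2\<bar> <= 6 * CJ * (?x * ?y^2)"
    unfolding e2_def using n by (intro order_trans[OF RS_cross[OF s1 cc2 cc3 rsym_one] mono3]) auto
  moreover have "\<bar>e4 + e4\<bar> <= 6 * CJ * (?x * ?y^2)"
    unfolding e4_def using n by (intro order_trans[OF RS_cross[OF slow_Lam cc2 cc4 rsym_one] mono3]) auto
  ultimately have "\<bar>inner (M2 Sg D) (M2 Sg (M2 (Jc n) (Bop Y D + Bop D Y)))\<bar> <= 26 * (CJ * (?x * ?y^2))" by linarith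
  then show ?thesis by (simp add: algebra_simps)
qed

end

section \<open>Solutions of the symmetric system\<close>

lemma norm_diff_le_of_deriv:
  fixes f :: "real => 'a::banach"
  assumes "\<And>t. t \<in> {0..T} ==> (f has_vector_derivative f' t) (at t within {0..T})"
    and "\<And>t. t \<in> {0..T} ==> norm (f' t) <= B" and "0 <= B" and "t \<in> {0..T}"
  shows "norm (f t - f 0) <= B * t"
proof -
  have "(f' has_integral (f t - f 0)) {0..t}"
    using assms(4) by (intro fundamental_theorem_of_calculus)
      (auto intro: has_vector_derivative_within_subset[OF assms(1)])
  then have "norm (f t - f 0) <= B * measure lborel {0..t}"
    using assms by (intro has_integral_bound_real[where f = f' and S = "{}"]) auto
  then show ?thesis using assms(4) by simp
qed

lemma gronwall:
  fixes f f' :: "real => real"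
  assumes d: "\<And>t. t \<in> {0..T} ==> (f has_real_derivative f' t) (at t within {0..T})"
    and le: "\<And>t. t \<in> {0..T} ==> f' t <= a * f t + b" and ab: "0 <= a" "0 <= b" and t: "t \<in> {0..T}"
  shows "f t <= exp (a * t) * (f 0 + b * t)"
proof -
  define G where "G t = exp (- (a * t)) * f t - b * t" for t
  have G: "(G has_real_derivative exp (- (a * u)) * (f' u - a * f u) - b) (at u within {0..T})" if "u \<in> {0..T}" for u
    unfolding G_def by (rule derivative_eq_intros d[OF that] refl | simp add: algebra_simps)+
  have "G t <= G 0"
  proof (cases "t = 0")
    case False
    then have t0: "0 < t" using t by auto
    show ?thesis
    proof (rule DERIV_nonpos_imp_decreasing_open[OF less_imp_le[OF t0]])
      fix u assume u: "0 < u" "u < t"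
      then have uT: "u \<in> {0..T}" "u \<in> interior {0..T}" using t by auto
      have "(G has_real_derivative exp (- (a * u)) * (f' u - a * f u) - b) (at u)"
        using G[OF uT(1)] at_within_interior[OF uT(2)] by simp
      moreover have "exp (- (a * u)) * (f' u - a * f u) - b <= 0"
      proof -
        have "exp (- (a * u)) * (f' u - a * f u) <= exp (- (a * u)) * b" using le[OF uT(1)] by simp
        also have "... <= 1 * b" using ab u by (intro mult_right_mono) auto
        finally show ?thesis by simp
      qed
      ultimately show "\<exists>y. (G has_real_derivative y) (at u) \<and> y <= 0" by blast
    next
      show "continuous_on {0..t} G"
        by (rule continuous_on_subset[OF DERIV_continuous_on[OF G]]) (use t in auto)
    qed
  qed simp
  then have "exp (- (a * t)) * f t <= f 0 + b * t" by (simp add: G_def)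
  then have "exp (a * t) * (exp (- (a * t)) * f t) <= exp (a * t) * (f 0 + b * t)" by (intro mult_left_mono) auto
  then show ?thesis by (simp add: mult.assoc[symmetric] exp_add[symmetric])
qed

text \<open>The exponential weight makes the Picard map a contraction on the whole interval.\<close>
theorem Picard_global:
  fixes V :: "'a::banach => 'a"
  assumes L: "L > 0" "\<And>x y. norm (V x - V y) <= L * norm (x - y)" and T: "0 <= T"
  obtains x where "x 0 = x0" "\<And>t. t \<in> {0..T} ==> (x has_vector_derivative V (x t)) (at t within {0..T})"
proof -
  have Vc: "continuous_on A V" for A
    by (rule continuous_on_subset[of UNIV], rule lipschitz_on_continuous_on[of L])
      (use L in \<open>auto intro!: lipschitz_onI simp: dist_norm less_imp_le\<close>)
  \<comment> \<open>Bounded continuous functions are taken on the whole line, so time is clamped to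
    the interval before use.\<close>
  define c where "c t = max 0 (min T t)" for t :: real
  have c: "c t \<in> {0..T}" for t using T by (auto simp: c_def)
  have ci: "c t = t" if "t \<in> {0..T}" for t using that by (auto simp: c_def)
  have cc: "continuous_on A c" for A unfolding c_def[abs_def] by (intro continuous_intros)
  define I where "I y t = x0 + integral {0..t} (\<lambda>u. V (exp (2 * L * u) *\<^sub>R apply_bcontfun y u))" for y t
  have yc: "continuous_on A (\<lambda>u. V (exp (2 * L * u) *\<^sub>R apply_bcontfun y u))" for A y
    by (intro continuous_on_compose2[OF Vc[of UNIV]] continuous_intros) auto
  have Ic: "continuous_on {0..T} (I y)" for y
    unfolding I_def by (intro continuous_intros indefinite_integral_continuous_1 integrable_continuous_interval yc)
  have Phi_in: "(\<lambda>t. exp (- (2 * L * c t)) *\<^sub>R I y (c t)) \<in> bcontfun" for y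
  proof -
    have cont: "continuous_on UNIV (\<lambda>t. exp (- (2 * L * c t)) *\<^sub>R I y (c t))"
      by (intro continuous_intros cc continuous_on_compose2[OF Ic cc]) (use c in auto)
    have "bounded ((\<lambda>t. exp (- (2 * L * t)) *\<^sub>R I y t) ` {0..T})"
      by (intro compact_imp_bounded compact_continuous_image continuous_intros Ic) auto
    then have "bounded (range (\<lambda>t. exp (- (2 * L * c t)) *\<^sub>R I y (c t)))"
      by (rule bounded_subset) (use c in auto)
    with cont show ?thesis by (auto simp: bcontfun_def)
  qed
  \<comment> \<open>\<open>Phi\<close> acts on \<open>exp (- 2 L t)\<close> times the trajectory.
    The integral of \<open>L * exp (2 L u)\<close> over \<open>{0..r}\<close> is below half of
    \<open>exp (2 L r)\<close>, which gives the contraction factor 1/2 for every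
    \<open>T\<close>.\<close>
  define Phi where "Phi y = Bcontfun (\<lambda>t. exp (- (2 * L * c t)) *\<^sub>R I y (c t))" for y
  have Phi: "apply_bcontfun (Phi y) t = exp (- (2 * L * c t)) *\<^sub>R I y (c t)" for y t
    unfolding Phi_def by (subst Bcontfun_inverse[OF Phi_in]) simp
  have "dist (Phi y) (Phi z) <= 1 / 2 * dist y z" for y z
  proof (rule dist_bound)
    fix t :: real
    define r where "r = c t"
    have r: "0 <= r" using c[of t] by (simp add: r_def)
    let ?h = "\<lambda>u. V (exp (2 * L * u) *\<^sub>R apply_bcontfun y u) - V (exp (2 * L * u) *\<^sub>R apply_bcontfun z u)"
    have "I y r - I z r = integral {0..r} ?h"
      unfolding I_def by (simp add: integral_diff[OF integrable_continuous_interval[OF yc] integrable_continuous_interval[OF yc]])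
    also have "norm ... <= integral {0..r} (\<lambda>u. exp (2 * L * u) * (L * dist y z))"
    proof (rule integral_norm_bound_integral)
      show "?h integrable_on {0..r}" by (intro integrable_continuous_interval continuous_intros yc)
      show "(\<lambda>u. exp (2 * L * u) * (L * dist y z)) integrable_on {0..r}" by (intro integrable_continuous_interval continuous_intros)
      fix u
      have "norm (?h u) <= L * norm (exp (2 * L * u) *\<^sub>R (apply_bcontfun y u - apply_bcontfun z u))"
        using L(2) by (simp add: scaleR_diff_right)
      also have "... = exp (2 * L * u) * (L * dist (apply_bcontfun y u) (apply_bcontfun z u))" by (simp add: dist_norm)
      also have "... <= exp (2 * L * u) * (L * dist y z)"
        using L(1) by (intro mult_left_mono dist_bounded) auto
      finally show "norm (?h u) <= exp (2 * L * u) * (L * dist y z)" .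
    qed
    also have "integral {0..r} (\<lambda>u. exp (2 * L * u) * (L * dist y z)) = (exp (2 * L * r) - 1) / 2 * dist y z"
    proof (rule integral_unique)
      have "((\<lambda>u. exp (2 * L * u) * (L * dist y z)) has_integral (exp (2 * L * r) / 2 * dist y z - exp (2 * L * 0) / 2 * dist y z)) {0..r}"
        by (rule fundamental_theorem_of_calculus[OF r])
          (auto intro!: derivative_eq_intros simp: has_real_derivative_iff_has_vector_derivative[symmetric])
      then show "((\<lambda>u. exp (2 * L * u) * (L * dist y z)) has_integral (exp (2 * L * r) - 1) / 2 * dist y z) {0..r}"
        by (simp add: algebra_simps diff_divide_distrib)
    qed
    also have "... <= exp (2 * L * r) / 2 * dist y z" by (intro mult_right_mono) auto
    finally have le: "norm (I y r - I z r) <= exp (2 * L * r) / 2 * dist y z" .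
    have "dist (apply_bcontfun (Phi y) t) (apply_bcontfun (Phi z) t) = exp (- (2 * L * r)) * norm (I y r - I z r)"
      unfolding Phi r_def[symmetric] dist_norm by (simp add: scaleR_diff_right[symmetric])
    also have "... <= exp (- (2 * L * r)) * (exp (2 * L * r) / 2 * dist y z)" by (intro mult_left_mono le) auto
    also have "... = 1 / 2 * dist y z" by (simp add: exp_minus field_simps)
    finally show "dist (apply_bcontfun (Phi y) t) (apply_bcontfun (Phi z) t) <= 1 / 2 * dist y z" .
  qed
  then obtain y where y: "Phi y = y" using banach_fix_type[of "1/2" Phi] by auto
  define x where "x t = exp (2 * L * t) *\<^sub>R apply_bcontfun y t" for t
  have xI: "x t = I y t" if "t \<in> {0..T}" for t
    using Phi[of y t] ci[OF that] unfolding y x_def by (simp add: exp_minus field_simps)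
  show thesis
  proof (rule that[of x])
    show "x 0 = x0" using xI[of 0] T by (simp add: I_def)
    fix t assume t: "t \<in> {0..T}"
    have "((\<lambda>u. integral {0..u} (\<lambda>u. V (x u))) has_vector_derivative V (x t)) (at t within {0..T})"
      using t unfolding x_def by (intro integral_has_vector_derivative yc)
    then have "(I y has_vector_derivative V (x t)) (at t within {0..T})"
      unfolding I_def x_def by (auto intro!: derivative_eq_intros)
    then show "(x has_vector_derivative V (x t)) (at t within {0..T})"
      by (rule has_vector_derivative_transform[OF t, rotated]) (rule xI)
  qed
qed

text \<open>Radial retraction to a ball, which turns a quadratic vector field into a globally
  Lipschitz one. The Lipschitz constant 2 proved below holds in every normed space.\<close>

definition clampn :: "real => 'a::real_normed_vector => 'a" where
  "clampn M x = (if norm x <= M then x else (M / norm x) *\<^sub>R x)"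

lemma clampn_norm: "0 <= M ==> norm (clampn M x) <= M"
  by (auto simp: clampn_def)

lemma clampn_scale: "0 <= M ==> \<exists>l. 0 <= l \<and> l <= 1 \<and> clampn M x = l *\<^sub>R x \<and> l * norm x <= M"
proof (cases "norm x <= M")
  case True then show "0 <= M ==> ?thesis" by (intro exI[of _ 1]) (auto simp: clampn_def)
next
  case False then show "0 <= M ==> ?thesis" by (intro exI[of _ "M / norm x"]) (auto simp: clampn_def field_simps)
qed

lemma clampn_lipschitz: assumes M: "0 <= M" shows "norm (clampn M x - clampn M y) <= 2 * norm (x - y)"
proof -
  have in_out: "norm (x - (M / norm y) *\<^sub>R y) <= 2 * norm (x - y)" if "norm x <= M" "\<not> norm y <= M" for x y :: 'a
  proof -
    have "norm (x - (M / norm y) *\<^sub>R y) <= norm (x - y) + norm (y - (M / norm y) *\<^sub>R y)"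
      using norm_triangle_ineq[of "x - y" "y - (M / norm y) *\<^sub>R y"] by simp
    also have "norm (y - (M / norm y) *\<^sub>R y) = norm y - M"
    proof -
      have "y - (M / norm y) *\<^sub>R y = (1 - M / norm y) *\<^sub>R y" by (simp add: scaleR_diff_left)
      then have "norm (y - (M / norm y) *\<^sub>R y) = \<bar>1 - M / norm y\<bar> * norm y" by (simp only: norm_scaleR)
      also have "\<bar>1 - M / norm y\<bar> = 1 - M / norm y"
      proof (rule abs_of_nonneg)
        have "0 < norm y" using that(2) M by linarith
        then show "0 <= 1 - M / norm y" using that(2) by simp
      qed
      also have "(1 - M / norm y) * norm y = norm y - M" using that M by (auto simp: field_simps)
      finally show ?thesis .
    qed
    also have "norm y - M <= norm (x - y)"
      using that norm_triangle_ineq2[of y x] by (simp add: norm_minus_commute)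
    finally show ?thesis by simp
  qed
  consider "norm x <= M" "norm y <= M" | "norm x <= M" "\<not> norm y <= M" | "\<not> norm x <= M" "norm y <= M" | "\<not> norm x <= M" "\<not> norm y <= M"
    by blast
  then show ?thesis
  proof cases
    case 1 then show ?thesis by (simp add: clampn_def)
  next
    case 2 then show ?thesis using in_out[OF 2] by (simp add: clampn_def)
  next
    case 3 then show ?thesis using in_out[OF 3(2,1)] by (simp add: clampn_def norm_minus_commute)
  next
    case 4
    then have xy: "0 < norm x" "0 < norm y" using M by auto
    have "norm ((M / norm x) *\<^sub>R x - (M / norm y) *\<^sub>R y) <= norm ((M / norm x) *\<^sub>R (x - y)) + norm ((M / norm x - M / norm y) *\<^sub>R y)"
      using norm_triangle_ineq[of "(M / norm x) *\<^sub>R (x - y)" "(M / norm x - M / norm y) *\<^sub>R y"]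
      by (simp add: scaleR_diff_left scaleR_diff_right)
    also have "norm ((M / norm x) *\<^sub>R (x - y)) = (M / norm x) * norm (x - y)" using M by simp
    also have "norm ((M / norm x - M / norm y) *\<^sub>R y) = (M / norm x) * \<bar>norm y - norm x\<bar>"
    proof -
      have "M / norm x - M / norm y = (M / norm x) * ((norm y - norm x) / norm y)" using xy by (simp add: field_simps)
      then show ?thesis using M xy by (simp add: abs_mult)
    qed
    also have "(M / norm x) * norm (x - y) + (M / norm x) * \<bar>norm y - norm x\<bar> <= 1 * norm (x - y) + 1 * norm (x - y)"
      using 4 M xy norm_triangle_ineq3[of y x] by (intro add_mono mult_mono) (auto simp: norm_minus_commute)
    finally show ?thesis using 4 by (simp add: clampn_def)
  qed
qed

section \<open>Comparison and strong convergence of multipliers\<close>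

lemma M2_scaleR: "rsym C a ==> M2 a (c *\<^sub>R X) = c *\<^sub>R M2 a X"
  using bounded_linear_M2 by (rule linear_scale[OF bounded_linear.linear])
lemma M2_cong: "(\<And>t. a t = b t) ==> M2 a X = M2 b X" by (metis ext)
lemma M2_one [simp]: "M2 (\<lambda>_. 1) X = X" by (simp add: M2_def)

lemma norm_rM_le_norm_rM:
  assumes "rsym C a" "rsym D b" "\<And>t. (a t)^2 <= (b t)^2"
  shows "norm (rM a x) <= norm (rM b x)"
proof -
  have "ennreal ((norm (rM a x))^2) = (NN t. ennreal ((cmod (fn (rM a x) t))^2))" by (simp add: nn_norm_fn)
  also have "... <= (NN t. ennreal ((cmod (fn (rM b x) t))^2))"
  proof (rule nn_integral_mono_AE)
    show "AE t in lborel. ennreal ((cmod (fn (rM a x) t))^2) <= ennreal ((cmod (fn (rM b x) t))^2)"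
      using fn_rM[OF assms(1), of x] fn_rM[OF assms(2), of x]
    proof eventually_elim
      case (elim t)
      have "(a t)^2 * (cmod (fn x t))^2 <= (b t)^2 * (cmod (fn x t))^2" by (intro mult_right_mono assms(3)) auto
      then show ?case unfolding elim by (intro ennreal_leI) (simp add: norm_mult power_mult_distrib)
    qed
  qed
  also have "... = ennreal ((norm (rM b x))^2)" by (simp add: nn_norm_fn)
  finally have "(norm (rM a x))^2 <= (norm (rM b x))^2" by simp
  then show ?thesis by (rule power2_le_imp_le) simp
qed

lemma norm_M2_mono:
  assumes "rsym C a" "rsym D b" "\<And>t. (a t)^2 <= (b t)^2"
  shows "norm (M2 a X) <= norm (M2 b X)"
  using norm_rM_le_norm_rM[OF assms, of "fst X"] norm_rM_le_norm_rM[OF assms, of "snd X"]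
  by (auto simp: M2_def norm_Pair intro!: real_sqrt_le_mono add_mono power_mono)

text \<open>Dominated convergence gives convergence on each vector; in operator norm it fails
  already for the cutoffs.\<close>

lemma rM_tendsto:
  fixes a :: "nat => real => real"
  assumes "\<And>k. rsym C (a k)" "\<And>t. (\<lambda>k. a k t) \<longlonglongrightarrow> l t" "rsym C l"
  shows "(\<lambda>k. rM (a k) x) \<longlonglongrightarrow> rM l x"
proof -
  have C: "0 <= C" using assms(3) abs_ge_zero order_trans unfolding rsym_def by blast
  have ab: "\<bar>a k t\<bar> <= C" "\<bar>l t\<bar> <= C" for k t using assms(1)[of k] assms(3) by (auto simp: rsym_def)
  note [measurable] = rsym_measurable[OF assms(1)] rsym_measurable[OF assms(3)]
  have ns: "(norm (rM (a k) x - rM l x))^2 = (LBINT t. (a k t - l t)^2 * (cmod (fn x t))^2)" for k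
    unfolding norm_sq_fn
  proof (rule integral_cong_AE)
    show "AE t in lborel. (cmod (fn (rM (a k) x - rM l x) t))^2 = (a k t - l t)^2 * (cmod (fn x t))^2"
      using fn_diff[of "rM (a k) x" "rM l x"] fn_rM[OF assms(1), of k x] fn_rM[OF assms(3), of x]
    proof eventually_elim
      case (elim t)
      have "cx (a k t) * fn x t - cx (l t) * fn x t = cx (a k t - l t) * fn x t"
        by (simp add: algebra_simps)
      then show ?case unfolding elim by (simp add: norm_mult power_mult_distrib del: of_real_diff)
    qed
  qed measurable
  have "(\<lambda>k. \<integral>t. (a k t - l t)^2 * (cmod (fn x t))^2 \<partial>lborel) \<longlonglongrightarrow> (LBINT t. (l t - l t)^2 * (cmod (fn x t))^2)"
  proof (rule Bochner_Integration.integral_dominated_convergence[where w = "\<lambda>t. (2 * C)^2 * (cmod (fn x t))^2"])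
    show "integrable lborel (\<lambda>t. (2 * C)^2 * (cmod (fn x t))^2)" using csq_fn[of x] by (simp add: csq_int_def)
    show "AE t in lborel. (\<lambda>k. (a k t - l t)^2 * (cmod (fn x t))^2) \<longlonglongrightarrow> (l t - l t)^2 * (cmod (fn x t))^2"
      by (intro AE_I2 tendsto_intros assms(2))
    fix k
    show "AE t in lborel. norm ((a k t - l t)^2 * (cmod (fn x t))^2) <= (2 * C)^2 * (cmod (fn x t))^2"
    proof (rule AE_I2)
      fix t
      have "\<bar>a k t - l t\<bar> <= 2 * C" using ab(1)[of k t] ab(2)[of t] by linarith
      then have "(a k t - l t)^2 <= (2 * C)^2" using power_mono[of "\<bar>a k t - l t\<bar>" "2 * C" 2] by simp
      then show "norm ((a k t - l t)^2 * (cmod (fn x t))^2) <= (2 * C)^2 * (cmod (fn x t))^2" by (simp add: mult_right_mono)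
    qed
  qed measurable
  then have "(\<lambda>k. (norm (rM (a k) x - rM l x))^2) \<longlonglongrightarrow> 0" by (simp add: ns)
  then have "(\<lambda>k. sqrt ((norm (rM (a k) x - rM l x))^2)) \<longlonglongrightarrow> sqrt 0" by (rule tendsto_real_sqrt)
  then have "(\<lambda>k. norm (rM (a k) x - rM l x)) \<longlonglongrightarrow> 0" by simp
  then show ?thesis by (simp add: LIM_zero_iff tendsto_norm_zero_iff)
qed

lemma M2_tendsto:
  fixes a :: "nat => real => real"
  assumes "\<And>k. rsym C (a k)" "\<And>t. (\<lambda>k. a k t) \<longlonglongrightarrow> l t" "rsym C l"
  shows "(\<lambda>k. M2 (a k) X) \<longlonglongrightarrow> M2 l X"
  unfolding M2_def by (intro tendsto_Pair rM_tendsto[OF assms])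

lemma cut_tendsto: "(\<lambda>k. cut (real k) t) \<longlonglongrightarrow> 1"
proof (rule tendsto_eventually)
  have "\<forall>\<^sub>F k in sequentially. \<bar>t\<bar> <= real k" using eventually_ge_at_top[of "nat \<lceil>\<bar>t\<bar>\<rceil>"]
    by eventually_elim linarith
  then show "\<forall>\<^sub>F k in sequentially. cut (real k) t = 1" by eventually_elim (simp add: cut_def)
qed

lemma M2_cut_tendsto: "(\<lambda>k. M2 (cut (real k)) X) \<longlonglongrightarrow> X"
  using M2_tendsto[OF rsym_cut cut_tendsto rsym_one, of X] by simp

section \<open>Truncated solutions, stability in the low norm, interpolation\<close>

context wb
begin

definition Ji :: "real => real" where "Ji t = 1 / jbr t"

lemma rsym_Ji: "rsym 1 Ji"
  unfolding rsym_def Ji_def[abs_def] using jbr_ge_1 by (auto simp: abs_le_iff)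

lemma rsym_J: "rsym 1 J"
  unfolding rsym_def using J_le_1 by (auto simp: abs_le_iff)

definition Zop :: "h \<times> h => h \<times> h" where "Zop X = Lop X + Bop X X"

lemma Lop_simps: "Lop (X + Y) = Lop X + Lop Y" "Lop (X - Y) = Lop X - Lop Y" "Lop (c *\<^sub>R X) = c *\<^sub>R Lop X"
  using bounded_linear_Lop by (auto simp: linear_simps)

text \<open>\<open>Lsym\<close> is purely imaginary and occupies both off-diagonal entries, so the
  two contributions cancel: the linear part drops out of every energy balance.\<close>

lemma inner_Lop:
  assumes "rsym C a" "rsym D b"
  shows "inner (M2 a X) (M2 b (Lop X)) = 0"
proof -
  obtain F G where X: "X = (F, G)" by (cases X)
  let ?m = "\<lambda>t. cx (a t) * (cx (b t) * Lsym t)"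
  have bm: "bsym (C * (D * 1)) ?m" by (intro bsym_mult rsym_bsym[OF assms(1)] rsym_bsym[OF assms(2)] bsym_Lsym)
  have e: "rM a (rM b (Mul Lsym x)) = Mul ?m x" for x
    unfolding rM_def Mul_Mul[OF rsym_bsym[OF assms(2)] bsym_Lsym]
    by (rule Mul_Mul[OF rsym_bsym[OF assms(1)] bsym_mult[OF rsym_bsym[OF assms(2)] bsym_Lsym]])
  have sk: "inner F (Mul ?m G) = - inner G (Mul ?m F)"
  proof -
    have "inner G (Mul ?m F) = inner F (Mul (\<lambda>t. cnj (?m t)) G)"
      using inner_Mul[OF bm, of F G] by (simp add: inner_commute)
    also have "Mul (\<lambda>t. cnj (?m t)) G = Mul (\<lambda>t. cx (-1) * ?m t) G"
      by (rule fun_cong[OF Mul_cong]) (simp add: Lsym_def)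
    also have "... = (-1) *\<^sub>R Mul ?m G"
    proof -
      have b1: "bsym 1 (\<lambda>t. cx (-1))" by (simp add: bsym_def)
      have "Mul (\<lambda>t. cx (-1)) x = (-1) *\<^sub>R x" for x
        using toh_scale[OF herm2_fn, of "-1" x] by (simp add: Mul_def)
      then show ?thesis using Mul_Mul[OF b1 bm, of G] by simp
    qed
    finally show ?thesis by simp
  qed
  show ?thesis
    unfolding X M2_def Lop_def inner_prod_def fst_conv snd_conv inner_rM[OF assms(1)] e using sk by simp
qed

definition Cen :: real where "Cen = (8 * 3 ^ NK + 3 * Cb) * CJ"

lemma Cen_nonneg: "0 <= Cen" using Cb_pos by (simp add: Cen_def)

text \<open>With the clamp at \<open>2 * d\<close> the squared norm grows at most like
  \<open>exp (4 * Cen * d * t)\<close>; up to time \<open>c0 / d\<close> this stays below 4, so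
  norms at most double. The summand 1 keeps the quotient defined when \<open>Cen\<close> is
  0.\<close>

definition c0 :: real where "c0 = ln 2 / (2 * Cen + 1)"

lemma c0_pos: "0 < c0" using Cen_nonneg by (simp add: c0_def add_nonneg_pos)

lemma deriv_norm_sq:
  assumes "(x has_vector_derivative x') (at t within S)"
  shows "((\<lambda>t. (norm (x t :: 'a::real_inner))^2) has_real_derivative 2 * inner (x t) x') (at t within S)"
proof -
  have "((\<lambda>t. inner (x t) (x t)) has_vector_derivative inner (x t) x' + inner x' (x t)) (at t within S)"
    by (rule bounded_bilinear.has_vector_derivative[OF bounded_bilinear_inner assms assms])
  then show ?thesis
    by (simp add: power2_norm_eq_inner has_real_derivative_iff_has_vector_derivative inner_commute)
qed

lemma M2_has_deriv:
  assumes "rsym C a" "(x has_vector_derivative x') (at t within S)"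
  shows "((\<lambda>t. M2 a (x t)) has_vector_derivative M2 a x') (at t within S)"
  by (rule bounded_linear.has_vector_derivative[OF bounded_linear_M2[OF assms(1)] assms(2)])

lemma Bop_bound: obtains KB where "KB > 0" "\<And>X Y. norm (Bop X Y) <= KB * norm X * norm Y"
  using bounded_bilinear.pos_bounded[OF bounded_bilinear_Bop] by (metis mult.commute mult.assoc)

lemma Lop_bound: "norm (Lop X) <= norm X"
proof -
  have "norm (Mul Lsym x) <= norm x" for x using norm_Mul_le[OF bsym_Lsym, of x] by simp
  then show ?thesis by (cases X) (auto simp: Lop_def norm_Pair add.commute intro!: real_sqrt_le_mono add_mono power_mono)
qed

lemma slow_one: "slow 1 (\<lambda>_. 1)" by (auto simp: slow_def jbr_mono)

text \<open>The field is first clamped at radius \<open>2 * d\<close> to have a global solution. The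
  energy bound for the weight 1 then keeps the solution in that ball, where the clamp does
  nothing.\<close>

lemma truncated_solution:
  assumes n: "0 <= n" and d: "0 < d" "norm X0 <= d"
  obtains X where "X 0 = M2 (cut n) X0"
    "\<And>t. t \<in> {0..c0 / d} ==> (X has_vector_derivative M2 (Jc n) (Zop (X t))) (at t within {0..c0 / d})"
    "\<And>t. t \<in> {0..c0 / d} ==> M2 (cut n) (X t) = X t"
    "\<And>t w. t \<in> {0..c0 / d} ==> slow 1 w ==> (\<And>x. w x <= 1) ==> norm (M2 w (X t)) <= 2 * norm (M2 w X0)"
proof -
  define M where "M = 2 * d"
  define T where "T = c0 / d"
  have M: "0 < M" "0 <= M" and T: "0 <= T" using d c0_pos by (auto simp: M_def T_def)
  define V where "V x = M2 (Jc n) (Lop x + Bop (clampn M x) (clampn M x))" for x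
  obtain KB where KB: "KB > 0" "\<And>X Y. norm (Bop X Y) <= KB * norm X * norm Y" using Bop_bound by blast
  interpret B: bounded_bilinear Bop by (rule bounded_bilinear_Bop)
  have lip: "norm (V x - V y) <= ((1 + \<bar>n\<bar>) * (1 + 4 * KB * M)) * norm (x - y)" for x y
  proof -
    let ?x = "clampn M x" and ?y = "clampn M y"
    have "V x - V y = M2 (Jc n) (Lop (x - y) + (Bop ?x (?x - ?y) + Bop (?x - ?y) ?y))"
      unfolding V_def M2_diff[OF rsym_Jc, symmetric] by (simp add: Lop_simps B.diff_left B.diff_right algebra_simps)
    also have "norm ... <= (1 + \<bar>n\<bar>) * norm (Lop (x - y) + (Bop ?x (?x - ?y) + Bop (?x - ?y) ?y))"
      by (rule norm_M2_le[OF rsym_Jc])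
    also have "... <= (1 + \<bar>n\<bar>) * (norm (x - y) + (KB * M * (2 * norm (x - y)) + KB * (2 * norm (x - y)) * M))"
    proof (intro mult_left_mono order_trans[OF norm_triangle_ineq] add_mono Lop_bound)
      show "norm (Bop ?x (?x - ?y)) <= KB * M * (2 * norm (x - y))"
        using KB(1) M by (intro order_trans[OF KB(2)] mult_mono clampn_norm clampn_lipschitz) auto
      show "norm (Bop (?x - ?y) ?y) <= KB * (2 * norm (x - y)) * M"
        using KB(1) M by (intro order_trans[OF KB(2)] mult_mono clampn_norm clampn_lipschitz) auto
    qed auto
    finally show ?thesis by (simp add: algebra_simps)
  qed
  have Lp: "(1 + \<bar>n\<bar>) * (1 + 4 * KB * M) > 0" using KB M by (intro mult_pos_pos add_pos_nonneg) auto
  obtain X where X: "X 0 = M2 (cut n) X0" "\<And>t. t \<in> {0..T} ==> (X has_vector_derivative V (X t)) (at t within {0..T})"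
    using Picard_global[OF Lp lip T] by blast
  have cutJ: "M2 (cut n) (M2 (Jc n) x) = M2 (Jc n) x" for x
    unfolding M2_M2[OF rsym_cut rsym_Jc] by (rule M2_cong) (simp add: Jc_def cut_def)
  have cutcut: "M2 (cut n) (M2 (cut n) x) = M2 (cut n) x" for x
    unfolding M2_M2[OF rsym_cut rsym_cut] by (rule M2_cong) (simp add: cut_01)
  have supp: "M2 (cut n) (X t) = X t" if t: "t \<in> {0..T}" for t
  proof -
    have "norm ((\<lambda>t. M2 (cut n) (X t) - X t) t - (\<lambda>t. M2 (cut n) (X t) - X t) 0) <= 0 * t"
    proof (rule norm_diff_le_of_deriv[OF _ _ _ t])
      fix u assume u: "u \<in> {0..T}"
      show "((\<lambda>t. M2 (cut n) (X t) - X t) has_vector_derivative M2 (cut n) (V (X u)) - V (X u)) (at u within {0..T})"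
        by (intro has_vector_derivative_diff M2_has_deriv[OF rsym_cut] X(2) u)
      show "norm (M2 (cut n) (V (X u)) - V (X u)) <= 0" by (simp add: V_def cutJ)
    qed simp
    then show ?thesis by (simp add: X(1) cutcut)
  qed
  have en: "norm (M2 w (X t)) <= 2 * norm (M2 w X0)" if t: "t \<in> {0..T}" and w: "slow 1 w" "\<And>x. w x <= 1" for t w
  proof -
    have rw: "rsym 1 w" unfolding rsym_def using slow_pos[OF w(1)] w(2) slow_even[OF w(1)] slow_measurable[OF w(1)] by (auto simp: less_imp_le)
    have 1: "(norm (M2 w (X t)))^2 <= exp ((2 * Cen * M) * t) * ((norm (M2 w (X 0)))^2 + 0 * t)"
    proof (rule gronwall[OF _ _ _ _ t])
      fix u assume u: "u \<in> {0..T}"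
      show "((\<lambda>t. (norm (M2 w (X t)))^2) has_real_derivative 2 * inner (M2 w (X u)) (M2 w (V (X u)))) (at u within {0..T})"
        by (intro deriv_norm_sq M2_has_deriv[OF rw] X(2) u)
      \<comment> \<open>The clamp multiplies the quadratic term by \<open>l * l\<close>; one factor
        \<open>l\<close> turns \<open>norm (X u)\<close> into at most \<open>M\<close>, and the
        other is at most 1, so the energy estimate survives before the clamp is known to be
        inactive.\<close>
      obtain l where l: "0 <= l" "l <= 1" "clampn M (X u) = l *\<^sub>R X u" "l * norm (X u) <= M"
        using clampn_scale[OF M(2), of "X u"] by blast
      have V: "V (X u) = M2 (Jc n) (Lop (X u)) + (l * l) *\<^sub>R M2 (Jc n) (Bop (X u) (X u))"
        unfolding V_def l(3) by (simp add: M2_add[OF rsym_Jc] M2_scaleR[OF rsym_Jc] B.scaleR_left B.scaleR_right)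
      have "inner (M2 w (X u)) (M2 w (V (X u))) = (l * l) * inner (M2 w (X u)) (M2 w (M2 (Jc n) (Bop (X u) (X u))))"
        unfolding V M2_add[OF rw] M2_scaleR[OF rw] inner_add_right M2_M2[OF rw rsym_Jc] inner_Lop[OF rw rsym_mult[OF rw rsym_Jc]]
        by simp
      also have "... <= (l * l) * (Cen * norm (X u) * (norm (M2 w (X u)))^2)"
        using energy_estimate[OF w supp[OF u]] l(1) by (intro mult_left_mono) (auto simp: Cen_def)
      also have "... = (l * (l * norm (X u))) * (Cen * (norm (M2 w (X u)))^2)" by simp
      also have "... <= (1 * M) * (Cen * (norm (M2 w (X u)))^2)"
        using l Cen_nonneg by (intro mult_right_mono mult_mono) auto
      finally show "2 * inner (M2 w (X u)) (M2 w (V (X u))) <= 2 * Cen * M * (norm (M2 w (X u)))^2 + 0" by (simp add: mult_ac)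
    qed (use Cen_nonneg M in auto)
    have 2: "exp ((2 * Cen * M) * t) <= 4"
    proof -
      have "(2 * Cen * M) * t <= (2 * Cen * M) * T" using t Cen_nonneg M by (intro mult_left_mono) auto
      also have "... = 2 * (2 * Cen) * c0" using d by (simp add: M_def T_def)
      also have "... <= 2 * ((2 * Cen + 1) * c0)" using c0_pos by (simp add: algebra_simps)
      also have "... = 2 * ln 2" using Cen_nonneg by (simp add: c0_def)
      finally have "exp ((2 * Cen * M) * t) <= exp (2 * ln 2)" by simp
      also have "exp (2 * ln 2 :: real) = 4" by (simp add: exp_double)
      finally show ?thesis .
    qed
    have 3: "(norm (M2 w (X 0)))^2 <= (norm (M2 w X0))^2"
      unfolding X(1) M2_M2[OF rw rsym_cut]
      by (rule power_mono[OF norm_M2_mono[OF rsym_mult[OF rw rsym_cut] rw]]) (auto simp: cut_def)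
    have "exp ((2 * Cen * M) * t) * ((norm (M2 w (X 0)))^2 + 0 * t) <= 4 * (norm (M2 w X0))^2"
      using mult_mono[OF 2 3] by simp
    with 1 have "(norm (M2 w (X t)))^2 <= (2 * norm (M2 w X0))^2" by (simp add: power_mult_distrib)
    then show ?thesis by (rule power2_le_imp_le) simp
  qed
  have "norm (X t) <= M" if t: "t \<in> {0..T}" for t
    using en[OF t slow_one] d by (simp add: M_def)
  then have "V (X t) = M2 (Jc n) (Zop (X t))" if t: "t \<in> {0..T}" for t
    using t by (simp add: V_def Zop_def clampn_def)
  with X supp en show thesis using that[of X] by (simp add: T_def)
qed

text \<open>Continuity is asked at level \<open>s\<close>, differentiability only after
  \<open>M2 Ji\<close>, that is, at level \<open>s - 1\<close>; this matches the normalization of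
  \<open>Zop\<close> by \<open>1 / jbr\<close>.\<close>

definition sol :: "real => (real => h \<times> h) => bool" where
  "sol T X \<longleftrightarrow> continuous_on {0..T} X \<and>
     (\<forall>t\<in>{0..T}. ((\<lambda>t. M2 Ji (X t)) has_vector_derivative Zop (X t)) (at t within {0..T}))"

text \<open>Polarization at the midpoint makes the difference of the quadratic terms bilinear in one
  background state and the difference, the form treated by
  \<open>difference_estimate\<close>.\<close>

lemma Zop_diff: "Zop X - Zop Y = Lop (X - Y) + (Bop ((1/2) *\<^sub>R (X + Y)) (X - Y) + Bop (X - Y) ((1/2) *\<^sub>R (X + Y)))"
proof -
  interpret B: bounded_bilinear Bop by (rule bounded_bilinear_Bop)
  have "Bop (X + Y) (X - Y) + Bop (X - Y) (X + Y) = 2 *\<^sub>R (Bop X X - Bop Y Y)"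
    by (simp add: B.add_left B.add_right B.diff_left B.diff_right scaleR_2 algebra_simps)
  then show ?thesis
    unfolding B.scaleR_left B.scaleR_right scaleR_add_right[symmetric] by (simp add: Zop_def Lop_simps)
qed

lemma low_estimate_cut:
  assumes "M2 (cut n) D = D"
  shows "\<bar>inner (M2 Sg D) (M2 Sg (M2 (Jc n) (Lop D + (Bop Y D + Bop D Y))))\<bar> <= 26 * CJ * norm Y * (norm (M2 Sg D))^2"
  unfolding M2_add[OF rsym_Jc] M2_add[OF rsym_Sg] inner_add_right M2_M2[OF rsym_Sg rsym_Jc] inner_Lop[OF rsym_Sg rsym_mult[OF rsym_Sg rsym_Jc]]
  using difference_estimate[OF assms, of Y]
  by (simp add: M2_add[OF rsym_Jc] M2_add[OF rsym_Sg] inner_add_right M2_M2[OF rsym_Sg rsym_Jc])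

text \<open>After stripping \<open>sig\<close> the factor \<open>jbr\<close> becomes the bounded
  symbol \<open>J = Sg * jbr\<close>, so both sides are continuous in \<open>D\<close> and the
  cutoff can be removed by a limit.\<close>

lemma low_estimate:
  "\<bar>inner (M2 Sg D) (M2 J (Lop D + (Bop Y D + Bop D Y)))\<bar> <= 26 * CJ * norm Y * (norm (M2 Sg D))^2"
proof -
  interpret B: bounded_bilinear Bop by (rule bounded_bilinear_Bop)
  let ?D = "\<lambda>k. M2 (cut (real k)) D"
  have S: "bounded_linear (M2 Sg)" and Jl: "bounded_linear (M2 J)" by (rule bounded_linear_M2[OF rsym_Sg], rule bounded_linear_M2[OF rsym_J])
  have D: "?D \<longlonglongrightarrow> D" by (rule M2_cut_tendsto)
  have cc: "M2 (cut n) (M2 (cut n) x) = M2 (cut n) x" for n x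
    unfolding M2_M2[OF rsym_cut rsym_cut] by (rule M2_cong) (simp add: cut_01)
  have e: "inner (M2 Sg (M2 (cut n) x)) (M2 Sg (M2 (Jc n) z)) = inner (M2 Sg (M2 (cut n) x)) (M2 J z)" for n x z
  proof -
    have 1: "M2 Sg (M2 (Jc n) z) = M2 (cut n) (M2 J z)"
      unfolding M2_M2[OF rsym_Sg rsym_Jc] M2_M2[OF rsym_cut rsym_J]
      by (rule M2_cong) (simp add: Jc_def Sg_def jbr_div_sig[symmetric])
    have 2: "M2 (cut n) (M2 Sg (M2 (cut n) x)) = M2 Sg (M2 (cut n) x)"
      unfolding M2_M2[OF rsym_Sg rsym_cut] M2_M2[OF rsym_cut rsym_mult[OF rsym_Sg rsym_cut]]
      by (rule M2_cong) (simp add: cut_def)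
    show ?thesis unfolding 1 inner_M2[OF rsym_cut, symmetric] 2 ..
  qed
  have le: "\<bar>inner (M2 Sg (?D k)) (M2 J (Lop (?D k) + (Bop Y (?D k) + Bop (?D k) Y)))\<bar> <= 26 * CJ * norm Y * (norm (M2 Sg (?D k)))^2" for k
    using low_estimate_cut[OF cc, of "real k" D Y] by (simp only: e)
  show ?thesis
  proof (rule LIMSEQ_le)
    show "(\<lambda>k. \<bar>inner (M2 Sg (?D k)) (M2 J (Lop (?D k) + (Bop Y (?D k) + Bop (?D k) Y)))\<bar>) \<longlonglongrightarrow> \<bar>inner (M2 Sg D) (M2 J (Lop D + (Bop Y D + Bop D Y)))\<bar>"
      by (intro tendsto_intros bounded_linear.tendsto[OF S] bounded_linear.tendsto[OF Jl] bounded_linear.tendsto[OF bounded_linear_Lop] B.tendsto D)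
    show "(\<lambda>k. 26 * CJ * norm Y * (norm (M2 Sg (?D k)))^2) \<longlonglongrightarrow> 26 * CJ * norm Y * (norm (M2 Sg D))^2"
      by (intro tendsto_intros bounded_linear.tendsto[OF S] D)
  qed (use le in blast)
qed

lemma M2_Sg_eq: "M2 Sg x = M2 J (M2 Ji x)"
  unfolding M2_M2[OF rsym_J rsym_Ji] by (rule M2_cong) (simp add: Sg_def Ji_def jbr_div_sig[symmetric])

lemma sol_difference:
  assumes X: "sol T X" and Y: "sol T Y" and M: "\<And>t. t \<in> {0..T} ==> norm (X t) <= M \<and> norm (Y t) <= M" and t: "t \<in> {0..T}"
  shows "norm (M2 Sg (X t - Y t)) <= exp (26 * CJ * M * t) * norm (M2 Sg (X 0 - Y 0))"
proof -
  have M0: "0 <= M" using M[OF t] norm_ge_zero order_trans by blast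
  have "(norm (M2 Sg (X t - Y t)))^2 <= exp ((2 * (26 * CJ * M)) * t) * ((norm (M2 Sg (X 0 - Y 0)))^2 + 0 * t)"
  proof (rule gronwall[OF _ _ _ _ t])
    fix u assume u: "u \<in> {0..T}"
    have "((\<lambda>t. M2 J (M2 Ji (X t) - M2 Ji (Y t))) has_vector_derivative M2 J (Zop (X u) - Zop (Y u))) (at u within {0..T})"
      using X Y u by (intro M2_has_deriv[OF rsym_J] has_vector_derivative_diff) (auto simp: sol_def)
    then have "((\<lambda>t. M2 Sg (X t - Y t)) has_vector_derivative M2 J (Zop (X u) - Zop (Y u))) (at u within {0..T})"
      by (simp add: M2_Sg_eq M2_diff[OF rsym_Ji])
    then show "((\<lambda>t. (norm (M2 Sg (X t - Y t)))^2) has_real_derivative 2 * inner (M2 Sg (X u - Y u)) (M2 J (Zop (X u) - Zop (Y u)))) (at u within {0..T})"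
      by (rule deriv_norm_sq)
    have "norm ((1/2) *\<^sub>R (X u + Y u)) <= M"
      using M[OF u] norm_triangle_ineq[of "X u" "Y u"] by simp
    then have "26 * CJ * norm ((1/2) *\<^sub>R (X u + Y u)) * (norm (M2 Sg (X u - Y u)))^2 <= 26 * CJ * M * (norm (M2 Sg (X u - Y u)))^2"
      by (intro mult_right_mono mult_left_mono) auto
    then show "2 * inner (M2 Sg (X u - Y u)) (M2 J (Zop (X u) - Zop (Y u))) <= (2 * (26 * CJ * M)) * (norm (M2 Sg (X u - Y u)))^2 + 0"
      unfolding Zop_diff using low_estimate[of "X u - Y u" "(1/2) *\<^sub>R (X u + Y u)"] by linarith
  qed (use M0 in auto)
  also have "... = (exp (26 * CJ * M * t) * norm (M2 Sg (X 0 - Y 0)))^2"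
    by (simp add: power_mult_distrib exp_double[symmetric] mult_ac)
  finally show ?thesis by (rule power2_le_imp_le) simp
qed

text \<open>Where \<open>jbr t <= R\<close> one has \<open>R powr s * Sg t >= 1\<close>; elsewhere
  the high frequency weight equals 1.\<close>

lemma interpolation:
  assumes "R \<ge> 1"
  shows "norm x <= norm (M2 (\<lambda>t. min 1 (jbr t / R)) x) + R powr s * norm (M2 Sg x)"
proof -
  let ?w = "\<lambda>t. min 1 (jbr t / R)"
  let ?c = "\<lambda>t. if jbr t <= R then 1 else 0 :: real"
  have rw: "rsym 1 ?w" unfolding rsym_def using assms by (auto simp: abs_le_iff)
  have rc: "rsym 1 ?c" unfolding rsym_def by auto
  have rc': "rsym 1 (\<lambda>t. 1 - ?c t)" unfolding rsym_def by auto
  have rS: "rsym (R powr s) (\<lambda>t. R powr s * Sg t)"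
  proof -
    have "rsym (R powr s) (\<lambda>_. R powr s)" by (simp add: rsym_def)
    from rsym_mult[OF this rsym_Sg] show ?thesis by (simp only: mult_1_right)
  qed
  have "x = M2 ?c x + M2 (\<lambda>t. 1 - ?c t) x"
  proof -
    have "M2 (\<lambda>t. 1 - ?c t) x = x - M2 ?c x"
    proof -
      have "rM (\<lambda>t. 1 - ?c t) y = y - rM ?c y" for y
      proof (rule h_eqI)
        show "AE t in lborel. fn (rM (\<lambda>t. 1 - ?c t) y) t = fn (y - rM ?c y) t"
          using fn_rM[OF rc', of y] fn_rM[OF rc, of y] fn_diff[of y "rM ?c y"] by eventually_elim (simp add: left_diff_distrib)
      qed
      then show ?thesis by (cases x) (simp add: M2_def)
    qed
    then show ?thesis by simp
  qed
  then have "norm x <= norm (M2 ?c x) + norm (M2 (\<lambda>t. 1 - ?c t) x)" by (metis norm_triangle_ineq)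
  also have "norm (M2 ?c x) <= norm (M2 (\<lambda>t. R powr s * Sg t) x)"
  proof (rule norm_M2_mono[OF rc rS])
    fix t
    have "1 <= R powr s * Sg t" if "jbr t <= R"
      using powr_mono2[of s "jbr t" R] that s_gt by (simp add: Sg_def sig_def)
    then show "(?c t)^2 <= (R powr s * Sg t)^2" by (auto simp: one_le_power)
  qed
  also have "M2 (\<lambda>t. R powr s * Sg t) x = R powr s *\<^sub>R M2 Sg x"
  proof -
    have "rM (\<lambda>t. R powr s * Sg t) y = R powr s *\<^sub>R rM Sg y" for y
    proof (rule h_eqI)
      show "AE t in lborel. fn (rM (\<lambda>t. R powr s * Sg t) y) t = fn (R powr s *\<^sub>R rM Sg y) t"
        using fn_rM[OF rS, of y] fn_rM[OF rsym_Sg, of y] fn_scale[of "R powr s" "rM Sg y"] by eventually_elim simp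
    qed
    then show ?thesis by (cases x) (simp add: M2_def)
  qed
  also have "norm (M2 (\<lambda>t. 1 - ?c t) x) <= norm (M2 ?w x)"
    by (rule norm_M2_mono[OF rc' rw]) (use assms in \<open>auto simp: min_def field_simps\<close>)
  finally show ?thesis by simp
qed

lemma tail_tendsto: "(\<lambda>k. norm (M2 (\<lambda>t. min 1 (jbr t / (real k + 1))) x)) \<longlonglongrightarrow> 0"
proof -
  have r0: "rsym 1 (\<lambda>_. 0)" by (simp add: rsym_def)
  have "(\<lambda>k. M2 (\<lambda>t. min 1 (jbr t / (real k + 1))) x) \<longlonglongrightarrow> M2 (\<lambda>_. 0) x"
  proof (rule M2_tendsto[OF _ _ r0])
    show "rsym 1 (\<lambda>t. min 1 (jbr t / (real k + 1)))" for k unfolding rsym_def by (auto simp: abs_le_iff)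
    fix t :: real
    have "(\<lambda>k. jbr t / (real k + 1)) \<longlonglongrightarrow> 0"
      using tendsto_mult[OF tendsto_const[of "jbr t"] LIMSEQ_inverse_real_of_nat] by (simp add: divide_inverse add.commute)
    then have "(\<lambda>k. min 1 (jbr t / (real k + 1))) \<longlonglongrightarrow> min 1 0" by (intro tendsto_min tendsto_const)
    then show "(\<lambda>k. min 1 (jbr t / (real k + 1))) \<longlonglongrightarrow> 0" by simp
  qed
  moreover have "M2 (\<lambda>_. 0) x = 0"
    using norm_M2_le[of 0 "\<lambda>_. 0" x] by (simp add: rsym_def)
  ultimately show ?thesis by (simp add: tendsto_norm_zero)
qed

end

lemma M2_diff_sym:
  assumes "rsym C a" "rsym D b" "rsym B (\<lambda>t. a t - b t)"
  shows "M2 a x - M2 b x = M2 (\<lambda>t. a t - b t) x"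
proof -
  have "rM a y - rM b y = rM (\<lambda>t. a t - b t) y" for y
  proof (rule h_eqI)
    show "AE t in lborel. fn (rM a y - rM b y) t = fn (rM (\<lambda>t. a t - b t) y) t"
      using fn_rM[OF assms(1), of y] fn_rM[OF assms(2), of y] fn_rM[OF assms(3), of y] fn_diff[of "rM a y" "rM b y"]
      by eventually_elim (simp add: left_diff_distrib)
  qed
  then show ?thesis by (cases x) (simp add: M2_def)
qed

section \<open>Limit of the truncated solutions\<close>

context wb
begin

lemma J_decreasing: "\<bar>x\<bar> <= \<bar>y\<bar> ==> J y <= J x"
  unfolding J_def using jbr_mono[of x y] s_gt by (intro powr_mono2') auto

lemma Ji_decreasing: "\<bar>x\<bar> <= \<bar>y\<bar> ==> Ji y <= Ji x"
  unfolding Ji_def using jbr_mono[of x y] by (intro divide_left_mono) auto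

lemma J_tendsto_0: "(\<lambda>k. J (real k)) \<longlonglongrightarrow> 0" and Ji_tendsto_0: "(\<lambda>k. Ji (real k)) \<longlonglongrightarrow> 0"
proof -
  have "filterlim (\<lambda>k. jbr (real k)) at_top sequentially"
    by (rule filterlim_at_top_mono[OF filterlim_real_sequentially]) (auto intro!: always_eventually order_trans[OF abs_ge_self abs_le_jbr])
  then show "(\<lambda>k. J (real k)) \<longlonglongrightarrow> 0" "(\<lambda>k. Ji (real k)) \<longlonglongrightarrow> 0"
    unfolding J_def Ji_def using s_gt
    by (auto intro!: tendsto_neg_powr tendsto_divide_0[OF tendsto_const] intro: filterlim_at_top_imp_at_infinity)
qed

lemma Zop_lipschitz:
  obtains K where "K \<ge> 0" "\<And>X Y M. norm X <= M ==> norm Y <= M ==> norm (Zop X - Zop Y) <= (1 + K * M) * norm (X - Y)"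
    "\<And>X M. norm X <= M ==> norm (Zop X) <= (1 + K * M) * M"
proof -
  interpret B: bounded_bilinear Bop by (rule bounded_bilinear_Bop)
  obtain KB where KB: "KB > 0" "\<And>X Y. norm (Bop X Y) <= KB * norm X * norm Y" using Bop_bound by blast
  have lip: "norm (Zop X - Zop Y) <= (1 + (2 * KB) * M) * norm (X - Y)" if "norm X <= M" "norm Y <= M" for X Y M
  proof -
    let ?m = "(1/2) *\<^sub>R (X + Y)"
    have m: "norm ?m <= M" using that norm_triangle_ineq[of X Y] by simp
    have M0: "0 <= M" using that(1) norm_ge_zero order_trans by blast
    have "norm (Zop X - Zop Y) <= norm (X - Y) + (KB * M * norm (X - Y) + KB * norm (X - Y) * M)"
      unfolding Zop_diff
    proof (intro order_trans[OF norm_triangle_ineq] add_mono Lop_bound)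
      show "norm (Bop ?m (X - Y)) <= KB * M * norm (X - Y)"
        using KB(1) m M0 by (intro order_trans[OF KB(2)] mult_mono) auto
      show "norm (Bop (X - Y) ?m) <= KB * norm (X - Y) * M"
        using KB(1) m M0 by (intro order_trans[OF KB(2)] mult_mono) auto
    qed
    then show ?thesis by (simp add: algebra_simps)
  qed
  have z: "Zop 0 = 0" by (simp add: Zop_def linear_0[OF bounded_linear.linear[OF bounded_linear_Lop]] B.zero_left)
  show thesis
  proof (rule that[of "2 * KB"])
    fix X :: "h \<times> h" and M assume XM: "norm X <= M"
    then have M0: "0 <= M" using norm_ge_zero order_trans by blast
    have "norm (Zop X) <= (1 + 2 * KB * M) * norm X" using lip[of X M 0] XM M0 by (simp add: z)
    also have "... <= (1 + 2 * KB * M) * M" using XM KB(1) M0 by (intro mult_left_mono add_nonneg_nonneg) auto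
    finally show "norm (Zop X) <= (1 + 2 * KB * M) * M" .
  qed (use KB lip in auto)
qed

lemma M2_Ji_inj: assumes "M2 Ji x = 0" shows "x = 0"
proof -
  have "cx (Ji t) \<noteq> 0" for t by (simp add: Ji_def)
  then have "rM Ji y = 0 ==> y = 0" for y
    unfolding rM_def by (rule Mul_eq_0_iff[OF rsym_bsym[OF rsym_Ji]])
  then show ?thesis using assms by (cases x) (simp add: M2_def zero_prod_def)
qed

lemma slow_tail: "slow 1 (\<lambda>t. min 1 (jbr t / (real k + 1)))" by (rule slow_min) simp

text \<open>Truncated solutions are close in the low norm, with rate \<open>J k\<close>. A high
  frequency weight chosen from the tail of the data bounds their tails uniformly, and
  \<open>interpolation\<close> combines the two into uniform convergence at level
  \<open>s\<close>.\<close>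

theorem existence:
  assumes d: "0 < d" "norm X0 <= d"
  obtains X where "sol (c0 / d) X" "X 0 = X0"
    "\<And>t w. t \<in> {0..c0 / d} ==> slow 1 w ==> (\<And>x. w x <= 1) ==> norm (M2 w (X t)) <= 2 * norm (M2 w X0)"
proof -
  note [measurable] = rsym_measurable[OF rsym_Sg] rsym_measurable[OF rsym_Jc] rsym_measurable[OF rsym_Ji]
  define T where "T = c0 / d"
  have T: "0 <= T" using d c0_pos by (simp add: T_def)
  have "\<exists>X. X 0 = M2 (cut (real k)) X0 \<and>
    (\<forall>t\<in>{0..T}. (X has_vector_derivative M2 (Jc (real k)) (Zop (X t))) (at t within {0..T})) \<and>
    (\<forall>t\<in>{0..T}. M2 (cut (real k)) (X t) = X t) \<and>
    (\<forall>t\<in>{0..T}. \<forall>w. slow 1 w \<longrightarrow> (\<forall>x. w x <= 1) \<longrightarrow> norm (M2 w (X t)) <= 2 * norm (M2 w X0))" for k :: nat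
    unfolding T_def by (rule truncated_solution[of "real k", OF _ d]) (simp, blast)
  then obtain Xn where Xn: "\<And>k. Xn k 0 = M2 (cut (real k)) X0"
    "\<And>k t. t \<in> {0..T} ==> (Xn k has_vector_derivative M2 (Jc (real k)) (Zop (Xn k t))) (at t within {0..T})"
    "\<And>k t. t \<in> {0..T} ==> M2 (cut (real k)) (Xn k t) = Xn k t"
    "\<And>k t w. t \<in> {0..T} ==> slow 1 w ==> (\<And>x. w x <= 1) ==> norm (M2 w (Xn k t)) <= 2 * norm (M2 w X0)"
    by metis
  have bd: "norm (Xn k t) <= 2 * d" if "t \<in> {0..T}" for k t
    using Xn(4)[OF that slow_one, of k] d by simp
  obtain K where K: "K \<ge> 0" "\<And>X Y M. norm X <= M ==> norm Y <= M ==> norm (Zop X - Zop Y) <= (1 + K * M) * norm (X - Y)"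
    "\<And>X M. norm X <= M ==> norm (Zop X) <= (1 + K * M) * M" using Zop_lipschitz by blast
  define BZ where "BZ = (1 + K * (2 * d)) * (2 * d)"
  have BZ: "0 <= BZ" "norm (Zop (Xn k t)) <= BZ" if "t \<in> {0..T}" for k t
    using K(1) d K(3)[OF bd[OF that]] by (auto simp: BZ_def)
  \<comment> \<open>104 is twice 26 times 2: the derivative of a square, the difference estimate,
    and the bound \<open>2 * d\<close> for the midpoint. The summand 1 pays for splitting the
    product with the truncation error.\<close>
  define a where "a = 104 * CJ * d + 1"
  define C1 where "C1 = sqrt (exp (a * T) * (d^2 + BZ^2 * T))"
  have a0: "0 <= a" using d by (simp add: a_def)
  have low: "norm (M2 Sg (Xn m t - Xn k t)) <= C1 * J (real k)" if km: "k <= m" and t: "t \<in> {0..T}" for k m t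
  proof -
    define e where "e = J (real k)"
    have e0: "0 <= e" by (simp add: e_def)
    define D where "D u = Xn m u - Xn k u" for u
    have cmk: "M2 (cut (real m)) (M2 (cut (real k)) x) = M2 (cut (real k)) x" for x
      unfolding M2_M2[OF rsym_cut rsym_cut] by (rule M2_cong) (use km in \<open>auto simp: cut_def\<close>)
    have cD: "M2 (cut (real m)) (D u) = D u" if u: "u \<in> {0..T}" for u
      unfolding D_def M2_diff[OF rsym_cut] using Xn(3)[OF u, of m] Xn(3)[OF u, of k] cmk[of "Xn k u"] by simp
    let ?E = "\<lambda>u. M2 Sg (M2 (Jc (real m)) (Zop (Xn k u))) - M2 Sg (M2 (Jc (real k)) (Zop (Xn k u)))"
    \<comment> \<open>Two cutoffs differ only for frequencies between \<open>k\<close> and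
      \<open>m\<close>, where a symbol bounded by the decreasing \<open>J\<close> is at most
      \<open>J k\<close>.\<close>
    have small: "\<bar>p t * cut (real m) t - p t * cut (real k) t\<bar> <= e" if p: "\<And>t. 0 <= p t" "\<And>t. p t <= J t" for p t
    proof (cases "\<bar>t\<bar> <= real k \<or> \<not> \<bar>t\<bar> <= real m")
      case True then show ?thesis using km e0 by (auto simp: cut_def)
    next
      case False
      then have "p t <= e" using p(2)[of t] J_decreasing[of "real k" t] by (simp add: e_def)
      then show ?thesis using False p(1)[of t] by (simp add: cut_def)
    qed
    have E: "norm (?E u) <= e * BZ" if u: "u \<in> {0..T}" for u
    proof -
      have r: "rsym e (\<lambda>t. Sg t * Jc (real m) t - Sg t * Jc (real k) t)"
        unfolding rsym_def
      proof (intro conjI allI)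
        fix t
        have "Sg t * Jc n t = J t * cut n t" for n by (simp add: Sg_def Jc_def jbr_div_sig[symmetric])
        then show "\<bar>Sg t * Jc (real m) t - Sg t * Jc (real k) t\<bar> <= e" using small[of J t] by simp
      qed (use rsym_Sg rsym_Jc in \<open>auto simp: rsym_def\<close>)
      have "?E u = M2 (\<lambda>t. Sg t * Jc (real m) t - Sg t * Jc (real k) t) (Zop (Xn k u))"
        unfolding M2_M2[OF rsym_Sg rsym_Jc] by (rule M2_diff_sym[OF rsym_mult[OF rsym_Sg rsym_Jc] rsym_mult[OF rsym_Sg rsym_Jc] r])
      also have "norm ... <= e * norm (Zop (Xn k u))" by (rule norm_M2_le[OF r])
      also have "... <= e * BZ" using BZ(2)[OF u] e0 by (intro mult_left_mono)
      finally show ?thesis .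
    qed
    have D0: "norm (M2 Sg (D 0)) <= e * d"
    proof -
      have r: "rsym e (\<lambda>t. Sg t * cut (real m) t - Sg t * cut (real k) t)"
        unfolding rsym_def
      proof (intro conjI allI)
        fix t
        have "0 <= Sg t" "Sg t <= J t" for t using one_div_sig_le[of t] by (auto simp: Sg_def)
        then show "\<bar>Sg t * cut (real m) t - Sg t * cut (real k) t\<bar> <= e" using small[of Sg t] by simp
      qed (use rsym_Sg rsym_cut in \<open>auto simp: rsym_def\<close>)
      have "M2 Sg (D 0) = M2 (\<lambda>t. Sg t * cut (real m) t - Sg t * cut (real k) t) X0"
        unfolding D_def Xn(1) M2_diff[OF rsym_Sg] M2_M2[OF rsym_Sg rsym_cut]
        by (rule M2_diff_sym[OF rsym_mult[OF rsym_Sg rsym_cut] rsym_mult[OF rsym_Sg rsym_cut] r])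
      also have "norm ... <= e * norm X0" by (rule norm_M2_le[OF r])
      also have "... <= e * d" using d e0 by (intro mult_left_mono)
      finally show ?thesis .
    qed
    have "(norm (M2 Sg (D t)))^2 <= exp (a * t) * ((norm (M2 Sg (D 0)))^2 + (e * BZ)^2 * t)"
    proof (rule gronwall[OF _ _ a0 _ t])
      fix u assume u: "u \<in> {0..T}"
      let ?V = "M2 Sg (M2 (Jc (real m)) (Zop (Xn m u)) - M2 (Jc (real k)) (Zop (Xn k u)))"
      show "((\<lambda>t. (norm (M2 Sg (D t)))^2) has_real_derivative 2 * inner (M2 Sg (D u)) ?V) (at u within {0..T})"
        unfolding D_def by (intro deriv_norm_sq M2_has_deriv[OF rsym_Sg] has_vector_derivative_diff Xn(2) u)
      let ?Y = "(1/2) *\<^sub>R (Xn m u + Xn k u)"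
      have V: "?V = M2 Sg (M2 (Jc (real m)) (Zop (Xn m u) - Zop (Xn k u))) + ?E u"
        by (simp add: M2_diff[OF rsym_Sg] M2_diff[OF rsym_Jc])
      have "inner (M2 Sg (D u)) (M2 Sg (M2 (Jc (real m)) (Zop (Xn m u) - Zop (Xn k u)))) <= 26 * CJ * norm ?Y * (norm (M2 Sg (D u)))^2"
        using low_estimate_cut[OF cD[OF u], of ?Y] unfolding Zop_diff D_def[symmetric] by linarith
      also have "... <= 26 * CJ * (2 * d) * (norm (M2 Sg (D u)))^2"
        using bd[OF u, of m] bd[OF u, of k] norm_triangle_ineq[of "Xn m u" "Xn k u"]
        by (intro mult_right_mono mult_left_mono) auto
      finally have 1: "inner (M2 Sg (D u)) (M2 Sg (M2 (Jc (real m)) (Zop (Xn m u) - Zop (Xn k u)))) <= 52 * CJ * d * (norm (M2 Sg (D u)))^2" by simp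
      have 2: "2 * inner (M2 Sg (D u)) (?E u) <= (norm (M2 Sg (D u)))^2 + (e * BZ)^2"
      proof -
        have "inner (M2 Sg (D u)) (?E u) <= norm (M2 Sg (D u)) * (e * BZ)"
          using norm_cauchy_schwarz[of "M2 Sg (D u)" "?E u"] mult_left_mono[OF E[OF u], of "norm (M2 Sg (D u))"] by simp
        then show ?thesis using sum_squares_bound[of "norm (M2 Sg (D u))" "e * BZ"] by simp
      qed
      show "2 * inner (M2 Sg (D u)) ?V <= a * (norm (M2 Sg (D u)))^2 + (e * BZ)^2"
        using 1 2 unfolding V inner_add_right a_def by (simp add: algebra_simps)
    qed simp
    also have "... <= exp (a * T) * ((e * d)^2 + (e * BZ)^2 * T)"
      using t a0 D0 e0 BZ(1)[OF t] by (intro mult_mono add_mono power_mono) (auto intro!: mult_left_mono add_nonneg_nonneg)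
    also have "... = (C1 * e)^2"
    proof -
      have "C1^2 = exp (a * T) * (d^2 + BZ^2 * T)" unfolding C1_def using T by (intro real_sqrt_pow2 mult_nonneg_nonneg add_nonneg_nonneg) auto
      then show ?thesis by (simp add: power_mult_distrib algebra_simps)
    qed
    finally show ?thesis unfolding D_def e_def
      by (rule power2_le_imp_le) (auto simp: C1_def intro!: mult_nonneg_nonneg add_nonneg_nonneg T)
  qed
  have C10: "0 <= C1" unfolding C1_def using T by (intro real_sqrt_ge_zero mult_nonneg_nonneg add_nonneg_nonneg) auto
  have "uniformly_Cauchy_on {0..T} Xn"
    unfolding uniformly_Cauchy_on_def
  proof (intro allI impI)
    fix \<epsilon> :: real assume \<epsilon>: "\<epsilon> > 0"
    have "\<forall>\<^sub>F k in sequentially. norm (M2 (\<lambda>t. min 1 (jbr t / (real k + 1))) X0) < \<epsilon> / 8"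
      using order_tendstoD(2)[OF tail_tendsto, of "\<epsilon> / 8"] \<epsilon> by simp
    then obtain k0 where k0: "norm (M2 (\<lambda>t. min 1 (jbr t / (real k0 + 1))) X0) < \<epsilon> / 8"
      by (auto simp: eventually_sequentially)
    \<comment> \<open>The order of choices matters: \<open>k0\<close> is fixed from the tail of
      \<open>X0\<close> alone; only afterwards is the truncation taken so large that the low norm
      beats the constant \<open>(k0 + 1) powr s\<close>.\<close>
    define w where "w t = min 1 (jbr t / (real k0 + 1))" for t
    have sw: "slow 1 w" unfolding w_def[abs_def] by (rule slow_tail)
    have w1: "w t <= 1" for t by (simp add: w_def)
    have rw: "rsym 1 w" unfolding rsym_def using slow_pos[OF sw] w1 slow_even[OF sw] slow_measurable[OF sw] by (auto simp: less_imp_le)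
    define R where "R = (real k0 + 1) powr s * C1"
    have "(\<lambda>k. R * J (real k)) \<longlonglongrightarrow> R * 0" by (intro tendsto_intros J_tendsto_0)
    then have "\<forall>\<^sub>F k in sequentially. R * J (real k) < \<epsilon> / 2" using \<epsilon> by (intro order_tendstoD(2)) auto
    then obtain N where N: "\<And>k. k \<ge> N ==> R * J (real k) < \<epsilon> / 2" by (auto simp: eventually_sequentially)
    have main: "norm (Xn m t - Xn k t) < \<epsilon>" if "N <= k" "k <= m" "t \<in> {0..T}" for k m t
    proof -
      have "norm (M2 w (Xn m t - Xn k t)) <= 4 * norm (M2 w X0)"
        unfolding M2_diff[OF rw] using norm_triangle_ineq4[of "M2 w (Xn m t)" "M2 w (Xn k t)"]
          Xn(4)[OF that(3) sw w1, of m] Xn(4)[OF that(3) sw w1, of k] by simp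
      also have "... < \<epsilon> / 2" using k0 by (simp add: w_def[abs_def])
      finally have 1: "norm (M2 w (Xn m t - Xn k t)) < \<epsilon> / 2" .
      have "(real k0 + 1) powr s * norm (M2 Sg (Xn m t - Xn k t)) <= (real k0 + 1) powr s * (C1 * J (real k))"
        by (intro mult_left_mono low that) auto
      also have "... < \<epsilon> / 2" using N[OF that(1)] by (simp add: R_def mult.assoc)
      finally have 2: "(real k0 + 1) powr s * norm (M2 Sg (Xn m t - Xn k t)) < \<epsilon> / 2" .
      have "norm (Xn m t - Xn k t) <= norm (M2 w (Xn m t - Xn k t)) + (real k0 + 1) powr s * norm (M2 Sg (Xn m t - Xn k t))"
        unfolding w_def[abs_def] by (rule interpolation) simp
      with 1 2 show ?thesis by linarith
    qed
    show "\<exists>M. \<forall>x\<in>{0..T}. \<forall>m\<ge>M. \<forall>n\<ge>M. dist (Xn m x) (Xn n x) < \<epsilon>"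
    proof (intro exI[of _ N] ballI allI impI)
      fix x m n assume x: "x \<in> {0..T}" and mn: "N <= m" "N <= n"
      show "dist (Xn m x) (Xn n x) < \<epsilon>"
        using main[of n m x] main[of m n x] x mn by (cases "n <= m") (auto simp: dist_norm norm_minus_commute)
    qed
  qed
  then obtain X where X: "uniform_limit {0..T} Xn X sequentially"
    by (auto simp: Cauchy_uniformly_convergent uniformly_convergent_on_def dest!: Cauchy_uniformly_convergent)
  have lim: "(\<lambda>k. Xn k t) \<longlonglongrightarrow> X t" if "t \<in> {0..T}" for t by (rule tendsto_uniform_limitI[OF X that])
  have cont: "continuous_on {0..T} X"
  proof (rule uniform_limit_theorem[OF _ X])
    show "\<forall>\<^sub>F k in sequentially. continuous_on {0..T} (Xn k)"
      unfolding continuous_on_eq_continuous_within using has_vector_derivative_continuous[OF Xn(2)]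
      by (intro always_eventually) blast
  qed simp
  have XB: "norm (X t) <= 2 * d" if "t \<in> {0..T}" for t
    by (rule tendsto_upperbound[OF tendsto_norm[OF lim[OF that]]]) (use bd[OF that] in auto)
  have X0: "X 0 = X0"
    using LIMSEQ_unique[OF lim[of 0]] M2_cut_tendsto[of X0] T by (simp add: Xn(1))
  have wX: "norm (M2 w (X t)) <= 2 * norm (M2 w X0)" if t: "t \<in> {0..T}" and w: "slow 1 w" "\<And>x. w x <= 1" for t w
  proof -
    have rw: "rsym 1 w" unfolding rsym_def using slow_pos[OF w(1)] w(2) slow_even[OF w(1)] slow_measurable[OF w(1)] by (auto simp: less_imp_le)
    have "(\<lambda>k. norm (M2 w (Xn k t))) \<longlonglongrightarrow> norm (M2 w (X t))"
      by (intro tendsto_norm bounded_linear.tendsto[OF bounded_linear_M2[OF rw]] lim t)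
    then show ?thesis by (rule tendsto_upperbound) (use Xn(4)[OF t w] in auto)
  qed
  define Lz where "Lz = 1 + K * (2 * d)"
  have Lz: "Lz > 0" using K(1) d by (simp add: Lz_def add_pos_nonneg)
  have zc: "continuous_on {0..T} (\<lambda>u. Zop (X u))"
  proof -
    interpret B: bounded_bilinear Bop by (rule bounded_bilinear_Bop)
    show ?thesis unfolding Zop_def
      by (intro continuous_on_add bounded_linear.continuous_on[OF bounded_linear_Lop] B.continuous_on cont)
  qed
  define I where "I t = integral {0..t} (\<lambda>u. Zop (X u))" for t
  have I': "(I has_vector_derivative Zop (X t)) (at t within {0..T})" if "t \<in> {0..T}" for t
    unfolding I_def by (rule integral_has_vector_derivative[OF zc that])
  have I0: "I 0 = 0" by (simp add: I_def)
  \<comment> \<open>The second factor \<open>M2 Ji\<close> makes the truncation error small: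
    \<open>Ji * (1 - cut k)\<close> is at most \<open>Ji k\<close>, while without it the cutoffs do
    not converge in operator norm. Injectivity of \<open>M2 Ji\<close> removes it at the
    end.\<close>
  let ?P = "\<lambda>k t. M2 Ji (M2 Ji (Xn k t)) - M2 Ji (I t)"
  have eq: "M2 Ji (X t) = M2 Ji X0 + I t" if t: "t \<in> {0..T}" for t
  proof -
    define Q where "Q = M2 Ji (M2 Ji (X t)) - M2 Ji (I t) - M2 Ji (M2 Ji X0)"
    have bJ: "bounded_linear (M2 Ji)" by (rule bounded_linear_M2[OF rsym_Ji])
    have "(\<lambda>k. ?P k t - ?P k 0) \<longlonglongrightarrow> Q"
    proof -
      have "0 \<in> {0..T}" using T by simp
      from lim[OF this] have l0: "(\<lambda>k. Xn k 0) \<longlonglongrightarrow> X0" by (simp add: X0)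
      have "(\<lambda>k. ?P k t - ?P k 0) \<longlonglongrightarrow> (M2 Ji (M2 Ji (X t)) - M2 Ji (I t)) - (M2 Ji (M2 Ji X0) - M2 Ji (I 0))"
        by (intro tendsto_diff tendsto_const bounded_linear.tendsto[OF bJ] lim t l0)
      then show ?thesis by (simp add: Q_def I0 linear_0[OF bounded_linear.linear[OF bJ]])
    qed
    then have Ql: "(\<lambda>k. norm (?P k t - ?P k 0)) \<longlonglongrightarrow> norm Q" by (rule tendsto_norm)
    have "norm Q <= \<epsilon> * T" if \<epsilon>: "\<epsilon> > 0" for \<epsilon>
    proof -
      have "\<forall>\<^sub>F k in sequentially. \<forall>u\<in>{0..T}. dist (Xn k u) (X u) < \<epsilon> / (2 * Lz)"
        using X \<epsilon> Lz unfolding uniform_limit_iff by simp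
      moreover have "(\<lambda>k. Ji (real k) * BZ) \<longlonglongrightarrow> 0 * BZ" by (intro tendsto_intros Ji_tendsto_0)
      then have "\<forall>\<^sub>F k in sequentially. Ji (real k) * BZ < \<epsilon> / 2" using \<epsilon> by (intro order_tendstoD(2)) auto
      ultimately have "\<forall>\<^sub>F k in sequentially. norm (?P k t - ?P k 0) <= \<epsilon> * T"
      proof eventually_elim
        case (elim k)
        have "norm (?P k t - ?P k 0) <= \<epsilon> * t"
        proof (rule norm_diff_le_of_deriv[OF _ _ _ t])
          fix u assume u: "u \<in> {0..T}"
          let ?z = "Zop (Xn k u)"
          show "(?P k has_vector_derivative M2 Ji (M2 Ji (M2 (Jc (real k)) ?z)) - M2 Ji (Zop (X u))) (at u within {0..T})"
            by (intro has_vector_derivative_diff M2_has_deriv[OF rsym_Ji] Xn(2) I' u)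
          have r: "rsym (Ji (real k)) (\<lambda>t. Ji t * cut (real k) t - Ji t)"
            unfolding rsym_def
          proof (intro conjI allI)
            fix t show "\<bar>Ji t * cut (real k) t - Ji t\<bar> <= Ji (real k)"
              using Ji_decreasing[of "real k" t] by (auto simp: cut_def Ji_def)
          qed (use rsym_Ji rsym_cut in \<open>auto simp: rsym_def\<close>)
          have "M2 Ji (M2 Ji (M2 (Jc (real k)) ?z)) = M2 (\<lambda>t. Ji t * cut (real k) t) ?z"
            unfolding M2_M2[OF rsym_Ji rsym_Jc] M2_M2[OF rsym_Ji rsym_mult[OF rsym_Ji rsym_Jc]]
            by (rule M2_cong) (simp add: Ji_def Jc_def)
          then have "M2 Ji (M2 Ji (M2 (Jc (real k)) ?z)) - M2 Ji (Zop (X u))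
            = M2 (\<lambda>t. Ji t * cut (real k) t - Ji t) ?z + M2 Ji (?z - Zop (X u))"
            unfolding M2_diff_sym[OF rsym_mult[OF rsym_Ji rsym_cut] rsym_Ji r, symmetric] M2_diff[OF rsym_Ji] by simp
          also have "norm ... <= Ji (real k) * BZ + norm (?z - Zop (X u))"
            using norm_M2_le[OF r, of ?z] mult_left_mono[OF BZ(2)[OF u, of k], of "Ji (real k)"] norm_M2_le[OF rsym_Ji, of "?z - Zop (X u)"]
            by (intro order_trans[OF norm_triangle_ineq] add_mono) (auto simp: Ji_def)
          also have "norm (?z - Zop (X u)) <= Lz * norm (Xn k u - X u)"
            unfolding Lz_def by (rule K(2)[OF bd[OF u] XB[OF u]])
          also have "Lz * norm (Xn k u - X u) <= Lz * (\<epsilon> / (2 * Lz))"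
            using elim(1) u Lz by (intro mult_left_mono) (auto simp: dist_norm less_imp_le)
          also have "Lz * (\<epsilon> / (2 * Lz)) = \<epsilon> / 2" using Lz by simp
          finally show "norm (M2 Ji (M2 Ji (M2 (Jc (real k)) ?z)) - M2 Ji (Zop (X u))) <= \<epsilon>"
            using elim(2) by linarith
        qed (use \<epsilon> in simp)
        also have "... <= \<epsilon> * T" using t \<epsilon> by (intro mult_left_mono) auto
        finally show ?case .
      qed
      then show ?thesis by (intro tendsto_upperbound[OF Ql]) auto
    qed
    then have small: "norm Q <= \<epsilon> * T" if "\<epsilon> > 0" for \<epsilon> using that by blast
    have "norm Q <= 0"
    proof (rule field_le_epsilon)
      fix e :: real assume "e > 0"
      have "e / (T + 1) * T <= e" using T \<open>e > 0\<close> by (simp add: field_simps)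
      then show "norm Q <= 0 + e" using small[of "e / (T + 1)"] T \<open>e > 0\<close> by simp
    qed
    then have "M2 Ji (M2 Ji (X t) - I t - M2 Ji X0) = 0"
      unfolding Q_def by (simp add: M2_diff[OF rsym_Ji])
    then have "M2 Ji (X t) - I t - M2 Ji X0 = 0" by (rule M2_Ji_inj)
    then show ?thesis by (simp add: algebra_simps)
  qed
  have "((\<lambda>t. M2 Ji (X t)) has_vector_derivative Zop (X t)) (at t within {0..T})" if t: "t \<in> {0..T}" for t
  proof (rule has_vector_derivative_transform[OF t])
    show "((\<lambda>t. M2 Ji X0 + I t) has_vector_derivative Zop (X t)) (at t within {0..T})"
      using has_vector_derivative_add[OF has_vector_derivative_const I'[OF t]] by simp
  qed (rule eq)
  then have "sol T X" using cont by (simp add: sol_def)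
  then show thesis using that[of X] X0 wX by (simp add: T_def)
qed

end

section \<open>Plancherel theorem and Fourier transform of real functions\<close>

lemma csq_Cauchy_Schwarz:
  assumes "csq_int f" "csq_int g"
  shows "(cmod (LBINT x. f x * g x))^2 <= (LBINT x. (cmod (f x))^2) * (LBINT x. (cmod (g x))^2)"
proof -
  note [measurable] = csq_intD[OF assms(1)] csq_intD[OF assms(2)]
  have "ennreal ((cmod (LBINT x. f x * g x))^2) = (ennreal (cmod (LBINT x. f x * g x)))^2"
    by (simp add: ennreal_power)
  also have "... <= (NN x. ennreal (cmod (f x * g x)))^2"
    by (intro power_mono norm_integral_le_nn) auto
  also have "... = (NN x. ennreal (cmod (f x)) * ennreal (cmod (g x)))^2"
    by (simp add: norm_mult ennreal_mult')
  also have "... <= (NN x. (ennreal (cmod (f x)))^2) * (NN x. (ennreal (cmod (g x)))^2)"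
    by (rule Cauchy_Schwarz_nn_integral) measurable
  also have "... = ennreal ((LBINT x. (cmod (f x))^2) * (LBINT x. (cmod (g x))^2))"
    by (simp add: ennreal_power nn_integral_csq[OF assms(1)] nn_integral_csq[OF assms(2)] ennreal_mult')
  finally show ?thesis by (simp add: zero_le_mult_iff)
qed

lemma integrable_product_bounded:
  fixes a b :: "real => complex"
  assumes a: "integrable lborel a" and b: "integrable lborel b"
    and m: "(\<lambda>(x, y). m x y) \<in> meas2" "\<And>x y. cmod (m x y) <= C"
  shows "integrable (lborel \<Otimes>\<^sub>M lborel) (\<lambda>(x, y). a x * b y * m x y)"
proof (rule integrableI_bounded)
  have [measurable]: "a \<in> meas" "b \<in> meas" using a b by auto
  note [measurable] = m(1)
  have "(\<lambda>p. a (fst p) * b (snd p) * (\<lambda>(x, y). m x y) p) \<in> meas2" by measurable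
  then show ms: "(\<lambda>(x, y). a x * b y * m x y) \<in> borel_measurable (lborel \<Otimes>\<^sub>M lborel)"
    by (simp add: case_prod_beta' cong: measurable_cong_sets)
  have C: "0 <= C" using m(2) norm_ge_zero order_trans by blast
  have "(\<integral>\<^sup>+p. ennreal (cmod ((\<lambda>(x, y). a x * b y * m x y) p)) \<partial>(lborel \<Otimes>\<^sub>M lborel))
      = (NN x. \<integral>\<^sup>+y. ennreal (cmod (a x * b y * m x y)) \<partial>lborel)"
    using ms by (subst lborel.nn_integral_fst[symmetric]) (auto cong: measurable_cong_sets)
  also have "... <= (NN x. \<integral>\<^sup>+y. ennreal (C * cmod (a x)) * ennreal (cmod (b y)) \<partial>lborel)"
  proof (intro nn_integral_mono)
    fix x y
    have "cmod (a x * b y * m x y) <= cmod (a x) * cmod (b y) * C"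
      unfolding norm_mult by (intro mult_left_mono m(2)) auto
    then show "ennreal (cmod (a x * b y * m x y)) <= ennreal (C * cmod (a x)) * ennreal (cmod (b y))"
      using C by (simp add: ennreal_mult'[symmetric] mult_ac ennreal_leI)
  qed
  also have "... = ennreal C * (NN x. ennreal (cmod (a x))) * (NN y. ennreal (cmod (b y)))"
    using C by (simp add: nn_integral_cmult nn_integral_multc ennreal_mult')
  also have "... < \<infinity>"
    using a b by (auto simp: integrable_iff_bounded ennreal_mult_less_top)
  finally show "(\<integral>\<^sup>+p. ennreal (cmod ((\<lambda>(x, y). a x * b y * m x y) p)) \<partial>(lborel \<Otimes>\<^sub>M lborel)) < \<infinity>" .
qed

lemma Fubini_product_bounded:
  fixes a b :: "real => complex"
  assumes a: "integrable lborel a" and b: "integrable lborel b"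
    and m: "(\<lambda>(x, y). m x y) \<in> meas2" "\<And>x y. cmod (m x y) <= C"
  shows "(LBINT y. (LBINT x. a x * b y * m x y)) = (LBINT x. (LBINT y. a x * b y * m x y))"
  by (rule lborel_pair.Fubini_integral) (use integrable_product_bounded[OF assms] in simp)

lemma cis_measurable [measurable]: "cis \<in> meas"
  unfolding cis_conv_exp by (intro borel_measurable_continuous_onI continuous_intros)

lemma cnj_measurable [measurable]: "cnj \<in> meas"
  by (intro borel_measurable_continuous_onI continuous_intros)

lemma gauss_integrable: "e > 0 ==> integrable lborel (\<lambda>x::real. exp (- (e * x)\<^sup>2 / 2))"
proof -
  assume e: "e > 0"
  have "integrable lborel (\<lambda>x. sqrt (2 * pi) * std_normal_density x)" by simp
  then have "integrable lborel (\<lambda>x::real. exp (- x\<^sup>2 / 2))" by (simp add: std_normal_density_def)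
  from lborel_integrable_real_affine[OF this, of e 0] e show ?thesis by simp
qed

text \<open>A rescaling of the known characteristic function of the standard normal
  distribution.\<close>

lemma gauss_FT:
  assumes e: "e > 0"
  shows "(LBINT t. cis (- (z * t)) * cx (exp (- (e * t)\<^sup>2 / 2)))
    = cx (sqrt (2 * pi) / e * exp (- (z / e)\<^sup>2 / 2))"
proof -
  have "cx (exp (- (w^2) / 2)) = (LBINT x. cx (std_normal_density x) * cis (w * x))" for w
  proof -
    have "cx (exp (- (w^2) / 2)) = char std_normal_distribution w" by (simp add: char_std_normal_distribution)
    also have "... = (LBINT x. std_normal_density x *\<^sub>R cis (w * x))"
      unfolding char_def cis_conv_exp[symmetric] by (subst integral_density) auto
    finally show ?thesis by (simp add: scaleR_conv_of_real)
  qed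
  from this[of "- (z / e)"]
  have "cx (exp (- ((z / e)^2) / 2)) = (LBINT x. cx (1 / sqrt (2 * pi)) * (cis (- (z / e) * x) * cx (exp (- x\<^sup>2 / 2))))"
    by (simp add: std_normal_density_def mult_ac)
  also have "... = cx (1 / sqrt (2 * pi)) * (LBINT x. cis (- (z / e) * x) * cx (exp (- x\<^sup>2 / 2)))"
    by (rule integral_mult_right_zero)
  also have "(LBINT x. cis (- (z / e) * x) * cx (exp (- x\<^sup>2 / 2)))
     = \<bar>e\<bar> *\<^sub>R (LBINT t. cis (- (z / e) * (0 + e * t)) * cx (exp (- (0 + e * t)\<^sup>2 / 2)))"
    by (rule lborel_integral_real_affine) (use e in simp)
  also have "... = cx e * (LBINT t. cis (- (z * t)) * cx (exp (- (e * t)\<^sup>2 / 2)))"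
    using e by (simp add: scaleR_conv_of_real)
  finally show ?thesis using e by (simp add: field_simps)
qed

definition cft :: "(real => complex) => real => complex" where
  "cft f u = cx kap * (LBINT x. f x * cis (- (x * u)))"

lemma cft_measurable: assumes [measurable]: "f \<in> meas" shows "cft f \<in> meas"
  unfolding cft_def[abs_def] by measurable

lemma cft_bounded: assumes "integrable lborel f" shows "cmod (cft f u) <= (LBINT x. cmod (f x))"
proof -
  have "cmod (LBINT x. f x * cis (- (x * u))) <= (LBINT x. cmod (f x * cis (- (x * u))))"
    by (rule integral_norm_bound)
  then have "cmod (LBINT x. f x * cis (- (x * u))) <= (LBINT x. cmod (f x))" by (simp add: norm_mult)
  then have "kap * cmod (LBINT x. f x * cis (- (x * u))) <= 1 * (LBINT x. cmod (f x))"
    using kap by (intro mult_mono) auto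
  then show ?thesis using kap by (simp add: cft_def norm_mult)
qed

definition acorr :: "(real => complex) => real => complex" where
  "acorr f z = (LBINT x. f x * cnj (f (x - z)))"

lemma csq_shift: assumes "csq_int f" shows "csq_int (\<lambda>x. f (x - z))" "(LBINT x. (cmod (f (x - z)))^2) = (LBINT x. (cmod (f x))^2)"
proof -
  note [measurable] = csq_intD[OF assms]
  have "integrable lborel (\<lambda>x. (cmod (f (- z + 1 * x)))^2)"
    using assms by (intro lborel_integrable_real_affine) (auto simp: csq_int_def)
  then show "csq_int (\<lambda>x. f (x - z))" by (simp add: csq_int_def)
  show "(LBINT x. (cmod (f (x - z)))^2) = (LBINT x. (cmod (f x))^2)"
    using lborel_integral_real_affine[of 1 "\<lambda>x. (cmod (f x))^2" "- z"] by simp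
qed

lemma acorr_bound: assumes "csq_int f" shows "cmod (acorr f z) <= (LBINT x. (cmod (f x))^2)"
proof -
  have "(cmod (acorr f z))^2 <= (LBINT x. (cmod (f x))^2)^2"
    unfolding acorr_def using csq_Cauchy_Schwarz[OF assms csq_int_cnj[OF csq_shift(1)[OF assms, of z]]] csq_shift(2)[OF assms, of z]
    by (simp add: power2_eq_square)
  then show ?thesis by (rule power2_le_imp_le) simp
qed

lemma acorr_measurable: assumes "csq_int f" shows "acorr f \<in> meas"
proof -
  note [measurable] = csq_intD[OF assms]
  show ?thesis unfolding acorr_def[abs_def] by measurable
qed

text \<open>Gaussian regularization of Plancherel's identity: for small \<open>e\<close> the left
  side approaches the squared norm of the transform, and the right side averages the autocorrelation
  near 0, where it equals the squared norm of \<open>f\<close>.\<close>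

lemma cft_gauss:
  assumes f1: "integrable lborel f" and f2: "csq_int f" and e: "e > 0"
  shows "(LBINT t. cft f t * cnj (cft f t) * cx (exp (- (e * t)\<^sup>2 / 2)))
    = (LBINT u. cx (std_normal_density u) * acorr f (e * u))"
proof -
  note [measurable] = csq_intD[OF f2] cft_measurable
  define w where "w t = cx (exp (- (e * t)\<^sup>2 / 2))" for t
  have wi: "integrable lborel w" unfolding w_def by (intro integrable_of_real gauss_integrable e)
  have fm: "f \<in> meas" using f1 by auto
  have [measurable]: "cft f \<in> meas" "w \<in> meas"
    using fm wi by (auto intro: cft_measurable)
  define B where "B = (LBINT x. cmod (f x))"
  have B: "cmod (cft f t) <= B" for t unfolding B_def by (rule cft_bounded[OF f1])
  have fci: "integrable lborel (\<lambda>y. cnj (f y))" using f1 by simp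
  have "(LBINT t. cft f t * cnj (cft f t) * w t) = (LBINT t. (LBINT x. f x * w t * (cx kap * cis (- (x * t)) * cnj (cft f t))))"
  proof (intro Bochner_Integration.integral_cong refl)
    fix t
    have "cft f t * cnj (cft f t) * w t = (LBINT x. f x * cis (- (x * t))) * (cx kap * cnj (cft f t) * w t)"
      by (simp add: cft_def)
    also have "... = (LBINT x. f x * cis (- (x * t)) * (cx kap * cnj (cft f t) * w t))"
      by (rule integral_mult_left_zero[symmetric])
    finally show "cft f t * cnj (cft f t) * w t = (LBINT x. f x * w t * (cx kap * cis (- (x * t)) * cnj (cft f t)))"
      by (simp add: mult_ac)
  qed
  also have "... = (LBINT x. (LBINT t. f x * w t * (cx kap * cis (- (x * t)) * cnj (cft f t))))"
  proof (rule Fubini_product_bounded[OF f1 wi, where C = B])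
    show "(\<lambda>(x, t). cx kap * cis (- (x * t)) * cnj (cft f t)) \<in> meas2" by measurable
    fix x t
    have "kap * cmod (cft f t) <= 1 * B" using kap B[of t] by (intro mult_mono) auto
    then show "cmod (cx kap * cis (- (x * t)) * cnj (cft f t)) <= B" using kap by (simp add: norm_mult)
  qed
  also have "... = (LBINT x. f x * (LBINT u. cnj (f (x - e * u)) * cx (std_normal_density u)))"
  proof (intro Bochner_Integration.integral_cong refl)
    fix x
    have "(LBINT t. f x * w t * (cx kap * cis (- (x * t)) * cnj (cft f t)))
      = f x * (LBINT t. w t * (cx kap * cis (- (x * t)) * cnj (cft f t)))"
      by (subst integral_mult_right_zero[symmetric]) (simp add: mult_ac)
    also have "(LBINT t. w t * (cx kap * cis (- (x * t)) * cnj (cft f t)))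
      = (LBINT t. (LBINT y. cnj (f y) * w t * (cx (kap * kap) * cis (- ((x - y) * t)))))"
    proof (intro Bochner_Integration.integral_cong refl)
      fix t
      have "cnj (cft f t) = cx kap * (LBINT y. cnj (f y) * cis (y * t))"
        unfolding cft_def complex_cnj_mult Bochner_Integration.integral_cnj[symmetric] by (simp add: cis_cnj)
      then have "w t * (cx kap * cis (- (x * t)) * cnj (cft f t))
         = (LBINT y. cnj (f y) * cis (y * t)) * (w t * cx (kap * kap) * cis (- (x * t)))" by simp
      also have "... = (LBINT y. cnj (f y) * cis (y * t) * (w t * cx (kap * kap) * cis (- (x * t))))"
        by (rule integral_mult_left_zero[symmetric])
      also have "... = (LBINT y. cnj (f y) * w t * (cx (kap * kap) * cis (- ((x - y) * t))))"
      proof (intro Bochner_Integration.integral_cong refl)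
        fix y
        have "cis (- ((x - y) * t)) = cis (y * t) * cis (- (x * t))" by (simp add: cis_mult algebra_simps)
        then show "cnj (f y) * cis (y * t) * (w t * cx (kap * kap) * cis (- (x * t))) = cnj (f y) * w t * (cx (kap * kap) * cis (- ((x - y) * t)))"
          by simp
      qed
      finally show "w t * (cx kap * cis (- (x * t)) * cnj (cft f t)) = (LBINT y. cnj (f y) * w t * (cx (kap * kap) * cis (- ((x - y) * t))))" .
    qed
    also have "... = (LBINT y. (LBINT t. cnj (f y) * w t * (cx (kap * kap) * cis (- ((x - y) * t)))))"
      by (rule Fubini_product_bounded[OF fci wi, where C = "kap * kap"]) (use kap in \<open>auto simp: norm_mult\<close>)
    also have "... = (LBINT y. cnj (f y) * cx (kap * (1 / e * exp (- ((x - y) / e)\<^sup>2 / 2))))"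
    proof (intro Bochner_Integration.integral_cong refl)
      fix y
      have "(LBINT t. cnj (f y) * w t * (cx (kap * kap) * cis (- ((x - y) * t))))
        = (cnj (f y) * cx (kap * kap)) * (LBINT t. cis (- ((x - y) * t)) * w t)"
        by (subst integral_mult_right_zero[symmetric]) (simp add: mult_ac)
      also have "... = (cnj (f y) * cx (kap * kap)) * cx (sqrt (2 * pi) / e * exp (- ((x - y) / e)\<^sup>2 / 2))"
        unfolding w_def gauss_FT[OF e] ..
      also have "... = cnj (f y) * cx (kap * (1 / e * exp (- ((x - y) / e)\<^sup>2 / 2)))"
      proof -
        have ks: "kap * sqrt (2 * pi) = 1" by (simp add: kap_def)
        have "kap * kap * (sqrt (2 * pi) / e * q) = kap * ((kap * sqrt (2 * pi)) * (1 / e * q))" for q by simp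
        then have "kap * kap * (sqrt (2 * pi) / e * q) = kap * (1 / e * q)" for q unfolding ks by simp
        then show ?thesis by (simp only: mult.assoc of_real_mult[symmetric])
      qed
      finally show "(LBINT t. cnj (f y) * w t * (cx (kap * kap) * cis (- ((x - y) * t)))) = cnj (f y) * cx (kap * (1 / e * exp (- ((x - y) / e)\<^sup>2 / 2)))" .
    qed
    also have "... = \<bar>- e\<bar> *\<^sub>R (LBINT u. cnj (f (x + - e * u)) * cx (kap * (1 / e * exp (- ((x - (x + - e * u)) / e)\<^sup>2 / 2))))"
      by (rule lborel_integral_real_affine) (use e in simp)
    also have "... = (LBINT u. cnj (f (x - e * u)) * cx (std_normal_density u))"
      using e by (subst integral_scaleR_right[symmetric])
        (auto intro!: Bochner_Integration.integral_cong simp: std_normal_density_def kap_def scaleR_conv_of_real)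
    finally show "(LBINT t. f x * w t * (cx kap * cis (- (x * t)) * cnj (cft f t)))
      = f x * (LBINT u. cnj (f (x - e * u)) * cx (std_normal_density u))" .
  qed
  also have "... = (LBINT x. (LBINT u. f x * (cnj (f (x - e * u)) * cx (std_normal_density u))))"
    by simp
  also have "... = (LBINT u. (LBINT x. f x * (cnj (f (x - e * u)) * cx (std_normal_density u))))"
  proof (rule lborel_pair.Fubini_integral[symmetric])
    have m: "(\<lambda>(x, u). f x * (cnj (f (x - e * u)) * cx (std_normal_density u))) \<in> meas2"
      by measurable
    show "integrable (lborel \<Otimes>\<^sub>M lborel) (\<lambda>(x, u). f x * (cnj (f (x - e * u)) * cx (std_normal_density u)))"
    proof (rule integrableI_bounded)
      show ms: "(\<lambda>(x, u). f x * (cnj (f (x - e * u)) * cx (std_normal_density u))) \<in> borel_measurable (lborel \<Otimes>\<^sub>M lborel)"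
        using m by (simp cong: measurable_cong_sets)
      have "(\<integral>\<^sup>+p. ennreal (cmod ((\<lambda>(x, u). f x * (cnj (f (x - e * u)) * cx (std_normal_density u))) p)) \<partial>(lborel \<Otimes>\<^sub>M lborel))
        = (NN u. \<integral>\<^sup>+x. ennreal (cmod (f x * (cnj (f (x - e * u)) * cx (std_normal_density u)))) \<partial>lborel)"
        using ms by (subst lborel_pair.nn_integral_snd[symmetric]) (auto cong: measurable_cong_sets)
      also have "... <= (NN u. ennreal (LBINT x. (cmod (f x))^2) * ennreal (std_normal_density u))"
      proof (intro nn_integral_mono)
        fix u
        have "(NN x. ennreal (cmod (f x * (cnj (f (x - e * u)) * cx (std_normal_density u)))))
          = (NN x. ennreal (cmod (f x)) * ennreal (cmod (f (x - e * u))) * ennreal (std_normal_density u))"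
          by (intro nn_integral_cong) (simp add: norm_mult ennreal_mult' mult.assoc)
        also have "... = (NN x. ennreal (cmod (f x)) * ennreal (cmod (f (x - e * u)))) * ennreal (std_normal_density u)"
          by (rule nn_integral_multc) measurable
        also have "(NN x. ennreal (cmod (f x)) * ennreal (cmod (f (x - e * u)))) <= ennreal (LBINT x. (cmod (f x))^2)"
        proof (rule ennreal_sq_le_imp_le)
          have "(NN x. ennreal (cmod (f x)) * ennreal (cmod (f (x - e * u))))^2
            <= (NN x. (ennreal (cmod (f x)))^2) * (NN x. (ennreal (cmod (f (x - e * u))))^2)"
            by (rule Cauchy_Schwarz_nn_integral) measurable
          also have "... = (ennreal (LBINT x. (cmod (f x))^2))^2"
            unfolding ennreal_power[OF norm_ge_zero] nn_integral_csq[OF f2] nn_integral_csq[OF csq_shift(1)[OF f2]] csq_shift(2)[OF f2]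
            by (rule power2_eq_square[symmetric])
          finally show "(NN x. ennreal (cmod (f x)) * ennreal (cmod (f (x - e * u))))^2 <= (ennreal (LBINT x. (cmod (f x))^2))^2" .
        qed simp
        finally show "(NN x. ennreal (cmod (f x * (cnj (f (x - e * u)) * cx (std_normal_density u)))))
          <= ennreal (LBINT x. (cmod (f x))^2) * ennreal (std_normal_density u)" by (simp add: mult_right_mono)
      qed
      also have "... = ennreal (LBINT x. (cmod (f x))^2) * (NN u. ennreal (std_normal_density u))"
        by (rule nn_integral_cmult) measurable
      also have "... < \<infinity>"
        by (subst nn_integral_eq_integral) (auto simp: ennreal_mult'[symmetric])
      finally show "(\<integral>\<^sup>+p. ennreal (cmod ((\<lambda>(x, u). f x * (cnj (f (x - e * u)) * cx (std_normal_density u))) p)) \<partial>(lborel \<Otimes>\<^sub>M lborel)) < \<infinity>" .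
    qed
  qed
  also have "... = (LBINT u. cx (std_normal_density u) * acorr f (e * u))"
    unfolding acorr_def by (intro Bochner_Integration.integral_cong refl) (simp add: mult_ac flip: integral_mult_right_zero)
  finally show ?thesis unfolding w_def .
qed

lemma integrable_indicator_Icc [simp]: "integrable lborel (indicator {a..b::real} :: real => real)"
  by (simp add: integrable_indicator_iff emeasure_lborel_Icc_eq)

lemma csq_compact_bounded:
  assumes "h \<in> meas" "\<And>x. cmod (h x) <= B" "\<And>x. \<bar>x\<bar> > R ==> h x = 0"
  shows "csq_int h"
proof (rule csq_int_bound[where h = "\<lambda>x. B^2 * indicator {-R..R} x"])
  fix x
  show "(cmod (h x))^2 <= B^2 * indicator {-R..R} x"
    using assms(2)[of x] assms(3)[of x] by (cases "\<bar>x\<bar> > R") (auto simp: indicator_def intro!: power_mono)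
qed (use assms(1) in auto)

text \<open>First the values are truncated. A bounded measurable function is an almost everywhere
  limit of continuous ones; clamping their values and multiplying by a tent cutoff supplies the
  dominating function.\<close>

lemma Cc_dense:
  assumes f: "csq_int f" and R: "\<And>x. \<bar>x\<bar> > R ==> f x = 0" and e: "e > 0"
  obtains g B where "continuous_on UNIV g" "\<And>x. cmod (g x) <= B" "\<And>x. \<bar>x\<bar> > R + 1 ==> g x = 0" "csq_int g"
    "(LBINT x. (cmod (f x - g x))^2) <= e"
proof -
  note [measurable] = csq_intD[OF f]
  define F where "F k x = (if cmod (f x) <= real k then f x else 0)" for k x
  have [measurable]: "F k \<in> meas" for k unfolding F_def[abs_def] by measurable
  have "(\<lambda>k. \<integral>x. (cmod (f x - F k x))^2 \<partial>lborel) \<longlonglongrightarrow> (LBINT x. (cmod (f x - f x))^2)"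
  proof (rule Bochner_Integration.integral_dominated_convergence[where w = "\<lambda>x. (cmod (f x))^2"])
    show "AE x in lborel. (\<lambda>k. (cmod (f x - F k x))^2) \<longlonglongrightarrow> (cmod (f x - f x))^2"
    proof (intro AE_I2 tendsto_eventually)
      fix x
      show "\<forall>\<^sub>F k in sequentially. (cmod (f x - F k x))^2 = (cmod (f x - f x))^2"
        using eventually_ge_at_top[of "nat \<lceil>cmod (f x)\<rceil>"]
      proof eventually_elim
        case (elim k)
        then have "cmod (f x) <= real k" by linarith
        then show ?case by (simp add: F_def)
      qed
    qed
    show "AE x in lborel. norm ((cmod (f x - F k x))^2) <= (cmod (f x))^2" for k
      by (intro AE_I2) (auto simp: F_def)
  qed (use f in \<open>auto simp: csq_int_def\<close>)
  then have "\<forall>\<^sub>F k in sequentially. (LBINT x. (cmod (f x - F k x))^2) < e / 4"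
    using e by (intro order_tendstoD(2)) auto
  then obtain k where k: "(LBINT x. (cmod (f x - F k x))^2) < e / 4"
    by (auto simp: eventually_sequentially)
  have Fk: "cmod (F k x) <= real k" "\<bar>x\<bar> > R ==> F k x = 0" for x using R[of x] by (auto simp: F_def)
  have "F k \<in> borel_measurable lebesgue" by (rule measurable_completion) simp
  then have "F k measurable_on UNIV" by (rule lebesgue_measurable_imp_measurable_on) simp
  then obtain N g where g: "negligible N" "\<And>n. continuous_on UNIV (g n)" "\<And>x. x \<notin> N ==> (\<lambda>n. g n x) \<longlonglongrightarrow> F k x"
    unfolding measurable_on_def by auto
  define chi where "chi x = max 0 (min 1 (R + 1 - \<bar>x\<bar>))" for x :: real
  define G where "G n x = clampn (real k) (g n x) * cx (chi x)" for n x
  have cl: "continuous_on A (clampn (real k) :: complex => complex)" for A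
    by (rule continuous_on_subset[of UNIV], rule lipschitz_on_continuous_on[of 2])
      (auto intro!: lipschitz_onI clampn_lipschitz simp: dist_norm)
  have cG: "continuous_on UNIV (G n)" for n
    unfolding G_def chi_def by (intro continuous_intros continuous_on_compose2[OF cl[of UNIV] g(2)]) auto
  have [measurable]: "G n \<in> meas" for n by (rule borel_measurable_continuous_onI[OF cG])
  have chi01: "0 <= chi x" "chi x <= 1" for x by (auto simp: chi_def)
  have Gb: "cmod (G n x) <= real k" for n x
    using mult_mono[OF clampn_norm[of "real k" "g n x"] chi01(2)[of x]] chi01[of x] by (simp add: G_def norm_mult)
  have G0: "\<bar>x\<bar> > R + 1 ==> G n x = 0" for n x by (simp add: G_def chi_def)
  have "(\<lambda>n. \<integral>x. (cmod (F k x - G n x))^2 \<partial>lborel) \<longlonglongrightarrow> (LBINT x. (cmod (F k x - F k x))^2)"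
  proof (rule Bochner_Integration.integral_dominated_convergence[where w = "\<lambda>x. (2 * real k)^2 * indicator {-(R+1)..R+1} x"])
    show "AE x in lborel. (\<lambda>n. (cmod (F k x - G n x))^2) \<longlonglongrightarrow> (cmod (F k x - F k x))^2"
    proof -
      obtain N' where N': "N' \<in> null_sets lborel" "N \<subseteq> N'"
        using g(1) by (auto simp: negligible_iff_null_sets null_sets_completion_iff2)
      have "AE x in lborel. x \<notin> N" using AE_not_in[OF N'(1)] by eventually_elim (use N'(2) in auto)
      then show ?thesis
      proof eventually_elim
        case (elim x)
        have "isCont (clampn (real k)) (F k x)" using cl[of UNIV] by (simp add: continuous_on_eq_continuous_at)
        then have "(\<lambda>n. clampn (real k) (g n x)) \<longlonglongrightarrow> clampn (real k) (F k x)"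
          using g(3)[OF elim] by (rule isCont_tendsto_compose)
        then have "(\<lambda>n. G n x) \<longlonglongrightarrow> clampn (real k) (F k x) * cx (chi x)"
          unfolding G_def by (intro tendsto_intros)
        also have "clampn (real k) (F k x) * cx (chi x) = F k x"
          using Fk[of x] by (cases "\<bar>x\<bar> > R") (auto simp: clampn_def chi_def)
        finally show ?case by (intro tendsto_intros)
      qed
    qed
    show "AE x in lborel. norm ((cmod (F k x - G n x))^2) <= (2 * real k)^2 * indicator {-(R+1)..R+1} x" for n
    proof (rule AE_I2)
      fix x
      have "cmod (F k x - G n x) <= 2 * real k"
        using norm_triangle_ineq4[of "F k x" "G n x"] Fk(1)[of x] Gb[of n x] by linarith
      then have "(cmod (F k x - G n x))^2 <= (2 * real k)^2" by (intro power_mono) auto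
      then show "norm ((cmod (F k x - G n x))^2) <= (2 * real k)^2 * indicator {-(R+1)..R+1} x"
        using Fk(2)[of x] G0[of x n] by (cases "\<bar>x\<bar> > R + 1") (auto simp: indicator_def)
    qed
  qed auto
  then have "\<forall>\<^sub>F n in sequentially. (LBINT x. (cmod (F k x - G n x))^2) < e / 4"
    using e by (intro order_tendstoD(2)) auto
  then obtain n where n: "(LBINT x. (cmod (F k x - G n x))^2) < e / 4"
    by (auto simp: eventually_sequentially)
  have csG: "csq_int (G n)" by (rule csq_compact_bounded[OF _ Gb G0]) auto
  have csF: "csq_int (F k)" by (rule csq_compact_bounded[OF _ Fk]) auto
  have i1: "integrable lborel (\<lambda>x. (cmod (f x - F k x))^2)" and i2: "integrable lborel (\<lambda>x. (cmod (F k x - G n x))^2)"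
    and i3: "integrable lborel (\<lambda>x. (cmod (f x - G n x))^2)"
    using csq_int_diff[OF f csF] csq_int_diff[OF csF csG] csq_int_diff[OF f csG] by (auto simp: csq_int_def)
  have "(LBINT x. (cmod (f x - G n x))^2) <= (LBINT x. 2 * (cmod (f x - F k x))^2 + 2 * (cmod (F k x - G n x))^2)"
  proof (rule integral_mono[OF i3])
    show "integrable lborel (\<lambda>x. 2 * (cmod (f x - F k x))^2 + 2 * (cmod (F k x - G n x))^2)" using i1 i2 by auto
    show "(cmod (f x - G n x))^2 <= 2 * (cmod (f x - F k x))^2 + 2 * (cmod (F k x - G n x))^2" for x
      using cmod_add_sq_le[of "f x - F k x" "F k x - G n x"] by simp
  qed
  also have "... = 2 * (LBINT x. (cmod (f x - F k x))^2) + 2 * (LBINT x. (cmod (F k x - G n x))^2)"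
    using i1 i2 by simp
  also have "... <= e" using k n by simp
  finally show thesis using that[OF cG Gb G0 csG] by blast
qed

text \<open>Clear for a continuous function of compact support, and translations preserve the L2
  norm, so the error of the approximation is the same before and after the shift.\<close>

lemma translation_continuous:
  assumes f: "csq_int f" and R: "\<And>x. \<bar>x\<bar> > R ==> f x = 0" and z: "z \<longlonglongrightarrow> 0"
  shows "(\<lambda>n. \<integral>x. (cmod (f (x - z n) - f x))^2 \<partial>lborel) \<longlonglongrightarrow> 0"
proof (rule LIMSEQ_I)
  fix e :: real assume e: "e > 0"
  obtain g B where g: "continuous_on UNIV g" "\<And>x. cmod (g x) <= B" "\<And>x. \<bar>x\<bar> > R + 1 ==> g x = 0" "csq_int g"
    "(LBINT x. (cmod (f x - g x))^2) <= e / 16"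
  proof (rule Cc_dense[of f R "e / 16"])
    show "csq_int f" by fact
    show "f x = 0" if "\<bar>x\<bar> > R" for x using R that by blast
    show "0 < e / 16" using e by simp
  qed (rule that)
  note [measurable] = csq_intD[OF f] csq_intD[OF g(4)]
  obtain Z where Z: "\<And>n. \<bar>z n\<bar> <= Z"
    using convergent_imp_Bseq[OF convergentI[OF z]] by (auto simp: Bseq_def)
  have "(\<lambda>n. \<integral>x. (cmod (g (x - z n) - g x))^2 \<partial>lborel) \<longlonglongrightarrow> (LBINT x. (cmod (g (x - 0) - g x))^2)"
  proof (rule Bochner_Integration.integral_dominated_convergence[where w = "\<lambda>x. (2 * B)^2 * indicator {-(R+1+Z)..R+1+Z} x"])
    show "AE x in lborel. (\<lambda>n. (cmod (g (x - z n) - g x))^2) \<longlonglongrightarrow> (cmod (g (x - 0) - g x))^2"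
    proof (intro AE_I2 tendsto_intros)
      fix x
      have "isCont g (x - 0)" using g(1) by (simp add: continuous_on_eq_continuous_at)
      then show "(\<lambda>n. g (x - z n)) \<longlonglongrightarrow> g (x - 0)" by (rule isCont_tendsto_compose) (intro tendsto_intros z)
    qed
    show "AE x in lborel. norm ((cmod (g (x - z n) - g x))^2) <= (2 * B)^2 * indicator {-(R+1+Z)..R+1+Z} x" for n
    proof (rule AE_I2)
      fix x
      have "cmod (g (x - z n) - g x) <= 2 * B"
        using norm_triangle_ineq4[of "g (x - z n)" "g x"] g(2)[of x] g(2)[of "x - z n"] by linarith
      then have 1: "(cmod (g (x - z n) - g x))^2 <= (2 * B)^2" by (intro power_mono) auto
      show "norm ((cmod (g (x - z n) - g x))^2) <= (2 * B)^2 * indicator {-(R+1+Z)..R+1+Z} x"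
      proof (cases "\<bar>x\<bar> > R + 1 + Z")
        case True
        then have "\<bar>x - z n\<bar> > R + 1" "\<bar>x\<bar> > R + 1" using Z[of n] by linarith+
        then show ?thesis using g(3) by simp
      next
        case False
        then have "x \<in> {-(R+1+Z)..R+1+Z}" by auto
        then show ?thesis using 1 by simp
      qed
    qed
  qed auto
  then have "\<forall>\<^sub>F n in sequentially. (LBINT x. (cmod (g (x - z n) - g x))^2) < e / 8"
    using e by (intro order_tendstoD(2)) auto
  then obtain N where N: "\<And>n. n \<ge> N ==> (LBINT x. (cmod (g (x - z n) - g x))^2) < e / 8"
    by (auto simp: eventually_sequentially)
  have fg: "csq_int (\<lambda>x. f x - g x)" by (rule csq_int_diff[OF f g(4)])
  have "norm ((LBINT x. (cmod (f (x - z n) - f x))^2) - 0) < e" if n: "n \<ge> N" for n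
  proof -
    let ?a = "\<lambda>x. (cmod (f (x - z n) - g (x - z n)))^2" and ?b = "\<lambda>x. (cmod (g (x - z n) - g x))^2" and ?c = "\<lambda>x. (cmod (f x - g x))^2"
    have i: "integrable lborel ?a" "integrable lborel ?b" "integrable lborel ?c"
      using csq_shift(1)[OF fg, of "z n"] csq_int_diff[OF csq_shift(1)[OF g(4), of "z n"] g(4)] fg by (auto simp: csq_int_def)
    have "(LBINT x. (cmod (f (x - z n) - f x))^2) <= (LBINT x. 4 * ?a x + 4 * ?b x + 2 * ?c x)"
    proof (rule integral_mono)
      show "integrable lborel (\<lambda>x. (cmod (f (x - z n) - f x))^2)"
        using csq_int_diff[OF csq_shift(1)[OF f, of "z n"] f] by (simp add: csq_int_def)
      show "integrable lborel (\<lambda>x. 4 * ?a x + 4 * ?b x + 2 * ?c x)" using i by auto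
      fix x
      have "(cmod (f (x - z n) - f x))^2 <= 2 * (cmod (f (x - z n) - g x))^2 + 2 * (cmod (g x - f x))^2"
        using cmod_add_sq_le[of "f (x - z n) - g x" "g x - f x"] by simp
      moreover have "(cmod (f (x - z n) - g x))^2 <= 2 * ?a x + 2 * ?b x"
        using cmod_add_sq_le[of "f (x - z n) - g (x - z n)" "g (x - z n) - g x"] by simp
      ultimately show "(cmod (f (x - z n) - f x))^2 <= 4 * ?a x + 4 * ?b x + 2 * ?c x"
        by (simp add: norm_minus_commute)
    qed
    also have "... = 4 * (LBINT x. ?a x) + 4 * (LBINT x. ?b x) + 2 * (LBINT x. ?c x)" using i by simp
    also have "(LBINT x. ?a x) = (LBINT x. ?c x)" using csq_shift(2)[OF fg, of "z n"] by simp
    also have "4 * (LBINT x. ?c x) + 4 * (LBINT x. ?b x) + 2 * (LBINT x. ?c x) < e"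
      using g(5) N[OF n] e by linarith
    finally show ?thesis by simp
  qed
  then show "\<exists>no. \<forall>n\<ge>no. norm ((LBINT x. (cmod (f (x - z n) - f x))^2) - 0) < e" by blast
qed

lemma acorr_tendsto:
  assumes f: "csq_int f" and R: "\<And>x. \<bar>x\<bar> > R ==> f x = 0" and z: "z \<longlonglongrightarrow> 0"
  shows "(\<lambda>n. acorr f (z n)) \<longlonglongrightarrow> cx (LBINT x. (cmod (f x))^2)"
proof -
  have a0: "cx (LBINT x. (cmod (f x))^2) = (LBINT x. f x * cnj (f x))"
    by (subst integral_complex_of_real[symmetric]) (simp add: complex_norm_square del: of_real_power)
  have le: "(cmod (acorr f (z n) - (LBINT x. f x * cnj (f x))))^2 <= (LBINT x. (cmod (f x))^2) * (LBINT x. (cmod (f (x - z n) - f x))^2)" for n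
  proof -
    have d: "csq_int (\<lambda>x. cnj (f (x - z n) - f x))" by (intro csq_int_cnj csq_int_diff csq_shift f)
    have "acorr f (z n) - (LBINT x. f x * cnj (f x)) = (LBINT x. f x * cnj (f (x - z n) - f x))"
      unfolding acorr_def
      by (subst Bochner_Integration.integral_diff[symmetric])
        (auto intro!: csq_int_mult_integrable csq_int_cnj csq_shift f simp: right_diff_distrib)
    then show ?thesis using csq_Cauchy_Schwarz[OF f d] by (simp del: complex_cnj_diff)
  qed
  have "(\<lambda>n. (LBINT x. (cmod (f x))^2) * (LBINT x. (cmod (f (x - z n) - f x))^2)) \<longlonglongrightarrow> (LBINT x. (cmod (f x))^2) * 0"
    by (intro tendsto_intros translation_continuous[OF f R z])
  then have "(\<lambda>n. (LBINT x. (cmod (f x))^2) * (LBINT x. (cmod (f (x - z n) - f x))^2)) \<longlonglongrightarrow> 0" by (simp only: mult_zero_right)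
  then have "(\<lambda>n. (cmod (acorr f (z n) - (LBINT x. f x * cnj (f x))))^2) \<longlonglongrightarrow> 0"
    by (rule Lim_null_comparison[rotated]) (rule always_eventually, rule allI, unfold real_norm_def abs_power2, rule le)
  then have "(\<lambda>n. sqrt ((cmod (acorr f (z n) - (LBINT x. f x * cnj (f x))))^2)) \<longlonglongrightarrow> sqrt 0" by (rule tendsto_real_sqrt)
  then have "(\<lambda>n. cmod (acorr f (z n) - (LBINT x. f x * cnj (f x)))) \<longlonglongrightarrow> 0" by simp
  then show ?thesis unfolding a0 by (simp add: LIM_zero_iff tendsto_norm_zero_iff)
qed

lemma csq_compact_integrable:
  assumes f: "csq_int f" and R: "\<And>x. \<bar>x\<bar> > R ==> f x = 0" shows "integrable lborel f"
proof -
  have "csq_int (\<lambda>x. indicator {-R..R} x :: complex)"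
    by (rule csq_compact_bounded[where B = 1 and R = R]) (auto simp: indicator_def)
  from csq_int_mult_integrable[OF f this] have "integrable lborel (\<lambda>x. f x * indicator {-R..R} x)" .
  moreover have "f x * indicator {-R..R} x = f x" for x using R[of x] by (cases "\<bar>x\<bar> > R") (auto simp: indicator_def)
  ultimately show ?thesis by simp
qed

text \<open>Let the Gaussian width in \<open>cft_gauss\<close> tend to infinity: monotone
  convergence on the frequency side, dominated convergence and continuity of the autocorrelation at
  0 on the other.\<close>

theorem Plancherel_compact:
  assumes f: "csq_int f" and R: "\<And>x. \<bar>x\<bar> > R ==> f x = 0"
  shows "csq_int (cft f)" "(LBINT t. (cmod (cft f t))^2) = (LBINT x. (cmod (f x))^2)"
proof -
  have f1: "integrable lborel f" by (rule csq_compact_integrable[OF f R])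
  have [measurable]: "cft f \<in> meas" using csq_intD[OF f] by (auto intro: cft_measurable)
  define w where "w n t = exp (- ((1 / (real n + 1)) * t)\<^sup>2 / 2)" for n :: nat and t :: real
  define A where "A n = (LBINT t. (cmod (cft f t))^2 * w n t)" for n
  have wi: "integrable lborel (w n)" for n unfolding w_def by (rule gauss_integrable) simp
  have [measurable]: "w n \<in> meas" for n using wi[of n] by auto
  let ?B = "(LBINT x. cmod (f x))"
  have Ai: "integrable lborel (\<lambda>t. (cmod (cft f t))^2 * w n t)" for n
  proof (rule Bochner_Integration.integrable_bound[OF integrable_mult_right[OF wi[of n], of "?B^2"]])
    show "AE t in lborel. norm ((cmod (cft f t))^2 * w n t) <= norm (?B^2 * w n t)"
      using cft_bounded[OF f1] by (intro AE_I2) (auto simp: abs_mult w_def intro!: mult_right_mono power_mono)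
  qed measurable
  have Aeq: "cx (A n) = (LBINT u. cx (std_normal_density u) * acorr f ((1 / (real n + 1)) * u))" for n
  proof -
    have "cx (A n) = (LBINT t. cft f t * cnj (cft f t) * cx (w n t))"
      unfolding A_def by (subst integral_complex_of_real[symmetric]) (simp add: complex_norm_square del: of_real_power)
    then show ?thesis unfolding w_def using cft_gauss[OF f1 f, of "1 / (real n + 1)"] by simp
  qed
  note [measurable] = acorr_measurable[OF f]
  let ?N = "LBINT x. (cmod (f x))^2"
  have "(\<lambda>n. \<integral>u. cx (std_normal_density u) * acorr f ((1 / (real n + 1)) * u) \<partial>lborel) \<longlonglongrightarrow> (LBINT u. cx (std_normal_density u) * cx ?N)"
  proof (rule Bochner_Integration.integral_dominated_convergence[where w = "\<lambda>u. std_normal_density u * ?N"])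
    show "AE u in lborel. (\<lambda>n. cx (std_normal_density u) * acorr f ((1 / (real n + 1)) * u)) \<longlonglongrightarrow> cx (std_normal_density u) * cx ?N"
    proof (intro AE_I2 tendsto_intros acorr_tendsto[OF f R])
      fix u :: real
      have "(\<lambda>n. inverse (real (Suc n)) * u) \<longlonglongrightarrow> 0 * u" by (intro tendsto_intros LIMSEQ_inverse_real_of_nat)
      then show "(\<lambda>n. (1 / (real n + 1)) * u) \<longlonglongrightarrow> 0" by (simp add: inverse_eq_divide add.commute)
    qed
    show "AE u in lborel. norm (cx (std_normal_density u) * acorr f ((1 / (real n + 1)) * u)) <= std_normal_density u * ?N" for n
      using acorr_bound[OF f] by (intro AE_I2) (auto simp: norm_mult intro!: mult_left_mono)
  qed auto
  also have "(LBINT u. cx (std_normal_density u) * cx ?N) = cx ?N"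
  proof -
    have "(LBINT u. std_normal_density u) = 1" by simp
    then show ?thesis by (simp only: integral_mult_left_zero integral_complex_of_real) simp
  qed
  finally have "(\<lambda>n. cx (A n)) \<longlonglongrightarrow> cx ?N" by (simp only: Aeq)
  then have Alim: "A \<longlonglongrightarrow> ?N" by (simp add: tendsto_of_real_iff)
  have "(\<lambda>n. \<integral>\<^sup>+t. ennreal ((cmod (cft f t))^2 * w n t) \<partial>lborel) \<longlonglongrightarrow> (NN t. ennreal ((cmod (cft f t))^2))"
  proof (rule nn_integral_LIMSEQ)
    show "incseq (\<lambda>n t. ennreal ((cmod (cft f t))^2 * w n t))"
    proof (rule incseq_SucI, rule le_funI)
      fix n t
      have "((1 / (real (Suc n) + 1)) * t)^2 <= ((1 / (real n + 1)) * t)^2"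
        unfolding power_mult_distrib by (intro mult_right_mono power_mono divide_left_mono) auto
      then have "w n t <= w (Suc n) t" by (simp add: w_def)
      then show "ennreal ((cmod (cft f t))^2 * w n t) <= ennreal ((cmod (cft f t))^2 * w (Suc n) t)"
        by (intro ennreal_leI mult_left_mono) auto
    qed
    fix t
    have "(\<lambda>n. inverse (real (Suc n)) * t) \<longlonglongrightarrow> 0 * t" by (intro tendsto_intros LIMSEQ_inverse_real_of_nat)
    then have l: "(\<lambda>n. (1 / (real n + 1)) * t) \<longlonglongrightarrow> 0" by (simp add: inverse_eq_divide add.commute)
    have "(\<lambda>n. exp (- ((1 / (real n + 1)) * t)\<^sup>2 / 2)) \<longlonglongrightarrow> exp (- 0\<^sup>2 / 2)" by (intro tendsto_intros l) auto
    then have "(\<lambda>n. w n t) \<longlonglongrightarrow> 1" by (simp add: w_def)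
    then have "(\<lambda>n. (cmod (cft f t))^2 * w n t) \<longlonglongrightarrow> (cmod (cft f t))^2 * 1" by (intro tendsto_intros)
    then show "(\<lambda>n. ennreal ((cmod (cft f t))^2 * w n t)) \<longlonglongrightarrow> ennreal ((cmod (cft f t))^2)" by (intro tendsto_ennrealI) simp
  qed measurable
  moreover have "(NN t. ennreal ((cmod (cft f t))^2 * w n t)) = ennreal (A n)" for n
    unfolding A_def by (rule nn_integral_eq_integral[OF Ai]) (auto simp: w_def)
  ultimately have "(\<lambda>n. ennreal (A n)) \<longlonglongrightarrow> (NN t. ennreal ((cmod (cft f t))^2))" by simp
  then have *: "(NN t. ennreal ((cmod (cft f t))^2)) = ennreal ?N"
    using LIMSEQ_unique tendsto_ennrealI[OF Alim] by blast
  then show c: "csq_int (cft f)" unfolding csq_int_nn by auto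
  show "(LBINT t. (cmod (cft f t))^2) = ?N" using * nn_integral_csq[OF c] by (simp add: integral_nonneg_AE)
qed

lemma cft_add: "integrable lborel f ==> integrable lborel g ==> cft (\<lambda>x. f x + g x) t = cft f t + cft g t"
  and cft_diff: "integrable lborel f ==> integrable lborel g ==> cft (\<lambda>x. f x - g x) t = cft f t - cft g t"
proof -
  assume fg: "integrable lborel f" "integrable lborel g"
  have i: "integrable lborel (\<lambda>x. u x * cis (- (x * t)))" if "integrable lborel u" for u :: "real => complex"
    by (rule Bochner_Integration.integrable_bound[OF that]) (use that in \<open>auto simp: norm_mult\<close>)
  show "cft (\<lambda>x. f x + g x) t = cft f t + cft g t" "cft (\<lambda>x. f x - g x) t = cft f t - cft g t"
    unfolding cft_def using i[OF fg(1)] i[OF fg(2)] by (simp_all add: ring_distribs)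
qed

lemma cft_cmult: "cft (\<lambda>x. c * f x) t = c * cft f t"
  unfolding cft_def by (simp add: mult.assoc)

lemma cft_real_minus: "cft (\<lambda>x. cx (f x)) (- t) = cnj (cft (\<lambda>x. cx (f x)) t)"
  unfolding cft_def complex_cnj_mult Bochner_Integration.integral_cnj[symmetric] by (simp add: cis_cnj)

lemma cft_herm_real:
  assumes "\<And>x. f (- x) = cnj (f x)" shows "cnj (cft f t) = cft f t"
proof -
  have "cnj (LBINT x. f x * cis (- (x * t))) = (LBINT x. cnj (f x) * cis (x * t))"
    unfolding Bochner_Integration.integral_cnj[symmetric] by (simp add: cis_cnj)
  also have "... = (LBINT x. cnj (f (0 - x)) * cis ((0 - x) * t))" by (rule integral_reflect_shift[symmetric])
  also have "... = (LBINT x. f x * cis (- (x * t)))" by (simp add: assms)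
  finally show ?thesis by (simp add: cft_def)
qed

section \<open>The Fourier transform of real square integrable functions\<close>

definition trn :: "(real => real) => real => real => real" where
  "trn f R x = indicator {-R..R} x * f x"

lemma trunc_ft_cft: "trunc_ft f R = cft (\<lambda>x. cx (trn f R x))"
proof
  fix t show "trunc_ft f R t = cft (\<lambda>x. cx (trn f R x)) t"
    unfolding trunc_ft_def cft_def kap_def trn_def set_lebesgue_integral_def
    by (simp add: scaleR_conv_of_real mult.assoc)
qed

lemma sq_int_csq: "sq_int f ==> csq_int (\<lambda>x. cx (f x))"
  by (auto simp: sq_int_def csq_int_def)

lemma csq_sq_int: "csq_int (\<lambda>x. cx (f x)) ==> sq_int f"
proof -
  assume a: "csq_int (\<lambda>x. cx (f x))"
  then have "(\<lambda>x. Re (cx (f x))) \<in> borel_measurable lborel" unfolding csq_int_def by (intro measurable_compose[OF _ borel_measurable_Re]) (rule conjunct1)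
  then show ?thesis using a by (auto simp: sq_int_def csq_int_def)
qed

lemma sq_int_add: "sq_int f ==> sq_int g ==> sq_int (\<lambda>x. f x + g x)"
  using csq_int_add[OF sq_int_csq sq_int_csq, of f g] by (intro csq_sq_int) simp
lemma sq_int_diff: "sq_int f ==> sq_int g ==> sq_int (\<lambda>x. f x - g x)"
  using csq_int_diff[OF sq_int_csq sq_int_csq, of f g] by (intro csq_sq_int) simp
lemma sq_int_cmult: "sq_int f ==> sq_int (\<lambda>x. c * f x)"
  using csq_int_cmult[OF sq_int_csq, of f "cx c"] by (intro csq_sq_int) simp
lemma sq_int_mult_integrable: "sq_int f ==> sq_int g ==> integrable lborel (\<lambda>x. f x * g x)"
  using integrable_Re[OF csq_int_mult_integrable[OF sq_int_csq sq_int_csq, of f g]] by simp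

lemma sq_int_trn: "sq_int f ==> sq_int (trn f R)"
proof (rule csq_sq_int)
  assume "sq_int f"
  then have "csq_int (\<lambda>x. indicator {-R..R} x * cx (f x))"
    by (intro csq_int_mult_bounded[where C = 1] sq_int_csq) (auto simp: indicator_def)
  moreover have "indicator {-R..R} x * cx (f x) = cx (trn f R x)" for x
    by (auto simp: trn_def indicator_def)
  ultimately show "csq_int (\<lambda>x. cx (trn f R x))" by simp
qed

lemma trn_0: "\<bar>x\<bar> > R ==> trn f R x = 0" by (auto simp: trn_def indicator_def)

lemma trn_integrable: assumes "sq_int f" shows "integrable lborel (\<lambda>x. cx (trn f R x))"
  by (rule csq_compact_integrable[OF sq_int_csq[OF sq_int_trn[OF assms]], of R]) (auto simp: trn_0)

lemma herm2_trunc: assumes "sq_int f" shows "herm2 (trunc_ft f R)"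
  unfolding trunc_ft_cft herm2_def
  using Plancherel_compact(1)[OF sq_int_csq[OF sq_int_trn[OF assms]], of R R] trn_0 cft_real_minus by auto

definition Th :: "(real => real) => real => h" where "Th f R = toh (trunc_ft f R)"

lemma norm_Th_diff:
  assumes "sq_int f" "sq_int g"
  shows "(norm (Th f R - Th g S))^2 = (LBINT x. (trn f R x - trn g S x)^2)"
proof -
  let ?u = "\<lambda>x. cx (trn f R x) - cx (trn g S x)"
  have u: "csq_int ?u" by (intro csq_int_diff sq_int_csq sq_int_trn assms)
  have u0: "\<bar>x\<bar> > max R S ==> ?u x = 0" for x by (simp add: trn_0)
  have "Th f R - Th g S = toh (\<lambda>t. trunc_ft f R t - trunc_ft g S t)"
    unfolding Th_def by (rule toh_diff[OF herm2_trunc[OF assms(1)] herm2_trunc[OF assms(2)]])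
  also have "(\<lambda>t. trunc_ft f R t - trunc_ft g S t) = cft ?u"
    unfolding trunc_ft_cft by (rule ext, subst cft_diff) (auto intro: trn_integrable assms)
  finally have e: "Th f R - Th g S = toh (cft ?u)" .
  have h: "herm2 (cft ?u)"
    using herm2_diff[OF herm2_trunc[OF assms(1)] herm2_trunc[OF assms(2)], of R S]
      \<open>(\<lambda>t. trunc_ft f R t - trunc_ft g S t) = cft ?u\<close> by simp
  have "ennreal ((norm (Th f R - Th g S))^2) = ennreal (LBINT t. (cmod (cft ?u t))^2)"
    unfolding e nn_norm_toh[OF h, symmetric] by (rule nn_integral_csq) (use h in \<open>simp add: herm2_def\<close>)
  then have "(norm (Th f R - Th g S))^2 = (LBINT t. (cmod (cft ?u t))^2)" by simp
  also have "... = (LBINT x. (cmod (?u x))^2)" by (rule Plancherel_compact(2)[OF u, of "max R S"]) (rule u0)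
  also have "... = (LBINT x. (trn f R x - trn g S x)^2)" by (simp flip: of_real_diff)
  finally show ?thesis .
qed

lemma Th_zero: "Th (\<lambda>_. 0) S = 0"
proof -
  have "trunc_ft (\<lambda>_. 0) S = (\<lambda>_. 0)" by (simp add: trunc_ft_cft trn_def cft_def fun_eq_iff)
  moreover have "toh (\<lambda>_. 0) = 0" by transfer (simp add: herm2_def)
  ultimately show ?thesis by (simp add: Th_def)
qed

lemma sq_int_zero: "sq_int (\<lambda>_. 0)" by (simp add: sq_int_def)

lemma norm_Th: "sq_int f ==> (norm (Th f R))^2 = (LBINT x. (trn f R x)^2)"
  using norm_Th_diff[OF _ sq_int_zero, of f R 0] by (simp add: Th_zero trn_def[of "\<lambda>_. 0"])

lemma Th_lin:
  assumes "sq_int f" "sq_int g"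
  shows "Th (\<lambda>x. f x + g x) R = Th f R + Th g R" "Th (\<lambda>x. c * f x) R = c *\<^sub>R Th f R"
proof -
  have "trunc_ft (\<lambda>x. f x + g x) R = (\<lambda>t. trunc_ft f R t + trunc_ft g R t)"
    unfolding trunc_ft_cft using cft_add[OF trn_integrable[OF assms(1)] trn_integrable[OF assms(2)], of R R]
    by (auto simp: trn_def ring_distribs fun_eq_iff)
  then show "Th (\<lambda>x. f x + g x) R = Th f R + Th g R"
    unfolding Th_def by (simp add: toh_add herm2_trunc assms)
  have "trunc_ft (\<lambda>x. c * f x) R = (\<lambda>t. cx c * trunc_ft f R t)"
    unfolding trunc_ft_cft cft_cmult[symmetric] by (simp add: trn_def mult_ac fun_eq_iff)
  then show "Th (\<lambda>x. c * f x) R = c *\<^sub>R Th f R"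
    unfolding Th_def by (simp add: toh_scale herm2_trunc assms)
qed

text \<open>A relation between actual functions and classes in \<open>h\<close>: a function
  determines its class, a class determines the function up to null sets.\<close>

definition isF :: "(real => real) => h => bool" where
  "isF f x \<longleftrightarrow> sq_int f \<and> (Th f \<longlongrightarrow> x) at_top"

lemma isF_unique: "isF f x ==> isF f y ==> x = y"
  unfolding isF_def by (auto intro: tendsto_unique[OF trivial_limit_at_top_linorder])

lemma isF_add: "isF f x ==> isF g y ==> isF (\<lambda>t. f t + g t) (x + y)"
  unfolding isF_def by (auto simp: Th_lin sq_int_add intro!: Lim_transform_eventually[OF tendsto_add])
lemma isF_cmult: "isF f x ==> isF (\<lambda>t. c * f t) (c *\<^sub>R x)"
  unfolding isF_def by (auto simp: Th_lin(2)[OF _ sq_int_zero] sq_int_cmult intro!: Lim_transform_eventually[OF tendsto_scaleR[OF tendsto_const]])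
lemma isF_diff: "isF f x ==> isF g y ==> isF (\<lambda>t. f t - g t) (x - y)"
  using isF_add[OF _ isF_cmult, of f x g y "-1"] by simp

lemma isF_cong_AE:
  assumes "isF f x" "g \<in> meas" "AE t in lborel. f t = g t"
  shows "isF g x"
proof -
  have m: "f \<in> meas" using assms(1) by (simp add: isF_def sq_int_def)
  have "csq_int (\<lambda>x. cx (g x))"
    by (rule csq_int_cong_AE[OF sq_int_csq]) (use assms in \<open>auto simp: isF_def\<close>)
  then have "sq_int g" by (rule csq_sq_int)
  moreover have "trunc_ft g = trunc_ft f"
  proof (rule ext, rule ext)
    fix R t
    have "(LBINT x. cx (trn g R x) * cis (- (x * t))) = (LBINT x. cx (trn f R x) * cis (- (x * t)))"
      using assms(3) m assms(2) by (intro integral_cong_AE) (auto simp: trn_def)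
    then show "trunc_ft g R t = trunc_ft f R t" by (simp add: trunc_ft_cft cft_def)
  qed
  then have "Th g = Th f" unfolding Th_def[abs_def] by (rule arg_cong)
  ultimately show ?thesis using assms(1) by (simp add: isF_def)
qed

lemma trn_tendsto:
  assumes "sq_int f"
  shows "((\<lambda>R. \<integral>x. (f x - trn f R x)^2 \<partial>lborel) \<longlongrightarrow> 0) at_top" "((\<lambda>R. \<integral>x. (trn f R x)^2 \<partial>lborel) \<longlongrightarrow> (LBINT x. (f x)^2)) at_top"
proof -
  have [measurable]: "f \<in> meas" "trn f R \<in> meas" for R
    using assms sq_int_trn[OF assms, of R] by (auto simp: sq_int_def)
  have ev: "\<forall>\<^sub>F R in at_top. trn f R x = f x" for x
    using eventually_ge_at_top[of "\<bar>x\<bar>"] by eventually_elim (auto simp: trn_def indicator_def)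
  have le: "(f x - trn f R x)^2 <= (f x)^2" "(trn f R x)^2 <= (f x)^2" for R x by (auto simp: trn_def indicator_def)
  have "((\<lambda>R. \<integral>x. (f x - trn f R x)^2 \<partial>lborel) \<longlongrightarrow> (LBINT x. (f x - f x)^2)) at_top"
  proof (rule integral_dominated_convergence_at_top[where w = "\<lambda>x. (f x)^2"])
    show "AE x in lborel. ((\<lambda>R. (f x - trn f R x)^2) \<longlongrightarrow> (f x - f x)^2) at_top"
    proof (rule AE_I2, rule tendsto_eventually)
      fix x
      show "\<forall>\<^sub>F R in at_top. (f x - trn f R x)^2 = (f x - f x)^2"
        using ev[of x] by eventually_elim simp
    qed
  qed (use le assms in \<open>auto simp: sq_int_def\<close>)
  then show "((\<lambda>R. \<integral>x. (f x - trn f R x)^2 \<partial>lborel) \<longlongrightarrow> 0) at_top" by simp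
  show "((\<lambda>R. \<integral>x. (trn f R x)^2 \<partial>lborel) \<longlongrightarrow> (LBINT x. (f x)^2)) at_top"
  proof (rule integral_dominated_convergence_at_top[where w = "\<lambda>x. (f x)^2"])
    show "AE x in lborel. ((\<lambda>R. (trn f R x)^2) \<longlongrightarrow> (f x)^2) at_top"
    proof (rule AE_I2, rule tendsto_eventually)
      fix x
      show "\<forall>\<^sub>F R in at_top. (trn f R x)^2 = (f x)^2"
        using ev[of x] by eventually_elim simp
    qed
  qed (use le assms in \<open>auto simp: sq_int_def\<close>)
qed

text \<open>By Plancherel, two truncations differ by at most the L2 tail of \<open>f\<close>, so the
  truncated transforms are Cauchy.\<close>

lemma isF_exists: assumes f: "sq_int f" shows "\<exists>x. isF f x"
proof -
  define \<tau> where "\<tau> R = (LBINT x. (f x - trn f R x)^2)" for R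
  have d: "norm (Th f S - Th f R) <= sqrt (\<tau> R)" if "R <= S" for R S
  proof (rule real_le_rsqrt)
    show "(norm (Th f S - Th f R))^2 <= \<tau> R"
      unfolding norm_Th_diff[OF f f] \<tau>_def
    proof (rule integral_mono)
      show "integrable lborel (\<lambda>x. (trn f S x - trn f R x)^2)" "integrable lborel (\<lambda>x. (f x - trn f R x)^2)"
        using sq_int_diff[OF sq_int_trn[OF f] sq_int_trn[OF f], of S R] sq_int_diff[OF f sq_int_trn[OF f], of R] by (auto simp: sq_int_def)
      show "(trn f S x - trn f R x)^2 <= (f x - trn f R x)^2" for x using that by (auto simp: trn_def indicator_def)
    qed
  qed
  have t0: "((\<lambda>R. sqrt (\<tau> R)) \<longlongrightarrow> 0) at_top" using tendsto_real_sqrt[OF trn_tendsto(1)[OF f]] by (simp add: \<tau>_def)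
  have "Cauchy (\<lambda>n. Th f (real n))"
  proof (rule metric_CauchyI)
    fix e :: real assume e: "e > 0"
    have "\<forall>\<^sub>F n in sequentially. sqrt (\<tau> (real n)) < e / 2"
      using order_tendstoD(2)[OF filterlim_compose[OF t0 filterlim_real_sequentially], of "e / 2"] e by simp
    then obtain N where N: "sqrt (\<tau> (real N)) < e / 2" by (auto simp: eventually_sequentially)
    have "dist (Th f (real m)) (Th f (real n)) < e" if "m \<ge> N" "n \<ge> N" for m n
      using dist_triangle[of "Th f (real m)" "Th f (real n)" "Th f (real N)"] d[of "real N" "real m"] d[of "real N" "real n"] N that
      by (simp add: dist_norm norm_minus_commute)
    then show "\<exists>M. \<forall>m\<ge>M. \<forall>n\<ge>M. dist (Th f (real m)) (Th f (real n)) < e" by blast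
  qed
  then obtain x where x: "(\<lambda>n. Th f (real n)) \<longlonglongrightarrow> x" by (auto simp: Cauchy_convergent_iff convergent_def)
  have "norm (Th f R - x) <= sqrt (\<tau> R)" for R
  proof (rule tendsto_upperbound[where F = sequentially])
    show "(\<lambda>n. norm (Th f R - Th f (real n))) \<longlonglongrightarrow> norm (Th f R - x)" by (intro tendsto_intros x)
    show "\<forall>\<^sub>F n in sequentially. norm (Th f R - Th f (real n)) <= sqrt (\<tau> R)"
      using eventually_ge_at_top[of "nat \<lceil>R\<rceil>"]
    proof eventually_elim
      case (elim n)
      then have "R <= real n" by linarith
      then show ?case using d by (simp add: norm_minus_commute)
    qed
  qed simp
  then have "((\<lambda>R. Th f R - x) \<longlongrightarrow> 0) at_top" by (intro Lim_null_comparison[OF _ t0] always_eventually) auto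
  then have "(Th f \<longlongrightarrow> x) at_top" by (simp add: LIM_zero_iff)
  with f show ?thesis by (auto simp: isF_def)
qed

lemma isF_norm: assumes "isF f x" shows "(norm x)^2 = (LBINT t. (f t)^2)"
proof -
  have f: "sq_int f" using assms by (simp add: isF_def)
  have "((\<lambda>R. (norm (Th f R))^2) \<longlongrightarrow> (norm x)^2) at_top" using assms by (intro tendsto_intros) (simp add: isF_def)
  then show ?thesis using trn_tendsto(2)[OF f] unfolding norm_Th[OF f]
    by (rule tendsto_unique[OF trivial_limit_at_top_linorder])
qed

lemma Parseval: assumes "isF f x" "isF g y" shows "(LBINT t. f t * g t) = inner x y"
proof -
  have fg: "sq_int f" "sq_int g" using assms by (auto simp: isF_def)
  have i: "integrable lborel (\<lambda>t. (f t)^2)" "integrable lborel (\<lambda>t. (g t)^2)" "integrable lborel (\<lambda>t. f t * g t)"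
    using fg sq_int_mult_integrable[OF fg] by (auto simp: sq_int_def)
  have "(norm (x + y))^2 = (LBINT t. (f t)^2 + (g t)^2 + 2 * (f t * g t))"
    unfolding isF_norm[OF isF_add[OF assms]] by (simp add: power2_sum mult.assoc)
  also have "... = (norm x)^2 + (norm y)^2 + 2 * (LBINT t. f t * g t)"
    using i by (simp add: isF_norm[OF assms(1)] isF_norm[OF assms(2)])
  finally show ?thesis by (simp add: power2_norm_eq_inner inner_simps inner_commute)
qed

lemma isF_inj: assumes "isF f x" "isF g x" shows "AE t in lborel. f t = g t"
proof -
  have d: "isF (\<lambda>t. f t - g t) (x - x)" by (rule isF_diff[OF assms])
  then have "(LBINT t. (f t - g t)^2) = 0" using isF_norm[OF d] by simp
  moreover have "integrable lborel (\<lambda>t. (f t - g t)^2)" using d by (simp add: isF_def sq_int_def)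
  ultimately have "AE t in lborel. (f t - g t)^2 = 0" by (subst (asm) integral_nonneg_eq_0_iff_AE) auto
  then show ?thesis by eventually_elim simp
qed

lemma isF_trn: assumes "sq_int f" shows "isF (trn f R) (Th f R)"
proof -
  have "Th (trn f R) S = Th f R" if "S \<ge> R" for S
  proof -
    have "trn (trn f R) S = trn f R" using that by (auto simp: trn_def indicator_def fun_eq_iff)
    then show ?thesis by (simp add: Th_def trunc_ft_cft)
  qed
  then have "\<forall>\<^sub>F S in at_top. Th (trn f R) S = Th f R" using eventually_ge_at_top[of R] by (rule eventually_mono[rotated])
  then have "(Th (trn f R) \<longlongrightarrow> Th f R) at_top" by (rule tendsto_eventually)
  then show ?thesis by (simp add: isF_def sq_int_trn assms)
qed

lemma nn_Th_dist:
  assumes "sq_int f"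
  shows "(NN u. ennreal ((cmod (trunc_ft f R u - fn x u))^2)) = ennreal ((norm (Th f R - x))^2)"
proof -
  have "(NN u. ennreal ((cmod (trunc_ft f R u - fn x u))^2)) = ennreal ((norm (toh (\<lambda>u. trunc_ft f R u - fn x u)))^2)"
    by (intro nn_norm_toh herm2_diff herm2_trunc herm2_fn assms)
  also have "toh (\<lambda>u. trunc_ft f R u - fn x u) = Th f R - x"
    using toh_diff[OF herm2_trunc[OF assms] herm2_fn, of R x] by (simp add: Th_def)
  finally show ?thesis .
qed

lemma isF_is_FT: assumes "isF f x" shows "is_FT f (fn x)"
proof -
  have f: "sq_int f" "(Th f \<longlongrightarrow> x) at_top" using assms by (auto simp: isF_def)
  have "((\<lambda>R. ennreal ((norm (Th f R - x))^2)) \<longlongrightarrow> ennreal ((norm (x - x))^2)) at_top" by (intro tendsto_ennrealI tendsto_intros f(2))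
  then show ?thesis using f by (simp add: is_FT_def csq_fn nn_Th_dist)
qed

text \<open>The given transform is a \<open>SOME\<close> choice, determined only up to null sets;
  from here on it is replaced by \<open>isF\<close>.\<close>

theorem is_FT_iff: "is_FT f g \<longleftrightarrow> csq_int g \<and> (\<exists>x. isF f x \<and> (AE t in lborel. g t = fn x t))"
proof
  assume g: "is_FT f g"
  then have f: "sq_int f" and gc: "csq_int g" by (auto simp: is_FT_def)
  obtain x where x: "isF f x" using isF_exists[OF f] by blast
  note [measurable] = csq_intD[OF gc]
  have lim: "((\<lambda>R. 2 * (NN u. ennreal ((cmod (trunc_ft f R u - g u))^2)) + 2 * (NN u. ennreal ((cmod (trunc_ft f R u - fn x u))^2))) \<longlongrightarrow> 2 * 0 + 2 * 0) at_top"
    using g isF_is_FT[OF x] unfolding is_FT_def by (intro tendsto_add tendsto_mult_ennreal tendsto_const) auto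
  have "(NN u. ennreal ((cmod (g u - fn x u))^2)) <= 2 * 0 + 2 * 0"
  proof (rule tendsto_lowerbound[OF lim])
    show "\<forall>\<^sub>F R in at_top. (NN u. ennreal ((cmod (g u - fn x u))^2))
      <= 2 * (NN u. ennreal ((cmod (trunc_ft f R u - g u))^2)) + 2 * (NN u. ennreal ((cmod (trunc_ft f R u - fn x u))^2))"
    proof (rule always_eventually, rule allI)
      fix R
      have [measurable]: "trunc_ft f R \<in> meas" using herm2_trunc[OF f, of R] by (simp add: herm2_def csq_int_def)
      have "(NN u. ennreal ((cmod (g u - fn x u))^2)) <= (NN u. 2 * ennreal ((cmod (trunc_ft f R u - g u))^2) + 2 * ennreal ((cmod (trunc_ft f R u - fn x u))^2))"
      proof (intro nn_integral_mono)
        fix u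
        have "(cmod (g u - fn x u))^2 <= 2 * (cmod (trunc_ft f R u - g u))^2 + 2 * (cmod (trunc_ft f R u - fn x u))^2"
          using cmod_add_sq_le[of "g u - trunc_ft f R u" "trunc_ft f R u - fn x u"] by (simp add: norm_minus_commute)
        from ennreal_leI[OF this]
        show "ennreal ((cmod (g u - fn x u))^2) <= 2 * ennreal ((cmod (trunc_ft f R u - g u))^2) + 2 * ennreal ((cmod (trunc_ft f R u - fn x u))^2)"
          by (simp add: ennreal_mult')
      qed
      also have "... = 2 * (NN u. ennreal ((cmod (trunc_ft f R u - g u))^2)) + 2 * (NN u. ennreal ((cmod (trunc_ft f R u - fn x u))^2))"
        by (simp add: nn_integral_add nn_integral_cmult)
      finally show "(NN u. ennreal ((cmod (g u - fn x u))^2)) <= 2 * (NN u. ennreal ((cmod (trunc_ft f R u - g u))^2)) + 2 * (NN u. ennreal ((cmod (trunc_ft f R u - fn x u))^2))" .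
    qed
  qed simp
  then have "(NN u. ennreal ((cmod (g u - fn x u))^2)) = 0" by simp
  then have "AE u in lborel. ennreal ((cmod (g u - fn x u))^2) = 0" by (subst (asm) nn_integral_0_iff_AE) auto
  then have "AE u in lborel. g u = fn x u" by eventually_elim (simp add: ennreal_eq_0_iff)
  with gc x show "csq_int g \<and> (\<exists>x. isF f x \<and> (AE t in lborel. g t = fn x t))" by blast
next
  assume "csq_int g \<and> (\<exists>x. isF f x \<and> (AE t in lborel. g t = fn x t))"
  then obtain x where gc: "csq_int g" and x: "isF f x" "AE t in lborel. g t = fn x t" by blast
  have "(NN u. ennreal ((cmod (trunc_ft f R u - g u))^2)) = (NN u. ennreal ((cmod (trunc_ft f R u - fn x u))^2))" for R
    using x(2) by (intro nn_integral_cong_AE) (auto elim: eventually_mono)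
  then show "is_FT f g" using isF_is_FT[OF x(1)] gc by (simp add: is_FT_def)
qed

lemma FT_AE: assumes "isF f x" shows "AE t in lborel. FT f t = fn x t"
proof -
  have "is_FT f (FT f)" unfolding FT_def by (rule someI[of "is_FT f"]) (rule isF_is_FT[OF assms])
  then obtain y where "isF f y" "AE t in lborel. FT f t = fn y t" by (auto simp: is_FT_iff)
  then show ?thesis using isF_unique[OF assms] by auto
qed

text \<open>The inverse transform of a frequency truncation, real valued by Hermitian symmetry
  (\<open>invF_complex\<close>).\<close>

definition invF :: "h => real => real => real" where
  "invF x S t = Re (cft (\<lambda>u. cx (cut S u) * fn x u) (- t))"

lemma cut_fn: "csq_int (\<lambda>u. cx (cut S u) * fn x u)" "\<bar>u\<bar> > S ==> cx (cut S u) * fn x u = 0"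
  "integrable lborel (\<lambda>u. cx (cut S u) * fn x u)"
proof -
  show c: "csq_int (\<lambda>u. cx (cut S u) * fn x u)"
    by (rule csq_int_mult_bounded[where C = 1]) (auto simp: csq_fn cut_def)
  show "\<bar>u\<bar> > S ==> cx (cut S u) * fn x u = 0" for u by (simp add: cut_def)
  then show "integrable lborel (\<lambda>u. cx (cut S u) * fn x u)" by (intro csq_compact_integrable[OF c, of S])
qed

lemma invF_complex: "cx (invF x S t) = cft (\<lambda>u. cx (cut S u) * fn x u) (- t)"
proof -
  have "cnj (cft (\<lambda>u. cx (cut S u) * fn x u) (- t)) = cft (\<lambda>u. cx (cut S u) * fn x u) (- t)"
    by (rule cft_herm_real) simp
  then show ?thesis unfolding invF_def by (simp add: complex_eq_iff)
qed

lemma csq_reflect: assumes "csq_int f" shows "csq_int (\<lambda>t. f (- t))" "(LBINT t. (cmod (f (- t)))^2) = (LBINT t. (cmod (f t))^2)"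
proof -
  note [measurable] = csq_intD[OF assms]
  have "integrable lborel (\<lambda>x. (cmod (f (0 + -1 * x)))^2)"
    using assms by (intro lborel_integrable_real_affine) (auto simp: csq_int_def)
  then show "csq_int (\<lambda>t. f (- t))" by (simp add: csq_int_def)
  show "(LBINT t. (cmod (f (- t)))^2) = (LBINT t. (cmod (f t))^2)"
    using lborel_integral_real_affine[of "-1" "\<lambda>x. (cmod (f x))^2" 0] by simp
qed

lemma sq_int_invF: "sq_int (invF x S)"
  by (rule csq_sq_int, unfold invF_complex, rule csq_reflect(1), rule Plancherel_compact(1)[OF cut_fn(1), of S]) (rule cut_fn(2))

lemma invF_diff: "(LBINT t. (invF x S t - invF x R t)^2) = (norm (rM (cut S) x - rM (cut R) x))^2"
proof -
  let ?u = "\<lambda>p. cx (cut S p) * fn x p - cx (cut R p) * fn x p"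
  have c: "csq_int ?u" by (intro csq_int_diff cut_fn)
  have "(invF x S t - invF x R t)^2 = (cmod (cft ?u (- t)))^2" for t
    unfolding cft_diff[OF cut_fn(3) cut_fn(3)] invF_complex[symmetric] by (simp flip: of_real_diff)
  then have "(LBINT t. (invF x S t - invF x R t)^2) = (LBINT t. (cmod (cft ?u (- t)))^2)" by simp
  also have "... = (LBINT t. (cmod (?u t))^2)"
    using csq_reflect(2)[OF Plancherel_compact(1)[OF c, of "max R S"]] Plancherel_compact(2)[OF c, of "max R S"] by (simp add: cut_def)
  also have "... = (norm (rM (cut S) x - rM (cut R) x))^2"
    unfolding norm_sq_fn
  proof (rule integral_cong_AE)
    show "AE t in lborel. (cmod (?u t))^2 = (cmod (fn (rM (cut S) x - rM (cut R) x) t))^2"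
      using fn_diff[of "rM (cut S) x" "rM (cut R) x"] fn_rM[OF rsym_cut, of S x] fn_rM[OF rsym_cut, of R x] by eventually_elim simp
  qed measurable
  finally show ?thesis .
qed

lemma inner_Th_cut:
  assumes f: "sq_int f"
  shows "inner (Th f R) (rM (cut S) x) = (LBINT t. trn f R t * invF x S t)"
proof -
  let ?x = "\<lambda>u. cx (cut S u) * fn x u"
  have hx: "herm2 ?x" by (rule herm2_bsym[OF rsym_bsym[OF rsym_cut] herm2_fn])
  have "inner (Th f R) (rM (cut S) x) = Re (LBINT u. trunc_ft f R u * cnj (?x u))"
    unfolding Th_def rM_def Mul_def by (rule inner_toh[OF herm2_trunc[OF f] hx])
  also have "(LBINT u. trunc_ft f R u * cnj (?x u)) = (LBINT u. (LBINT t. cx (trn f R t) * cnj (?x u) * (cx kap * cis (- (t * u)))))"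
  proof (intro Bochner_Integration.integral_cong refl)
    fix u
    have "trunc_ft f R u * cnj (?x u) = (LBINT t. cx (trn f R t) * cis (- (t * u))) * (cx kap * cnj (?x u))"
      by (simp add: trunc_ft_cft cft_def)
    also have "... = (LBINT t. cx (trn f R t) * cis (- (t * u)) * (cx kap * cnj (?x u)))"
      by (rule integral_mult_left_zero[symmetric])
    finally show "trunc_ft f R u * cnj (?x u) = (LBINT t. cx (trn f R t) * cnj (?x u) * (cx kap * cis (- (t * u))))"
      by (simp add: mult_ac)
  qed
  also have "... = (LBINT t. (LBINT u. cx (trn f R t) * cnj (?x u) * (cx kap * cis (- (t * u)))))"
  proof (rule Fubini_product_bounded[OF trn_integrable[OF f], where C = kap])
    show "integrable lborel (\<lambda>u. cnj (?x u))" using cut_fn(3)[of S x] by (simp only: integrable_cnj)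
    show "(\<lambda>(t, u). cx kap * cis (- (t * u))) \<in> meas2" by measurable
  qed (use kap in \<open>auto simp: norm_mult\<close>)
  also have "... = (LBINT t. cx (trn f R t * invF x S t))"
  proof (intro Bochner_Integration.integral_cong refl)
    fix t
    have "(LBINT u. cx (trn f R t) * cnj (?x u) * (cx kap * cis (- (t * u))))
      = cx (trn f R t) * (cx kap * (LBINT u. cnj (?x u) * cis (- (t * u))))"
      by (subst integral_mult_right_zero[symmetric])+ (simp add: mult_ac)
    also have "cx kap * (LBINT u. cnj (?x u) * cis (- (t * u))) = cnj (cft ?x (- t))"
      unfolding cft_def complex_cnj_mult Bochner_Integration.integral_cnj[symmetric] by (simp add: cis_cnj mult.commute)
    also have "cnj (cft ?x (- t)) = cx (invF x S t)" unfolding invF_complex[symmetric] by simp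
    finally show "(LBINT u. cx (trn f R t) * cnj (?x u) * (cx kap * cis (- (t * u)))) = cx (trn f R t * invF x S t)" by simp
  qed
  also have "Re ... = (LBINT t. trn f R t * invF x S t)" by (simp only: integral_complex_of_real Re_complex_of_real)
  finally show ?thesis .
qed

text \<open>An L2 limit of truncated inverse transforms gives a candidate \<open>f\<close> with some
  transform \<open>y\<close>. Plancherel yields \<open>norm y = norm x\<close>, and duality with the
  truncations of \<open>f\<close> yields \<open>inner y (x - y) = 0\<close>; together these force
  \<open>y = x\<close>. The subsequence is kept for pointwise inversion.\<close>

theorem isF_surj:
  obtains f r where "isF f x" "strict_mono (r :: nat => nat)" "AE t in lborel. (\<lambda>k. invF x (real (r k)) t) \<longlonglongrightarrow> f t"
proof -
  have cx: "(\<lambda>n. rM (cut (real n)) x) \<longlonglongrightarrow> x" using rM_tendsto[OF rsym_cut cut_tendsto rsym_one, of x] by simp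
  have im: "invF x S \<in> meas" for S using sq_int_invF[of x S] by (simp add: sq_int_def)
  have nn: "(NN t. ennreal ((cmod (cx (invF x (real m) t) - cx (invF x (real n) t)))^2)) = ennreal ((dist (rM (cut (real m)) x) (rM (cut (real n)) x))^2)" for m n
  proof -
    have "(NN t. ennreal ((cmod (cx (invF x (real m) t) - cx (invF x (real n) t)))^2)) = ennreal (LBINT t. (invF x (real m) t - invF x (real n) t)^2)"
      using nn_integral_csq[OF sq_int_csq[OF sq_int_diff[OF sq_int_invF sq_int_invF]], of x "real m" x "real n"] by (simp flip: of_real_diff)
    then show ?thesis unfolding invF_diff dist_norm .
  qed
  have cau: "\<exists>N. \<forall>m\<ge>N. \<forall>n\<ge>N. (NN t. ennreal ((cmod (cx (invF x (real m) t) - cx (invF x (real n) t)))^2)) <= ennreal e" if e: "e > 0" for e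
  proof -
    from metric_CauchyD[OF LIMSEQ_imp_Cauchy[OF cx] real_sqrt_gt_zero[OF e]]
    obtain N where N: "\<forall>m\<ge>N. \<forall>n\<ge>N. dist (rM (cut (real m)) x) (rM (cut (real n)) x) < sqrt e" ..
    have "(dist (rM (cut (real m)) x) (rM (cut (real n)) x))^2 <= e" if "m \<ge> N" "n \<ge> N" for m n
    proof -
      have "dist (rM (cut (real m)) x) (rM (cut (real n)) x) <= sqrt e" using N that less_imp_le by blast
      then have "(dist (rM (cut (real m)) x) (rM (cut (real n)) x))^2 <= (sqrt e)^2" by (rule power_mono) simp
      then show ?thesis using e by simp
    qed
    then show ?thesis unfolding nn by (auto intro!: exI[of _ N] ennreal_leI)
  qed
  obtain r :: "nat => nat" and g where r: "strict_mono r" and g: "g \<in> borel_measurable lborel"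
    "g = (\<lambda>t. if convergent (\<lambda>k. cx (invF x (real (r k)) t)) then lim (\<lambda>k. cx (invF x (real (r k)) t)) else 0)"
    "AE t in lborel. (\<lambda>k. cx (invF x (real (r k)) t)) \<longlonglongrightarrow> g t"
    "\<And>e. e > 0 ==> \<exists>N. \<forall>n\<ge>N. (NN t. ennreal ((cmod (cx (invF x (real n) t) - g t))^2)) <= ennreal e"
    by (rule Riesz_Fischer[of "\<lambda>n t. cx (invF x (real n) t)", OF _ cau]) (use im in \<open>simp | assumption | rule that\<close>)+
  define f where "f t = Re (g t)" for t
  have [measurable]: "f \<in> meas" "invF x S \<in> meas" for S using g(1) im unfolding f_def[abs_def] by auto
  have le: "(NN t. ennreal ((invF x (real n) t - f t)^2)) <= (NN t. ennreal ((cmod (cx (invF x (real n) t) - g t))^2))" for n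
  proof (intro nn_integral_mono ennreal_leI)
    fix t
    have "\<bar>Re (cx (invF x (real n) t) - g t)\<bar> <= cmod (cx (invF x (real n) t) - g t)" by (rule abs_Re_le_cmod)
    then have "\<bar>invF x (real n) t - f t\<bar>^2 <= (cmod (cx (invF x (real n) t) - g t))^2" by (intro power_mono) (auto simp: f_def)
    then show "(invF x (real n) t - f t)^2 <= (cmod (cx (invF x (real n) t) - g t))^2" by simp
  qed
  have fsq: "sq_int f"
  proof -
    obtain n where n: "(NN t. ennreal ((cmod (cx (invF x (real n) t) - g t))^2)) <= ennreal 1" using g(4)[of 1] by auto
    have "(NN t. ennreal ((invF x (real n) t - f t)^2)) < \<infinity>" using order_trans[OF le n] by (auto intro: le_less_trans)
    then have "sq_int (\<lambda>t. invF x (real n) t - f t)" by (auto simp: sq_int_def integrable_iff_bounded)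
    from sq_int_diff[OF sq_int_invF[of x "real n"] this] show ?thesis by simp
  qed
  obtain y where y: "isF f y" using isF_exists[OF fsq] by blast
  have "\<exists>z. isF (invF x (real n)) z" for n by (rule isF_exists[OF sq_int_invF])
  then obtain Y where Y: "\<And>n. isF (invF x (real n)) (Y n)" by metis
  have Yy: "Y \<longlonglongrightarrow> y"
  proof (rule metric_LIMSEQ_I)
    fix e :: real assume e: "e > 0"
    then have "(e/2)^2 > 0" by simp
    from g(4)[OF this] obtain N where N: "\<forall>n\<ge>N. (NN t. ennreal ((cmod (cx (invF x (real n) t) - g t))^2)) <= ennreal ((e/2)^2)" ..
    have "dist (Y n) y < e" if "n \<ge> N" for n
    proof -
      have "ennreal ((norm (Y n - y))^2) = (NN t. ennreal ((invF x (real n) t - f t)^2))"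
        unfolding isF_norm[OF isF_diff[OF Y y]] using sq_int_diff[OF sq_int_invF fsq, of x "real n"]
        by (intro nn_integral_eq_integral[symmetric]) (auto simp: sq_int_def)
      also have "... <= ennreal ((e/2)^2)" using le[of n] N that by (auto intro: order_trans)
      finally have "(norm (Y n - y))^2 <= (e/2)^2" by (rule ennreal_le_iff[THEN iffD1, rotated]) simp
      then have "norm (Y n - y) <= e/2" by (rule power2_le_imp_le) (use e in linarith)
      then show ?thesis using e by (simp add: dist_norm)
    qed
    then show "\<exists>no. \<forall>n\<ge>no. dist (Y n) y < e" by blast
  qed
  \<comment> \<open>The cutoff at -1 is empty, so \<open>invF_diff\<close> against it becomes the
    norm identity for one truncation.\<close>
  have c1: "cut (-1) u = 0" for u by (simp add: cut_def)
  have inv0: "invF x (-1) t = 0" for t by (simp add: invF_def cft_def c1)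
  have r0: "rM (cut (-1)) x = 0"
  proof -
    have "cut (-1) = (\<lambda>t. 0)" by (auto simp: cut_def fun_eq_iff)
    then show ?thesis using norm_rM_le[of 0 "\<lambda>_. 0" x] by (simp add: rsym_def)
  qed
  have nY: "norm (Y n) = norm (rM (cut (real n)) x)" for n
  proof -
    have "(norm (Y n))^2 = (norm (rM (cut (real n)) x))^2" using isF_norm[OF Y, of n] invF_diff[of x "real n" "-1"] by (simp add: inv0 r0)
    then show ?thesis by simp
  qed
  have nxy: "norm y = norm x"
    using LIMSEQ_unique[OF tendsto_norm[OF Yy]] tendsto_norm[OF cx] by (simp add: nY)
  have "inner (Th f R) (x - y) = 0" for R
  proof -
    have "inner (Th f R) (rM (cut (real n)) x - Y n) = 0" for n
      unfolding inner_diff_right inner_Th_cut[OF fsq] Parseval[OF isF_trn[OF fsq] Y] by simp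
    moreover have "(\<lambda>n. inner (Th f R) (rM (cut (real n)) x - Y n)) \<longlonglongrightarrow> inner (Th f R) (x - y)" by (intro tendsto_intros cx Yy)
    ultimately show ?thesis by (simp add: LIMSEQ_const_iff)
  qed
  moreover have "((\<lambda>R. inner (Th f R) (x - y)) \<longlongrightarrow> inner y (x - y)) at_top" using y by (intro tendsto_intros) (simp add: isF_def)
  ultimately have "inner y (x - y) = 0" by (simp add: tendsto_const_iff)
  then have "inner y x = (norm y)^2" by (simp add: inner_diff_right power2_norm_eq_inner)
  then have "(norm (x - y))^2 = 0" using nxy by (simp add: power2_norm_eq_inner inner_simps inner_commute norm_eq_sqrt_inner)
  then have "y = x" by simp
  moreover have "AE t in lborel. (\<lambda>k. invF x (real (r k)) t) \<longlonglongrightarrow> f t"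
    using g(3)
  proof eventually_elim
    case (elim t)
    from tendsto_Re[OF elim] show ?case by (simp add: f_def)
  qed
  ultimately show thesis using that[of f r] y r by simp
qed

lemma isF_sq: "isF f x ==> sq_int f" by (simp add: isF_def)
lemma sq_int_measurable: "sq_int f ==> f \<in> meas" by (simp add: sq_int_def)

text \<open>The truncated inversion integrals converge everywhere by dominated convergence and,
  along a subsequence, almost everywhere to \<open>f\<close>.\<close>

lemma Fourier_inversion_L1:
  assumes f: "isF f x" and i: "integrable lborel (fn x)"
  shows "AE t in lborel. cx (f t) = cft (fn x) (- t)"
proof -
  obtain f' r where f': "isF f' x" and r: "strict_mono (r :: nat => nat)" and lim: "AE t in lborel. (\<lambda>k. invF x (real (r k)) t) \<longlonglongrightarrow> f' t"
    by (rule isF_surj)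
  have 1: "(\<lambda>k. cx (invF x (real (r k)) t)) \<longlonglongrightarrow> cft (fn x) (- t)" for t
    unfolding invF_complex cft_def
  proof (rule tendsto_mult[OF tendsto_const], rule Bochner_Integration.integral_dominated_convergence[where w = "\<lambda>u. cmod (fn x u)"], goal_cases)
    case (4)
    show ?case
    proof (rule AE_I2)
    fix u
    have "(\<lambda>k. cut (real k) u) \<longlonglongrightarrow> 1" by (rule cut_tendsto)
    from LIMSEQ_subseq_LIMSEQ[OF this r] have "(\<lambda>k. cut (real (r k)) u) \<longlonglongrightarrow> 1" by (simp add: o_def)
    then have c: "(\<lambda>k. cx (cut (real (r k)) u)) \<longlonglongrightarrow> cx 1" by (rule tendsto_of_real)
    have "(\<lambda>k. cx (cut (real (r k)) u) * fn x u * cis (- (u * - t))) \<longlonglongrightarrow> cx 1 * fn x u * cis (- (u * - t))"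
      by (intro tendsto_mult tendsto_const c)
    then show "(\<lambda>k. cx (cut (real (r k)) u) * fn x u * cis (- (u * - t))) \<longlonglongrightarrow> fn x u * cis (- (u * - t))" by simp
    qed
  next
    case (5 k)
    show ?case by (rule AE_I2) (simp add: norm_mult cut_def)
  qed (use i in auto)
  show ?thesis using lim isF_inj[OF f f']
  proof eventually_elim
    case (elim t)
    then show ?case using LIMSEQ_unique[OF tendsto_of_real[OF elim(1)] 1[of t]] by simp
  qed
qed

section \<open>Products as convolutions\<close>

context wb
begin

text \<open>Functions represented at level \<open>s\<close> have integrable transforms, hence are
  bounded up to null sets; this makes them multipliers on L2.\<close>

lemma integrable_fn_Sg: "integrable lborel (fn (rM Sg X))"
proof (rule integrableI_bounded)
  have "(NN t. ennreal (cmod (fn (rM Sg X) t))) <= (NN t. ennreal (J t) * ennreal (cmod (fn X t)))"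
  proof (rule nn_integral_mono_AE)
    show "AE t in lborel. ennreal (cmod (fn (rM Sg X) t)) <= ennreal (J t) * ennreal (cmod (fn X t))"
      using fn_rM[OF rsym_Sg, of X]
    proof eventually_elim
      case (elim t)
      have "cmod (fn (rM Sg X) t) <= J t * cmod (fn X t)"
        unfolding elim norm_mult norm_of_real using one_div_sig_le[of t] by (intro mult_right_mono) (auto simp: Sg_def)
      then show ?case by (simp add: ennreal_mult'[symmetric] ennreal_leI)
    qed
  qed
  also have "... <= ennreal (nJ * norm X)" by (rule nn_J_fn)
  also have "... < \<infinity>" by simp
  finally show "(NN t. ennreal (cmod (fn (rM Sg X) t))) < \<infinity>" .
qed simp

definition kc :: "real => real => complex" where "kc u v = cx (kap * Sg (u - v))"

lemma kern_kc: "kern 1 kc"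
  unfolding kern_def
proof (intro conjI allI)
  note [measurable] = rsym_measurable[OF rsym_Sg]
  show "(\<lambda>(u, v). kc u v) \<in> meas2" unfolding kc_def by measurable
  fix u v :: real
  show "kc (- u) (- v) = cnj (kc u v)" unfolding kc_def diff_minus_minus rsym_even[OF rsym_Sg] by simp
  have "kap * Sg (u - v) <= 1 * J (u - v)" using kap one_div_sig_le[of "u - v"] by (intro mult_mono) (auto simp: Sg_def)
  moreover have "0 <= kap * Sg (u - v)" using kap by (simp add: Sg_def)
  ultimately show "cmod (kc u v) <= 1 * (J (u - v) + J v + J u)"
    unfolding kc_def norm_of_real mult_1 using J_nonneg[of u] J_nonneg[of v] by linarith
qed

text \<open>For a spatially truncated second factor this is Fubini together with L1 inversion for
  \<open>f\<close>; the truncation is removed by continuity of \<open>bil kc\<close>.\<close>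

theorem convolution:
  fixes f g :: "real => real"
  assumes f: "isF f (rM Sg X)" and g: "isF g y"
  shows "isF (\<lambda>t. f t * g t) (bil kc X y)"
proof -
  let ?x = "fn (rM Sg X)"
  have xi: "integrable lborel ?x" by (rule integrable_fn_Sg)
  have fAE: "AE t in lborel. cx (f t) = cft ?x (- t)" by (rule Fourier_inversion_L1[OF f xi])
  have [measurable]: "f \<in> meas" "g \<in> meas" "cft ?x \<in> meas"
    using isF_sq[OF f] isF_sq[OF g] by (auto simp: sq_int_def cft_measurable)
  have "csq_int (\<lambda>t. cft ?x (- t) * cx (g t))"
    by (rule csq_int_mult_bounded[OF sq_int_csq[OF isF_sq[OF g]]]) (auto intro: cft_bounded[OF xi])
  then have "csq_int (\<lambda>t. cx (f t * g t))"
    by (rule csq_int_cong_AE) (use fAE in auto)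
  then have sq: "sq_int (\<lambda>t. f t * g t)" by (rule csq_sq_int)
  have eq: "Th (\<lambda>t. f t * g t) R = bil kc X (Th g R)" for R
  proof -
    have gi: "integrable lborel (\<lambda>t. cx (trn g R t))" by (rule trn_integrable[OF isF_sq[OF g]])
    have "trunc_ft (\<lambda>t. f t * g t) R u = bilf kc X (Th g R) u" for u
    proof -
      have [measurable]: "trn g R \<in> meas" using sq_int_trn[OF isF_sq[OF g], of R] by (simp add: sq_int_def)
      have "(LBINT t. cx (trn (\<lambda>t. f t * g t) R t) * cis (- (t * u)))
        = (LBINT t. (LBINT v. cx (trn g R t) * ?x v * (cx kap * cis (t * (v - u)))))"
      proof (rule integral_cong_AE)
        show "(\<lambda>t. cx (trn (\<lambda>t. f t * g t) R t) * cis (- (t * u))) \<in> borel_measurable lborel"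
          unfolding trn_def by measurable
        show "AE t in lborel. cx (trn (\<lambda>t. f t * g t) R t) * cis (- (t * u)) = (LBINT v. cx (trn g R t) * ?x v * (cx kap * cis (t * (v - u))))"
          using fAE
        proof eventually_elim
          case (elim t)
          have "(LBINT v. cx (trn g R t) * ?x v * (cx kap * cis (t * (v - u))))
            = (LBINT v. (cx (trn g R t) * cis (- (t * u)) * cx kap) * (?x v * cis (- (v * - t))))"
            by (intro Bochner_Integration.integral_cong refl) (simp add: mult_ac cis_mult right_diff_distrib)
          also have "... = cx (trn g R t) * cis (- (t * u)) * cft ?x (- t)"
            by (simp add: cft_def)
          finally have "(LBINT v. cx (trn g R t) * ?x v * (cx kap * cis (t * (v - u)))) = cx (trn g R t) * cis (- (t * u)) * cx (f t)" unfolding elim .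
          moreover have "cx (trn (\<lambda>t. f t * g t) R t) * cis (- (t * u)) = cx (trn g R t) * cis (- (t * u)) * cx (f t)" by (simp add: trn_def mult_ac)
          ultimately show ?case by (rule trans[OF _ sym, rotated])
        qed
      qed measurable
      also have "... = (LBINT v. (LBINT t. cx (trn g R t) * ?x v * (cx kap * cis (t * (v - u)))))"
        by (rule Fubini_product_bounded[OF gi xi, where C = kap, symmetric]) (use kap in \<open>auto simp: norm_mult\<close>)
      also have "... = (LBINT v. ?x v * trunc_ft g R (u - v))"
      proof (intro Bochner_Integration.integral_cong refl)
        fix v
        have "(LBINT t. cx (trn g R t) * ?x v * (cx kap * cis (t * (v - u))))
          = (LBINT t. (?x v * cx kap) * (cx (trn g R t) * cis (- (t * (u - v)))))"
          by (intro Bochner_Integration.integral_cong refl) (simp add: mult_ac right_diff_distrib)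
        also have "... = ?x v * trunc_ft g R (u - v)" by (simp add: trunc_ft_cft cft_def)
        finally show "(LBINT t. cx (trn g R t) * ?x v * (cx kap * cis (t * (v - u)))) = ?x v * trunc_ft g R (u - v)" .
      qed
      also have "... = (LBINT v. ?x (u - v) * trunc_ft g R (u - (u - v)))" by (rule integral_reflect_shift[symmetric])
      also have "... = (LBINT v. cx (Sg (u - v)) * fn X (u - v) * fn (Th g R) v)"
      proof (rule integral_cong_AE)
        note [measurable] = rsym_measurable[OF rsym_Sg]
        have [measurable]: "trunc_ft g R \<in> meas" using herm2_trunc[OF isF_sq[OF g], of R] by (simp add: herm2_def csq_int_def)
        show "(\<lambda>v. ?x (u - v) * trunc_ft g R (u - (u - v))) \<in> borel_measurable lborel" by measurable
        show "(\<lambda>v. cx (Sg (u - v)) * fn X (u - v) * fn (Th g R) v) \<in> borel_measurable lborel" by measurable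
        show "AE v in lborel. ?x (u - v) * trunc_ft g R (u - (u - v)) = cx (Sg (u - v)) * fn X (u - v) * fn (Th g R) v"
          using AE_lborel_reflect_shift[OF fn_rM[OF rsym_Sg, of X], of u] fn_toh[OF herm2_trunc[OF isF_sq[OF g], of R]]
          unfolding Th_def by eventually_elim simp
      qed
      finally show ?thesis
        unfolding trunc_ft_cft[of "\<lambda>t. f t * g t"] cft_def[of "\<lambda>x. cx (trn (\<lambda>t. f t * g t) R x)"] bilf_def kc_def
        by (simp add: mult.assoc)
    qed
    then have "trunc_ft (\<lambda>t. f t * g t) R = bilf kc X (Th g R)" by (rule ext)
    then show ?thesis by (simp add: Th_def bil_def)
  qed
  interpret b: bounded_bilinear "bil kc" by (rule bounded_bilinear_bil[OF kern_kc])
  have "((\<lambda>R. bil kc X (Th g R)) \<longlongrightarrow> bil kc X y) at_top" using g by (intro b.tendsto tendsto_const) (simp add: isF_def)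
  then show ?thesis unfolding isF_def eq[abs_def] using sq by simp
qed

end

section \<open>Test functions and weak equations\<close>

lemma test_fun_props:
  assumes "test_fun \<phi> \<phi>'"
  obtains R B where "R > 0" "\<And>x. \<bar>x\<bar> > R ==> \<phi> x = 0" "\<And>x. \<bar>x\<bar> > R ==> \<phi>' x = 0" "\<And>x. \<bar>\<phi> x\<bar> <= B" "\<And>x. \<bar>\<phi>' x\<bar> <= B"
    "continuous_on UNIV \<phi>" "continuous_on UNIV \<phi>'" "\<And>x. (\<phi> has_real_derivative \<phi>' x) (at x)"
proof -
  have d: "\<And>x. (\<phi> has_real_derivative \<phi>' x) (at x)" and c': "continuous_on UNIV \<phi>'" using assms by (auto simp: test_fun_def)
  obtain R0 where R0: "\<And>x. \<bar>x\<bar> > R0 ==> \<phi> x = 0" using assms by (auto simp: test_fun_def)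
  define R where "R = max R0 1"
  have R: "R > 0" "\<And>x. \<bar>x\<bar> > R ==> \<phi> x = 0" using R0 by (auto simp: R_def)
  have c: "continuous_on UNIV \<phi>" using d by (intro continuous_at_imp_continuous_on ballI DERIV_isCont)
  have p0: "\<phi>' x = 0" if "\<bar>x\<bar> > R" for x
  proof -
    have "open {y::real. R < \<bar>y\<bar>}" by (intro open_Collect_less continuous_intros)
    then have "\<forall>\<^sub>F y in nhds x. R < \<bar>y\<bar>" using that by (auto simp: eventually_nhds)
    then have "\<forall>\<^sub>F y in nhds x. \<phi> y = 0" by (rule eventually_mono) (rule R)
    then have "(\<phi> has_real_derivative 0) (at x)" by (subst DERIV_cong_ev[where g = "\<lambda>_. 0" and y = x]) auto
    then show ?thesis using d DERIV_unique by blast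
  qed
  have bd: "\<exists>B. \<forall>x. \<bar>u x\<bar> <= B" if "continuous_on UNIV u" "\<And>x. \<bar>x\<bar> > R ==> u x = 0" for u :: "real => real"
  proof -
    have "bounded (u ` {-R..R})" by (intro compact_imp_bounded compact_continuous_image continuous_on_subset[OF that(1)]) auto
    then obtain B where B: "\<forall>x\<in>{-R..R}. \<bar>u x\<bar> <= B" by (auto simp: bounded_iff)
    have "\<bar>u x\<bar> <= max B 0" for x
    proof (cases "\<bar>x\<bar> > R")
      case True then show ?thesis using that(2)[of x] by simp
    next
      case False
      then have "x \<in> {-R..R}" by auto
      then show ?thesis using B by (auto simp: le_max_iff_disj)
    qed
    then show ?thesis by blast
  qed
  obtain B1 B2 where B: "\<And>x. \<bar>\<phi> x\<bar> <= B1" "\<And>x. \<bar>\<phi>' x\<bar> <= B2" using bd[OF c R(2)] bd[OF c' p0] by blast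
  show thesis
    by (rule that[of R "max B1 B2"]) (use R p0 c c' d B in \<open>auto simp: le_max_iff_disj\<close>)
qed

lemma isF_compact:
  assumes "sq_int f" "\<And>x. \<bar>x\<bar> > R ==> f x = 0"
  shows "isF f (toh (cft (\<lambda>x. cx (f x))))" "herm2 (cft (\<lambda>x. cx (f x)))"
proof -
  have "trn f R x = f x" for x using assms(2)[of x] by (cases "\<bar>x\<bar> > R") (auto simp: trn_def indicator_def)
  then have t: "trn f R = f" by (rule ext)
  show "isF f (toh (cft (\<lambda>x. cx (f x))))" using isF_trn[OF assms(1), of R] by (simp add: t Th_def trunc_ft_cft)
  show "herm2 (cft (\<lambda>x. cx (f x)))" using herm2_trunc[OF assms(1), of R] by (simp add: t trunc_ft_cft)
qed

text \<open>Integration by parts on an interval reaching one unit beyond the support, where the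
  boundary terms vanish.\<close>

lemma test_fun_isF:
  assumes "test_fun \<phi> \<phi>'"
  obtains P P' where "isF \<phi> P" "isF \<phi>' P'" "AE p in lborel. fn P' p = \<i> * cx p * fn P p"
proof -
  obtain R B where R: "R > 0" "\<And>x. \<bar>x\<bar> > R ==> \<phi> x = 0" "\<And>x. \<bar>x\<bar> > R ==> \<phi>' x = 0" "\<And>x. \<bar>\<phi> x\<bar> <= B" "\<And>x. \<bar>\<phi>' x\<bar> <= B"
    "continuous_on UNIV \<phi>" "continuous_on UNIV \<phi>'" "\<And>x. (\<phi> has_real_derivative \<phi>' x) (at x)" by (rule test_fun_props[OF assms]) (rule that)
  have sq: "sq_int u" if "continuous_on UNIV u" "\<And>x. \<bar>x\<bar> > R ==> u x = 0" "\<And>x. \<bar>u x\<bar> <= B" for u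
    by (rule csq_sq_int, rule csq_compact_bounded[where B = B and R = R]) (use that in \<open>auto intro!: borel_measurable_of_real borel_measurable_continuous_onI\<close>)
  have s1: "sq_int \<phi>" and s2: "sq_int \<phi>'" using R sq by blast+
  note i1 = csq_compact_integrable[OF sq_int_csq[OF s1], of R] and i2 = csq_compact_integrable[OF sq_int_csq[OF s2], of R]
  have h1: "isF \<phi> (toh (cft (\<lambda>x. cx (\<phi> x))))" "herm2 (cft (\<lambda>x. cx (\<phi> x)))"
    by (rule isF_compact[OF s1 R(2)], assumption)+
  have h2: "isF \<phi>' (toh (cft (\<lambda>x. cx (\<phi>' x))))" "herm2 (cft (\<lambda>x. cx (\<phi>' x)))"
    by (rule isF_compact[OF s2 R(3)], assumption)+
  let ?c = "\<lambda>f. cft (\<lambda>x. cx (f x))"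
  have ce: "?c \<phi>' p = \<i> * cx p * ?c \<phi> p" for p
  proof -
    let ?F = "\<lambda>x. cx (\<phi> x) * cis (- (x * p))"
    let ?f = "\<lambda>x. cx (\<phi>' x) * cis (- (x * p)) + cx (\<phi> x) * (- \<i> * cx p * cis (- (x * p)))"
    have cis_d: "((\<lambda>x. cis (- (x * p))) has_vector_derivative (- \<i> * cx p * cis (- (x * p)))) (at x within A)" for x A
    proof -
      have "((\<lambda>x. exp (x *\<^sub>R (- \<i> * cx p))) has_vector_derivative exp (x *\<^sub>R (- \<i> * cx p)) * (- \<i> * cx p)) (at x within A)"
        by (rule exp_scaleR_has_vector_derivative_right)
      moreover have "exp (x *\<^sub>R (- \<i> * cx p)) = cis (- (x * p))" for x
        by (simp add: cis_conv_exp scaleR_conv_of_real mult_ac)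
      ultimately show ?thesis by (simp add: mult_ac)
    qed
    have "(LBINT x. indicator {-(R+1)..R+1} x *\<^sub>R ?f x) = ?F (R+1) - ?F (-(R+1))"
    proof (rule integral_FTC_Icc)
      show "- (R + 1) <= R + 1" using R(1) by simp
      show "(?F has_vector_derivative ?f x) (at x within {- (R + 1)..R + 1})" for x
        using has_vector_derivative_mult[OF has_vector_derivative_of_real[OF has_field_derivative_at_within[OF R(8)]] cis_d, of x "{- (R + 1)..R + 1}"]
        by (simp add: add.commute)
      show "continuous_on {- (R + 1)..R + 1} ?f"
        by (intro continuous_intros continuous_on_subset[OF R(6)] continuous_on_subset[OF R(7)]) auto
    qed
    also have "... = 0" using R(1) by (simp add: R(2))
    finally have "(LBINT x. indicator {-(R+1)..R+1} x *\<^sub>R ?f x) = 0" .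
    moreover have "indicator {-(R+1)..R+1} x *\<^sub>R ?f x = ?f x" for x
      using R(2)[of x] R(3)[of x] by (cases "\<bar>x\<bar> > R") (auto simp: indicator_def)
    ultimately have z: "(LBINT x. ?f x) = 0" by simp
    have i: "integrable lborel (\<lambda>x. u x * cis (- (x * p)))" if "integrable lborel u" for u :: "real => complex"
      by (rule Bochner_Integration.integrable_bound[OF that]) (use that in \<open>auto simp: norm_mult\<close>)
    have "(LBINT x. ?f x) = (LBINT x. cx (\<phi>' x) * cis (- (x * p))) + (LBINT x. (- \<i> * cx p) * (cx (\<phi> x) * cis (- (x * p))))"
      using i[OF i1] i[OF i2] R(2,3) by (subst Bochner_Integration.integral_add[symmetric]) (auto simp: mult_ac)
    also have "(LBINT x. (- \<i> * cx p) * (cx (\<phi> x) * cis (- (x * p)))) = (- \<i> * cx p) * (LBINT x. cx (\<phi> x) * cis (- (x * p)))"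
      by (rule integral_mult_right_zero)
    finally show ?thesis using z by (simp add: cft_def)
  qed
  have "AE p in lborel. fn (toh (?c \<phi>')) p = \<i> * cx p * fn (toh (?c \<phi>)) p"
    using fn_toh[OF h1(2)] fn_toh[OF h2(2)] by eventually_elim (simp add: ce)
  then show thesis by (rule that[OF h1(1) h2(1)])
qed

text \<open>Test functions are only C1 with compact support. Averages of a continuous
  \<open>g\<close> over short intervals are such functions and tend to \<open>g\<close>; density of
  continuous functions of compact support then completes the argument.\<close>

lemma du_Bois_Reymond:
  assumes d: "sq_int d" and 0: "\<And>\<phi> \<phi>'. test_fun \<phi> \<phi>' ==> (LBINT x. d x * \<phi> x) = 0"
  shows "AE x in lborel. d x = 0"
proof -
  note [measurable] = sq_int_measurable[OF d]
  have Cc: "(LBINT x. d x * g x) = 0"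
    if g: "continuous_on UNIV g" "\<And>x. \<bar>g x\<bar> <= B" "\<And>x. \<bar>x\<bar> > R ==> g x = 0" for g :: "real => real" and B R
  proof -
    have B: "0 <= B" using g(2)[of 0] by linarith
    have [measurable]: "g \<in> meas" using g(1) by (rule borel_measurable_continuous_onI)
    obtain G where G: "\<And>x. (G has_real_derivative g x) (at x)"
    proof -
      have "\<exists>F. \<forall>x::real. (-\<infinity>) < ereal x \<longrightarrow> ereal x < \<infinity> \<longrightarrow> (F has_vector_derivative g x) (at x)"
        using g(1) by (intro einterval_antiderivative) (auto simp: continuous_on_eq_continuous_at)
      then show thesis using that by (auto simp: has_real_derivative_iff_has_vector_derivative)
    qed
    define e where "e n = 1 / (real n + 1)" for n
    have e: "0 < e n" "e n <= 1" for n by (auto simp: e_def)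
    \<comment> \<open>The mean of \<open>g\<close> over an interval of length
      \<open>e n <= 1\<close>, so the support grows by at most 1 and the bound \<open>B\<close> is
      kept.\<close>
    define p where "p n x = (G (x + e n) - G x) / e n" for n x
    have pz: "\<exists>z. x < z \<and> z < x + e n \<and> p n x = g z" for n x
    proof -
      from MVT2[of x "x + e n" G g] G e(1)[of n] obtain z where "x < z" "z < x + e n" "G (x + e n) - G x = (x + e n - x) * g z" by auto
      then show ?thesis using e(1)[of n] by (auto simp: p_def intro!: exI[of _ z])
    qed
    have pB: "\<bar>p n x\<bar> <= B" for n x using pz[of x n] g(2) by auto
    have p0: "p n x = 0" if "\<bar>x\<bar> > \<bar>R\<bar> + 1" for n x
    proof -
      obtain z where z: "x < z" "z < x + e n" "p n x = g z" using pz by blast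
      then have "\<bar>z\<bar> > R" using e(2)[of n] that by linarith
      then show ?thesis using z g(3) by simp
    qed
    have tf: "test_fun (p n) (\<lambda>x. (g (x + e n) - g x) / e n)" for n
      unfolding test_fun_def
    proof (intro conjI allI)
      fix x
      have "((\<lambda>x. G (x + e n)) has_real_derivative g (x + e n)) (at x)"
        using G[of "x + e n"] by (simp add: DERIV_shift)
      then show "(p n has_real_derivative (g (x + e n) - g x) / e n) (at x)"
        unfolding p_def[abs_def] by (intro DERIV_cdivide DERIV_diff G)
    next
      show "continuous_on UNIV (\<lambda>x. (g (x + e n) - g x) / e n)"
        using e(1)[of n] by (intro continuous_intros g(1) continuous_on_compose2[OF g(1)]) auto
      show "\<exists>R. \<forall>x. R < \<bar>x\<bar> \<longrightarrow> p n x = 0" using p0 by blast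
    qed
    have pm[measurable]: "p n \<in> meas" for n
      using tf[of n] unfolding test_fun_def
      by (intro borel_measurable_continuous_onI continuous_at_imp_continuous_on ballI) (blast intro: DERIV_isCont)
    have di: "integrable lborel (\<lambda>x. trn d (\<bar>R\<bar> + 1) x)"
      using integrable_Re[OF trn_integrable[OF d, of "\<bar>R\<bar> + 1"]] by simp
    have elim: "e \<longlonglongrightarrow> 0" using LIMSEQ_inverse_real_of_nat unfolding e_def[abs_def] by (simp add: inverse_eq_divide add.commute)
    have "(\<lambda>n. \<integral>x. d x * p n x \<partial>lborel) \<longlonglongrightarrow> (LBINT x. d x * g x)"
    proof (rule Bochner_Integration.integral_dominated_convergence[where w = "\<lambda>x. B * \<bar>trn d (\<bar>R\<bar> + 1) x\<bar>"])
      show "integrable lborel (\<lambda>x. B * \<bar>trn d (\<bar>R\<bar> + 1) x\<bar>)" using di by auto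
      show "AE x in lborel. norm (d x * p n x) <= B * \<bar>trn d (\<bar>R\<bar> + 1) x\<bar>" for n
      proof (rule AE_I2)
        fix x show "norm (d x * p n x) <= B * \<bar>trn d (\<bar>R\<bar> + 1) x\<bar>"
        proof (cases "\<bar>x\<bar> > \<bar>R\<bar> + 1")
          case True then show ?thesis using B by (simp add: p0)
        next
          case False
          then have "trn d (\<bar>R\<bar> + 1) x = d x" by (auto simp: trn_def indicator_def)
          then show ?thesis using mult_right_mono[OF pB[of n x], of "\<bar>d x\<bar>"] by (simp add: abs_mult mult.commute)
        qed
      qed
      show "AE x in lborel. (\<lambda>n. d x * p n x) \<longlonglongrightarrow> d x * g x"
      proof (intro AE_I2 tendsto_mult tendsto_const)
        fix x
        obtain z where z: "\<And>n. x < z n \<and> z n < x + e n \<and> p n x = g (z n)" using pz[of x] by metis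
        have "z \<longlonglongrightarrow> x"
        proof (rule tendsto_sandwich[where f = "\<lambda>_. x" and h = "\<lambda>n. x + e n"])
          show "(\<lambda>n. x + e n) \<longlonglongrightarrow> x" using tendsto_add[OF tendsto_const elim, of x] by simp
          show "\<forall>\<^sub>F n in sequentially. x <= z n" "\<forall>\<^sub>F n in sequentially. z n <= x + e n" using z by (auto intro!: always_eventually less_imp_le)
        qed simp
        moreover have "isCont g x" using g(1) by (simp add: continuous_on_eq_continuous_at)
        ultimately have "(\<lambda>n. g (z n)) \<longlonglongrightarrow> g x" by (rule isCont_tendsto_compose[rotated])
        then show "(\<lambda>n. p n x) \<longlonglongrightarrow> g x" using z by simp
      qed
    qed auto
    then show ?thesis using 0[OF tf] by (simp add: LIMSEQ_const_iff)
  qed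
  have "(LBINT x. (trn d (real n) x)^2) = 0" for n
  proof -
    let ?u = "trn d (real n)"
    let ?D = "LBINT x. (d x)^2"
    have us: "sq_int ?u" by (rule sq_int_trn[OF d])
    \<comment> \<open>Since \<open>d\<close> is orthogonal to the real part of \<open>g\<close>, the
      integral of \<open>?u\<close> squared equals that of \<open>d\<close> times
      \<open>?u - Re g\<close>, and Cauchy-Schwarz makes it small.\<close>
    have b: "(LBINT x. (?u x)^2)^2 <= ?D * a" if a: "a > 0" for a
    proof -
      obtain g B where g: "continuous_on UNIV g" "\<And>x. cmod (g x) <= B" "\<And>x. \<bar>x\<bar> > real n + 1 ==> g x = 0" "csq_int g"
        "(LBINT x. (cmod (cx (?u x) - g x))^2) <= a"
        by (rule Cc_dense[OF sq_int_csq[OF us] _ a, of "real n"]) (auto simp: trn_0)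
      have gz: "(LBINT x. d x * Re (g x)) = 0"
        by (rule Cc[where B = B and R = "real n + 1"]) (use g in \<open>auto intro!: continuous_intros order_trans[OF abs_Re_le_cmod]\<close>)
      have gsq: "sq_int (\<lambda>x. Re (g x))"
      proof (rule csq_sq_int, rule csq_int_bound)
        show "integrable lborel (\<lambda>x. (cmod (g x))^2)" using g(4) by (simp add: csq_int_def)
        show "(\<lambda>x. cx (Re (g x))) \<in> borel_measurable lborel"
          using g(1) by (auto intro!: borel_measurable_continuous_onI continuous_intros)
        show "(cmod (cx (Re (g x))))^2 <= (cmod (g x))^2" for x
          unfolding norm_of_real by (intro power_mono abs_Re_le_cmod) auto
      qed
      have dd: "csq_int (\<lambda>x. cx (?u x - Re (g x)))" by (intro sq_int_csq sq_int_diff us gsq)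
      have "(LBINT x. (?u x)^2) = (LBINT x. d x * ?u x)"
        by (intro Bochner_Integration.integral_cong refl) (auto simp: trn_def indicator_def power2_eq_square)
      also have "... = (LBINT x. d x * (?u x - Re (g x)))"
        using gz sq_int_mult_integrable[OF d us] sq_int_mult_integrable[OF d gsq] by (simp add: right_diff_distrib)
      finally have e: "cx (LBINT x. (?u x)^2) = (LBINT x. cx (d x) * cx (?u x - Re (g x)))"
        by (simp only: of_real_mult[symmetric] integral_complex_of_real)
      have "(LBINT x. (?u x)^2)^2 = (cmod (cx (LBINT x. (?u x)^2)))^2" by simp
      also have "... <= (LBINT x. (cmod (cx (d x)))^2) * (LBINT x. (cmod (cx (?u x - Re (g x))))^2)"
        unfolding e by (rule csq_Cauchy_Schwarz[OF sq_int_csq[OF d] dd])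
      also have "... <= ?D * a"
      proof (intro mult_mono)
        have "(LBINT x. (cmod (cx (?u x - Re (g x))))^2) <= (LBINT x. (cmod (cx (?u x) - g x))^2)"
        proof (rule integral_mono)
          show "integrable lborel (\<lambda>x. (cmod (cx (?u x - Re (g x))))^2)" using dd by (simp add: csq_int_def)
          show "integrable lborel (\<lambda>x. (cmod (cx (?u x) - g x))^2)" using csq_int_diff[OF sq_int_csq[OF us] g(4)] by (simp add: csq_int_def)
          show "(cmod (cx (?u x - Re (g x))))^2 <= (cmod (cx (?u x) - g x))^2" for x
            unfolding norm_of_real using abs_Re_le_cmod[of "cx (?u x) - g x"] by (intro power_mono) auto
        qed
        then show "(LBINT x. (cmod (cx (?u x - Re (g x))))^2) <= a" using g(5) by linarith
      qed auto
      finally show ?thesis .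
    qed
    have "(LBINT x. (?u x)^2)^2 <= 0"
    proof (rule field_le_epsilon)
      fix c :: real assume c: "c > 0"
      have D0: "?D \<ge> 0" by (rule integral_nonneg_AE) simp
      have "?D / (?D + 1) <= 1" by (rule divide_le_eq_1_pos[THEN iffD2]) (use D0 in linarith)+
      then have "c * (?D / (?D + 1)) <= c * 1" using c by (intro mult_left_mono) auto
      then have "?D * (c / (?D + 1)) <= c" by (simp add: mult.commute)
      then show "(LBINT x. (?u x)^2)^2 <= 0 + c" using b[of "c / (?D + 1)"] c D0 by auto
    qed
    then show ?thesis by simp
  qed
  then have "AE x in lborel. (trn d (real n) x)^2 = 0" for n
    using sq_int_trn[OF d, of "real n"] by (subst integral_nonneg_eq_0_iff_AE[symmetric]) (auto simp: sq_int_def)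
  then have "AE x in lborel. \<forall>n. (trn d (real n) x)^2 = 0" by (simp add: AE_all_countable)
  then show ?thesis
  proof eventually_elim
    case (elim x)
    obtain n where "\<bar>x\<bar> <= real n" using real_arch_simple by blast
    then have "trn d (real n) x = d x" by (auto simp: trn_def indicator_def)
    then show ?case using elim[rule_format, of n] by simp
  qed
qed

section \<open>Products and the change of unknown\<close>

text \<open>\<open>is_solution\<close> states differentiability through difference quotients in
  norm; this is the translation.\<close>

lemma has_vector_derivative_iff_quotient:
  "(f has_vector_derivative D) (at t within S) \<longleftrightarrow> ((\<lambda>y. (1 / (y - t)) *\<^sub>R (f y - f t)) \<longlongrightarrow> D) (at t within S)"
proof -
  have ne: "\<forall>\<^sub>F y in at t within S. y \<noteq> t" by (simp add: eventually_at_filter)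
  have e: "norm (f y - f t - (y - t) *\<^sub>R D) / norm (y - t) = norm ((1 / (y - t)) *\<^sub>R (f y - f t) - D)" if "y \<noteq> t" for y
  proof -
    have "(1 / (y - t)) *\<^sub>R (f y - f t) - D = (1 / (y - t)) *\<^sub>R (f y - f t - (y - t) *\<^sub>R D)"
      using that by (simp add: scaleR_diff_right)
    then show ?thesis by (simp add: divide_inverse mult.commute)
  qed
  have "(f has_vector_derivative D) (at t within S) \<longleftrightarrow> ((\<lambda>y. norm (f y - f t - (y - t) *\<^sub>R D) / norm (y - t)) \<longlongrightarrow> 0) (at t within S)"
    unfolding has_vector_derivative_def has_derivative_iff_norm by (simp add: bounded_linear_scaleR_left)
  also have "... \<longleftrightarrow> ((\<lambda>y. norm ((1 / (y - t)) *\<^sub>R (f y - f t) - D)) \<longlongrightarrow> 0) (at t within S)"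
    by (rule filterlim_cong[OF refl refl]) (rule eventually_mono[OF ne], rule e)
  also have "... \<longleftrightarrow> ((\<lambda>y. (1 / (y - t)) *\<^sub>R (f y - f t)) \<longlongrightarrow> D) (at t within S)"
    by (simp add: tendsto_norm_zero_iff LIM_zero_iff)
  finally show ?thesis .
qed

lemma norm_Pair_mono:
  assumes "norm a' <= c * norm a" "norm b' <= c * norm b" "0 <= c"
  shows "norm (a', b') <= c * norm (a, b)"
proof -
  have "(norm a')^2 + (norm b')^2 <= (c * norm a)^2 + (c * norm b)^2" using assms by (intro add_mono power_mono) auto
  also have "... = c^2 * ((norm a)^2 + (norm b)^2)" by (simp add: power_mult_distrib ring_distribs)
  finally have "sqrt ((norm a')^2 + (norm b')^2) <= sqrt (c^2 * ((norm a)^2 + (norm b)^2))" by (rule real_sqrt_le_mono)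
  then show ?thesis using assms(3) by (simp add: norm_Pair real_sqrt_mult)
qed

context sob
begin

lemma kern_of_real:
  assumes "(\<lambda>(u, v). r u v) \<in> meas2" "\<And>u v. r (- u) (- v) = r u v"
    "\<And>u v. \<bar>r u v\<bar> <= K * (J (u - v) + J v)" "K \<ge> 0"
  shows "kern K (\<lambda>u v. cx (r u v))"
  unfolding kern_def
proof (intro conjI allI)
  have "(\<lambda>p. cx ((\<lambda>(u, v). r u v) p)) \<in> meas2" using assms(1) by measurable
  then show "(\<lambda>(u, v). cx (r u v)) \<in> meas2" by (simp add: case_prod_beta')
  fix u v :: real
  show "cx (r (- u) (- v)) = cnj (cx (r u v))" by (simp add: assms(2))
  have "K * (J (u - v) + J v) <= K * (J (u - v) + J v + J u)" using assms(4) by (intro mult_left_mono) auto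
  then show "cmod (cx (r u v)) <= K * (J (u - v) + J v + J u)" using assms(3)[of u v] by simp
qed

lemma Mul_bil_cong:
  assumes "kern K k" "bsym A a" "bsym B b" "bsym M m" "kern K' k'" "bsym A' a'" "bsym B' b'" "bsym M' m'"
    "\<And>u v. m u * k u v * a (u - v) * b v = m' u * k' u v * a' (u - v) * b' v"
  shows "Mul m (bil k (Mul a x) (Mul b y)) = Mul m' (bil k' (Mul a' x) (Mul b' y))"
  unfolding Mul_bil_Mul[OF assms(1-4)] Mul_bil_Mul[OF assms(5-8)] assms(9) ..

end

lemma bsym_one: "bsym 1 (\<lambda>_. 1)" by (simp add: bsym_def)

section \<open>Calculus of products and passage between q and the surface elevation\<close>

context wb
begin

definition km :: "real => real => real" where "km u v = kap * sig u / (sig (u - v) * sig v)"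
definition km1 :: "real => real => real" where "km1 u v = km u v * jbr v / jbr u"

lemma km_measurable [measurable]: "(\<lambda>(u, v). km u v) \<in> meas2"
  "(\<lambda>(u, v). km1 u v) \<in> meas2"
  unfolding km1_def[abs_def] km_def[abs_def] by measurable

lemma km_minus: "km (- u) (- v) = km u v" "km1 (- u) (- v) = km1 u v"
  unfolding km1_def km_def diff_minus_minus sig_minus jbr_minus by simp_all

lemma kern_km: "kern (2 ^ NK) (\<lambda>u v. cx (km u v))"
proof (rule kern_of_real)
  fix u v :: real
  have p: "0 < sig (u - v)" "0 < sig v" by simp_all
  have sl: "slow NK sig" by (rule slow_mono_exp[OF slow_sig]) (unfold NK_def, rule le_add1)
  have "\<bar>km u v\<bar> = kap * (sig u / (sig (u - v) * sig v))" unfolding km_def using kap(1) by simp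
  also have "... <= 1 * ((2 ^ NK * (sig (u - v) + sig v)) / (sig (u - v) * sig v))"
    using kap slow_sum[OF sl, of u v] by (intro mult_mono divide_right_mono) auto
  also have "... = 2 ^ NK * (1 / sig (u - v) + 1 / sig v)" using p by (simp add: field_simps)
  also have "... <= 2 ^ NK * (J (u - v) + J v)" by (intro mult_left_mono add_mono one_div_sig_le) auto
  finally show "\<bar>km u v\<bar> <= 2 ^ NK * (J (u - v) + J v)" .
qed (auto simp: km_minus)

lemma kern_km1: "kern (2 ^ NK) (\<lambda>u v. cx (km1 u v))"
proof (rule kern_of_real)
  fix u v :: real
  define w where "w x = jbr x powr (s - 1)" for x
  have w: "0 < w x" for x by (simp add: w_def)
  have sw: "sig x = jbr x * w x" for x by (simp add: sig_powr w_def)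
  have wJ: "1 / w x = J x" for x using w[of x] by (simp add: jbr_div_sig[symmetric] sw)
  have "\<bar>km1 u v\<bar> = kap * (w u / (sig (u - v) * w v))"
    unfolding km1_def km_def sw[of u] sw[of v] using kap(1) w[of u] w[of v] by (simp add: abs_mult)
  also have "... <= 1 * ((2 ^ NK * (w (u - v) + w v)) / (sig (u - v) * w v))"
    using kap slow_sum[OF slow_sm1, of u v] w by (intro mult_mono divide_right_mono) (auto simp: w_def)
  also have "... = 2 ^ NK * (1 / sig (u - v) + (w (u - v) / sig (u - v)) * (1 / w v))" using w[of v] by (simp add: field_simps)
  also have "... <= 2 ^ NK * (J (u - v) + 1 * J v)"
  proof (intro mult_left_mono add_mono mult_mono one_div_sig_le)
    show "w (u - v) / sig (u - v) <= 1" using w[of "u - v"] jbr_ge_1[of "u - v"] by (simp add: sw)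
  qed (use w[of v] in \<open>auto simp: wJ\<close>)
  finally show "\<bar>km1 u v\<bar> <= 2 ^ NK * (J (u - v) + J v)" by simp
qed (auto simp: km_minus)

text \<open>Multiplication of physical functions on the Fourier side: \<open>pr\<close> for two factors represented at
  level \<open>s\<close>, \<open>pr1\<close> for a second factor (and product) represented at level \<open>s - 1\<close>.\<close>

definition pr :: "h => h => h" where "pr = bil (\<lambda>u v. cx (km u v))"
definition pr1 :: "h => h => h" where "pr1 = bil (\<lambda>u v. cx (km1 u v))"
text \<open>The symbol of minus d/dx, divided by \<open>jbr\<close>, so that \<open>Dx\<close> maps
  a representation at level \<open>s\<close> to one at level \<open>s - 1\<close>. The minus sign is
  the one of the equations.\<close>

definition dsym :: "real => complex" where "dsym u = - \<i> * cx (u / jbr u)"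
definition Dx :: "h => h" where "Dx = Mul dsym"
definition Li :: "real => real" where "Li t = 1 / Lam t"
definition iL :: "h => h" where "iL = rM Li"
text \<open>In the unknown G the term v v_x carries the unbounded factor \<open>Lam\<close> outside,
  so it is not a composition of \<open>pr1\<close>, \<open>Dx\<close> and \<open>iL\<close>; it
  stays a kernel operator and is identified only after applying \<open>iL\<close>.\<close>

definition R4 :: "h => h" where "R4 G = bil (ik (\<lambda>u v. r4 u v / jbr u)) G G"
definition KA :: real where "KA = 2 ^ NK * CJ + 1"

lemma KA: "1 <= KA" "0 < KA" by (auto simp: KA_def add_nonneg_pos)

lemma bsym_dsym: "bsym 1 dsym"
  unfolding bsym_def
proof (intro conjI allI)
  show "dsym \<in> meas" unfolding dsym_def[abs_def] by measurable
  show "dsym (- x) = cnj (dsym x)" for x by (simp add: dsym_def)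
  show "cmod (dsym x) <= 1" for x using abs_le_jbr[of x] by (simp add: dsym_def norm_mult norm_divide)
qed

lemma rsym_Li: "rsym 1 Li"
  unfolding rsym_def Li_def[abs_def] using Lam_ge_1 by (auto simp: abs_le_iff)

lemmas bsym_Li = rsym_bsym[OF rsym_Li] and bsym_Ji = rsym_bsym[OF rsym_Ji] and bsym_J = rsym_bsym[OF rsym_J] and bsym_Sg = rsym_bsym[OF rsym_Sg]

lemma bilinear_pr: "bounded_bilinear pr" unfolding pr_def by (rule bounded_bilinear_bil[OF kern_km])
lemma bilinear_pr1: "bounded_bilinear pr1" unfolding pr1_def by (rule bounded_bilinear_bil[OF kern_km1])
lemma linear_Dx: "bounded_linear Dx" unfolding Dx_def by (rule bounded_linear_Mul[OF bsym_dsym])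
lemma linear_iL: "bounded_linear iL" unfolding iL_def by (rule bounded_linear_rM[OF rsym_Li])
lemma linear_Ji: "bounded_linear (rM Ji)" by (rule bounded_linear_rM[OF rsym_Ji])

lemma norm_pr: "norm (pr x y) <= KA * norm x * norm y" and norm_pr1: "norm (pr1 x y) <= KA * norm x * norm y"
proof -
  have "2 ^ NK * CJ * norm x * norm y <= KA * norm x * norm y" by (intro mult_right_mono) (auto simp: KA_def)
  then show "norm (pr x y) <= KA * norm x * norm y" "norm (pr1 x y) <= KA * norm x * norm y"
    unfolding pr_def pr1_def using norm_bil_le[OF kern_km, of x y] norm_bil_le[OF kern_km1, of x y] by linarith+
qed

lemma pr_commute: "pr x y = pr y x"
  unfolding pr_def bil_swap[OF kern_km, of x y]
  by (rule arg_cong2[of _ _ _ _ "\<lambda>k z. bil k z x"]) (auto simp: km_def fun_eq_iff mult.commute)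

lemma Ji_pr: "rM Ji (pr x y) = pr1 x (rM Ji y)"
  using Mul_bil_cong[OF kern_km bsym_one bsym_one bsym_Ji kern_km1 bsym_one bsym_Ji bsym_one, of x y]
  by (simp add: Mul_one rM_def pr_def pr1_def km1_def Ji_def)

lemma J_pr1: "rM J (pr1 x y) = bil kc x (rM J y)"
  using Mul_bil_cong[OF kern_km1 bsym_one bsym_one bsym_J kern_kc bsym_one bsym_J bsym_one, of x y]
  by (simp add: Mul_one rM_def pr1_def km1_def km_def kc_def Sg_def jbr_div_sig[symmetric] mult_ac)

lemma Sg_pr: "rM Sg (pr x y) = bil kc x (rM Sg y)"
  using Mul_bil_cong[OF kern_km bsym_one bsym_one bsym_Sg kern_kc bsym_one bsym_Sg bsym_one, of x y]
  by (simp add: Mul_one rM_def pr_def km_def kc_def Sg_def mult_ac)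

lemma isF_pr: "isF f (rM Sg x) ==> isF u (rM Sg y) ==> isF (\<lambda>t. f t * u t) (rM Sg (pr x y))"
  unfolding Sg_pr by (rule convolution)

lemma isF_pr1: "isF f (rM Sg x) ==> isF u (rM J y) ==> isF (\<lambda>t. f t * u t) (rM J (pr1 x y))"
  unfolding J_pr1 by (rule convolution)

lemma rM_J_inj: assumes "rM J x = rM J y" shows "x = y"
proof -
  have "rM J (x - y) = 0" using assms bounded_linear_rM[OF rsym_J] by (simp add: linear_simps)
  then have "x - y = 0" unfolding rM_def by (rule Mul_eq_0_iff[OF bsym_J, rotated]) (metis J_pos less_irrefl of_real_eq_0_iff)
  then show ?thesis by simp
qed

lemma iL_inj: assumes "iL x = iL y" shows "x = y"
proof -
  have "iL (x - y) = 0" using assms linear_iL by (simp add: linear_simps)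
  then have "x - y = 0" unfolding iL_def rM_def by (rule Mul_eq_0_iff[OF bsym_Li, rotated]) (simp add: Li_def)
  then show ?thesis by simp
qed

text \<open>On kernels this would be a triple integral. Surjectivity of the Fourier transform
  reduces it to associativity of pointwise multiplication of functions.\<close>

lemma pr1_assoc: "pr1 x (pr1 y z) = pr1 (pr x y) z"
proof (rule rM_J_inj)
  obtain f1 where f1: "isF f1 (rM Sg x)" by (rule isF_surj)
  obtain f2 where f2: "isF f2 (rM Sg y)" by (rule isF_surj)
  obtain u where u: "isF u (rM J z)" by (rule isF_surj)
  show "rM J (pr1 x (pr1 y z)) = rM J (pr1 (pr x y) z)"
    using isF_unique[OF isF_pr1[OF f1 isF_pr1[OF f2 u]]] isF_pr1[OF isF_pr[OF f1 f2] u] by (simp add: mult.assoc)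
qed

lemma pr1_left_commute: "pr1 x (pr1 y z) = pr1 y (pr1 x z)"
  unfolding pr1_assoc pr_commute[of x y] ..

lemma pr1_Dx: "pr1 x (Dx y) = bil (\<lambda>u v. 1 * cx (km1 u v) * 1 * dsym v) x y"
  using Mul_bil_Mul[OF kern_km1 bsym_one bsym_dsym bsym_one, of x y] by (simp add: Mul_one pr1_def Dx_def)

text \<open>On symbols the product rule is v + (u - v) = u.\<close>

lemma Leibniz: "Dx (pr x y) = pr1 x (Dx y) + pr1 y (Dx x)"
proof -
  note k = kern_Mul[OF kern_km1 bsym_one bsym_dsym bsym_one]
  have "pr1 y (Dx x) = bil (\<lambda>u v. 1 * cx (km1 u (u - v)) * 1 * dsym (u - v)) x y"
    unfolding pr1_Dx by (rule bil_swap[OF k])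
  then have "pr1 x (Dx y) + pr1 y (Dx x) = bil (\<lambda>u v. 1 * cx (km1 u v) * 1 * dsym v + 1 * cx (km1 u (u - v)) * 1 * dsym (u - v)) x y"
    unfolding pr1_Dx[of x y] by (simp only: bil_kernel_add[OF k kern_swap[OF k]])
  also have "... = bil (\<lambda>u v. dsym u * cx (km u v) * 1 * 1) x y"
  proof (rule arg_cong[of _ _ "\<lambda>k. bil k x y"], intro ext)
    fix u v :: real
    have s: "km u (u - v) = km u v" by (simp add: km_def mult.commute)
    have e: "km1 u v * (v / jbr v) + km1 u (u - v) * ((u - v) / jbr (u - v)) = u / jbr u * km u v"
      unfolding km1_def s by (simp add: field_simps)
    show "1 * cx (km1 u v) * 1 * dsym v + 1 * cx (km1 u (u - v)) * 1 * dsym (u - v) = dsym u * cx (km u v) * 1 * 1"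
      using arg_cong[OF e, of "\<lambda>z. - \<i> * cx z"] unfolding dsym_def by (simp add: mult_ac distrib_left)
  qed
  also have "... = Dx (pr x y)"
    using Mul_bil_Mul[OF kern_km bsym_one bsym_one bsym_dsym, of x y] by (simp add: Mul_one pr_def Dx_def)
  finally show ?thesis ..
qed

lemma Lsym_iL: "Mul Lsym x = Dx (iL x)" "Mul Lsym x = iL (Dx x)"
proof -
  have e: "dsym t * cx (Li t) = Lsym t" "cx (Li t) * dsym t = Lsym t" for t by (simp_all add: Lsym_def dsym_def Li_def)
  show "Mul Lsym x = Dx (iL x)" unfolding Dx_def iL_def rM_def Mul_Mul[OF bsym_dsym bsym_Li] e ..
  show "Mul Lsym x = iL (Dx x)" unfolding Dx_def iL_def rM_def Mul_Mul[OF bsym_Li bsym_dsym] e ..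
qed

text \<open>A dictionary from the kernels, on which the estimates were made, to products and
  derivatives, in which the change of unknown is computed.\<close>

lemma B_terms:
  "bil (ik (\<lambda>u v. r1 u v / jbr u)) x y = (1/2) *\<^sub>R pr1 x (Dx (iL y))"
  "bil (ik (\<lambda>u v. r2 u v / jbr u)) x y = pr1 (iL x) (Dx y)"
  "bil (ik (\<lambda>u v. r3 u v / jbr u)) x y = (1/2) *\<^sub>R iL (pr1 x (Dx y))"
  "iL (bil (ik (\<lambda>u v. r4 u v / jbr u)) x y) = pr1 (iL x) (Dx (iL y))"
proof -
  have k2: "kern (\<bar>1/2\<bar> * 2 ^ NK) (\<lambda>u v. cx (1/2) * cx (km1 u v))" by (rule kern_scale[OF kern_km1])
  have h: "(1/2) *\<^sub>R pr1 x y = bil (\<lambda>u v. cx (1/2) * cx (km1 u v)) x y" for x y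
    unfolding pr1_def by (rule bil_kernel_scale[OF kern_km1, symmetric])
  have L: "Mul Lsym x = Dx (iL x)" for x by (rule Lsym_iL(1))
  have "Mul (\<lambda>_. 1) (bil (ik (\<lambda>u v. r1 u v / jbr u)) (Mul (\<lambda>_. 1) x) (Mul (\<lambda>_. 1) y))
    = Mul (\<lambda>_. 1) (bil (\<lambda>u v. cx (1/2) * cx (km1 u v)) (Mul (\<lambda>_. 1) x) (Mul Lsym y))"
    by (rule Mul_bil_cong[OF kern_r1 bsym_one bsym_one bsym_one k2 bsym_one bsym_Lsym bsym_one])
      (simp add: ik_def r1_def g_def km1_def km_def Lsym_def mult_ac)
  then show "bil (ik (\<lambda>u v. r1 u v / jbr u)) x y = (1/2) *\<^sub>R pr1 x (Dx (iL y))" unfolding Mul_one h[symmetric] L .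
  have "Mul (\<lambda>_. 1) (bil (ik (\<lambda>u v. r2 u v / jbr u)) (Mul (\<lambda>_. 1) x) (Mul (\<lambda>_. 1) y))
    = Mul (\<lambda>_. 1) (bil (\<lambda>u v. cx (km1 u v)) (Mul (\<lambda>t. cx (Li t)) x) (Mul dsym y))"
    by (rule Mul_bil_cong[OF kern_r2 bsym_one bsym_one bsym_one kern_km1 bsym_Li bsym_dsym bsym_one])
      (simp add: ik_def r2_def g_def km1_def km_def dsym_def Li_def mult_ac)
  then show "bil (ik (\<lambda>u v. r2 u v / jbr u)) x y = pr1 (iL x) (Dx y)" unfolding Mul_one pr1_def iL_def rM_def Dx_def .
  have "Mul (\<lambda>_. 1) (bil (ik (\<lambda>u v. r3 u v / jbr u)) (Mul (\<lambda>_. 1) x) (Mul (\<lambda>_. 1) y))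
    = Mul (\<lambda>t. cx (Li t)) (bil (\<lambda>u v. cx (1/2) * cx (km1 u v)) (Mul (\<lambda>_. 1) x) (Mul dsym y))"
    by (rule Mul_bil_cong[OF kern_r3 bsym_one bsym_one bsym_one k2 bsym_one bsym_dsym bsym_Li])
      (simp add: ik_def r3_def g_def km1_def km_def dsym_def Li_def mult_ac)
  then have "bil (ik (\<lambda>u v. r3 u v / jbr u)) x y = iL ((1/2) *\<^sub>R pr1 x (Dx y))" unfolding Mul_one h Dx_def iL_def rM_def .
  then show "bil (ik (\<lambda>u v. r3 u v / jbr u)) x y = (1/2) *\<^sub>R iL (pr1 x (Dx y))" using linear_iL by (simp add: linear_simps)
  have "Mul (\<lambda>t. cx (Li t)) (bil (ik (\<lambda>u v. r4 u v / jbr u)) (Mul (\<lambda>_. 1) x) (Mul (\<lambda>_. 1) y))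
    = Mul (\<lambda>_. 1) (bil (\<lambda>u v. cx (km1 u v)) (Mul (\<lambda>t. cx (Li t)) x) (Mul Lsym y))"
    by (rule Mul_bil_cong[OF kern_r4 bsym_one bsym_one bsym_Li kern_km1 bsym_Li bsym_Lsym bsym_one])
      (simp add: ik_def r4_def g_def km1_def km_def Lsym_def Li_def mult_ac)
  then show "iL (bil (ik (\<lambda>u v. r4 u v / jbr u)) x y) = pr1 (iL x) (Dx (iL y))" unfolding Mul_one pr1_def[symmetric] L unfolding iL_def rM_def .
qed

definition ph :: "h => h" where "ph Q = Q + (1/4) *\<^sub>R pr Q Q"
definition tz :: "h \<times> h => h \<times> h" where "tz X = (ph (fst X), snd X)"
text \<open>The right hand side of the original system with \<epsilon> = 1 in the unknowns (sig
  \<zeta>, sig Lam v), again divided by \<open>jbr\<close>.\<close>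

definition zop :: "h \<times> h => h \<times> h" where
  "zop W = (Dx (iL (snd W) + pr (iL (snd W)) (fst W)), iL (Dx (fst W)) + R4 (snd W))"

lemma iL_R4: "iL (R4 G) = (1/2) *\<^sub>R Dx (pr (iL G) (iL G))"
  unfolding R4_def B_terms Leibniz by (simp add: scaleR_2[symmetric])

text \<open>With \<open>\<zeta> = q + q^2/4\<close> one has \<open>\<zeta>\<^sub>q = 1 + q/2\<close> and \<open>1 + \<zeta> = (1 + q/2)^2\<close>.\<close>

lemma zop_tz:
  "fst (zop (tz X)) = fst (Zop X) + (1/2) *\<^sub>R pr1 (fst X) (fst (Zop X))" "snd (zop (tz X)) = snd (Zop X)"
proof -
  interpret p: bounded_bilinear pr by (rule bilinear_pr)
  interpret q: bounded_bilinear pr1 by (rule bilinear_pr1)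
  obtain Q G where X: "X = (Q, G)" by (cases X)
  note lin = linear_simps(1)[OF linear_Dx] linear_simps(5)[OF linear_Dx] linear_simps(1)[OF linear_iL] linear_simps(5)[OF linear_iL]
  let ?g = "iL G"
  have Z: "fst (Zop X) = Dx ?g + ((1/2) *\<^sub>R pr1 Q (Dx ?g) + pr1 ?g (Dx Q))"
    unfolding X Zop_def Lop_def Bop_def by (simp add: B_terms Lsym_iL(1))
  show "fst (zop (tz X)) = fst (Zop X) + (1/2) *\<^sub>R pr1 (fst X) (fst (Zop X))"
    unfolding Z unfolding X zop_def tz_def ph_def
    by (simp add: lin p.add_right p.scaleR_right q.add_right q.scaleR_right q.add_left q.scaleR_left Leibniz
        pr1_assoc[symmetric] pr1_left_commute[of ?g Q] scaleR_add_right)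
      (simp add: algebra_simps flip: scaleR_add_left)
  have "Dx (pr Q Q) = 2 *\<^sub>R pr1 Q (Dx Q)" unfolding Leibniz by (simp add: scaleR_2)
  then show "snd (zop (tz X)) = snd (Zop X)"
    unfolding X Zop_def Lop_def Bop_def zop_def tz_def ph_def R4_def
    by (simp add: B_terms(3) Lsym_iL(2) lin)
qed

lemma ph_diff: "ph x - ph y = (x - y) + (1/4) *\<^sub>R pr (x + y) (x - y)"
proof -
  interpret p: bounded_bilinear pr by (rule bilinear_pr)
  have "pr x x - pr y y = pr (x + y) (x - y)" by (simp add: p.add_left p.diff_right pr_commute[of y x])
  then show ?thesis unfolding ph_def by (simp add: algebra_simps flip: scaleR_diff_right)
qed

lemma pr_small: assumes "norm x <= 1 / KA" "norm y <= 1 / KA" shows "norm ((1/4) *\<^sub>R pr (x + y) z) <= norm z / 2"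
proof -
  have "norm (pr (x + y) z) <= KA * (2 / KA) * norm z"
    using norm_pr[of "x + y" z] norm_triangle_ineq[of x y] assms KA
    by (elim order_trans) (intro mult_right_mono mult_left_mono, auto)
  then show ?thesis using KA by simp
qed

lemma ph_bounds:
  assumes "norm x <= 1 / KA" "norm y <= 1 / KA"
  shows "norm (ph x - ph y) <= 2 * norm (x - y)" "norm (x - y) <= 2 * norm (ph x - ph y)"
proof -
  have s: "norm ((1/4) *\<^sub>R pr (x + y) (x - y)) <= norm (x - y) / 2" by (rule pr_small[OF assms])
  show "norm (ph x - ph y) <= 2 * norm (x - y)" unfolding ph_diff
    using norm_triangle_ineq[of "x - y" "(1/4) *\<^sub>R pr (x + y) (x - y)"] s norm_ge_zero[of "x - y"] by linarith
  show "norm (x - y) <= 2 * norm (ph x - ph y)" unfolding ph_diff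
    using norm_triangle_ineq4[of "(x - y) + (1/4) *\<^sub>R pr (x + y) (x - y)" "(1/4) *\<^sub>R pr (x + y) (x - y)"] s by (simp only: add_diff_cancel_right')
qed

lemma ph_zero [simp]: "ph 0 = 0"
  using bounded_bilinear.zero_left[OF bilinear_pr] by (simp add: ph_def)

text \<open>The inverse is 2 (sqrt (1 + \<zeta>) - 1), obtained here as a fixed point of Q = F -
  Q^2/4, which is a contraction by 1/2 on this ball; no composition estimate in Sobolev spaces is
  required.\<close>

lemma ph_inverse:
  assumes F: "norm F <= 1 / (2 * KA)"
  shows "\<exists>Q. ph Q = F \<and> norm Q <= 2 * norm F"
proof -
  interpret p: bounded_bilinear pr by (rule bilinear_pr)
  let ?S = "cball 0 (2 * norm F) :: h set" and ?f = "\<lambda>Q. F - (1/4) *\<^sub>R pr Q Q"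
  have F2: "2 * norm F <= 1 / KA" using F KA by (simp add: field_simps)
  have le: "norm Q <= 1 / KA" if "Q \<in> ?S" for Q using that F2 by simp
  have maps: "?f ` ?S \<subseteq> ?S"
  proof clarify
    fix Q assume Q: "Q \<in> ?S"
    have "norm ((1/4) *\<^sub>R pr (Q + 0) Q) <= norm Q / 2" using le[OF Q] KA by (intro pr_small) auto
    then have "norm (?f Q) <= 2 * norm F" using norm_triangle_ineq4[of F "(1/4) *\<^sub>R pr Q Q"] Q by simp
    then show "?f Q \<in> ?S" by simp
  qed
  have lip: "dist (?f x) (?f y) <= 1/2 * dist x y" if "x \<in> ?S" "y \<in> ?S" for x y
  proof -
    have e: "?f x - ?f y = - ((ph x - ph y) - (x - y))" by (simp add: ph_def)
    have "norm (?f x - ?f y) = norm ((1/4) *\<^sub>R pr (x + y) (x - y))" unfolding e ph_diff by (simp only: norm_minus_cancel add_diff_cancel_left')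
    then show ?thesis using pr_small[OF le[OF that(1)] le[OF that(2)], of "x - y"] by (simp only: dist_norm)
  qed
  have "\<exists>!Q\<in>?S. ?f Q = Q"
    by (rule Banach_fix[OF complete_eq_closed[THEN iffD2, OF closed_cball] _ _ _ maps lip]) auto
  then obtain Q where "norm Q <= 2 * norm F" "?f Q = Q" by auto
  then show ?thesis by (intro exI[of _ Q]) (simp add: ph_def algebra_simps)
qed

lemma norm_tz_diff:
  assumes "norm X <= 1 / KA" "norm Y <= 1 / KA"
  shows "norm (tz X - tz Y) <= 2 * norm (X - Y)" "norm (X - Y) <= 2 * norm (tz X - tz Y)"
proof -
  have a: "norm (fst X) <= 1 / KA" "norm (fst Y) <= 1 / KA" using assms norm_fst_le'[of X] norm_fst_le'[of Y] by linarith+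
  have e: "tz X - tz Y = (ph (fst X) - ph (fst Y), snd X - snd Y)" "X - Y = (fst X - fst Y, snd X - snd Y)" by (simp_all add: tz_def prod_eq_iff)
  show "norm (tz X - tz Y) <= 2 * norm (X - Y)" "norm (X - Y) <= 2 * norm (tz X - tz Y)"
    unfolding e using ph_bounds[OF a] by (intro norm_Pair_mono; simp)+
qed

lemma tz_zero [simp]: "tz 0 = 0" by (simp add: tz_def zero_prod_def)

definition zsol :: "real => (real => h \<times> h) => bool" where
  "zsol T W \<longleftrightarrow> continuous_on {0..T} W \<and>
     (\<forall>t\<in>{0..T}. ((\<lambda>t. M2 Ji (W t)) has_vector_derivative zop (W t)) (at t within {0..T}))"

lemma has_vector_derivative_M2_iff:
  "((\<lambda>t. M2 Ji (W t)) has_vector_derivative D) (at t within S) \<longleftrightarrow>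
    ((\<lambda>t. rM Ji (fst (W t))) has_vector_derivative fst D) (at t within S) \<and> ((\<lambda>t. rM Ji (snd (W t))) has_vector_derivative snd D) (at t within S)"
proof
  assume a: "((\<lambda>t. M2 Ji (W t)) has_vector_derivative D) (at t within S)"
  show "((\<lambda>t. rM Ji (fst (W t))) has_vector_derivative fst D) (at t within S) \<and> ((\<lambda>t. rM Ji (snd (W t))) has_vector_derivative snd D) (at t within S)"
    using bounded_linear.has_vector_derivative[OF bounded_linear_fst a] bounded_linear.has_vector_derivative[OF bounded_linear_snd a] by simp
next
  assume a: "((\<lambda>t. rM Ji (fst (W t))) has_vector_derivative fst D) (at t within S) \<and> ((\<lambda>t. rM Ji (snd (W t))) has_vector_derivative snd D) (at t within S)"
  show "((\<lambda>t. M2 Ji (W t)) has_vector_derivative D) (at t within S)"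
    using has_vector_derivative_Pair[OF conjunct1[OF a] conjunct2[OF a]] by (simp add: M2_def)
qed

text \<open>The chain rule before the limit: a difference of squares factors, the sum being handled
  at level \<open>s\<close> and the quotient at level \<open>s - 1\<close>, the level at which
  differentiability is available.\<close>

lemma Ji_ph_quotient:
  "(1 / (y - t)) *\<^sub>R (rM Ji (ph a) - rM Ji (ph b)) =
    (1 / (y - t)) *\<^sub>R (rM Ji a - rM Ji b) + (1/4) *\<^sub>R pr1 (a + b) ((1 / (y - t)) *\<^sub>R (rM Ji a - rM Ji b))"
proof -
  interpret q: bounded_bilinear pr1 by (rule bilinear_pr1)
  note l = linear_Ji
  have "rM Ji (ph a) - rM Ji (ph b) = rM Ji (ph a - ph b)" using l by (simp add: linear_simps)
  also have "... = rM Ji a - rM Ji b + (1/4) *\<^sub>R pr1 (a + b) (rM Ji a - rM Ji b)"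
    unfolding ph_diff using l by (simp add: linear_simps Ji_pr)
  finally show ?thesis by (simp add: scaleR_add_right q.scaleR_right)
qed

lemma continuous_tz: "continuous_on A X ==> continuous_on A (\<lambda>t. tz (X t))"
  unfolding tz_def ph_def by (intro continuous_intros bounded_bilinear.continuous_on[OF bilinear_pr])

lemma sol_zsol: assumes X: "sol T X" shows "zsol T (\<lambda>t. tz (X t))"
  unfolding zsol_def
proof (intro conjI ballI)
  interpret q: bounded_bilinear pr1 by (rule bilinear_pr1)
  have c: "continuous_on {0..T} X" using X by (simp add: sol_def)
  then show "continuous_on {0..T} (\<lambda>t. tz (X t))" by (rule continuous_tz)
  fix t assume t: "t \<in> {0..T}"
  have d: "((\<lambda>t. rM Ji (fst (X t))) has_vector_derivative fst (Zop (X t))) (at t within {0..T})"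
    "((\<lambda>t. rM Ji (snd (X t))) has_vector_derivative snd (Zop (X t))) (at t within {0..T})"
    using X t unfolding sol_def has_vector_derivative_M2_iff by auto
  have ct: "((\<lambda>y. fst (X y)) \<longlongrightarrow> fst (X t)) (at t within {0..T})" using c t by (intro tendsto_fst) (simp add: continuous_on_def)
  have "((\<lambda>t. rM Ji (ph (fst (X t)))) has_vector_derivative fst (zop (tz (X t)))) (at t within {0..T})"
    unfolding has_vector_derivative_iff_quotient Ji_ph_quotient
  proof -
    have lim: "((\<lambda>y. (1 / (y - t)) *\<^sub>R (rM Ji (fst (X y)) - rM Ji (fst (X t)))) \<longlongrightarrow> fst (Zop (X t))) (at t within {0..T})"
      using d(1) by (simp only: has_vector_derivative_iff_quotient)
    have e: "fst (zop (tz (X t))) = fst (Zop (X t)) + (1/4) *\<^sub>R pr1 (fst (X t) + fst (X t)) (fst (Zop (X t)))"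
      unfolding zop_tz scaleR_2[symmetric] q.scaleR_left by simp
    show "((\<lambda>y. (1 / (y - t)) *\<^sub>R (rM Ji (fst (X y)) - rM Ji (fst (X t))) + (1/4) *\<^sub>R pr1 (fst (X y) + fst (X t)) ((1 / (y - t)) *\<^sub>R (rM Ji (fst (X y)) - rM Ji (fst (X t))))) \<longlongrightarrow> fst (zop (tz (X t)))) (at t within {0..T})"
      unfolding e by (rule tendsto_add[OF lim tendsto_scaleR[OF tendsto_const q.tendsto[OF tendsto_add[OF ct tendsto_const] lim]]])
  qed
  then show "((\<lambda>t. M2 Ji (tz (X t))) has_vector_derivative zop (tz (X t))) (at t within {0..T})"
    unfolding has_vector_derivative_M2_iff zop_tz(2) using d(2) by (simp add: tz_def)
qed

lemma pr1_lower: assumes "norm Q <= 1 / KA" shows "norm z <= 2 * norm (z + (1/2) *\<^sub>R pr1 Q z)"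
proof -
  have "norm (pr1 Q z) <= KA * (1 / KA) * norm z" using assms KA by (intro order_trans[OF norm_pr1] mult_right_mono mult_left_mono) auto
  then have "norm ((1/2) *\<^sub>R pr1 Q z) <= norm z / 2" using KA by simp
  then show ?thesis using norm_triangle_ineq4[of "z + (1/2) *\<^sub>R pr1 Q z" "(1/2) *\<^sub>R pr1 Q z"] by (simp only: add_diff_cancel_right')
qed

text \<open>The converse chain rule. \<open>ph_bounds\<close> gives continuity of Q, and since 1 +
  q/2 is invertible by \<open>pr1_lower\<close>, the difference quotients of Q are bounded by those
  of \<open>ph Q\<close> and converge with them.\<close>

lemma zsol_sol:
  assumes W: "zsol T W" and X: "\<And>t. t \<in> {0..T} ==> W t = tz (X t) \<and> norm (fst (X t)) <= 1 / KA"
  shows "sol T X"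
  unfolding sol_def
proof (intro conjI ballI)
  interpret q: bounded_bilinear pr1 by (rule bilinear_pr1)
  have c: "continuous_on {0..T} W" using W by (simp add: zsol_def)
  have ct: "((\<lambda>y. fst (X y)) \<longlongrightarrow> fst (X t)) (at t within {0..T})" if t: "t \<in> {0..T}" for t
  proof -
    have "((\<lambda>y. fst (W y)) \<longlongrightarrow> fst (W t)) (at t within {0..T})" using c t by (intro tendsto_fst) (simp add: continuous_on_def)
    then have "((\<lambda>y. 2 * norm (fst (W y) - fst (W t))) \<longlongrightarrow> 2 * norm (fst (W t) - fst (W t))) (at t within {0..T})" by (intro tendsto_mult tendsto_const tendsto_norm tendsto_diff)
    then have z: "((\<lambda>y. 2 * norm (fst (W y) - fst (W t))) \<longlongrightarrow> 0) (at t within {0..T})" by simp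
    have "\<forall>\<^sub>F y in at t within {0..T}. norm (fst (X y) - fst (X t)) <= 2 * norm (fst (W y) - fst (W t))"
      unfolding eventually_at_filter using X t ph_bounds(2) by (intro always_eventually) (auto simp: tz_def)
    from Lim_null_comparison[OF this z] show ?thesis by (simp add: LIM_zero_iff)
  qed
  have sn: "snd (X t) = snd (W t)" if "t \<in> {0..T}" for t using X[OF that] by (simp add: tz_def)
  have "continuous_on {0..T} (\<lambda>t. (fst (X t), snd (W t)))"
    using ct c by (intro continuous_on_Pair continuous_on_snd) (auto simp: continuous_on_def)
  then show "continuous_on {0..T} X" by (rule continuous_on_eq) (simp add: sn prod_eq_iff)
  fix t assume t: "t \<in> {0..T}"
  have d: "((\<lambda>t. rM Ji (fst (W t))) has_vector_derivative fst (zop (tz (X t)))) (at t within {0..T})"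
    "((\<lambda>t. rM Ji (snd (W t))) has_vector_derivative snd (zop (tz (X t)))) (at t within {0..T})"
    using bspec[OF conjunct2[OF W[unfolded zsol_def has_vector_derivative_M2_iff]] t] X[OF t] by simp_all
  let ?F = "at t within {0..T}"
  let ?N = "fst (Zop (X t))"
  let ?d = "\<lambda>y. (1 / (y - t)) *\<^sub>R (rM Ji (fst (X y)) - rM Ji (fst (X t)))"
  let ?e = "\<lambda>y. (1 / (y - t)) *\<^sub>R (rM Ji (fst (W y)) - rM Ji (fst (W t)))"
  have inT: "\<forall>\<^sub>F y in ?F. y \<in> {0..T}" by (simp add: eventually_at_filter)
  have e: "?e y = ?d y + (1/4) *\<^sub>R pr1 (fst (X y) + fst (X t)) (?d y)" if "y \<in> {0..T}" for y
    using Ji_ph_quotient[of y t "fst (X y)" "fst (X t)"] X[OF that] X[OF t] by (simp add: tz_def)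
  have elim: "(?e \<longlongrightarrow> ?N + (1/2) *\<^sub>R pr1 (fst (X t)) ?N) ?F" using d(1) unfolding has_vector_derivative_iff_quotient zop_tz .
  have db: "norm (?d y) <= 2 * norm (?e y)" if y: "y \<in> {0..T}" for y
  proof -
    have "norm ((1/2) *\<^sub>R (fst (X y) + fst (X t))) <= 1 / KA"
      using norm_triangle_ineq[of "fst (X y)" "fst (X t)"] X[OF y] X[OF t] by simp
    from pr1_lower[OF this, of "?d y"] show ?thesis unfolding e[OF y] by (simp add: q.scaleR_left)
  qed
  \<comment> \<open>The bounded factor 1 + q/2 is frozen at time \<open>t\<close>; the error of
    freezing is the product of \<open>fst (X y) - fst (X t)\<close>, which tends to 0, with bounded
    quotients.\<close>
  have main: "norm (?d y - ?N) <= 2 * norm (?e y - (?N + (1/2) *\<^sub>R pr1 (fst (X t)) ?N)) + KA * norm (fst (X y) - fst (X t)) * norm (?e y)" if y: "y \<in> {0..T}" for y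
  proof -
    have a: "(?d y - ?N) + (1/2) *\<^sub>R pr1 (fst (X t)) (?d y - ?N) = (?e y - (?N + (1/2) *\<^sub>R pr1 (fst (X t)) ?N)) - (1/4) *\<^sub>R pr1 (fst (X y) - fst (X t)) (?d y)"
    proof -
      have "(1/4) *\<^sub>R pr1 (fst (X y) + fst (X t)) (?d y) - (1/4) *\<^sub>R pr1 (fst (X y) - fst (X t)) (?d y) = (1/2) *\<^sub>R pr1 (fst (X t)) (?d y)"
        unfolding q.add_left q.diff_left scaleR_diff_right[symmetric] by (simp flip: scaleR_2)
      moreover have "(1/2) *\<^sub>R pr1 (fst (X t)) (?d y - ?N) = (1/2) *\<^sub>R pr1 (fst (X t)) (?d y) - (1/2) *\<^sub>R pr1 (fst (X t)) ?N"
        by (simp only: q.diff_right scaleR_diff_right)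
      moreover have "A - B = C ==> Z = C - C' ==> (d - N) + Z = (d + A - (N + C')) - B" for A B C C' Z d N :: h by (auto simp: algebra_simps)
      ultimately show ?thesis unfolding e[OF y] by blast
    qed
    have "norm (?d y - ?N) <= 2 * norm ((?d y - ?N) + (1/2) *\<^sub>R pr1 (fst (X t)) (?d y - ?N))" using X[OF t] by (intro pr1_lower) blast
    also have "... <= 2 * (norm (?e y - (?N + (1/2) *\<^sub>R pr1 (fst (X t)) ?N)) + norm ((1/4) *\<^sub>R pr1 (fst (X y) - fst (X t)) (?d y)))"
      unfolding a by (intro mult_left_mono norm_triangle_ineq4) simp
    also have "norm ((1/4) *\<^sub>R pr1 (fst (X y) - fst (X t)) (?d y)) <= (1/4) * (KA * norm (fst (X y) - fst (X t)) * (2 * norm (?e y)))"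
      unfolding norm_scaleR[of "1/4"]
    proof (intro mult_mono)
      show "norm (pr1 (fst (X y) - fst (X t)) (?d y)) <= KA * norm (fst (X y) - fst (X t)) * (2 * norm (?e y))"
        by (rule order_trans[OF norm_pr1]) (intro mult_left_mono db y, use KA in auto)
    qed auto
    finally show ?thesis by simp
  qed
  have "((\<lambda>y. 2 * norm (?e y - (?N + (1/2) *\<^sub>R pr1 (fst (X t)) ?N)) + KA * norm (fst (X y) - fst (X t)) * norm (?e y)) \<longlongrightarrow>
    2 * norm ((?N + (1/2) *\<^sub>R pr1 (fst (X t)) ?N) - (?N + (1/2) *\<^sub>R pr1 (fst (X t)) ?N)) + KA * norm (fst (X t) - fst (X t)) * norm (?N + (1/2) *\<^sub>R pr1 (fst (X t)) ?N)) ?F"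
    by (intro tendsto_add tendsto_mult tendsto_norm tendsto_diff tendsto_const elim ct[OF t])
  then have z: "((\<lambda>y. 2 * norm (?e y - (?N + (1/2) *\<^sub>R pr1 (fst (X t)) ?N)) + KA * norm (fst (X y) - fst (X t)) * norm (?e y)) \<longlongrightarrow> 0) ?F" by simp
  have "((\<lambda>y. ?d y - ?N) \<longlongrightarrow> 0) ?F"
    by (rule Lim_null_comparison[OF eventually_mono[OF inT main] z])
  then have d1: "((\<lambda>t. rM Ji (fst (X t))) has_vector_derivative ?N) ?F"
    unfolding has_vector_derivative_iff_quotient by (simp add: LIM_zero_iff)
  have d2: "((\<lambda>t. rM Ji (snd (X t))) has_vector_derivative snd (Zop (X t))) ?F"
    using d(2) unfolding zop_tz by (rule has_vector_derivative_transform[OF t, rotated]) (simp add: sn)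
  show "((\<lambda>t. M2 Ji (X t)) has_vector_derivative Zop (X t)) (at t within {0..T})"
    unfolding has_vector_derivative_M2_iff using d1 d2 ..
qed

text \<open>\<open>c0 / 2\<close> compensates for the norm that may double when passing from \<zeta>
  to q. \<open>1 / (32 * KA)\<close> puts \<open>16 * c1\<close> within the radius
  \<open>1 / (2 * KA)\<close> of \<open>ph_inverse\<close>, twice the bound \<open>8 * c1\<close>
  that solutions obey.\<close>

definition c1 :: real where "c1 = min (c0 / 2) (1 / (32 * KA))"

lemma c1: "0 < c1" "c1 <= c0 / 2" "32 * (KA * c1) <= 1"
proof -
  show "0 < c1" "c1 <= c0 / 2" using c0_pos KA by (auto simp: c1_def)
  have "c1 <= 1 / (32 * KA)" by (simp add: c1_def)
  then show "32 * (KA * c1) <= 1" using KA by (simp add: field_simps)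
qed

lemma le_c1_KA: "x <= 16 * c1 ==> x <= 1 / (2 * KA)" "x <= 16 * c1 ==> x <= 1 / KA"
proof -
  assume x: "x <= 16 * c1"
  have "16 * c1 <= 1 / (2 * KA)" using c1(3) KA by (simp add: field_simps)
  moreover have "1 / (2 * KA) <= 1 / KA" using KA by (simp add: field_simps)
  ultimately show "x <= 1 / (2 * KA)" "x <= 1 / KA" using x by linarith+
qed

section \<open>Existence, uniqueness and continuous dependence for the original unknowns\<close>

lemma sol_mono: assumes "sol T X" "T' <= T" shows "sol T' X"
proof -
  have sub: "{0..T'} \<subseteq> {0..T}" using assms(2) by auto
  show ?thesis
    using assms(1) sub unfolding sol_def
    by (meson continuous_on_subset has_vector_derivative_within_subset subsetD)
qed

lemma zsol_mono: assumes "zsol T X" "T' <= T" shows "zsol T' X"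
proof -
  have sub: "{0..T'} \<subseteq> {0..T}" using assms(2) by auto
  show ?thesis
    using assms(1) sub unfolding zsol_def
    by (meson continuous_on_subset has_vector_derivative_within_subset subsetD)
qed

theorem z_exist:
  assumes d: "0 < d" "norm W0 <= d" "d <= c1"
  obtains X where "sol (c1 / d) X" "tz (X 0) = W0"
    "\<And>t. t \<in> {0..c1 / d} ==> norm (X t) <= 4 * norm W0"
    "\<And>t w. t \<in> {0..c1 / d} ==> slow 1 w ==> (\<And>x. w x <= 1) ==> norm (M2 w (X t)) <= 2 * norm (M2 w (X 0))"
proof -
  have "norm (fst W0) <= 16 * c1" using norm_fst_le'[of W0] d by linarith
  from ph_inverse[OF le_c1_KA(1)[OF this]] obtain Q where Q: "ph Q = fst W0" "norm Q <= 2 * norm (fst W0)" by blast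
  let ?X0 = "(Q, snd W0)"
  \<comment> \<open>Inverting \<open>ph\<close> may double the norm, so \<open>existence\<close> is
    applied with \<open>2 * d\<close>.\<close>
  have n: "norm ?X0 <= 2 * norm W0" using norm_Pair_mono[of Q 2 "fst W0" "snd W0" "snd W0"] Q by simp
  then have n2: "norm ?X0 <= 2 * d" "0 < 2 * d" using d by auto
  obtain X where X: "sol (c0 / (2 * d)) X" "X 0 = ?X0"
    and w: "\<And>t w. t \<in> {0..c0 / (2 * d)} ==> slow 1 w ==> (\<And>x. w x <= 1) ==> norm (M2 w (X t)) <= 2 * norm (M2 w ?X0)"
    by (rule existence[OF n2(2,1)]) (rule that, assumption+, blast)
  have T: "c1 / d <= c0 / (2 * d)" using c1(2) d by (simp add: field_simps)
  have "norm (X t) <= 4 * norm W0" if "t \<in> {0..c1 / d}" for t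
    using w[of t "\<lambda>_. 1"] slow_one that T n by (simp add: M2_one)
  then show thesis using that[of X] sol_mono[OF X(1) T] X(2) Q w T by (simp add: tz_def)
qed

text \<open>While the elevation of \<open>W\<close> stays in the domain of
  \<open>ph_inverse\<close>, \<open>W\<close> comes from a solution \<open>Y\<close> of the
  symmetric system, and the low norm estimate gives Y = X. Then \<open>W\<close> obeys the bound
  \<open>8 * c1\<close>, strictly inside the domain, so it can never leave it.\<close>

theorem z_unique:
  assumes T: "0 <= T" and X: "sol T X" and Xn: "\<And>t. t \<in> {0..T} ==> norm (X t) <= 4 * c1"
    and W: "zsol T W" and W0: "W 0 = tz (X 0)" and t: "t \<in> {0..T}"
  shows "W t = tz (X t)"
proof -
  have c: "continuous_on {0..T} W" using W by (simp add: zsol_def)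
  have XK: "norm (X t) <= 1 / KA" if "t \<in> {0..T}" for t using Xn[OF that] c1 by (intro le_c1_KA(2)) linarith
  have loc: "W S = tz (X S)" if S: "S \<in> {0..T}" and Wn: "\<And>t. t \<in> {0..S} ==> norm (fst (W t)) <= 1 / (2 * KA)" for S
  proof -
    have "\<forall>t\<in>{0..S}. \<exists>Q. ph Q = fst (W t) \<and> norm Q <= 2 * norm (fst (W t))" using ph_inverse Wn by blast
    then obtain Q where Q: "\<And>t. t \<in> {0..S} ==> ph (Q t) = fst (W t) \<and> norm (Q t) <= 2 * norm (fst (W t))" by metis
    define Y where "Y t = (Q t, snd (W t))" for t
    have Qn: "norm (Q t) <= 1 / KA" if "t \<in> {0..S}" for t
    proof -
      have "2 * norm (fst (W t)) <= 2 * (1 / (2 * KA))" using Wn[OF that] by (rule mult_left_mono) simp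
      then show ?thesis using Q[OF that] KA by simp
    qed
    have WY: "W t = tz (Y t)" if "t \<in> {0..S}" for t using Q[OF that] by (simp add: tz_def Y_def)
    have Y: "sol S Y" by (rule zsol_sol[OF zsol_mono[OF W]]) (use S WY Qn in \<open>auto simp: Y_def\<close>)
    have X': "sol S X" using sol_mono[OF X] S by simp
    have "compact (Y ` {0..S})" using Y by (intro compact_continuous_image) (auto simp: sol_def)
    then obtain B where B: "\<And>t. t \<in> {0..S} ==> norm (Y t) <= B" by (metis bounded_iff compact_imp_bounded imageI)
    have S0: "S \<in> {0..S}" "0 \<in> {0..S}" using S by auto
    have eq0: "X 0 = Y 0"
    proof -
      have "tz (X 0) = tz (Y 0)" using WY[OF S0(2)] W0 by simp
      then have "fst (X 0) = fst (Y 0)" "snd (X 0) = snd (Y 0)"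
        using ph_bounds(2)[of "fst (X 0)" "fst (Y 0)"] Qn[OF S0(2)] XK[of 0] T norm_fst_le'[of "X 0"] by (auto simp: tz_def Y_def)
      then show ?thesis by (simp add: prod_eq_iff)
    qed
    have "norm (M2 Sg (X S - Y S)) <= exp (26 * CJ * max B (4 * c1) * S) * norm (M2 Sg (X 0 - Y 0))"
      by (rule sol_difference[OF X' Y _ S0(1)]) (use B Xn S in \<open>auto simp: le_max_iff_disj\<close>)
    also have "... = 0" using bounded_linear_M2[OF rsym_Sg] by (simp add: eq0 linear_simps)
    finally have z: "M2 Sg (X S - Y S) = 0" by simp
    have "rM Sg y = 0 ==> y = 0" for y
      unfolding rM_def by (rule Mul_eq_0_iff[OF bsym_Sg]) (simp_all add: Sg_def)
    then have "fst (X S - Y S) = 0" "snd (X S - Y S) = 0" using z unfolding M2_def zero_prod_def prod.inject by blast+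
    then have "X S - Y S = 0" by (simp add: prod_eq_iff)
    then show ?thesis using WY[OF S0(1)] by simp
  qed
  have small: "norm (fst (W t)) <= 1 / (2 * KA)" if t: "t \<in> {0..T}" for t
  proof (rule ccontr)
    assume "\<not> norm (fst (W t)) <= 1 / (2 * KA)"
    then have t': "norm (fst (W t)) \<ge> 1 / (2 * KA)" by simp
    \<comment> \<open>The infimum \<open>S\<close> is the first time at which the elevation would
      reach the boundary of the domain; \<open>loc\<close> applies up to and including
      \<open>S\<close> and contradicts the value there.\<close>
    let ?B = "{t \<in> {0..T}. 1 / (2 * KA) <= norm (fst (W t))}"
    have cn: "continuous_on {0..T} (\<lambda>t. norm (fst (W t)))" by (intro continuous_intros c)
    have "closed ?B" using continuous_closed_preimage[OF cn closed_atLeastAtMost closed_atLeast[of "1 / (2 * KA)"]] by (simp add: vimage_def Int_def)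
    moreover have ne: "?B \<noteq> {}" "bdd_below ?B" using t t' by (auto intro!: bdd_belowI[of _ 0])
    ultimately have I: "Inf ?B \<in> ?B" by (intro closed_contains_Inf)
    define S where "S = Inf ?B"
    have S: "S \<in> {0..T}" "1 / (2 * KA) <= norm (fst (W S))" using I by (auto simp: S_def)
    have lt: "norm (fst (W t)) < 1 / (2 * KA)" if "t \<in> {0..<S}" for t
    proof (rule ccontr)
      assume "\<not> ?thesis"
      then have "t \<in> ?B" using that S(1) by auto
      from cInf_lower[OF this ne(2)] that show False by (simp add: S_def)
    qed
    have bound: "norm (fst (tz (X t))) <= 8 * c1" if "t \<in> {0..T}" for t
    proof -
      have "norm (tz (X t) - tz 0) <= 2 * norm (X t - 0)" using XK[OF that] KA by (intro norm_tz_diff) auto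
      then show ?thesis using Xn[OF that] norm_fst_le'[of "tz (X t)"] by simp
    qed
    have le: "norm (fst (W t)) <= 1 / (2 * KA)" if "t \<in> {0..S}" for t
    proof (cases "t = S")
      case False
      then show ?thesis using lt[of t] that by simp
    next
      case True
      show ?thesis
      proof (cases "S = 0")
        case True
        then show ?thesis using \<open>t = S\<close> W0 bound[of 0] T c1 le_c1_KA(1)[of "8 * c1"] by simp
      next
        case False
        then have Sp: "0 < S" using S(1) by simp
        have "(\<lambda>t. norm (fst (W t))) ` (closure {0..<S}) \<subseteq> {..1 / (2 * KA)}"
        proof (rule image_closure_subset)
          show "continuous_on (closure {0..<S}) (\<lambda>t. norm (fst (W t)))" using cn by (rule continuous_on_subset) (use S(1) Sp in auto)
          show "(\<lambda>t. norm (fst (W t))) ` {0..<S} \<subseteq> {..1 / (2 * KA)}" using lt by (auto intro: less_imp_le)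
        qed simp
        then show ?thesis using \<open>t = S\<close> Sp by (force simp: image_subset_iff)
      qed
    qed
    have "norm (fst (W S)) <= 8 * c1" using loc[OF S(1) le] bound[OF S(1)] by simp
    also have "... < 16 * c1" using c1 by simp
    also have "... <= 1 / (2 * KA)" by (rule le_c1_KA(1)) simp
    finally show False using S(2) by simp
  qed
  show ?thesis by (rule loc[OF t]) (use small t in auto)
qed

text \<open>The weight is chosen from the tail of \<open>X 0\<close>, and since the data are close
  it also bounds the tail of the other solution at all times; the low norm of the difference obeys
  Gronwall, and \<open>interpolation\<close> joins the two. Hence \<delta> depends on
  \<open>X\<close> only.\<close>

theorem z_dependence:
  assumes d: "0 < d" and X: "sol (c1 / d) X" and Xn: "\<And>t. t \<in> {0..c1 / d} ==> norm (X t) <= 4 * c1"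
    and Xw: "\<And>t w. t \<in> {0..c1 / d} ==> slow 1 w ==> (\<And>x. w x <= 1) ==> norm (M2 w (X t)) <= 2 * norm (M2 w (X 0))"
    and e: "0 < e"
  shows "\<exists>\<delta>>0. \<forall>d1 W t. 0 < d1 \<longrightarrow> d1 <= c1 \<longrightarrow> norm (W 0) <= d1 \<longrightarrow> norm (W 0 - tz (X 0)) < \<delta> \<longrightarrow> zsol (c1 / d1) W \<longrightarrow>
    t \<in> {0..min (c1 / d) (c1 / d1)} \<longrightarrow> norm (W t - tz (X t)) <= e"
proof -
  have "\<forall>\<^sub>F k in sequentially. norm (M2 (\<lambda>t. min 1 (jbr t / (real k + 1))) (X 0)) < e / 16"
    using order_tendstoD(2)[OF tail_tendsto[of "X 0"], of "e / 16"] e by simp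
  then obtain k where k: "norm (M2 (\<lambda>t. min 1 (jbr t / (real k + 1))) (X 0)) < e / 16" by (auto simp: eventually_sequentially)
  define R w where "R = real k + 1" and "w t = min 1 (jbr t / (real k + 1))" for t
  have R: "R \<ge> 1" by (simp add: R_def)
  have w: "slow 1 w" "\<And>x. w x <= 1" "rsym 1 w"
    unfolding w_def[abs_def] using slow_tail[of k] by (auto simp: rsym_def abs_le_iff)
  define E where "E = R powr s * exp (26 * CJ * (4 * c1) * (c1 / d))"
  have E: "0 <= E" by (simp add: E_def)
  \<comment> \<open>Tails and low norm add up to \<open>e / 4 + 2 * \<delta> * (2 + E)\<close>,
    which is \<open>e / 2\<close> for this \<delta>; returning through \<open>tz\<close> doubles it
    to \<open>e\<close>.\<close>
  define \<delta> where "\<delta> = e / (8 * (2 + E))"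
  have \<delta>: "0 < \<delta>" using e E by (simp add: \<delta>_def)
  show ?thesis
  proof (intro exI[of _ \<delta>] conjI \<delta> allI impI)
    fix d1 W t
    assume d1: "0 < d1" "d1 <= c1" and W0: "norm (W 0) <= d1" and dW: "norm (W 0 - tz (X 0)) < \<delta>" and W: "zsol (c1 / d1) W"
      and t: "t \<in> {0..min (c1 / d) (c1 / d1)}"
    obtain Y where Y: "sol (c1 / d1) Y" "tz (Y 0) = W 0"
      and Yn: "\<And>t. t \<in> {0..c1 / d1} ==> norm (Y t) <= 4 * norm (W 0)"
      and Yw: "\<And>t w. t \<in> {0..c1 / d1} ==> slow 1 w ==> (\<And>x. w x <= 1) ==> norm (M2 w (Y t)) <= 2 * norm (M2 w (Y 0))"
      by (rule z_exist[OF d1(1) W0 d1(2)]) (rule that, assumption+, blast)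
    have T1: "0 <= c1 / d1" "0 <= c1 / d" using c1 d1 d by simp_all
    have Yn': "norm (Y t) <= 4 * c1" if "t \<in> {0..c1 / d1}" for t using Yn[OF that] W0 d1 by linarith
    have t1: "t \<in> {0..c1 / d1}" "t \<in> {0..c1 / d}" using t by auto
    have WY: "W t = tz (Y t)" by (rule z_unique[OF T1(1) Y(1) Yn' W _ t1(1)]) (use Y in auto)
    have lK: "4 * c1 <= 1 / KA" using c1 by (intro le_c1_KA) simp
    have XK: "norm (X t) <= 1 / KA" if "t \<in> {0..c1 / d}" for t using Xn[OF that] lK by linarith
    have YK: "norm (Y t) <= 1 / KA" if "t \<in> {0..c1 / d1}" for t using Yn'[OF that] lK by linarith
    have "norm (Y 0 - X 0) <= 2 * norm (tz (Y 0) - tz (X 0))" using XK[of 0] YK[of 0] T1 by (intro norm_tz_diff) auto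
    then have D0: "norm (Y 0 - X 0) <= 2 * \<delta>" using dW Y by simp
    have sd: "norm (M2 Sg (Y t - X t)) <= exp (26 * CJ * (4 * c1) * t) * norm (M2 Sg (Y 0 - X 0))"
      by (rule sol_difference[OF sol_mono[OF Y(1)] sol_mono[OF X], of "min (c1 / d) (c1 / d1)"]) (use Xn Yn' t in auto)
    also have "... <= exp (26 * CJ * (4 * c1) * (c1 / d)) * (1 * norm (Y 0 - X 0))"
    proof (intro mult_mono norm_M2_le[OF rsym_Sg])
      have "26 * CJ * (4 * c1) * t <= 26 * CJ * (4 * c1) * (c1 / d)" by (rule mult_left_mono) (use t1 c1 in auto)
      then show "exp (26 * CJ * (4 * c1) * t) <= exp (26 * CJ * (4 * c1) * (c1 / d))" by simp
    qed auto
    finally have "R powr s * norm (M2 Sg (Y t - X t)) <= R powr s * (exp (26 * CJ * (4 * c1) * (c1 / d)) * (1 * norm (Y 0 - X 0)))"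
      by (rule mult_left_mono) simp
    then have a: "R powr s * norm (M2 Sg (Y t - X t)) <= E * (2 * \<delta>)"
      using mult_left_mono[OF D0 E] by (simp add: E_def mult.assoc)
    have wX: "norm (M2 w (X 0)) < e / 16" using k unfolding w_def[abs_def] .
    have "norm (M2 w (Y 0)) <= norm (M2 w (X 0)) + norm (M2 w (Y 0 - X 0))"
      using norm_triangle_ineq[of "M2 w (X 0)" "M2 w (Y 0 - X 0)"] by (simp add: M2_add[OF w(3), symmetric])
    also have "norm (M2 w (Y 0 - X 0)) <= 2 * \<delta>" using norm_M2_le[OF w(3), of "Y 0 - X 0"] D0 by simp
    finally have wY: "norm (M2 w (Y 0)) <= e / 16 + 2 * \<delta>" using wX by simp
    have "norm (M2 w (Y t - X t)) <= norm (M2 w (Y t)) + norm (M2 w (X t))"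
      unfolding M2_diff[OF w(3)] by (rule norm_triangle_ineq4)
    moreover have "norm (M2 w (Y t)) <= 2 * norm (M2 w (Y 0))" by (rule Yw[OF t1(1) w(1,2)])
    moreover have "norm (M2 w (X t)) <= 2 * norm (M2 w (X 0))" by (rule Xw[OF t1(2) w(1,2)])
    moreover have "n <= a + b ==> a <= 2 * y ==> b <= 2 * x ==> x < p ==> y <= p + 2 * q ==> n <= 2 * (p + 2 * q) + 2 * p" for n a b x y p q :: real
      by argo
    ultimately have b: "norm (M2 w (Y t - X t)) <= 2 * (e / 16 + 2 * \<delta>) + 2 * (e / 16)"
      using wX wY by blast
    have "norm (Y t - X t) <= norm (M2 w (Y t - X t)) + R powr s * norm (M2 Sg (Y t - X t))"
      using interpolation[OF R, of "Y t - X t"] unfolding w_def[abs_def] R_def .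
    also have "... <= e / 4 + 2 * (\<delta> * (2 + E))" using a b by (simp add: algebra_simps)
    also have "\<delta> * (2 + E) = e / 8"
    proof -
      have "e / (8 * P) * P = e / 8" if "P > 0" for P :: real using that by simp
      from this[of "2 + E"] show ?thesis using E unfolding \<delta>_def by linarith
    qed
    finally have "norm (Y t - X t) <= e / 2" by simp
    moreover have "norm (tz (Y t) - tz (X t)) <= 2 * norm (Y t - X t)" by (rule norm_tz_diff(1)[OF YK[OF t1(1)] XK[OF t1(2)]])
    ultimately show "norm (W t - tz (X t)) <= e" unfolding WY by simp
  qed
qed

end

section \<open>Sobolev representations and well-posedness\<close>

definition wt :: "real => real => real" where "wt r x = jbr x powr (- r)"

lemma rsym_wt: "0 <= r ==> rsym 1 (wt r)"
  unfolding rsym_def wt_def[abs_def]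
proof (intro conjI allI)
  show "(\<lambda>x. jbr x powr - r) \<in> meas" by measurable
  fix x assume "0 <= r"
  then show "\<bar>jbr x powr - r\<bar> <= 1" using jbr_ge_1[of x] powr_mono[of "- r" 0 "jbr x"] by simp
qed simp

lemma wt_pos: "0 < wt r x" by (simp add: wt_def less_imp_neq[OF jbr_pos, symmetric])

lemma wt_cancel: "jbr x powr (2 * r) * (wt r x * a)^2 = a^2"
proof -
  have "jbr x powr (2 * r) * (wt r x)^2 = jbr x powr (2 * r + (- r + - r))"
    unfolding wt_def power2_eq_square powr_add ..
  also have "... = 1" by (simp add: less_imp_neq[OF jbr_pos, symmetric])
  finally show ?thesis by (simp add: power_mult_distrib mult.assoc[symmetric])
qed

lemma wint_isF: assumes "isF f x" shows "wint w f = (NN u. ennreal (w u * (cmod (fn x u))^2))"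
  unfolding wint_def using FT_AE[OF assms] by (intro nn_integral_cong_AE) (auto elim: eventually_mono)

lemma is_FT_FT: "isF f x ==> is_FT f (FT f)"
  unfolding FT_def by (rule someI[of "is_FT f"]) (rule isF_is_FT)

lemma isF_zero: "isF (\<lambda>_. 0) 0"
  by (simp add: isF_def sq_int_zero Th_zero[abs_def])

lemma nn_weighted:
  assumes [measurable]: "b \<in> meas" and b: "\<And>t. 0 <= b t" "\<And>t. b t <= C"
  shows "integrable lborel (\<lambda>t. b t * (cmod (fn x t))^2)"
    "(NN t. ennreal (b t * (cmod (fn x t))^2)) = ennreal (LBINT t. b t * (cmod (fn x t))^2)"
proof -
  have i: "integrable lborel (\<lambda>t. C * (cmod (fn x t))^2)" using csq_fn[of x] by (simp add: csq_int_def)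
  show j: "integrable lborel (\<lambda>t. b t * (cmod (fn x t))^2)"
  proof (rule Bochner_Integration.integrable_bound[OF i])
    show "AE t in lborel. norm (b t * (cmod (fn x t))^2) <= norm (C * (cmod (fn x t))^2)"
    proof (rule AE_I2)
      fix t
      have "b t * (cmod (fn x t))^2 <= C * (cmod (fn x t))^2" using b(2)[of t] by (intro mult_right_mono) auto
      then show "norm (b t * (cmod (fn x t))^2) <= norm (C * (cmod (fn x t))^2)" using b(1)[of t] by simp
    qed
  qed measurable
  show "(NN t. ennreal (b t * (cmod (fn x t))^2)) = ennreal (LBINT t. b t * (cmod (fn x t))^2)"
    by (rule nn_integral_eq_integral[OF j]) (use b(1) in auto)
qed

lemma rM_divide:
  assumes a: "rsym 1 a" "\<And>t. 0 < a t" and f: "(NN t. ennreal ((cmod (fn x t) / a t)^2)) < \<infinity>"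
  shows "\<exists>y. x = rM a y"
proof -
  note [measurable] = rsym_measurable[OF a(1)]
  let ?f = "\<lambda>t. fn x t / cx (a t)"
  have h: "herm2 ?f" unfolding herm2_def csq_int_nn
  proof (intro conjI allI)
    show "(NN t. ennreal ((cmod (?f t))^2)) < \<infinity>" using f less_imp_le[OF a(2)] by (simp add: norm_divide)
    show "?f (- t) = cnj (?f t)" for t by (simp add: rsym_even[OF a(1)])
  qed measurable
  have "x = rM a (toh ?f)"
  proof (rule h_eqI)
    show "AE t in lborel. fn x t = fn (rM a (toh ?f)) t"
      using fn_rM[OF a(1), of "toh ?f"] fn_toh[OF h] by eventually_elim (use a(2) in \<open>simp add: less_imp_neq[symmetric]\<close>)
  qed
  then show ?thesis by blast
qed

section \<open>Representation of pairs in the V spaces and the final statement\<close>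

context wb
begin

text \<open>\<open>W\<close> consists of the transforms of \<zeta> and v multiplied by
  \<open>jbr powr r\<close>, and for v also by \<open>Lam\<close>. Through \<open>iL\<close> and the
  bounded symbol \<open>wt r\<close> this is expressed without unbounded multipliers.\<close>

definition rep :: "real => (real => real) => (real => real) => h \<times> h => bool" where
  "rep r \<zeta> v W \<longleftrightarrow> isF \<zeta> (rM (wt r) (fst W)) \<and> isF v (rM (wt r) (iL (snd W)))"

lemma iL_wt: "0 <= r ==> rM (wt r) (iL x) = rM (\<lambda>t. wt r t * Li t) x"
  unfolding iL_def by (rule rM_rM[OF rsym_wt rsym_Li])

lemma rsym_wt_Li: "0 <= r ==> rsym 1 (\<lambda>t. wt r t * Li t)"
  using rsym_mult[OF rsym_wt rsym_Li] by simp

lemma Li_pos: "0 < Li t" by (simp add: Li_def)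

lemma Li_bounds: "1 <= (1 + sqrt \<mu> * \<bar>t\<bar>) * (Li t)^2" "(1 + sqrt \<mu> * \<bar>t\<bar>) * (Li t)^2 <= 2" "(Li t)^2 <= 1"
proof -
  have e: "(Li t)^2 = 1 / (Lam t)^2" by (simp add: Li_def power_divide)
  have p: "0 < (Lam t)^2" by simp
  have "(1 + sqrt \<mu> * \<bar>t\<bar>) / 2 <= (Lam t)^2" "(Lam t)^2 <= 1 + sqrt \<mu> * \<bar>t\<bar>" using Lam_sq_bounds[of t] by auto
  then show "1 <= (1 + sqrt \<mu> * \<bar>t\<bar>) * (Li t)^2" "(1 + sqrt \<mu> * \<bar>t\<bar>) * (Li t)^2 <= 2"
    unfolding e using p by (simp_all add: field_simps)
  show "(Li t)^2 <= 1" unfolding e using Lam_ge_1[of t] p by (simp add: field_simps)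
qed

text \<open>The weight of the V norm on the second component becomes
  \<open>(1 + sqrt \<mu> * |t|) * (Li t)^2\<close>, which lies between 1 and 2 for all \<mu>; so the
  V norm and the norm of \<open>W\<close> are equivalent with constants free of \<mu>.\<close>

lemma rep_V:
  assumes "rep r \<zeta> v W" "0 <= r"
  shows "V_space r \<mu> \<zeta> v" "norm W <= V_norm r \<mu> \<zeta> v" "V_norm r \<mu> \<zeta> v <= 2 * norm W"
proof -
  note [measurable] = rsym_measurable[OF rsym_Li]
  obtain F G where W: "W = (F, G)" by (cases W)
  have z: "isF \<zeta> (rM (wt r) F)" and v: "isF v (rM (\<lambda>t. wt r t * Li t) G)"
    using assms by (auto simp: rep_def W iL_wt)
  have sm: "0 < sqrt \<mu>" using mu by simp
  have wz: "wint (\<lambda>p. jbr p powr (2 * r)) \<zeta> = ennreal ((norm F)^2)"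
    unfolding wint_isF[OF z] nn_norm_fn[symmetric]
  proof (rule nn_integral_cong_AE)
    show "AE p in lborel. ennreal (jbr p powr (2 * r) * (cmod (fn (rM (wt r) F) p))^2) = ennreal ((cmod (fn F p))^2)"
      using fn_rM[OF rsym_wt[OF assms(2)], of F]
      by eventually_elim (simp add: norm_mult wt_cancel less_imp_le[OF wt_pos])
  qed
  have wv: "wint (\<lambda>p. jbr p powr (2 * r) * c p) v = (NN p. ennreal ((c p * (Li p)^2) * (cmod (fn G p))^2))" for c
    unfolding wint_isF[OF v]
  proof (rule nn_integral_cong_AE)
    show "AE p in lborel. ennreal (jbr p powr (2 * r) * c p * (cmod (fn (rM (\<lambda>t. wt r t * Li t) G) p))^2) = ennreal ((c p * (Li p)^2) * (cmod (fn G p))^2)"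
      using fn_rM[OF rsym_wt_Li[OF assms(2)], of G]
    proof eventually_elim
      case (elim p)
      have "jbr p powr (2 * r) * c p * (cmod (fn (rM (\<lambda>t. wt r t * Li t) G) p))^2 = c p * (jbr p powr (2 * r) * (wt r p * (Li p * cmod (fn G p)))^2)"
        unfolding elim using wt_pos[of r p] Li_pos[of p] by (simp add: norm_mult mult_ac)
      then have "jbr p powr (2 * r) * c p * (cmod (fn (rM (\<lambda>t. wt r t * Li t) G) p))^2 = (c p * (Li p)^2) * (cmod (fn G p))^2"
        unfolding wt_cancel by (simp only: power_mult_distrib mult.assoc)
      then show ?case by (rule arg_cong)
    qed
  qed
  define A B where "A = (LBINT t. (Li t)^2 * (cmod (fn G t))^2)" and "B = (LBINT t. (\<bar>t\<bar> * (Li t)^2) * (cmod (fn G t))^2)"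
  have bA: "(Li t)^2 <= 1" for t by (rule Li_bounds(3))
  have bB: "\<bar>t\<bar> * (Li t)^2 <= 2 / sqrt \<mu>" for t
  proof -
    have "sqrt \<mu> * (\<bar>t\<bar> * (Li t)^2) <= 2" using Li_bounds(2)[of t] unfolding distrib_right mult_1 mult.assoc using zero_le_power2[of "Li t"] by linarith
    then show ?thesis using sm by (simp add: field_simps)
  qed
  have iA: "integrable lborel (\<lambda>t. (Li t)^2 * (cmod (fn G t))^2)" and wA: "wint (\<lambda>p. jbr p powr (2 * r)) v = ennreal A"
    using nn_weighted[of "\<lambda>t. (Li t)^2" 1 G] bA wv[of "\<lambda>_. 1"] by (simp_all add: A_def)
  have iB: "integrable lborel (\<lambda>t. (\<bar>t\<bar> * (Li t)^2) * (cmod (fn G t))^2)" and wB: "wint (\<lambda>p. jbr p powr (2 * r) * \<bar>p\<bar>) v = ennreal B"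
    using nn_weighted[of "\<lambda>t. \<bar>t\<bar> * (Li t)^2" "2 / sqrt \<mu>" G] bB wv[of "\<lambda>t. \<bar>t\<bar>"] by (simp_all add: B_def)
  have "Hs r \<zeta>" "Hs r v" unfolding Hs_def wz wA using isF_is_FT[OF z] isF_is_FT[OF v] by auto
  then show "V_space r \<mu> \<zeta> v" unfolding V_space_def wB by simp
  have A0: "0 <= A" "0 <= B" unfolding A_def B_def by (auto intro!: integral_nonneg_AE AE_I2)
  have Vn: "V_norm r \<mu> \<zeta> v = sqrt ((norm F)^2 + (A + sqrt \<mu> * B))"
    unfolding V_norm_def Hs_norm_def Dhalf_Hs_norm_def wz wA wB using A0 by (simp add: add.assoc)
  have AB: "A + sqrt \<mu> * B = (LBINT t. ((1 + sqrt \<mu> * \<bar>t\<bar>) * (Li t)^2) * (cmod (fn G t))^2)"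
  proof -
    have "(LBINT t. ((1 + sqrt \<mu> * \<bar>t\<bar>) * (Li t)^2) * (cmod (fn G t))^2) = (LBINT t. (Li t)^2 * (cmod (fn G t))^2 + sqrt \<mu> * ((\<bar>t\<bar> * (Li t)^2) * (cmod (fn G t))^2))"
      by (intro Bochner_Integration.integral_cong refl) (simp add: algebra_simps)
    also have "... = A + sqrt \<mu> * B"
      unfolding A_def B_def Bochner_Integration.integral_add[OF iA integrable_mult_right[OF iB]] integral_mult_right_zero ..
    finally show ?thesis ..
  qed
  have iAB: "integrable lborel (\<lambda>t. ((1 + sqrt \<mu> * \<bar>t\<bar>) * (Li t)^2) * (cmod (fn G t))^2)"
  proof -
    have "0 <= (1 + sqrt \<mu> * \<bar>t\<bar>) * (Li t)^2" for t using Li_bounds(1)[of t] by linarith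
    then show ?thesis using Li_bounds(2) by (intro nn_weighted(1)[where C = 2]) auto
  qed
  have iG: "integrable lborel (\<lambda>t. (cmod (fn G t))^2)" using csq_fn[of G] by (simp add: csq_int_def)
  have lo: "(norm G)^2 <= A + sqrt \<mu> * B"
    unfolding AB norm_sq_fn
  proof (rule integral_mono[OF iG iAB])
    fix t show "(cmod (fn G t))^2 <= (1 + sqrt \<mu> * \<bar>t\<bar>) * (Li t)^2 * (cmod (fn G t))^2"
      using mult_right_mono[OF Li_bounds(1)[of t], of "(cmod (fn G t))^2"] by simp
  qed
  have "A + sqrt \<mu> * B <= (LBINT t. 2 * (cmod (fn G t))^2)"
    unfolding AB
  proof (rule integral_mono[OF iAB])
    fix t show "(1 + sqrt \<mu> * \<bar>t\<bar>) * (Li t)^2 * (cmod (fn G t))^2 <= 2 * (cmod (fn G t))^2"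
      by (intro mult_right_mono Li_bounds(2)) simp
  qed (use iG in simp)
  also have "... = 2 * (norm G)^2" by (simp add: norm_sq_fn)
  finally have hi: "A + sqrt \<mu> * B <= 2 * (norm G)^2" .
  show "norm W <= V_norm r \<mu> \<zeta> v" unfolding Vn W norm_Pair using lo by (intro real_sqrt_le_mono) simp
  have "V_norm r \<mu> \<zeta> v <= sqrt (4 * ((norm F)^2 + (norm G)^2))"
    unfolding Vn
  proof (rule real_sqrt_le_mono)
    have "y <= 2 * b ==> 0 <= a ==> 0 <= b ==> a + y <= 4 * (a + b)" for a b y :: real by argo
    then show "(norm F)^2 + (A + sqrt \<mu> * B) <= 4 * ((norm F)^2 + (norm G)^2)" using hi zero_le_power2 by blast
  qed
  then show "V_norm r \<mu> \<zeta> v <= 2 * norm W" unfolding W norm_Pair real_sqrt_mult real_sqrt_four .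
qed

lemma V_rep:
  assumes V: "V_space r \<mu> \<zeta> v" and r: "0 <= r"
  shows "\<exists>W. rep r \<zeta> v W"
proof -
  note [measurable] = rsym_measurable[OF rsym_Li] rsym_measurable[OF rsym_wt[OF r]]
  obtain x where x: "isF \<zeta> x" using V by (auto simp: V_space_def Hs_def is_FT_iff)
  obtain y where y: "isF v y" using V by (auto simp: V_space_def Hs_def is_FT_iff)
  have inv: "(a / wt r i)^2 = jbr i powr (2 * r) * a^2" for a i
    using wt_cancel[of i r "a / wt r i"] wt_pos[of r i] by simp
  have "\<exists>F. x = rM (wt r) F"
    by (rule rM_divide[OF rsym_wt[OF r] wt_pos]) (use V in \<open>simp add: inv V_space_def Hs_def wint_isF[OF x]\<close>)
  then obtain F where F: "x = rM (wt r) F" ..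
  have "\<exists>G. y = rM (\<lambda>t. wt r t * Li t) G"
  proof (rule rM_divide[OF rsym_wt_Li[OF r]])
    show "0 < wt r t * Li t" for t using wt_pos[of r t] Li_pos[of t] by simp
    have le: "(cmod (fn y t) / (wt r t * Li t))^2 <= jbr t powr (2 * r) * (cmod (fn y t))^2 + sqrt \<mu> * (jbr t powr (2 * r) * \<bar>t\<bar> * (cmod (fn y t))^2)" for t
    proof -
      let ?p = "jbr t powr (2 * r) * (cmod (fn y t))^2"
      have "(cmod (fn y t) / (wt r t * Li t))^2 = ?p * (1 / (Li t)^2)"
        unfolding inv[of "cmod (fn y t)" t, symmetric] by (simp add: power_divide power_mult_distrib)
      also have "... <= ?p * (1 + sqrt \<mu> * \<bar>t\<bar>)"
        using Li_bounds(1)[of t] Li_pos[of t] by (intro mult_left_mono) (simp_all add: field_simps)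
      finally show ?thesis by (simp add: algebra_simps)
    qed
    have "(NN t. ennreal ((cmod (fn y t) / (wt r t * Li t))^2))
      <= (NN t. ennreal (jbr t powr (2 * r) * (cmod (fn y t))^2) + ennreal (sqrt \<mu>) * ennreal (jbr t powr (2 * r) * \<bar>t\<bar> * (cmod (fn y t))^2))"
    proof (rule nn_integral_mono)
      fix t
      have "ennreal (jbr t powr (2 * r) * (cmod (fn y t))^2) + ennreal (sqrt \<mu>) * ennreal (jbr t powr (2 * r) * \<bar>t\<bar> * (cmod (fn y t))^2)
        = ennreal (jbr t powr (2 * r) * (cmod (fn y t))^2 + sqrt \<mu> * (jbr t powr (2 * r) * \<bar>t\<bar> * (cmod (fn y t))^2))"
        using mu by (simp add: ennreal_plus ennreal_mult'')
      then show "ennreal ((cmod (fn y t) / (wt r t * Li t))^2) <= ennreal (jbr t powr (2 * r) * (cmod (fn y t))^2) + ennreal (sqrt \<mu>) * ennreal (jbr t powr (2 * r) * \<bar>t\<bar> * (cmod (fn y t))^2)"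
        using ennreal_leI[OF le[of t]] by simp
    qed
    also have "... = wint (\<lambda>i. jbr i powr (2 * r)) v + ennreal (sqrt \<mu>) * wint (\<lambda>i. jbr i powr (2 * r) * \<bar>i\<bar>) v"
      unfolding wint_isF[OF y] by (subst nn_integral_add) (auto simp: nn_integral_cmult)
    also have "... < \<infinity>" using V by (auto simp: V_space_def Hs_def ennreal_mult_less_top)
    finally show "(NN t. ennreal ((cmod (fn y t) / (wt r t * Li t))^2)) < \<infinity>" .
  qed
  then obtain G where G: "y = rM (\<lambda>t. wt r t * Li t) G" ..
  have "rep r \<zeta> v (F, G)" using x y F G iL_wt[OF r, of G] by (simp add: rep_def)
  then show ?thesis ..
qed

lemma rep_diff: assumes "rep r \<zeta> v W" "rep r \<zeta>' v' W'" "0 <= r" shows "rep r (\<lambda>x. \<zeta> x - \<zeta>' x) (\<lambda>x. v x - v' x) (W - W')"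
  using assms(1,2) bounded_linear_rM[OF rsym_wt[OF assms(3)]] linear_iL unfolding rep_def by (auto simp: linear_simps intro!: isF_diff)

lemma rep_scale: assumes "rep r \<zeta> v W" "0 <= r" shows "rep r (\<lambda>x. c * \<zeta> x) (\<lambda>x. c * v x) (c *\<^sub>R W)"
  using assms(1) bounded_linear_rM[OF rsym_wt[OF assms(2)]] linear_iL unfolding rep_def by (auto simp: linear_simps intro!: isF_cmult)

lemma rep_unique: assumes "rep r \<zeta> v W" "rep r \<zeta> v W'" "0 <= r" shows "W = W'"
proof -
  have "rep r (\<lambda>x. 0) (\<lambda>x. 0) 0"
    using bounded_linear_rM[OF rsym_wt[OF assms(3)]] linear_iL isF_zero by (simp add: rep_def linear_simps)
  from rep_V(3)[OF this assms(3)] have "V_norm r \<mu> (\<lambda>x. 0) (\<lambda>x. 0) <= 0" by simp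
  moreover have "norm (W - W') <= V_norm r \<mu> (\<lambda>x. 0) (\<lambda>x. 0)" using rep_V(2)[OF rep_diff[OF assms] assms(3)] by simp
  ultimately have "norm (W - W') <= 0" by linarith
  then show ?thesis by simp
qed

lemma rep_exists: "\<exists>\<zeta> v. rep r \<zeta> v W"
  unfolding rep_def by (meson isF_surj)

lemma V_norm_tendsto_iff:
  assumes "\<And>y. y \<in> S ==> y \<noteq> t ==> rep r (f y) (u y) (U y)" "0 <= r"
  shows "((\<lambda>y. V_norm r \<mu> (f y) (u y)) \<longlongrightarrow> 0) (at t within S) \<longleftrightarrow> (U \<longlongrightarrow> 0) (at t within S)"
proof
  have ev: "\<forall>\<^sub>F y in at t within S. y \<in> S \<and> y \<noteq> t" by (simp add: eventually_at_filter)
  assume a: "((\<lambda>y. V_norm r \<mu> (f y) (u y)) \<longlongrightarrow> 0) (at t within S)"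
  show "(U \<longlongrightarrow> 0) (at t within S)"
    by (rule Lim_null_comparison[OF eventually_mono[OF ev] a]) (use rep_V(2)[OF assms(1) assms(2)] in blast)
next
  have ev: "\<forall>\<^sub>F y in at t within S. y \<in> S \<and> y \<noteq> t" by (simp add: eventually_at_filter)
  assume "(U \<longlongrightarrow> 0) (at t within S)"
  then have a: "((\<lambda>y. 2 * norm (U y)) \<longlongrightarrow> 0) (at t within S)" using tendsto_mult[OF tendsto_const tendsto_norm_zero, of U _ 2] by simp
  show "((\<lambda>y. V_norm r \<mu> (f y) (u y)) \<longlongrightarrow> 0) (at t within S)"
  proof (rule Lim_null_comparison[OF eventually_mono[OF ev] a])
    fix y assume "y \<in> S \<and> y \<noteq> t"
    moreover have "0 <= V_norm r \<mu> (f y) (u y)" using mu by (simp add: V_norm_def)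
    ultimately show "norm (V_norm r \<mu> (f y) (u y)) <= 2 * norm (U y)" using rep_V(3)[OF assms(1) assms(2)] by simp
  qed
qed

lemma wt_s: "wt s = Sg" and wt_s1: "wt (s - 1) = J"
  by (auto simp: wt_def Sg_def sig_def J_def fun_eq_iff powr_minus divide_inverse)

lemma s_nonneg: "0 <= s" "0 <= s - 1" "1 <= s" using s_gt by auto

text \<open>The same functions seen one level lower, where time derivatives are taken.\<close>

lemma rep_Ji: assumes "rep s \<zeta> v W" shows "rep (s - 1) \<zeta> v (M2 Ji W)"
proof -
  have 1: "rM J (rM Ji x) = rM Sg x" for x
    unfolding rM_rM[OF rsym_J rsym_Ji] by (rule rM_cong) (simp add: Ji_def Sg_def jbr_div_sig[symmetric])
  have "iL (rM Ji x) = rM Ji (iL x)" for x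
    unfolding iL_def rM_rM[OF rsym_Li rsym_Ji] rM_rM[OF rsym_Ji rsym_Li] by (rule rM_cong) simp
  then show ?thesis using assms by (simp add: rep_def wt_s wt_s1 1)
qed

lemma inner_Dx:
  assumes "AE u in lborel. fn P' u = \<i> * cx u * fn P u"
  shows "inner (rM Sg x) P' = inner (rM J (Dx x)) P"
proof -
  have "(LBINT t. fn (rM Sg x) t * cnj (fn P' t)) = (LBINT t. fn (rM J (Dx x)) t * cnj (fn P t))"
  proof (rule integral_cong_AE)
    show "AE t in lborel. fn (rM Sg x) t * cnj (fn P' t) = fn (rM J (Dx x)) t * cnj (fn P t)"
      using fn_rM[OF rsym_Sg, of x] fn_rM[OF rsym_J, of "Dx x"] fn_Mul[OF bsym_dsym, of x] assms
    proof eventually_elim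
      case (elim t)
      have "cx (J t) * dsym t = cx (Sg t) * (- \<i> * cx t)"
        unfolding dsym_def jbr_div_sig[symmetric] Sg_def by simp
      moreover have "fn (rM J (Dx x)) t * cnj (fn P t) = (cx (J t) * dsym t) * (fn x t * cnj (fn P t))" using elim unfolding Dx_def by simp
      moreover have "fn (rM Sg x) t * cnj (fn P' t) = (cx (Sg t) * (- \<i> * cx t)) * (fn x t * cnj (fn P t))" using elim by simp
      ultimately show ?case by simp
    qed
  qed measurable
  then show ?thesis by (simp add: inner_fn)
qed

text \<open>Parseval moves the derivative from the test function to \<open>P\<close>; du
  Bois-Reymond gives the converse. Testing p' against \<phi> and p against \<phi>' without a sign
  expresses p' = - dp/dx, in accordance with \<open>dsym\<close>.\<close>

lemma weak_derivative_iff: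
  assumes p: "isF p (rM Sg P)" and p': "isF p' (rM J N)"
  shows "(\<forall>\<phi> \<phi>'. test_fun \<phi> \<phi>' \<longrightarrow> (LBINT x. p' x * \<phi> x) = (LBINT x. p x * \<phi>' x)) \<longleftrightarrow> N = Dx P"
proof
  assume N: "N = Dx P"
  show "\<forall>\<phi> \<phi>'. test_fun \<phi> \<phi>' \<longrightarrow> (LBINT x. p' x * \<phi> x) = (LBINT x. p x * \<phi>' x)"
  proof (intro allI impI)
    fix \<phi> \<phi>' assume "test_fun \<phi> \<phi>'"
    then obtain U U' where U: "isF \<phi> U" "isF \<phi>' U'" "AE u in lborel. fn U' u = \<i> * cx u * fn U u" by (rule test_fun_isF)
    show "(LBINT x. p' x * \<phi> x) = (LBINT x. p x * \<phi>' x)"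
      unfolding Parseval[OF p' U(1)] Parseval[OF p U(2)] inner_Dx[OF U(3)] N ..
  qed
next
  assume a: "\<forall>\<phi> \<phi>'. test_fun \<phi> \<phi>' \<longrightarrow> (LBINT x. p' x * \<phi> x) = (LBINT x. p x * \<phi>' x)"
  obtain r where r: "isF r (rM J (Dx P))" by (rule isF_surj)
  have d: "isF (\<lambda>x. p' x - r x) (rM J N - rM J (Dx P))" by (rule isF_diff[OF p' r])
  have "AE x in lborel. p' x - r x = 0"
  proof (rule du_Bois_Reymond[OF isF_sq[OF d]])
    fix \<phi> \<phi>' assume t: "test_fun \<phi> \<phi>'"
    then obtain U U' where U: "isF \<phi> U" "isF \<phi>' U'" "AE u in lborel. fn U' u = \<i> * cx u * fn U u" by (rule test_fun_isF)
    have "inner (rM J N) U = inner (rM J (Dx P)) U"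
      using a t unfolding Parseval[OF p' U(1), symmetric] inner_Dx[OF U(3), symmetric] Parseval[OF p U(2), symmetric] by blast
    then show "(LBINT x. (p' x - r x) * \<phi> x) = 0" unfolding Parseval[OF d U(1)] by (simp add: inner_diff_left)
  qed
  then have "AE x in lborel. p' x = r x" by eventually_elim simp
  from isF_cong_AE[OF p' sq_int_measurable[OF isF_sq[OF r]] this] have "isF r (rM J N)" .
  from isF_unique[OF this r] show "N = Dx P" by (rule rM_J_inj)
qed

lemma R4_scale: "R4 (c *\<^sub>R x) = c^2 *\<^sub>R R4 x"
proof -
  interpret b: bounded_bilinear "bil (ik (\<lambda>u v. r4 u v / jbr u))" by (rule bounded_bilinear_bil[OF kern_r4])
  show ?thesis by (simp add: R4_def b.scaleR_left b.scaleR_right power2_eq_square)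
qed

text \<open>T is the square of \<open>Li\<close>, and \<open>Dx\<close> stands for minus d/dx; hence
  the two factors \<open>iL\<close> and the minus sign.\<close>

lemma w_symbol:
  assumes z: "isF \<zeta> (rM Sg F)"
  shows "is_FT w (\<lambda>u. \<i> * cx (u * Tmu \<mu> u) * FT \<zeta> u) \<longleftrightarrow> isF w (- rM J (iL (iL (Dx F))))"
proof -
  note [measurable] = Tmu_measurable
  let ?f = "\<lambda>u. \<i> * cx (u * Tmu \<mu> u) * FT \<zeta> u"
  have [measurable]: "FT \<zeta> \<in> meas" using is_FT_FT[OF z] by (simp add: is_FT_def csq_int_def)
  have eq: "AE u in lborel. fn (- rM J (iL (iL (Dx F)))) u = ?f u"
    using FT_AE[OF z] fn_rM[OF rsym_Sg, of F] fn_rM[OF rsym_J, of "iL (iL (Dx F))"] fn_rM[OF rsym_Li, of "iL (Dx F)"] fn_rM[OF rsym_Li, of "Dx F"]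
      fn_Mul[OF bsym_dsym, of F] fn_scale[of "-1" "rM J (iL (iL (Dx F)))"]
  proof eventually_elim
    case (elim u)
    have T: "Tmu \<mu> u = Li u * Li u" using Lam_sq[of u] Tmu_pos[of u] by (simp add: Li_def power2_eq_square field_simps)
    have k: "- (cx (J u) * dsym u) = \<i> * cx u * cx (Sg u)"
      unfolding dsym_def jbr_div_sig[symmetric] Sg_def by simp
    have "fn (- rM J (iL (iL (Dx F)))) u = - (cx (J u) * dsym u) * (cx (Li u) * cx (Li u) * fn F u)"
      using elim by (simp add: iL_def Dx_def)
    also have "... = ?f u" unfolding k T using elim by simp
    finally show ?case .
  qed
  have c: "csq_int ?f" by (rule csq_int_cong_AE[OF csq_fn _ eq]) measurable
  show ?thesis
  proof
    assume "is_FT w ?f"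
    then obtain y where y: "isF w y" "AE t in lborel. ?f t = fn y t" by (auto simp: is_FT_iff)
    have "y = - rM J (iL (iL (Dx F)))" by (rule h_eqI) (use y(2) eq in \<open>eventually_elim, simp\<close>)
    with y(1) show "isF w (- rM J (iL (iL (Dx F))))" by simp
  next
    assume "isF w (- rM J (iL (iL (Dx F))))"
    moreover have "AE t in lborel. ?f t = fn (- rM J (iL (iL (Dx F)))) t" using eq by eventually_elim simp
    ultimately show "is_FT w ?f" unfolding is_FT_iff using c by blast
  qed
qed

text \<open>Multiplication of the unknowns by \<epsilon> removes \<epsilon> from the equations. The
  second equation is first obtained under \<open>iL\<close>, where v v_x is the derivative of v^2/2;
  injectivity of \<open>iL\<close> then gives the component of \<open>zop\<close>.\<close>

lemma equations_iff:
  assumes W: "rep s \<zeta> v W" and N: "rep (s - 1) \<zeta>' v' N" and e: "0 < \<epsilon>"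
  shows "(\<exists>w. is_FT w (\<lambda>i. \<i> * cx (i * Tmu \<mu> i) * FT \<zeta> i) \<and>
      (\<forall>\<phi> \<phi>'. test_fun \<phi> \<phi>' \<longrightarrow>
        (LBINT x. \<zeta>' x * \<phi> x) = (LBINT x. (v x + \<epsilon> * \<zeta> x * v x) * \<phi>' x) \<and>
        (LBINT x. v' x * \<phi> x) = - (LBINT x. w x * \<phi> x) + \<epsilon> * (LBINT x. ((v x)^2 / 2) * \<phi>' x)))
    \<longleftrightarrow> \<epsilon> *\<^sub>R N = zop (\<epsilon> *\<^sub>R W)"
proof -
  interpret p: bounded_bilinear pr by (rule bilinear_pr)
  obtain F G where WF: "W = (F, G)" by (cases W)
  obtain N1 N2 where NN: "N = (N1, N2)" by (cases N)
  let ?g = "iL G"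
  have z: "isF \<zeta> (rM Sg F)" and v: "isF v (rM Sg ?g)" using W by (auto simp: rep_def WF wt_s)
  have z': "isF \<zeta>' (rM J N1)" and v': "isF v' (rM J (iL N2))" using N by (auto simp: rep_def NN wt_s1)
  note lS = bounded_linear_rM[OF rsym_Sg] and lJ = bounded_linear_rM[OF rsym_J]
  note lin = linear_simps(1)[OF linear_Dx] linear_simps(5)[OF linear_Dx] linear_simps(1)[OF linear_iL] linear_simps(5)[OF linear_iL]
  have "isF (\<lambda>x. v x + \<epsilon> * (\<zeta> x * v x)) (rM Sg ?g + \<epsilon> *\<^sub>R rM Sg (pr F ?g))"
    by (intro isF_add isF_cmult isF_pr z v)
  also have "rM Sg ?g + \<epsilon> *\<^sub>R rM Sg (pr F ?g) = rM Sg (?g + \<epsilon> *\<^sub>R pr F ?g)" using lS by (simp add: linear_simps)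
  finally have p1: "isF (\<lambda>x. v x + \<epsilon> * \<zeta> x * v x) (rM Sg (?g + \<epsilon> *\<^sub>R pr F ?g))" by (simp add: mult.assoc)
  note E1 = weak_derivative_iff[OF p1 z']
  have "isF (\<lambda>x. (\<epsilon> / 2) * (v x * v x)) ((\<epsilon> / 2) *\<^sub>R rM Sg (pr ?g ?g))" by (intro isF_cmult isF_pr v)
  also have "(\<epsilon> / 2) *\<^sub>R rM Sg (pr ?g ?g) = rM Sg ((\<epsilon> / 2) *\<^sub>R pr ?g ?g)" using lS by (simp add: linear_simps)
  finally have p2: "isF (\<lambda>x. \<epsilon> * ((v x)^2 / 2)) (rM Sg ((\<epsilon> / 2) *\<^sub>R pr ?g ?g))" by (simp add: power2_eq_square)
  have E2: "(\<forall>\<phi> \<phi>'. test_fun \<phi> \<phi>' \<longrightarrow> (LBINT x. v' x * \<phi> x) = - (LBINT x. w x * \<phi> x) + \<epsilon> * (LBINT x. ((v x)^2 / 2) * \<phi>' x))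
    \<longleftrightarrow> N2 = iL (Dx F) + \<epsilon> *\<^sub>R R4 G" if w: "isF w (- rM J (iL (iL (Dx F))))" for w
  proof -
    have "isF (\<lambda>x. v' x + w x) (rM J (iL N2) + - rM J (iL (iL (Dx F))))" by (rule isF_add[OF v' w])
    also have "rM J (iL N2) + - rM J (iL (iL (Dx F))) = rM J (iL N2 - iL (iL (Dx F)))" using lJ by (simp add: linear_simps)
    finally have p': "isF (\<lambda>x. v' x + w x) (rM J (iL N2 - iL (iL (Dx F))))" .
    have "((LBINT x. v' x * \<phi> x) = - (LBINT x. w x * \<phi> x) + \<epsilon> * (LBINT x. ((v x)^2 / 2) * \<phi>' x)) \<longleftrightarrow>
      ((LBINT x. (v' x + w x) * \<phi> x) = (LBINT x. \<epsilon> * ((v x)^2 / 2) * \<phi>' x))" if t: "test_fun \<phi> \<phi>'" for \<phi> \<phi>'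
    proof -
      obtain U U' where U: "isF \<phi> U" "isF \<phi>' U'" using t by (rule test_fun_isF)
      have "(LBINT x. (v' x + w x) * \<phi> x) = (LBINT x. v' x * \<phi> x) + (LBINT x. w x * \<phi> x)"
        using sq_int_mult_integrable[OF isF_sq[OF v'] isF_sq[OF U(1)]] sq_int_mult_integrable[OF isF_sq[OF w] isF_sq[OF U(1)]]
        by (simp add: distrib_right)
      moreover have "(LBINT x. \<epsilon> * ((v x)^2 / 2) * \<phi>' x) = \<epsilon> * (LBINT x. ((v x)^2 / 2) * \<phi>' x)"
        unfolding mult.assoc by (rule integral_mult_right_zero)
      ultimately show ?thesis by linarith
    qed
    then have "(\<forall>\<phi> \<phi>'. test_fun \<phi> \<phi>' \<longrightarrow> (LBINT x. v' x * \<phi> x) = - (LBINT x. w x * \<phi> x) + \<epsilon> * (LBINT x. ((v x)^2 / 2) * \<phi>' x)) \<longleftrightarrow>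
      iL N2 - iL (iL (Dx F)) = Dx ((\<epsilon> / 2) *\<^sub>R pr ?g ?g)"
      unfolding weak_derivative_iff[OF p2 p', symmetric] by blast
    also have "Dx ((\<epsilon> / 2) *\<^sub>R pr ?g ?g) = iL (\<epsilon> *\<^sub>R R4 G)" by (simp add: lin iL_R4)
    also have "iL N2 - iL (iL (Dx F)) = iL (\<epsilon> *\<^sub>R R4 G) \<longleftrightarrow> iL N2 = iL (iL (Dx F) + \<epsilon> *\<^sub>R R4 G)"
      unfolding lin(3) by (auto simp: algebra_simps)
    also have "... \<longleftrightarrow> N2 = iL (Dx F) + \<epsilon> *\<^sub>R R4 G" using iL_inj by blast
    finally show ?thesis .
  qed
  obtain w0 where w0: "isF w0 (- rM J (iL (iL (Dx F))))" by (rule isF_surj)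
  have R: "\<epsilon> *\<^sub>R N = zop (\<epsilon> *\<^sub>R W) \<longleftrightarrow> N1 = Dx (?g + \<epsilon> *\<^sub>R pr F ?g) \<and> N2 = iL (Dx F) + \<epsilon> *\<^sub>R R4 G"
  proof -
    have "zop (\<epsilon> *\<^sub>R W) = (\<epsilon> *\<^sub>R Dx (?g + \<epsilon> *\<^sub>R pr F ?g), \<epsilon> *\<^sub>R (iL (Dx F) + \<epsilon> *\<^sub>R R4 G))"
      unfolding zop_def WF by (simp add: lin p.scaleR_left p.scaleR_right R4_scale power2_eq_square scaleR_add_right pr_commute[of ?g F])
    then show ?thesis using e by (simp add: NN)
  qed
  show ?thesis unfolding R w_symbol[OF z] E1[symmetric] using E2 w0 by blast
qed

lemma continuous_zop: "continuous_on A W ==> continuous_on A (\<lambda>t. zop (W t))"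
  unfolding zop_def R4_def
  by (intro continuous_intros bounded_linear.continuous_on[OF linear_Dx] bounded_linear.continuous_on[OF linear_iL]
      bounded_bilinear.continuous_on[OF bilinear_pr] bounded_bilinear.continuous_on[OF bounded_bilinear_bil[OF kern_r4]])

text \<open>The continuity of the time derivative in V^(s-1), part of the definition, follows from
  the equation because \<open>zop\<close> is continuous.\<close>

theorem is_solution_iff:
  assumes W: "\<And>t. t \<in> {0..T} ==> rep s (\<zeta> t) (v t) (W t)" and e: "0 < \<epsilon>"
  shows "is_solution s \<mu> \<epsilon> T \<zeta>0 v0 \<zeta> v \<longleftrightarrow> \<zeta> 0 = \<zeta>0 \<and> v 0 = v0 \<and> zsol T (\<lambda>t. \<epsilon> *\<^sub>R W t)"
proof -
  let ?S = "{0..T}"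
  have V: "\<forall>t\<in>?S. V_space s \<mu> (\<zeta> t) (v t)" using rep_V(1)[OF W s_nonneg(1)] by blast
  have cont: "(\<forall>t\<in>?S. ((\<lambda>y. V_norm s \<mu> (\<lambda>x. \<zeta> y x - \<zeta> t x) (\<lambda>x. v y x - v t x)) \<longlongrightarrow> 0) (at t within ?S)) \<longleftrightarrow> continuous_on ?S W"
    unfolding continuous_on_def
  proof (rule ball_cong[OF refl])
    fix t assume t: "t \<in> ?S"
    have "((\<lambda>y. V_norm s \<mu> (\<lambda>x. \<zeta> y x - \<zeta> t x) (\<lambda>x. v y x - v t x)) \<longlongrightarrow> 0) (at t within ?S) \<longleftrightarrow> ((\<lambda>y. W y - W t) \<longlongrightarrow> 0) (at t within ?S)"
      by (rule V_norm_tendsto_iff[OF rep_diff[OF W W[OF t]]]) (simp_all add: s_nonneg)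
    then show "((\<lambda>y. V_norm s \<mu> (\<lambda>x. \<zeta> y x - \<zeta> t x) (\<lambda>x. v y x - v t x)) \<longlongrightarrow> 0) (at t within ?S) \<longleftrightarrow> (W \<longlongrightarrow> W t) (at t within ?S)"
      by (simp add: LIM_zero_iff)
  qed
  have quot: "((\<lambda>y. V_norm (s - 1) \<mu> (\<lambda>x. (\<zeta> y x - \<zeta> t x) / (y - t) - \<zeta>' x) (\<lambda>x. (v y x - v t x) / (y - t) - v' x)) \<longlongrightarrow> 0) (at t within ?S)
      \<longleftrightarrow> ((\<lambda>t. M2 Ji (W t)) has_vector_derivative N) (at t within ?S)"
    if t: "t \<in> ?S" and N: "rep (s - 1) \<zeta>' v' N" for t \<zeta>' v' N
  proof -
    have "rep (s - 1) (\<lambda>x. (1 / (y - t)) * (\<zeta> y x - \<zeta> t x) - \<zeta>' x) (\<lambda>x. (1 / (y - t)) * (v y x - v t x) - v' x) ((1 / (y - t)) *\<^sub>R (M2 Ji (W y) - M2 Ji (W t)) - N)"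
      if "y \<in> ?S" for y
      by (rule rep_diff[OF rep_scale[OF rep_diff[OF rep_Ji[OF W[OF that]] rep_Ji[OF W[OF t]]]] N]) (simp_all add: s_nonneg)
    then have "((\<lambda>y. V_norm (s - 1) \<mu> (\<lambda>x. (\<zeta> y x - \<zeta> t x) / (y - t) - \<zeta>' x) (\<lambda>x. (v y x - v t x) / (y - t) - v' x)) \<longlongrightarrow> 0) (at t within ?S)
      \<longleftrightarrow> ((\<lambda>y. (1 / (y - t)) *\<^sub>R (M2 Ji (W y) - M2 Ji (W t)) - N) \<longlongrightarrow> 0) (at t within ?S)"
      by (intro V_norm_tendsto_iff) (simp_all add: s_nonneg)
    then show ?thesis unfolding has_vector_derivative_iff_quotient by (simp add: LIM_zero_iff)
  qed
  have lJ: "bounded_linear (M2 Ji)" by (rule bounded_linear_M2[OF rsym_Ji])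
  have sc: "((\<lambda>t. M2 Ji (W t)) has_vector_derivative N) (at t within ?S) \<longleftrightarrow> ((\<lambda>t. M2 Ji (\<epsilon> *\<^sub>R W t)) has_vector_derivative \<epsilon> *\<^sub>R N) (at t within ?S)" for t N
  proof -
    have M: "M2 Ji (\<epsilon> *\<^sub>R W t) = \<epsilon> *\<^sub>R M2 Ji (W t)" for t using lJ by (simp add: linear_simps)
    have "((\<lambda>t. c *\<^sub>R f t) has_vector_derivative c *\<^sub>R D) (at t within ?S)" if "(f has_vector_derivative D) (at t within ?S)" for f :: "real => h \<times> h" and D and c :: real
      by (rule bounded_linear.has_vector_derivative[OF bounded_linear_scaleR_right that])
    from this[of "\<lambda>t. M2 Ji (W t)" N \<epsilon>] this[of "\<lambda>t. \<epsilon> *\<^sub>R M2 Ji (W t)" "\<epsilon> *\<^sub>R N" "1 / \<epsilon>"] show ?thesis unfolding M using e by auto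
  qed
  have ce: "continuous_on ?S (\<lambda>t. \<epsilon> *\<^sub>R W t) \<longleftrightarrow> continuous_on ?S W"
  proof
    assume "continuous_on ?S (\<lambda>t. \<epsilon> *\<^sub>R W t)"
    from continuous_on_scaleR[OF continuous_on_const this, of "1 / \<epsilon>"]
    have "continuous_on ?S (\<lambda>t. (1 / \<epsilon>) *\<^sub>R (\<epsilon> *\<^sub>R W t))" .
    then show "continuous_on ?S W" using e by simp
  qed (intro continuous_intros)
  show ?thesis
  proof
    assume a: "is_solution s \<mu> \<epsilon> T \<zeta>0 v0 \<zeta> v"
    then obtain \<zeta>' v' where
      1: "\<zeta> 0 = \<zeta>0" "v 0 = v0" "continuous_on ?S W"
      and 2: "\<forall>t\<in>?S. V_space (s - 1) \<mu> (\<zeta>' t) (v' t)"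
      and 3: "\<forall>t\<in>?S. ((\<lambda>y. V_norm (s - 1) \<mu> (\<lambda>x. (\<zeta> y x - \<zeta> t x) / (y - t) - \<zeta>' t x) (\<lambda>x. (v y x - v t x) / (y - t) - v' t x)) \<longlongrightarrow> 0) (at t within ?S)"
      and 4: "\<forall>t\<in>?S. \<exists>w. is_FT w (\<lambda>i. \<i> * cx (i * Tmu \<mu> i) * FT (\<zeta> t) i) \<and>
           (\<forall>\<phi> \<phi>'. test_fun \<phi> \<phi>' \<longrightarrow>
              (LBINT x. \<zeta>' t x * \<phi> x) = (LBINT x. (v t x + \<epsilon> * \<zeta> t x * v t x) * \<phi>' x) \<and>
              (LBINT x. v' t x * \<phi> x) = - (LBINT x. w x * \<phi> x) + \<epsilon> * (LBINT x. ((v t x)^2 / 2) * \<phi>' x))"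
      unfolding is_solution_def cont by blast
    have "((\<lambda>t. M2 Ji (\<epsilon> *\<^sub>R W t)) has_vector_derivative zop (\<epsilon> *\<^sub>R W t)) (at t within ?S)" if t: "t \<in> ?S" for t
    proof -
      obtain N where N: "rep (s - 1) (\<zeta>' t) (v' t) N" using V_rep[OF _ s_nonneg(2)] 2 t by blast
      have "\<epsilon> *\<^sub>R N = zop (\<epsilon> *\<^sub>R W t)" using equations_iff[OF W[OF t] N e] 4 t by blast
      moreover have "((\<lambda>t. M2 Ji (W t)) has_vector_derivative N) (at t within ?S)" using quot[OF t N] 3 t by blast
      ultimately show ?thesis unfolding sc by simp
    qed
    then show "\<zeta> 0 = \<zeta>0 \<and> v 0 = v0 \<and> zsol T (\<lambda>t. \<epsilon> *\<^sub>R W t)" using 1 by (simp add: zsol_def ce)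
  next
    assume a: "\<zeta> 0 = \<zeta>0 \<and> v 0 = v0 \<and> zsol T (\<lambda>t. \<epsilon> *\<^sub>R W t)"
    define N where "N t = (1 / \<epsilon>) *\<^sub>R zop (\<epsilon> *\<^sub>R W t)" for t
    have eN: "\<epsilon> *\<^sub>R N t = zop (\<epsilon> *\<^sub>R W t)" for t using e by (simp add: N_def)
    have cW: "continuous_on ?S W" using a by (simp add: zsol_def ce)
    have cN: "continuous_on ?S N" unfolding N_def by (intro continuous_intros continuous_zop cW)
    have "\<forall>t. \<exists>p. rep (s - 1) (fst p) (snd p) (N t)" using rep_exists by auto
    then obtain p where p: "\<And>t. rep (s - 1) (fst (p t)) (snd (p t)) (N t)" by metis
    define \<zeta>' v' where "\<zeta>' t = fst (p t)" and "v' t = snd (p t)" for t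
    have r: "rep (s - 1) (\<zeta>' t) (v' t) (N t)" for t using p by (simp add: \<zeta>'_def v'_def)
    have 2: "\<forall>t\<in>?S. V_space (s - 1) \<mu> (\<zeta>' t) (v' t)" using rep_V(1)[OF r s_nonneg(2)] by blast
    have 5: "\<forall>t\<in>?S. ((\<lambda>y. V_norm (s - 1) \<mu> (\<lambda>x. \<zeta>' y x - \<zeta>' t x) (\<lambda>x. v' y x - v' t x)) \<longlongrightarrow> 0) (at t within ?S)"
    proof
      fix t assume t: "t \<in> ?S"
      have "((\<lambda>y. N y - N t) \<longlongrightarrow> 0) (at t within ?S)" using cN t by (simp add: continuous_on_def LIM_zero_iff)
      then show "((\<lambda>y. V_norm (s - 1) \<mu> (\<lambda>x. \<zeta>' y x - \<zeta>' t x) (\<lambda>x. v' y x - v' t x)) \<longlongrightarrow> 0) (at t within ?S)"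
        by (subst V_norm_tendsto_iff[OF rep_diff[OF r r]]) (simp_all add: s_nonneg)
    qed
    have 3: "\<forall>t\<in>?S. ((\<lambda>y. V_norm (s - 1) \<mu> (\<lambda>x. (\<zeta> y x - \<zeta> t x) / (y - t) - \<zeta>' t x) (\<lambda>x. (v y x - v t x) / (y - t) - v' t x)) \<longlongrightarrow> 0) (at t within ?S)"
    proof
      fix t assume t: "t \<in> ?S"
      show "((\<lambda>y. V_norm (s - 1) \<mu> (\<lambda>x. (\<zeta> y x - \<zeta> t x) / (y - t) - \<zeta>' t x) (\<lambda>x. (v y x - v t x) / (y - t) - v' t x)) \<longlongrightarrow> 0) (at t within ?S)"
        unfolding quot[OF t r] sc eN using a t by (simp add: zsol_def)
    qed
    have 4: "\<forall>t\<in>?S. \<exists>w. is_FT w (\<lambda>i. \<i> * cx (i * Tmu \<mu> i) * FT (\<zeta> t) i) \<and>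
           (\<forall>\<phi> \<phi>'. test_fun \<phi> \<phi>' \<longrightarrow>
              (LBINT x. \<zeta>' t x * \<phi> x) = (LBINT x. (v t x + \<epsilon> * \<zeta> t x * v t x) * \<phi>' x) \<and>
              (LBINT x. v' t x * \<phi> x) = - (LBINT x. w x * \<phi> x) + \<epsilon> * (LBINT x. ((v t x)^2 / 2) * \<phi>' x))"
    proof
      fix t assume t: "t \<in> ?S"
      show "\<exists>w. is_FT w (\<lambda>i. \<i> * cx (i * Tmu \<mu> i) * FT (\<zeta> t) i) \<and>
           (\<forall>\<phi> \<phi>'. test_fun \<phi> \<phi>' \<longrightarrow>
              (LBINT x. \<zeta>' t x * \<phi> x) = (LBINT x. (v t x + \<epsilon> * \<zeta> t x * v t x) * \<phi>' x) \<and>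
              (LBINT x. v' t x * \<phi> x) = - (LBINT x. w x * \<phi> x) + \<epsilon> * (LBINT x. ((v t x)^2 / 2) * \<phi>' x))"
        by (rule equations_iff[OF W[OF t] r e, THEN iffD2]) (rule eN)
    qed
    show "is_solution s \<mu> \<epsilon> T \<zeta>0 v0 \<zeta> v"
      unfolding is_solution_def cont using a V cW 2 3 4 5 by blast
  qed
qed

text \<open>With \<open>d = \<epsilon> * V\<close>, the size of the scaled data, the time
  \<open>T / \<epsilon>\<close> is \<open>c1 / d\<close>. The constant 16 is 2 (q against \<zeta> at
  time 0), 2 (energy growth), 2 (\<zeta> against q) and 2 (\<open>rep_V\<close>) multiplied
  together.\<close>

theorem well_posed:
  fixes h0 :: real
  assumes V0: "V_space s \<mu> \<zeta>0 v0" and e: "0 < \<epsilon>" and le: "\<epsilon> <= c1 * inverse (V_norm s \<mu> \<zeta>0 v0)"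
  shows "let T = c1 * inverse (V_norm s \<mu> \<zeta>0 v0) in
    \<exists>\<zeta> v. is_solution s \<mu> \<epsilon> (T / \<epsilon>) \<zeta>0 v0 \<zeta> v \<and>
      (\<forall>t\<in>{0..T / \<epsilon>}. V_norm s \<mu> (\<zeta> t) (v t) <= 16 * V_norm s \<mu> \<zeta>0 v0) \<and>
      (\<forall>\<zeta>b vb. is_solution s \<mu> \<epsilon> (T / \<epsilon>) \<zeta>0 v0 \<zeta>b vb \<longrightarrow>
         (\<forall>t\<in>{0..T / \<epsilon>}. V_norm s \<mu> (\<lambda>x. \<zeta>b t x - \<zeta> t x) (\<lambda>x. vb t x - v t x) = 0)) \<and>
      (\<forall>j>0. \<exists>\<delta>>0. \<forall>\<zeta>1 v1 \<zeta>b vb.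
         V_space s \<mu> \<zeta>1 v1 \<longrightarrow> V_norm s \<mu> (\<lambda>x. \<zeta>1 x - \<zeta>0 x) (\<lambda>x. v1 x - v0 x) < \<delta> \<longrightarrow>
         (\<forall>x. 1 + \<epsilon> * \<zeta>1 x \<ge> h0) \<longrightarrow> \<epsilon> <= c1 * inverse (V_norm s \<mu> \<zeta>1 v1) \<longrightarrow>
         is_solution s \<mu> \<epsilon> (c1 * inverse (V_norm s \<mu> \<zeta>1 v1) / \<epsilon>) \<zeta>1 v1 \<zeta>b vb \<longrightarrow>
         (\<forall>t\<in>{0..min T (c1 * inverse (V_norm s \<mu> \<zeta>1 v1)) / \<epsilon>}.
            V_norm s \<mu> (\<lambda>x. \<zeta>b t x - \<zeta> t x) (\<lambda>x. vb t x - v t x) <= j))"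
proof -
  have Vpos: "0 < V" "\<epsilon> * V <= c1" "c1 * inverse V / \<epsilon> = c1 / (\<epsilon> * V)" if "\<epsilon> <= c1 * inverse V" "0 <= V" for V
  proof -
    \<comment> \<open>In HOL \<open>inverse 0 = 0\<close>, so a positive \<epsilon> with
      \<open>\<epsilon> <= c1 * inverse V\<close> excludes \<open>V = 0\<close>.\<close>
    show V: "0 < V" using that e by (cases "V = 0") auto
    show "\<epsilon> * V <= c1" using that V by (simp add: field_simps)
    show "c1 * inverse V / \<epsilon> = c1 / (\<epsilon> * V)" using V e by (simp add: field_simps)
  qed
  have V_nonneg: "0 <= V_norm s \<mu> f u" for f u using mu by (simp add: V_norm_def)
  define V T where "V = V_norm s \<mu> \<zeta>0 v0" and "T = c1 * inverse (V_norm s \<mu> \<zeta>0 v0)"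
  define d where "d = \<epsilon> * V"
  note Vp = Vpos[OF le V_nonneg, folded V_def]
  have T: "T / \<epsilon> = c1 / d" using Vp(3) by (simp add: T_def d_def V_def)
  have d: "0 < d" "d <= c1" using Vp e by (auto simp: d_def)
  obtain W0 where W0: "rep s \<zeta>0 v0 W0" using V_rep[OF V0 s_nonneg(1)] by blast
  have W0V: "norm W0 <= V" using rep_V(2)[OF W0 s_nonneg(1)] by (simp add: V_def)
  then have W0d: "norm (\<epsilon> *\<^sub>R W0) <= d" using e by (simp add: d_def)
  obtain X where X: "sol (c1 / d) X" "tz (X 0) = \<epsilon> *\<^sub>R W0"
    and Xn: "\<And>t. t \<in> {0..c1 / d} ==> norm (X t) <= 4 * norm (\<epsilon> *\<^sub>R W0)"
    and Xw: "\<And>t w. t \<in> {0..c1 / d} ==> slow 1 w ==> (\<And>x. w x <= 1) ==> norm (M2 w (X t)) <= 2 * norm (M2 w (X 0))"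
    by (rule z_exist[OF d(1) W0d d(2)]) (rule that, assumption+, blast)
  have Xc: "norm (X t) <= 4 * c1" if "t \<in> {0..c1 / d}" for t using Xn[OF that] W0d d by linarith
  define W where "W t = (1 / \<epsilon>) *\<^sub>R tz (X t)" for t
  have eW: "\<epsilon> *\<^sub>R W t = tz (X t)" for t using e by (simp add: W_def)
  have W00: "W 0 = W0" using X(2) e by (simp add: W_def)
  have "\<forall>t. \<exists>p. rep s (fst p) (snd p) (W t)" using rep_exists by auto
  then obtain p where p: "\<And>t. rep s (fst (p t)) (snd (p t)) (W t)" by metis
  \<comment> \<open>\<open>rep\<close> fixes functions only up to null sets, while
    \<open>is_solution\<close> asks for \<open>\<zeta> 0 = \<zeta>0\<close> as functions; so the
    given data are inserted at time 0.\<close>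
  define \<zeta> v where "\<zeta> t = (if t = 0 then \<zeta>0 else fst (p t))" and "v t = (if t = 0 then v0 else snd (p t))" for t
  have r: "rep s (\<zeta> t) (v t) (W t)" for t using p W0 W00 by (simp add: \<zeta>_def v_def)
  have T0: "0 <= c1 / d" using c1 d by simp
  have sol: "is_solution s \<mu> \<epsilon> (c1 / d) \<zeta>0 v0 \<zeta> v"
  proof (rule is_solution_iff[where W = W, OF r e, THEN iffD2], intro conjI)
    show "\<zeta> 0 = \<zeta>0" "v 0 = v0" by (simp_all add: \<zeta>_def v_def)
    show "zsol (c1 / d) (\<lambda>t. \<epsilon> *\<^sub>R W t)" unfolding eW by (rule sol_zsol[OF X(1)])
  qed
  have represent: "\<exists>U. (\<forall>t\<in>{0..S}. rep s (\<zeta>b t) (vb t) (U t)) \<and> zsol S (\<lambda>t. \<epsilon> *\<^sub>R U t)" if a: "is_solution s \<mu> \<epsilon> S \<zeta>1 v1 \<zeta>b vb" for S \<zeta>1 v1 \<zeta>b vb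
  proof -
    have "\<forall>t\<in>{0..S}. \<exists>U. rep s (\<zeta>b t) (vb t) U" using a V_rep[OF _ s_nonneg(1)] unfolding is_solution_def by blast
    then obtain U where U: "\<And>t. t \<in> {0..S} ==> rep s (\<zeta>b t) (vb t) (U t)" by metis
    have "zsol S (\<lambda>t. \<epsilon> *\<^sub>R U t)" using a is_solution_iff[where T = S and \<zeta> = \<zeta>b and v = vb and W = U, OF U e] by blast
    with U show ?thesis by blast
  qed
  have bound: "V_norm s \<mu> (\<zeta> t) (v t) <= 16 * V" if t: "t \<in> {0..c1 / d}" for t
  proof -
    have XK: "norm (X t) <= 1 / KA" using Xc[OF t] c1 by (intro le_c1_KA(2)) linarith
    have "norm (tz (X t) - tz 0) <= 2 * norm (X t - 0)" using XK KA by (intro norm_tz_diff) auto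
    then have "norm (tz (X t)) <= 8 * (\<epsilon> * norm W0)" using Xn[OF t] e by simp
    then have "norm (W t) <= 8 * norm W0" using e by (simp add: W_def field_simps)
    then show ?thesis using rep_V(3)[OF r[of t] s_nonneg(1)] W0V by linarith
  qed
  have unique: "V_norm s \<mu> (\<lambda>x. \<zeta>b t x - \<zeta> t x) (\<lambda>x. vb t x - v t x) = 0"
    if a: "is_solution s \<mu> \<epsilon> (c1 / d) \<zeta>0 v0 \<zeta>b vb" and t: "t \<in> {0..c1 / d}" for \<zeta>b vb t
  proof -
    obtain U where U: "\<forall>t\<in>{0..c1 / d}. rep s (\<zeta>b t) (vb t) (U t)" "zsol (c1 / d) (\<lambda>t. \<epsilon> *\<^sub>R U t)" using represent[OF a] by blast
    have "rep s \<zeta>0 v0 (U 0)" using U(1) T0 a by (auto simp: is_solution_def dest!: bspec[of _ _ 0])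
    then have U0: "U 0 = W0" using rep_unique[OF _ W0 s_nonneg(1)] by blast
    have "\<epsilon> *\<^sub>R U t = tz (X t)" by (rule z_unique[OF T0 X(1) Xc U(2) _ t]) (auto simp: U0 X(2))
    then have "\<epsilon> *\<^sub>R U t = \<epsilon> *\<^sub>R W t" by (simp add: eW)
    then have "U t = W t" using e by simp
    moreover have "rep s (\<zeta>b t) (vb t) (U t)" using U(1) t by blast
    ultimately have "V_norm s \<mu> (\<lambda>x. \<zeta>b t x - \<zeta> t x) (\<lambda>x. vb t x - v t x) <= 2 * norm (W t - W t)"
      using rep_V(3)[OF rep_diff[OF _ r[of t] s_nonneg(1)] s_nonneg(1)] by metis
    then show ?thesis using V_nonneg[of "\<lambda>x. \<zeta>b t x - \<zeta> t x" "\<lambda>x. vb t x - v t x"] by simp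
  qed
  have dependence: "\<exists>\<delta>>0. \<forall>\<zeta>1 v1 \<zeta>b vb.
         V_space s \<mu> \<zeta>1 v1 \<longrightarrow> V_norm s \<mu> (\<lambda>x. \<zeta>1 x - \<zeta>0 x) (\<lambda>x. v1 x - v0 x) < \<delta> \<longrightarrow>
         (\<forall>x. 1 + \<epsilon> * \<zeta>1 x \<ge> h0) \<longrightarrow> \<epsilon> <= c1 * inverse (V_norm s \<mu> \<zeta>1 v1) \<longrightarrow>
         is_solution s \<mu> \<epsilon> (c1 * inverse (V_norm s \<mu> \<zeta>1 v1) / \<epsilon>) \<zeta>1 v1 \<zeta>b vb \<longrightarrow>
         (\<forall>t\<in>{0..min T (c1 * inverse (V_norm s \<mu> \<zeta>1 v1)) / \<epsilon>}.
            V_norm s \<mu> (\<lambda>x. \<zeta>b t x - \<zeta> t x) (\<lambda>x. vb t x - v t x) <= j)" if eta: "0 < j" for j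
  proof -
    have "0 < \<epsilon> * j / 2" using e eta by simp
    from z_dependence[OF d(1) X(1) Xc Xw this] obtain \<delta> where \<delta>: "0 < \<delta>"
      and dep: "\<And>d1 U t. 0 < d1 ==> d1 <= c1 ==> norm (U 0) <= d1 ==> norm (U 0 - tz (X 0)) < \<delta> ==> zsol (c1 / d1) U ==>
        t \<in> {0..min (c1 / d) (c1 / d1)} ==> norm (U t - tz (X t)) <= \<epsilon> * j / 2" by blast
    show ?thesis
    proof (intro exI[of _ "\<delta> / \<epsilon>"] conjI allI impI ballI)
      show "0 < \<delta> / \<epsilon>" using \<delta> e by simp
      fix \<zeta>1 v1 \<zeta>b vb t
      assume V1: "V_space s \<mu> \<zeta>1 v1" and cl: "V_norm s \<mu> (\<lambda>x. \<zeta>1 x - \<zeta>0 x) (\<lambda>x. v1 x - v0 x) < \<delta> / \<epsilon>"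
        and le1: "\<epsilon> <= c1 * inverse (V_norm s \<mu> \<zeta>1 v1)"
        and a: "is_solution s \<mu> \<epsilon> (c1 * inverse (V_norm s \<mu> \<zeta>1 v1) / \<epsilon>) \<zeta>1 v1 \<zeta>b vb"
        and t: "t \<in> {0..min T (c1 * inverse (V_norm s \<mu> \<zeta>1 v1)) / \<epsilon>}"
      define d1 where "d1 = \<epsilon> * V_norm s \<mu> \<zeta>1 v1"
      note Vp1 = Vpos[OF le1 V_nonneg]
      have d1: "0 < d1" "d1 <= c1" using Vp1 e by (auto simp: d1_def)
      have T1: "c1 * inverse (V_norm s \<mu> \<zeta>1 v1) / \<epsilon> = c1 / d1" using Vp1(3) by (simp add: d1_def)
      have t': "0 <= t" "t <= c1 / d" "t <= c1 / d1"
      proof -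
        show "0 <= t" using t by simp
        have "t <= min T (c1 * inverse (V_norm s \<mu> \<zeta>1 v1)) / \<epsilon>" using t by simp
        moreover have "min T (c1 * inverse (V_norm s \<mu> \<zeta>1 v1)) / \<epsilon> <= T / \<epsilon>" "min T (c1 * inverse (V_norm s \<mu> \<zeta>1 v1)) / \<epsilon> <= c1 * inverse (V_norm s \<mu> \<zeta>1 v1) / \<epsilon>"
          using e by (auto intro!: divide_right_mono)
        ultimately show "t <= c1 / d" "t <= c1 / d1" using T T1 by linarith+
      qed
      obtain U where U: "\<forall>t\<in>{0..c1 / d1}. rep s (\<zeta>b t) (vb t) (U t)" "zsol (c1 / d1) (\<lambda>t. \<epsilon> *\<^sub>R U t)" using represent[OF a] unfolding T1 by blast
      have U0: "rep s \<zeta>1 v1 (U 0)" using U(1) t' a by (auto simp: is_solution_def dest!: bspec[of _ _ 0])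
      have n0: "norm (\<epsilon> *\<^sub>R U 0) <= d1" using rep_V(2)[OF U0 s_nonneg(1)] e by (simp add: d1_def)
      have "norm (U 0 - W0) < \<delta> / \<epsilon>" using rep_V(2)[OF rep_diff[OF U0 W0 s_nonneg(1)] s_nonneg(1)] cl by linarith
      then have "\<epsilon> * norm (U 0 - W0) < \<delta>" using e by (simp add: field_simps)
      then have n1: "norm (\<epsilon> *\<^sub>R U 0 - tz (X 0)) < \<delta>" using e unfolding X(2) by (simp flip: scaleR_diff_right)
      have "norm (\<epsilon> *\<^sub>R U t - tz (X t)) <= \<epsilon> * j / 2"
        by (rule dep[OF d1 n0 n1 U(2)]) (use t' in auto)
      then have "\<epsilon> * norm (U t - W t) <= \<epsilon> * (j / 2)" using e unfolding eW[symmetric] by (simp flip: scaleR_diff_right)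
      then have n: "norm (U t - W t) <= j / 2" using e by simp
      have "rep s (\<zeta>b t) (vb t) (U t)" using U(1) t' by auto
      from rep_V(3)[OF rep_diff[OF this r[of t] s_nonneg(1)] s_nonneg(1)] n
      show "V_norm s \<mu> (\<lambda>x. \<zeta>b t x - \<zeta> t x) (\<lambda>x. vb t x - v t x) <= j" by linarith
    qed
  qed
  show ?thesis unfolding Let_def unfolding T_def[symmetric] unfolding T V_def[symmetric]
    using sol bound unique dependence by blast
qed

end

theorem mainTheorem2:
  fixes s h0 :: real
  assumes "s > 3 / 2" and "0 < h0" and "h0 < 1"
  shows "\<exists>c>0. \<exists>C>0. \<forall>\<mu>::real. 0 < \<mu> \<longrightarrow> \<mu> < 1 \<longrightarrow>
    (\<forall>\<zeta>0 v0 \<epsilon>. V_space s \<mu> \<zeta>0 v0 \<longrightarrow> (\<forall>x. 1 + \<epsilon> * \<zeta>0 x \<ge> h0) \<longrightarrow>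
       0 < \<epsilon> \<longrightarrow> \<epsilon> \<le> c * inverse (V_norm s \<mu> \<zeta>0 v0) \<longrightarrow>
       (let T = c * inverse (V_norm s \<mu> \<zeta>0 v0) in
        \<exists>\<zeta> v. is_solution s \<mu> \<epsilon> (T / \<epsilon>) \<zeta>0 v0 \<zeta> v \<and>
          (\<forall>t\<in>{0..T / \<epsilon>}. V_norm s \<mu> (\<zeta> t) (v t) \<le> C * V_norm s \<mu> \<zeta>0 v0) \<and>
          (\<forall>\<zeta>b vb. is_solution s \<mu> \<epsilon> (T / \<epsilon>) \<zeta>0 v0 \<zeta>b vb \<longrightarrow>
             (\<forall>t\<in>{0..T / \<epsilon>}. V_norm s \<mu> (\<lambda>x. \<zeta>b t x - \<zeta> t x) (\<lambda>x. vb t x - v t x) = 0)) \<and>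
          (\<forall>\<eta>>0. \<exists>\<delta>>0. \<forall>\<zeta>1 v1 \<zeta>b vb.
             V_space s \<mu> \<zeta>1 v1 \<longrightarrow>
             V_norm s \<mu> (\<lambda>x. \<zeta>1 x - \<zeta>0 x) (\<lambda>x. v1 x - v0 x) < \<delta> \<longrightarrow>
             (\<forall>x. 1 + \<epsilon> * \<zeta>1 x \<ge> h0) \<longrightarrow>
             \<epsilon> \<le> c * inverse (V_norm s \<mu> \<zeta>1 v1) \<longrightarrow>
             is_solution s \<mu> \<epsilon> (c * inverse (V_norm s \<mu> \<zeta>1 v1) / \<epsilon>) \<zeta>1 v1 \<zeta>b vb \<longrightarrow>
             (\<forall>t\<in>{0..min T (c * inverse (V_norm s \<mu> \<zeta>1 v1)) / \<epsilon>}.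
                V_norm s \<mu> (\<lambda>x. \<zeta>b t x - \<zeta> t x) (\<lambda>x. vb t x - v t x) \<le> \<eta>))))"
proof -
  have wb: "wb s \<mu>" if "0 < \<mu>" "\<mu> < 1" for \<mu> using assms(1) that by unfold_locales auto
  \<comment> \<open>\<open>c1\<close> is built inside \<open>wb\<close> from \<open>s\<close> alone,
    so outside the locale its only argument is \<open>s\<close>; this is how the constant becomes
    independent of \<mu>. The value 1/2 merely discharges the locale assumption.\<close>
  have c: "0 < wb.c1 s" by (rule wb.c1(1)[OF wb[of "1/2"]]) simp_all
  show ?thesis
  proof (rule exI[of _ "wb.c1 s"], rule conjI[OF c], rule exI[of _ 16], intro conjI allI impI, goal_cases)
    case (2 \<mu> \<zeta>0 v0 \<epsilon>)
    show ?case by (rule wb.well_posed[OF wb[OF 2(1,2)] 2(3,5,6)])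
  qed simp
qed

end
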